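(* Let $d\ge2$, $n,m\ge1$, $T\subset\mathbb R^m$ nonempty symmetric bounded, $A=(a_{\mathbf i})_{\mathbf i\in[n]^d\times[m]}$ real. There is a constant $C(d)$ depending only on $d$ such that for any $U\subset(B_2^n)^{d-1}\times T$ and any $p\ge1$, \[F_A(U)\le C(d)\Big(\sqrt p\,\Delta_A(U)+\sum_{k=0}^{d-1}p^{\frac{k+1-d}{2}}s_k(A)\Big).\]
   Context: $\mathbf i=(i_1,\ldots,i_{d+1})$, $i_I=(i_j)_{j\in I}$; $g_1,\ldots,g_n$ i.i.d. standard Gaussian. For $U\subset(\mathbb R^n)^{d-1}\times\mathbb R^m$: $F_A(U)=\mathbb E\sup_{(x^2,\ldots,x^d,t)\in U}\sum_{\mathbf i}a_{\mathbf i}g_{i_1}\prod_{k=2}^dx^k_{i_k}t_{i_{d+1}}$; $\rho_A((x^2,\ldots,x^d,t),(y^2,\ldots,y^d,t'))=\sqrt{\sum_{i_1}\big(\sum_{i_2,\ldots,i_{d+1}}a_{\mathbf i}(\prod_{k=2}^dx^k_{i_k}t_{i_{d+1}}-\prod_{k=2}^dy^k_{i_k}t'_{i_{d+1}})\big)^2}$; $\Delta_A(U)$ is the diameter of $U$ in $\rho_A$. $\mathcal P(U)$: unordered partitions into nonempty disjoint blocks; $(\mathcal P,\mathcal P')\in\mathcal P([d])$ means $\mathcal P\cup\mathcal P'\in\mathcal P([d])$, $\mathcal P\cap\mathcal P'=\emptyset$. For $\mathcal P=\{I_1,\ldots,I_k\}$, $\mathcal P'=\{J_1,\ldots,J_l\}$: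 $\|A\|_{\mathcal P'\mid\mathcal P}=\sup\{\mathbb E\sup_{t\in T}\sum_{\mathbf i}a_{\mathbf i}\prod_rx^r_{i_{I_r}}\prod_sg^s_{i_{J_s}}t_{i_{d+1}}:\sum_{i_{I_r}}(x^r_{i_{I_r}})^2\le1\ \forall r\}$, $(g^s_{i_{J_s}})_{i_{J_s}\in[n]^{J_s}}$ independent families of i.i.d. standard Gaussians; $s_k(A)=\sum_{(\mathcal P,\mathcal P')\in\mathcal P([d]),|\mathcal P|=k}\|A\|_{\mathcal P'\mid\mathcal P}$. $B_2^n$: closed Euclidean unit ball. *)

theory Defs
  imports "HOL-Probability.Probability" "HOL-Library.Disjoint_Sets"
begin

definition gauss :: "'i set \<Rightarrow> ('i \<Rightarrow> real) measure" where
  "gauss I = PiM I (\<lambda>_. density lborel std_normal_density)"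

definition idx :: "nat \<Rightarrow> nat \<Rightarrow> nat \<Rightarrow> (nat \<Rightarrow> nat) set" where
  "idx d n m = (\<Pi>\<^sub>E j\<in>{1..d+1}. if j \<le> d then {1..n} else {1..m})"

definition B2 :: "nat \<Rightarrow> (nat \<Rightarrow> real) set" where
  "B2 n = {v. (\<forall>j. j \<notin> {1..n} \<longrightarrow> v j = 0) \<and> (\<Sum>j=1..n. (v j)^2) \<le> 1}"

definition FA_form :: "nat \<Rightarrow> nat \<Rightarrow> nat \<Rightarrow> ((nat \<Rightarrow> nat) \<Rightarrow> real)
    \<Rightarrow> (nat \<Rightarrow> real) \<Rightarrow> (nat \<Rightarrow> nat \<Rightarrow> real) \<times> (nat \<Rightarrow> real) \<Rightarrow> real" where
  "FA_form d n m a g u = (\<Sum>i\<in>idx d n m.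
      a i * g (i 1) * (\<Prod>k=2..d. fst u k (i k)) * snd u (i (d+1)))"

definition F_A :: "nat \<Rightarrow> nat \<Rightarrow> nat \<Rightarrow> ((nat \<Rightarrow> nat) \<Rightarrow> real)
    \<Rightarrow> ((nat \<Rightarrow> nat \<Rightarrow> real) \<times> (nat \<Rightarrow> real)) set \<Rightarrow> real" where
  "F_A d n m a U = (\<integral>g. (SUP u\<in>U. FA_form d n m a g u) \<partial>gauss {1..n})"

definition rho_A :: "nat \<Rightarrow> nat \<Rightarrow> nat \<Rightarrow> ((nat \<Rightarrow> nat) \<Rightarrow> real)
    \<Rightarrow> (nat \<Rightarrow> nat \<Rightarrow> real) \<times> (nat \<Rightarrow> real)
    \<Rightarrow> (nat \<Rightarrow> nat \<Rightarrow> real) \<times> (nat \<Rightarrow> real) \<Rightarrow> real" where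
  "rho_A d n m a u v = sqrt (\<Sum>i1=1..n. (\<Sum>i\<in>{i\<in>idx d n m. i 1 = i1}.
      a i * ((\<Prod>k=2..d. fst u k (i k)) * snd u (i (d+1))
             - (\<Prod>k=2..d. fst v k (i k)) * snd v (i (d+1))))^2)"

definition Delta_A :: "nat \<Rightarrow> nat \<Rightarrow> nat \<Rightarrow> ((nat \<Rightarrow> nat) \<Rightarrow> real)
    \<Rightarrow> ((nat \<Rightarrow> nat \<Rightarrow> real) \<times> (nat \<Rightarrow> real)) set \<Rightarrow> real" where
  "Delta_A d n m a U = (SUP uv\<in>U \<times> U. rho_A d n m a (fst uv) (snd uv))"

definition part_pairs :: "nat \<Rightarrow> (nat set set \<times> nat set set) set" where
  "part_pairs d = {(P, P'). partition_on {1..d} (P \<union> P') \<and> P \<inter> P' = {}}"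

definition normA :: "nat \<Rightarrow> nat \<Rightarrow> nat \<Rightarrow> ((nat \<Rightarrow> nat) \<Rightarrow> real) \<Rightarrow> (nat \<Rightarrow> real) set
    \<Rightarrow> nat set set \<Rightarrow> nat set set \<Rightarrow> real" where
  "normA d n m a T P P' = Sup {(\<integral>g. (SUP t\<in>T. (\<Sum>i\<in>idx d n m.
        a i * (\<Prod>I\<in>P. x I (restrict i I)) * (\<Prod>J\<in>P'. g (J, restrict i J)) * t (i (d+1))))
      \<partial>gauss (SIGMA J:P'. \<Pi>\<^sub>E j\<in>J. {1..n}))
    | x :: nat set \<Rightarrow> (nat \<Rightarrow> nat) \<Rightarrow> real.
        \<forall>I\<in>P. (\<Sum>j\<in>(\<Pi>\<^sub>E l\<in>I. {1..n}). (x I j)^2) \<le> 1}"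

definition s_k :: "nat \<Rightarrow> nat \<Rightarrow> nat \<Rightarrow> ((nat \<Rightarrow> nat) \<Rightarrow> real) \<Rightarrow> (nat \<Rightarrow> real) set
    \<Rightarrow> nat \<Rightarrow> real" where
  "s_k d n m a T k = (\<Sum>PP\<in>{PP\<in>part_pairs d. card (fst PP) = k}. normA d n m a T (fst PP) (snd PP))"

end

theory Submission
  imports Defs
begin

text \<open>Write \<open>r = sqrt p\<close> and let \<open>M\<close> be the sum of the \<open>r\<^sup>k s\<^sub>k\<close>. The bound is proved for families of tensors
  whose coordinates are blocks of indices, by induction on the number of coordinates; contracting with a
  vector and averaging over a Gaussian block both lead to families with fewer coordinates.

  Entropy: translates of the sets on which the support function of an auxiliary family is small have
  a definite Gaussian measure (Cameron--Martin), so a point set in the ball of radius \<open>r\<close> splits into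
  \<open>exp (C (r/\<delta>)\<^sup>2)\<close> classes within which one coordinate may be replaced by a common vector. The remaining
  differences are tensors of lower order. The auxiliary families consist of partial means of contractions,
  and the induction hypothesis controls their width.

  Chaining: to pass from scale \<open>\<delta>\<close> to \<open>\<delta>/2\<close>, split the set into such classes, recentre each class
  at one of its points and expand multilinearly. The terms containing a coordinate of the centre have lower
  order and norms at most \<open>\<delta> M\<close>, so they contribute \<open>C \<delta> M\<close> by induction; the remaining term is at scale \<open>\<delta>/2\<close>.
  By Gaussian concentration the splitting costs \<open>C r/\<delta>\<close> times the diameter, which is \<open>\<delta>\<^sup>2 M/r\<close> at all but the first
  scale, and the geometric series is summable.\<close>

section \<open>Support functions of bounded families\<close>

text \<open>Vectors are allowed length \<open>r\<close> instead of 1: by homogeneity all weights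
  p^(k/2) then disappear into the one number \<open>M\<close>, the claim becomes a bound C (r Delta
  + M), and the powers of p return only in a final division by r^(d-1). The obstacle is that entropy
  alone does not suffice. Classes of diameter delta M / r at the price exp (C (r/delta)^2)
  contribute about M at every dyadic scale, so Dudley's sum diverges. What is missing is a second
  factor delta. Once the points are recentred so that contraction with any one of their vectors
  brings the mixed norms down to delta M, the same covering argument gives diameters of order
  delta^2 M / r, and a scale contributes only delta M. To arrange this by covering, "contraction
  with this vector has small mixed norms" must itself be a bound on a support function whose family
  has controlled Gaussian width; this is the origin of \<open>dual_fam\<close>. Its members are
  averaged contractions, so the induction has to be about arbitrary symmetric families of tensors
  rather than about a single matrix.\<close>

definition lin :: "'i set \<Rightarrow> ('i \<Rightarrow> real) \<Rightarrow> ('i \<Rightarrow> real) \<Rightarrow> real" where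
  "lin I v y = (\<Sum>i\<in>I. v i * y i)"

definition supf :: "'i set \<Rightarrow> ('i \<Rightarrow> real) set \<Rightarrow> ('i \<Rightarrow> real) \<Rightarrow> real" where
  "supf I V y = (SUP v\<in>V. lin I v y)"

text \<open>Nonemptiness is part of the notion because \<open>SUP\<close> over the empty set is not
  a usable real number. One coordinatewise bound for the whole family keeps all suprema finite and
  dominates the support function by a multiple of the l1 norm of \<open>y\<close>, which is what
  integrability needs.\<close>

definition bounded_fam :: "'i set \<Rightarrow> ('i \<Rightarrow> real) set \<Rightarrow> bool" where
  "bounded_fam I V \<longleftrightarrow> V \<noteq> {} \<and> (\<exists>R. \<forall>v\<in>V. \<forall>i\<in>I. \<bar>v i\<bar> \<le> R)"

lemma abs_lin_le:
  assumes "\<And>i. i \<in> I \<Longrightarrow> \<bar>v i\<bar> \<le> R"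
  shows "\<bar>lin I v y\<bar> \<le> R * (\<Sum>i\<in>I. \<bar>y i\<bar>)"
proof -
  have "\<bar>lin I v y\<bar> \<le> (\<Sum>i\<in>I. \<bar>v i * y i\<bar>)" unfolding lin_def by (rule sum_abs)
  also have "\<dots> \<le> (\<Sum>i\<in>I. R * \<bar>y i\<bar>)"
    by (rule sum_mono) (auto simp: abs_mult intro!: mult_right_mono assms)
  finally show ?thesis by (simp add: sum_distrib_left)
qed

lemma bounded_fam_bdd_above: "bounded_fam I V \<Longrightarrow> bdd_above ((\<lambda>v. lin I v y) ` V)"
proof -
  assume "bounded_fam I V"
  then obtain R where R: "\<forall>v\<in>V. \<forall>i\<in>I. \<bar>v i\<bar> \<le> R" by (auto simp: bounded_fam_def)
  show ?thesis
  proof (rule bdd_aboveI2)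
    fix v assume "v \<in> V"
    then show "lin I v y \<le> R * (\<Sum>i\<in>I. \<bar>y i\<bar>)"
      using abs_lin_le[of I v R y] R by auto
  qed
qed

lemma lin_le_supf: "bounded_fam I V \<Longrightarrow> v \<in> V \<Longrightarrow> lin I v y \<le> supf I V y"
  unfolding supf_def by (rule cSUP_upper[OF _ bounded_fam_bdd_above])

lemma supf_least: "V \<noteq> {} \<Longrightarrow> (\<And>v. v \<in> V \<Longrightarrow> lin I v y \<le> c) \<Longrightarrow> supf I V y \<le> c"
  unfolding supf_def by (rule cSUP_least)

lemma supf_mono: "bounded_fam I V \<Longrightarrow> W \<noteq> {} \<Longrightarrow> W \<subseteq> V \<Longrightarrow> supf I W y \<le> supf I V y"
  by (rule supf_least) (auto intro: lin_le_supf)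

lemma bounded_fam_subset: "bounded_fam I V \<Longrightarrow> W \<noteq> {} \<Longrightarrow> W \<subseteq> V \<Longrightarrow> bounded_fam I W"
  unfolding bounded_fam_def by blast

lemma bounded_fam_nonempty: "bounded_fam I V \<Longrightarrow> V \<noteq> {}" by (simp add: bounded_fam_def)

lemma bounded_fam_finite: "finite I \<Longrightarrow> finite V \<Longrightarrow> V \<noteq> {} \<Longrightarrow> bounded_fam I V"
proof -
  assume "finite I" "finite V" "V \<noteq> {}"
  then have "\<forall>v\<in>V. \<forall>i\<in>I. \<bar>v i\<bar> \<le> (\<Sum>v\<in>V. \<Sum>i\<in>I. \<bar>v i\<bar>)"
    by (intro ballI order_trans[OF member_le_sum member_le_sum[of _ V "\<lambda>v. \<Sum>i\<in>I. \<bar>v i\<bar>"]])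
      (auto intro: sum_nonneg)
  then show ?thesis using \<open>V \<noteq> {}\<close> unfolding bounded_fam_def by blast
qed

lemma abs_supf_le:
  assumes "V \<noteq> {}" "\<And>v i. v \<in> V \<Longrightarrow> i \<in> I \<Longrightarrow> \<bar>v i\<bar> \<le> R"
  shows "\<bar>supf I V y\<bar> \<le> R * (\<Sum>i\<in>I. \<bar>y i\<bar>)"
proof -
  have b: "bounded_fam I V" using assms unfolding bounded_fam_def by blast
  obtain v where v: "v \<in> V" using assms by auto
  have *: "\<bar>lin I w y\<bar> \<le> R * (\<Sum>i\<in>I. \<bar>y i\<bar>)" if "w \<in> V" for w
    by (rule abs_lin_le) (use assms that in auto)
  have "supf I V y \<le> R * (\<Sum>i\<in>I. \<bar>y i\<bar>)"
    by (rule supf_least) (use assms * in \<open>auto simp: abs_le_iff\<close>)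
  moreover have "- (R * (\<Sum>i\<in>I. \<bar>y i\<bar>)) \<le> supf I V y"
    using lin_le_supf[OF b v, of y] *[OF v] by linarith
  ultimately show ?thesis by linarith
qed

lemma lin_diff: "lin I v y - lin I w y = lin I (\<lambda>i. v i - w i) y"
  by (simp add: lin_def sum_subtractf left_diff_distrib)

lemma lin_add_right: "lin I v (\<lambda>i. y i + z i) = lin I v y + lin I v z"
  by (simp add: lin_def sum.distrib distrib_left)

lemma lin_diff_right: "lin I v (\<lambda>i. y i - z i) = lin I v y - lin I v z"
  by (simp add: lin_def sum_subtractf right_diff_distrib)

lemma lin_cmult_right: "lin I v (\<lambda>i. c * y i) = c * lin I v y"
  by (simp add: lin_def sum_distrib_left algebra_simps)

lemma lin_cmult_left: "lin I (\<lambda>i. c * v i) y = c * lin I v y"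
  by (simp add: lin_def sum_distrib_left algebra_simps)

lemma lin_minus_left: "lin I (\<lambda>i. - v i) y = - lin I v y"
  by (simp add: lin_def sum_negf)

lemma lin_minus_right: "lin I v (\<lambda>i. - y i) = - lin I v y"
  by (simp add: lin_def sum_negf)

lemma lin_cong: "(\<And>i. i \<in> I \<Longrightarrow> v i = w i) \<Longrightarrow> (\<And>i. i \<in> I \<Longrightarrow> y i = z i) \<Longrightarrow> lin I v y = lin I w z"
  unfolding lin_def by (auto intro: sum.cong)

lemma supf_cong: "(\<And>i. i \<in> I \<Longrightarrow> y i = z i) \<Longrightarrow> supf I V y = supf I V z"
  unfolding supf_def by (rule SUP_cong) (auto intro: lin_cong)

lemma lin_le_L2: "lin I v y \<le> L2_set v I * L2_set y I"
proof -
  have "lin I v y \<le> (\<Sum>i\<in>I. \<bar>v i\<bar> * \<bar>y i\<bar>)"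
    unfolding lin_def by (rule sum_mono) (metis abs_ge_self abs_mult)
  then show ?thesis using L2_set_mult_ineq[of v y I] by linarith
qed

lemma supf_add: "bounded_fam I V \<Longrightarrow> supf I V (\<lambda>i. y i + z i) \<le> supf I V y + supf I V z"
  by (rule supf_least) (auto simp: bounded_fam_nonempty lin_add_right intro!: add_mono lin_le_supf)

lemma supf_cmult: "bounded_fam I V \<Longrightarrow> c \<ge> 0 \<Longrightarrow> supf I V (\<lambda>i. c * y i) \<le> c * supf I V y"
  by (rule supf_least) (auto simp: bounded_fam_nonempty lin_cmult_right intro!: mult_left_mono lin_le_supf)

text \<open>Closure under negation makes the support function even and nonnegative; Markov's
  inequality and the translation argument rely on both.\<close>

definition sym_fam :: "('i \<Rightarrow> real) set \<Rightarrow> bool" where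
  "sym_fam V \<longleftrightarrow> (\<forall>v\<in>V. (\<lambda>i. - v i) \<in> V)"

lemma supf_uminus_le: assumes "bounded_fam I V" "sym_fam V" shows "supf I V (\<lambda>i. - y i) \<le> supf I V y"
proof (rule supf_least)
  show "V \<noteq> {}" using assms by (simp add: bounded_fam_def)
  fix v assume "v \<in> V"
  then have "lin I (\<lambda>i. - v i) y \<le> supf I V y" using assms by (intro lin_le_supf) (auto simp: sym_fam_def)
  then show "lin I v (\<lambda>i. - y i) \<le> supf I V y" by (simp add: lin_minus_left lin_minus_right)
qed

lemma supf_uminus: "bounded_fam I V \<Longrightarrow> sym_fam V \<Longrightarrow> supf I V (\<lambda>i. - y i) = supf I V y"
  using supf_uminus_le[of I V y] supf_uminus_le[of I V "\<lambda>i. - y i"] by simp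

lemma supf_nonneg: assumes "bounded_fam I V" "sym_fam V" shows "0 \<le> supf I V y"
proof -
  obtain v where v: "v \<in> V" using assms by (auto simp: bounded_fam_def)
  then have "lin I v y \<le> supf I V y" "lin I (\<lambda>i. - v i) y \<le> supf I V y"
    using assms by (auto intro!: lin_le_supf simp: sym_fam_def)
  then show ?thesis by (simp add: lin_minus_left)
qed

lemma supf_diff_le: "bounded_fam I V \<Longrightarrow> sym_fam V \<Longrightarrow> supf I V (\<lambda>i. y i - z i) \<le> supf I V y + supf I V z"
  using supf_add[of I V y "\<lambda>i. - z i"] supf_uminus[of I V z] by simp

text \<open>For every rational point q and every tolerance 1/(k+1), one member of \<open>V\<close>
  close to q is kept, if there is one. The kept members are coordinatewise dense in
  \<open>V\<close>, so the supremum becomes a countable one, as measurability requires.\<close>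

lemma countable_dense_family:
  assumes "bounded_fam I V" "finite I"
  obtains e :: "nat \<Rightarrow> 'i \<Rightarrow> real" where "range e \<subseteq> V" "\<And>y. supf I V y = supf I (range e) y"
proof -
  let ?P = "\<lambda>(q::'i\<Rightarrow>real) (k::nat) v. v \<in> V \<and> (\<forall>i\<in>I. \<bar>v i - q i\<bar> < 1 / (k+1))"
  let ?Q = "(PiE I (\<lambda>_. \<rat>)) \<times> (UNIV::nat set)"
  define S where "S = {qk\<in>?Q. \<exists>v. ?P (fst qk) (snd qk) v}"
  define D where "D = (\<lambda>qk. SOME v. ?P (fst qk) (snd qk) v) ` S"
  have "countable (PiE I (\<lambda>_. \<rat> :: real set))" by (intro countable_PiE countable_rat assms(2))
  then have "countable S" unfolding S_def
    by (intro countable_subset[OF _ countable_SIGMA[OF _ countableI_type]]) auto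
  then have cD: "countable D" unfolding D_def by auto
  have DV: "D \<subseteq> V"
  proof
    fix d assume "d \<in> D"
    then obtain qk where ex: "\<exists>v. ?P (fst qk) (snd qk) v" and d: "d = (SOME v. ?P (fst qk) (snd qk) v)"
      unfolding D_def S_def by auto
    show "d \<in> V" using someI_ex[OF ex] unfolding d by blast
  qed
  have dense: "\<exists>d\<in>D. \<forall>i\<in>I. \<bar>v i - d i\<bar> \<le> 2 / (real k+1)" if v: "v \<in> V" for v k
  proof -
    have "\<exists>q\<in>\<rat>. \<bar>v i - q\<bar> < 1 / (real k+1)" for i
    proof -
      have "v i < v i + 1 / (real k+1)" by simp
      from Rats_dense_in_real[OF this] obtain q where "q\<in>\<rat>" "v i < q" "q < v i + 1/(real k+1)" by auto
      then show ?thesis by (intro bexI[of _ q]) auto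
    qed
    then obtain q where q: "\<And>i. q i \<in> \<rat>" "\<And>i. \<bar>v i - q i\<bar> < 1 / (real k+1)" by metis
    let ?q = "restrict q I"
    have ex: "?P ?q k v" using v q by auto
    have S: "(?q, k) \<in> S" unfolding S_def using q ex by auto
    let ?d = "SOME v. ?P ?q k v"
    have "?P ?q k ?d" using someI[of "?P ?q k", OF ex] .
    then have d: "\<forall>i\<in>I. \<bar>?d i - q i\<bar> < 1 / (real k+1)" by (simp add: add.commute)
    have "\<bar>v i - ?d i\<bar> \<le> 2 / (real k+1)" if i: "i\<in>I" for i
    proof -
      have "\<bar>?d i - q i\<bar> < 1 / (real k+1)" using d i by blast
      moreover have "2 / (real k + 1) = 1/(real k+1) + 1/(real k+1)" by (simp add: add_divide_distrib[symmetric])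
      ultimately show ?thesis using q(2)[of i] by linarith
    qed
    moreover have "?d \<in> D" unfolding D_def using S by force
    ultimately show ?thesis by blast
  qed
  have Dne: "D \<noteq> {}" using dense assms(1) by (force simp: bounded_fam_def)
  have bD: "bounded_fam I D" using bounded_fam_subset[OF assms(1) Dne DV] .
  have eq: "supf I V y = supf I D y" for y
  proof (rule antisym)
    show "supf I D y \<le> supf I V y" by (rule supf_mono[OF assms(1) Dne DV])
    show "supf I V y \<le> supf I D y"
    proof (rule supf_least)
      show "V \<noteq> {}" using assms(1) by (simp add: bounded_fam_def)
      fix v assume v: "v \<in> V"
      show "lin I v y \<le> supf I D y"
      proof (rule LIMSEQ_le_const)
        show "(\<lambda>k. supf I D y + 2/(real k + 1) * (\<Sum>i\<in>I. \<bar>y i\<bar>)) \<longlonglongrightarrow> supf I D y"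
        proof -
          have "(\<lambda>k. 1 / (real (Suc k))) \<longlonglongrightarrow> 0" using LIMSEQ_inverse_real_of_nat by (simp add: inverse_eq_divide)
          then have "(\<lambda>k. supf I D y + 2 * (1/real (Suc k)) * (\<Sum>i\<in>I. \<bar>y i\<bar>)) \<longlonglongrightarrow> supf I D y + 2*0 * (\<Sum>i\<in>I. \<bar>y i\<bar>)"
            by (intro tendsto_intros)
          then show ?thesis by (simp add: add.commute)
        qed
        show "\<exists>N. \<forall>k\<ge>N. lin I v y \<le> supf I D y + 2/(real k + 1) * (\<Sum>i\<in>I. \<bar>y i\<bar>)"
        proof (intro exI allI impI)
          fix k
          obtain d where d: "d\<in>D" "\<forall>i\<in>I. \<bar>v i - d i\<bar> \<le> 2 / (real k+1)" using dense[OF v] by blast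
          have "\<bar>lin I (\<lambda>i. v i - d i) y\<bar> \<le> 2/(real k + 1) * (\<Sum>i\<in>I. \<bar>y i\<bar>)"
            by (rule abs_lin_le) (use d in auto)
          then show "lin I v y \<le> supf I D y + 2/(real k + 1) * (\<Sum>i\<in>I. \<bar>y i\<bar>)"
            using lin_le_supf[OF bD d(1), of y] lin_diff[of I v y d] by linarith
        qed
      qed
    qed
  qed
  have "range (from_nat_into D) = D" using cD Dne by (simp add: range_from_nat_into)
  then show ?thesis using that[of "from_nat_into D"] DV eq by auto
qed

section \<open>Measurability, integrability and finite approximation of suprema\<close>

lemma supf_finite_measurable:
  assumes "finite V" "V \<noteq> {}" "\<And>i. i \<in> I \<Longrightarrow> (\<lambda>w. Y w i) \<in> borel_measurable M"
  shows "(\<lambda>w. supf I V (Y w)) \<in> borel_measurable M"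
proof -
  have [measurable]: "(\<lambda>w. lin I v (Y w)) \<in> borel_measurable M" for v
    unfolding lin_def using assms(3) by (intro borel_measurable_sum) (simp add: borel_measurable_times)
  show ?thesis unfolding supf_def using assms
    by (intro borel_measurable_cSUP) (auto simp: countable_finite)
qed

lemma supf_measurable:
  assumes "bounded_fam I V" "finite I" "\<And>i. i \<in> I \<Longrightarrow> (\<lambda>w. Y w i) \<in> borel_measurable M"
  shows "(\<lambda>w. supf I V (Y w)) \<in> borel_measurable M"
proof -
  obtain e :: "nat \<Rightarrow> _" where e: "range e \<subseteq> V" "\<And>y. supf I V y = supf I (range e) y"
    by (rule countable_dense_family[OF assms(1,2)]) blast
  have b: "bounded_fam I (range e)" using bounded_fam_subset[OF assms(1) _ e(1)] by auto
  have [measurable]: "(\<lambda>w. lin I v (Y w)) \<in> borel_measurable M" for v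
    unfolding lin_def using assms(3) by (intro borel_measurable_sum) (simp add: borel_measurable_times)
  show ?thesis unfolding e(2) unfolding supf_def
    by (intro borel_measurable_cSUP) (use bounded_fam_bdd_above[OF b] in auto)
qed

lemma supf_integrable:
  assumes "bounded_fam I V" "finite I" "\<And>i. i \<in> I \<Longrightarrow> integrable M (\<lambda>w. Y w i)"
  shows "integrable M (\<lambda>w. supf I V (Y w))"
proof -
  obtain R where R: "\<forall>v\<in>V. \<forall>i\<in>I. \<bar>v i\<bar> \<le> R" using assms by (auto simp: bounded_fam_def)
  show ?thesis
  proof (rule Bochner_Integration.integrable_bound)
    show "integrable M (\<lambda>w. R * (\<Sum>i\<in>I. \<bar>Y w i\<bar>))" using assms by auto
    show "(\<lambda>w. supf I V (Y w)) \<in> borel_measurable M" by (rule supf_measurable) (use assms in auto)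
    show "AE w in M. norm (supf I V (Y w)) \<le> norm (R * (\<Sum>i\<in>I. \<bar>Y w i\<bar>))"
      using abs_supf_le[of V I R] R assms(1) by (auto simp: bounded_fam_def intro!: AE_I2 order_trans[OF _ abs_ge_self])
  qed
qed

text \<open>Finite initial segments of the countable dense family increase to the full supremum, and
  the l1 domination allows the limit under the integral. Measurable maximisers and exponential
  moments are then needed for finite families only.\<close>

lemma supf_finite_approx:
  assumes "bounded_fam I V" "finite I" "\<And>i. i \<in> I \<Longrightarrow> integrable M (\<lambda>w. Y w i)" and "\<epsilon> > 0"
  obtains F where "finite F" "F \<noteq> {}" "F \<subseteq> V"
    "(\<integral>w. supf I V (Y w) \<partial>M) \<le> (\<integral>w. supf I F (Y w) \<partial>M) + \<epsilon>"
proof -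
  obtain e :: "nat \<Rightarrow> _" where e: "range e \<subseteq> V" "\<And>y. supf I V y = supf I (range e) y"
    by (rule countable_dense_family[OF assms(1,2)]) blast
  have b: "bounded_fam I (range e)" using bounded_fam_subset[OF assms(1) _ e(1)] by auto
  obtain R where R: "\<forall>v\<in>V. \<forall>i\<in>I. \<bar>v i\<bar> \<le> R" using assms by (auto simp: bounded_fam_def)
  have conv: "(\<lambda>n. supf I (e ` {..n}) y) \<longlonglongrightarrow> supf I (range e) y" for y
  proof (rule increasing_tendsto)
    show "\<forall>\<^sub>F n in sequentially. supf I (e ` {..n}) y \<le> supf I (range e) y"
      by (intro always_eventually allI supf_mono[OF b]) auto
    fix x assume "x < supf I (range e) y"
    then obtain k where k: "x < lin I (e k) y"
      unfolding supf_def using less_cSUP_iff[OF _ bounded_fam_bdd_above[OF b]] by auto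
    have "x < supf I (e ` {..n}) y" if "n \<ge> k" for n
      using k lin_le_supf[of I "e ` {..n}" "e k" y] bounded_fam_subset[OF b, of "e ` {..n}"] that
      by fastforce
    then show "\<forall>\<^sub>F n in sequentially. x < supf I (e ` {..n}) y" unfolding eventually_sequentially by blast
  qed
  have "(\<lambda>n. \<integral>w. supf I (e ` {..n}) (Y w) \<partial>M) \<longlonglongrightarrow> (\<integral>w. supf I (range e) (Y w) \<partial>M)"
  proof (rule integral_dominated_convergence)
    show "integrable M (\<lambda>w. R * (\<Sum>i\<in>I. \<bar>Y w i\<bar>))" using assms by auto
    show "(\<lambda>w. supf I (range e) (Y w)) \<in> borel_measurable M" by (rule supf_measurable[OF b assms(2)]) (use assms in auto)
    show "(\<lambda>w. supf I (e ` {..n}) (Y w)) \<in> borel_measurable M" for n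
      by (rule supf_finite_measurable) (use assms in auto)
    show "AE w in M. (\<lambda>n. supf I (e ` {..n}) (Y w)) \<longlonglongrightarrow> supf I (range e) (Y w)" using conv by auto
    show "AE w in M. norm (supf I (e ` {..n}) (Y w)) \<le> R * (\<Sum>i\<in>I. \<bar>Y w i\<bar>)" for n
      using abs_supf_le[of "e ` {..n}" I R] R e(1) by (intro AE_I2) (auto simp: image_subset_iff)
  qed
  then have "\<forall>\<^sub>F n in sequentially. dist (\<integral>w. supf I (e ` {..n}) (Y w) \<partial>M) (\<integral>w. supf I (range e) (Y w) \<partial>M) < \<epsilon>"
    using assms(4) by (rule tendstoD)
  then obtain n where "dist (\<integral>w. supf I (e ` {..n}) (Y w) \<partial>M) (\<integral>w. supf I (range e) (Y w) \<partial>M) < \<epsilon>"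
    using eventually_happens'[OF sequentially_bot] by blast
  then have "(\<integral>w. supf I V (Y w) \<partial>M) \<le> (\<integral>w. supf I (e ` {..n}) (Y w) \<partial>M) + \<epsilon>"
    unfolding e(2) dist_real_def by linarith
  then show ?thesis using that[of "e ` {..n}"] e(1) by auto
qed

text \<open>The maximiser is the one of least index in an enumeration of \<open>F\<close>, so that
  measurability concerns only a map into the natural numbers. The enumeration \<open>e\<close> may
  repeat members.\<close>

lemma supf_argmax:
  assumes "finite F" "F \<noteq> {}" "\<And>i. i \<in> I \<Longrightarrow> (\<lambda>w. Y w i) \<in> borel_measurable M"
  obtains e :: "nat \<Rightarrow> 'i \<Rightarrow> real" and \<kappa> where "range e \<subseteq> F" "\<kappa> \<in> measurable M (count_space UNIV)"
    "\<And>w. lin I (e (\<kappa> w)) (Y w) = supf I F (Y w)"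
proof -
  let ?e = "from_nat_into F"
  have r: "range ?e = F" using assms by (simp add: range_from_nat_into countable_finite)
  have [measurable]: "(\<lambda>w. lin I v (Y w)) \<in> borel_measurable M" for v
    unfolding lin_def using assms(3) by (intro borel_measurable_sum) (simp add: borel_measurable_times)
  have [measurable]: "(\<lambda>w. supf I F (Y w)) \<in> borel_measurable M" by (rule supf_finite_measurable[OF assms])
  define \<kappa> where "\<kappa> = (\<lambda>w. LEAST k. lin I (?e k) (Y w) = supf I F (Y w))"
  have "\<kappa> \<in> measurable M (count_space UNIV)" unfolding \<kappa>_def by measurable
  moreover have "lin I (?e (\<kappa> w)) (Y w) = supf I F (Y w)" for w
  proof -
    have "supf I F (Y w) \<in> (\<lambda>v. lin I v (Y w)) ` F" unfolding supf_def
      using assms by (subst cSup_eq_Max) (auto intro!: Max_in)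
    then obtain v where "v \<in> F" "lin I v (Y w) = supf I F (Y w)" by auto
    then obtain k where "lin I (?e k) (Y w) = supf I F (Y w)" using r by (metis imageE)
    then show ?thesis unfolding \<kappa>_def by (rule LeastI)
  qed
  ultimately show ?thesis using that r by blast
qed

section \<open>Shifts and rotations of Gaussian measures\<close>

definition std_gauss :: "real measure" where "std_gauss = density lborel std_normal_density"

lemma gauss_std_gauss: "gauss I = PiM I (\<lambda>_. std_gauss)" by (simp add: gauss_def std_gauss_def)

lemma prob_std_gauss: "prob_space std_gauss" unfolding std_gauss_def by (rule prob_space_normal_density) simp

lemma sets_std_gauss[simp, measurable_cong]: "sets std_gauss = sets borel" by (simp add: std_gauss_def)

lemma space_std_gauss[simp]: "space std_gauss = UNIV" by (simp add: std_gauss_def)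

lemma product_prob_std_gauss: "product_prob_space (\<lambda>_::'i. std_gauss)"
proof -
  interpret prob_space std_gauss by (rule prob_std_gauss)
  show ?thesis by unfold_locales
qed

lemma product_sigma_finite_std_gauss: "product_sigma_finite (\<lambda>_::'i. std_gauss)"
  using product_prob_std_gauss by (rule product_prob_space.axioms)

lemma prob_gauss: "prob_space (gauss I)"
  unfolding gauss_std_gauss by (rule prob_space_PiM) (rule prob_std_gauss)

lemma sets_gauss[measurable_cong]: "sets (gauss I) = sets (PiM I (\<lambda>_. borel))"
  unfolding gauss_std_gauss by (intro sets_PiM_cong) auto

lemma space_gauss: "space (gauss I) = extensional I"
  unfolding gauss_std_gauss by (auto simp: space_PiM PiE_def)

lemma sigma_finite_std_gauss: "sigma_finite_measure std_gauss"
  by (rule prob_space_imp_sigma_finite[OF prob_std_gauss])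

lemma measurable_coord: "i \<in> I \<Longrightarrow> (\<lambda>g. g i) \<in> borel_measurable (gauss I)"
  by (simp add: measurable_component_singleton cong: measurable_cong_sets[OF sets_gauss refl])

lemma nn_integral_std_gauss:
  assumes "f \<in> borel_measurable borel"
  shows "(\<integral>\<^sup>+x. f x \<partial>std_gauss) = (\<integral>\<^sup>+x. ennreal (std_normal_density x) * f x \<partial>lborel)"
  unfolding std_gauss_def using assms by (subst nn_integral_density) auto

lemma std_gauss_shift:
  assumes [measurable]: "f \<in> borel_measurable borel"
  shows "(\<integral>\<^sup>+x. f (x - a) \<partial>std_gauss) = (\<integral>\<^sup>+x. f x * ennreal (exp (- a * x - a\<^sup>2/2)) \<partial>std_gauss)"
proof -
  have d: "std_normal_density (a + x) = std_normal_density x * exp (- a * x - a\<^sup>2/2)" for x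
  proof -
    have "- (a + x)\<^sup>2/2 = - x\<^sup>2/2 + (- a * x - a\<^sup>2/2)" by (simp add: power2_eq_square field_simps)
    then show ?thesis unfolding std_normal_density_def by (simp only: exp_add)
  qed
  have "(\<integral>\<^sup>+x. f (x - a) \<partial>std_gauss) = (\<integral>\<^sup>+x. ennreal (std_normal_density x) * f (x - a) \<partial>lborel)"
    by (subst nn_integral_std_gauss) auto
  also have "\<dots> = (\<integral>\<^sup>+x. ennreal (std_normal_density (a + x)) * f x \<partial>lborel)"
    by (subst nn_integral_real_affine[where c=1 and t=a]) auto
  also have "\<dots> = (\<integral>\<^sup>+x. ennreal (std_normal_density x) * (f x * ennreal (exp (- a * x - a\<^sup>2/2))) \<partial>lborel)"
    unfolding d by (intro nn_integral_cong) (simp add: ennreal_mult mult_ac)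
  also have "\<dots> = (\<integral>\<^sup>+x. f x * ennreal (exp (- a * x - a\<^sup>2/2)) \<partial>std_gauss)"
    by (subst nn_integral_std_gauss) auto
  finally show ?thesis .
qed

lemma std_gauss_uminus:
  assumes [measurable]: "f \<in> borel_measurable borel"
  shows "(\<integral>\<^sup>+x. f (- x) \<partial>std_gauss) = (\<integral>\<^sup>+x. f x \<partial>std_gauss)"
proof -
  have "(\<integral>\<^sup>+x. f (- x) \<partial>std_gauss) = (\<integral>\<^sup>+x. ennreal (std_normal_density x) * f (- x) \<partial>lborel)"
    by (subst nn_integral_std_gauss) auto
  also have "\<dots> = (\<integral>\<^sup>+x. ennreal (std_normal_density x) * f x \<partial>lborel)"
    by (subst nn_integral_real_affine[where c="-1" and t=0]) (auto simp: std_normal_density_def)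
  finally show ?thesis by (simp add: nn_integral_std_gauss)
qed

text \<open>Serves translations (\<open>w\<close> the ratio of densities) and reflections
  (\<open>w\<close> equal to 1) alike: a weighted change of variables in one dimension passes to the
  product measure coordinate by coordinate, by Fubini.\<close>

lemma gauss_transform:
  fixes T :: "'i \<Rightarrow> real \<Rightarrow> real" and w :: "'i \<Rightarrow> real \<Rightarrow> ennreal"
  assumes "finite I"
    and "\<And>i. i \<in> I \<Longrightarrow> T i \<in> borel_measurable borel" "\<And>i. i \<in> I \<Longrightarrow> w i \<in> borel_measurable borel"
    and "\<And>i f. i \<in> I \<Longrightarrow> f \<in> borel_measurable borel \<Longrightarrow> (\<integral>\<^sup>+x. f (T i x) \<partial>std_gauss) = (\<integral>\<^sup>+x. f x * w i x \<partial>std_gauss)"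
    and "f \<in> borel_measurable (gauss I)"
  shows "(\<integral>\<^sup>+g. f (\<lambda>i\<in>I. T i (g i)) \<partial>gauss I) = (\<integral>\<^sup>+g. f g * (\<Prod>i\<in>I. w i (g i)) \<partial>gauss I)"
  using assms
proof (induction I arbitrary: f rule: finite_induct)
  case empty
  interpret product_sigma_finite "\<lambda>_::'i. std_gauss" by (rule product_sigma_finite_std_gauss)
  show ?case using prob_space.emeasure_space_1[OF prob_gauss[of "{} :: 'i set", unfolded gauss_std_gauss]]
    by (simp add: gauss_std_gauss nn_integral_empty restrict_def)
next
  case (insert i I)
  interpret product_sigma_finite "\<lambda>_::'i. std_gauss" by (rule product_sigma_finite_std_gauss)
  interpret sigma_finite_measure std_gauss by (rule sigma_finite_std_gauss)
  note [measurable] = insert.prems(4)[unfolded gauss_std_gauss]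
  have [measurable]: "T i \<in> borel_measurable borel" "w i \<in> borel_measurable borel" using insert.prems by auto
  have [measurable]: "j \<in> I \<Longrightarrow> T j \<in> borel_measurable borel" "j \<in> I \<Longrightarrow> w j \<in> borel_measurable borel" for j
    using insert.prems by auto
  have [measurable]: "(\<lambda>g. \<lambda>j\<in>insert i I. T j (g j)) \<in> measurable (PiM (insert i I) (\<lambda>_. std_gauss)) (PiM (insert i I) (\<lambda>_. std_gauss))"
    by (intro measurable_restrict) (use insert.prems in auto)
  have [measurable]: "(\<lambda>g. \<lambda>j\<in>I. T j (g j)) \<in> measurable (PiM I (\<lambda>_. std_gauss)) (PiM I (\<lambda>_. std_gauss))"
    by (intro measurable_restrict) (use insert.prems in auto)
  have [measurable]: "(\<lambda>g. \<Prod>j\<in>insert i I. w j (g j)) \<in> borel_measurable (PiM (insert i I) (\<lambda>_. std_gauss))"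
    by (intro borel_measurable_prod_ennreal) (use insert.prems in auto)
  have up: "(\<lambda>j\<in>insert i I. T j ((x(i := y)) j)) = (\<lambda>j\<in>I. T j (x j))(i := T i y)" for x y
    using insert.hyps by (auto simp: restrict_def fun_eq_iff)
  have pr: "(\<Prod>j\<in>insert i I. w j ((x(i := y)) j)) = w i y * (\<Prod>j\<in>I. w j (x j))" for x y
  proof -
    have "(\<Prod>j\<in>I. w j ((x(i := y)) j)) = (\<Prod>j\<in>I. w j (x j))"
      by (rule prod.cong) (use insert.hyps in auto)
    then show ?thesis using insert.hyps by (simp del: fun_upd_apply add: fun_upd_same)
  qed
  have fm: "(\<lambda>y. f (x(i := y))) \<in> borel_measurable borel" if "x \<in> space (PiM I (\<lambda>_. std_gauss))" for x
    using that by measurable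
  define F where "F = (\<lambda>x. \<integral>\<^sup>+y. f (x(i := y)) * w i y \<partial>std_gauss)"
  have [measurable]: "F \<in> borel_measurable (PiM I (\<lambda>_. std_gauss))" unfolding F_def by measurable
  have "(\<integral>\<^sup>+g. f (\<lambda>j\<in>insert i I. T j (g j)) \<partial>gauss (insert i I))
      = (\<integral>\<^sup>+x. (\<integral>\<^sup>+y. f ((\<lambda>j\<in>I. T j (x j))(i := T i y)) \<partial>std_gauss) \<partial>gauss I)"
    unfolding gauss_std_gauss
    by (subst product_nn_integral_insert[OF insert.hyps], measurable, simp only: up)
  also have "\<dots> = (\<integral>\<^sup>+x. F (\<lambda>j\<in>I. T j (x j)) \<partial>gauss I)"
    unfolding F_def by (intro nn_integral_cong insert.prems(3)[OF insertI1] fm) (auto simp: space_PiM)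
  also have "\<dots> = (\<integral>\<^sup>+x. F x * (\<Prod>j\<in>I. w j (x j)) \<partial>gauss I)"
    by (rule insert.IH) (use insert.prems in \<open>auto simp: gauss_std_gauss\<close>)
  also have "\<dots> = (\<integral>\<^sup>+x. (\<integral>\<^sup>+y. f (x(i := y)) * (\<Prod>j\<in>insert i I. w j ((x(i := y)) j)) \<partial>std_gauss) \<partial>gauss I)"
    unfolding F_def pr
  proof (rule nn_integral_cong)
    fix x :: "'i \<Rightarrow> real" assume "x \<in> space (gauss I)"
    then have [measurable]: "(\<lambda>y. f (x(i := y))) \<in> borel_measurable borel" by (intro fm) (simp add: gauss_std_gauss)
    have "(\<integral>\<^sup>+y. f (x(i := y)) * w i y \<partial>std_gauss) * (\<Prod>j\<in>I. w j (x j))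
        = (\<integral>\<^sup>+y. f (x(i := y)) * w i y * (\<Prod>j\<in>I. w j (x j)) \<partial>std_gauss)"
      by (subst nn_integral_multc) auto
    then show "(\<integral>\<^sup>+y. f (x(i := y)) * w i y \<partial>std_gauss) * (\<Prod>j\<in>I. w j (x j))
        = (\<integral>\<^sup>+y. f (x(i := y)) * (w i y * (\<Prod>j\<in>I. w j (x j))) \<partial>std_gauss)"
      by (simp add: mult.assoc)
  qed
  also have "\<dots> = (\<integral>\<^sup>+g. f g * (\<Prod>j\<in>insert i I. w j (g j)) \<partial>gauss (insert i I))"
    unfolding gauss_std_gauss by (subst product_nn_integral_insert) (use insert.hyps in auto)
  finally show ?case .
qed

lemma Cameron_Martin:
  assumes "finite I" "f \<in> borel_measurable (gauss I)"
  shows "(\<integral>\<^sup>+g. f (\<lambda>i\<in>I. g i - y i) \<partial>gauss I)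
    = (\<integral>\<^sup>+g. f g * ennreal (exp (- lin I y g - (\<Sum>i\<in>I. (y i)\<^sup>2)/2)) \<partial>gauss I)"
proof -
  have "(\<integral>\<^sup>+g. f (\<lambda>i\<in>I. g i - y i) \<partial>gauss I)
    = (\<integral>\<^sup>+g. f g * (\<Prod>i\<in>I. ennreal (exp (- y i * g i - (y i)\<^sup>2/2))) \<partial>gauss I)"
    by (rule gauss_transform[where T="\<lambda>i x. x - y i", OF assms(1) _ _ std_gauss_shift assms(2)]) auto
  also have "\<dots> = (\<integral>\<^sup>+g. f g * ennreal (exp (- lin I y g - (\<Sum>i\<in>I. (y i)\<^sup>2)/2)) \<partial>gauss I)"
    by (simp add: prod_ennreal exp_sum[symmetric] assms(1) lin_def sum_subtractf sum_negf sum_divide_distrib)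
  finally show ?thesis .
qed

lemma gauss_uminus:
  assumes "finite I" "f \<in> borel_measurable (gauss I)"
  shows "(\<integral>\<^sup>+g. f (\<lambda>i\<in>I. - g i) \<partial>gauss I) = (\<integral>\<^sup>+g. f g \<partial>gauss I)"
  using gauss_transform[of I "\<lambda>i x. - x" "\<lambda>i x. 1" f] assms by (auto simp: std_gauss_uminus)

text \<open>The Cameron--Martin formula for the constant function 1 and the translation by
  -v.\<close>

lemma gauss_mgf:
  assumes "finite I"
  shows "(\<integral>\<^sup>+g. ennreal (exp (lin I v g)) \<partial>gauss I) = ennreal (exp ((\<Sum>i\<in>I. (v i)\<^sup>2)/2))"
proof -
  interpret prob_space "gauss I" by (rule prob_gauss)
  let ?s = "(\<Sum>i\<in>I. (v i)\<^sup>2)/2"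
  have [measurable]: "(\<lambda>g. lin I v g) \<in> borel_measurable (gauss I)"
    unfolding lin_def by (intro borel_measurable_sum borel_measurable_times measurable_coord) auto
  have "1 = (\<integral>\<^sup>+g. 1 \<partial>gauss I)" by (simp add: emeasure_space_1)
  also have "\<dots> = (\<integral>\<^sup>+g. 1 * ennreal (exp (- lin I (\<lambda>i. - v i) g - (\<Sum>i\<in>I. (- v i)\<^sup>2)/2)) \<partial>gauss I)"
    by (rule Cameron_Martin[OF assms]) auto
  also have "\<dots> = (\<integral>\<^sup>+g. ennreal (exp (- ?s)) * ennreal (exp (lin I v g)) \<partial>gauss I)"
    by (intro nn_integral_cong) (simp add: lin_minus_left ennreal_mult[symmetric] exp_add[symmetric])
  also have "\<dots> = ennreal (exp (- ?s)) * (\<integral>\<^sup>+g. ennreal (exp (lin I v g)) \<partial>gauss I)"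
    by (subst nn_integral_cmult) auto
  finally have "ennreal (exp ?s) * 1 = ennreal (exp ?s) * (ennreal (exp (- ?s)) * (\<integral>\<^sup>+g. ennreal (exp (lin I v g)) \<partial>gauss I))"
    by simp
  then show ?thesis
    by (simp only: mult.assoc[symmetric] ennreal_mult[symmetric] exp_ge_zero exp_add[symmetric]) simp
qed

text \<open>On \<open>K\<close> the translation has density exp (-<y,g> - |y|^2/2). As
  \<open>K\<close> is symmetric, this may be averaged with its reflection, which replaces exp
  (-<y,g>) by a hyperbolic cosine, and that is at least 1.\<close>

lemma symmetric_shift_prob:
  assumes "finite I" "Measurable.pred (gauss I) K" "\<And>g. K (\<lambda>i\<in>I. - g i) \<longleftrightarrow> K g"
  shows "measure (gauss I) {g\<in>space (gauss I). K (\<lambda>i\<in>I. g i - y i)}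
    \<ge> exp (- (\<Sum>i\<in>I. (y i)\<^sup>2)/2) * measure (gauss I) {g\<in>space (gauss I). K g}"
proof -
  interpret prob_space "gauss I" by (rule prob_gauss)
  let ?G = "gauss I" and ?c = "exp (- (\<Sum>i\<in>I. (y i)\<^sup>2)/2)"
  let ?f = "indicator {g\<in>space ?G. K g} :: ('a \<Rightarrow> real) \<Rightarrow> ennreal"
  have [measurable]: "(\<lambda>g. lin I v g) \<in> borel_measurable ?G" for v
    unfolding lin_def by (intro borel_measurable_sum borel_measurable_times measurable_coord) auto
  note [measurable] = assms(2)
  have sub[measurable]: "(\<lambda>g. \<lambda>i\<in>I. g i - y i) \<in> measurable ?G ?G"
    unfolding gauss_std_gauss by measurable
  have a: "(\<integral>\<^sup>+g. ?f (\<lambda>i\<in>I. g i - y i) \<partial>?G) = emeasure ?G {g\<in>space ?G. K (\<lambda>i\<in>I. g i - y i)}"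
  proof -
    have [measurable]: "Measurable.pred ?G (\<lambda>g. K (\<lambda>i\<in>I. g i - y i))"
      by (rule measurable_compose[OF sub assms(2)])
    have "(\<integral>\<^sup>+g. ?f (\<lambda>i\<in>I. g i - y i) \<partial>?G) = (\<integral>\<^sup>+g. indicator {g\<in>space ?G. K (\<lambda>i\<in>I. g i - y i)} g \<partial>?G)"
      by (intro nn_integral_cong) (use measurable_space[OF sub] in \<open>auto simp: indicator_def\<close>)
    then show ?thesis by simp
  qed
  let ?h = "\<lambda>s g. ?f g * ennreal (exp (s * lin I y g - (\<Sum>i\<in>I. (y i)\<^sup>2)/2))"
  have b1: "(\<integral>\<^sup>+g. ?f (\<lambda>i\<in>I. g i - y i) \<partial>?G) = (\<integral>\<^sup>+g. ?h (-1) g \<partial>?G)"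
    using Cameron_Martin[OF assms(1), of ?f y] by simp
  have b2: "(\<integral>\<^sup>+g. ?h (-1) g \<partial>?G) = (\<integral>\<^sup>+g. ?h 1 g \<partial>?G)"
  proof -
    have "(\<integral>\<^sup>+g. ?h (-1) g \<partial>?G) = (\<integral>\<^sup>+g. ?h (-1) (\<lambda>i\<in>I. - g i) \<partial>?G)"
      by (rule gauss_uminus[symmetric, OF assms(1)]) auto
    also have "\<dots> = (\<integral>\<^sup>+g. ?h 1 g \<partial>?G)"
    proof (intro nn_integral_cong)
      fix g assume "g \<in> space ?G"
      have "lin I y (\<lambda>i\<in>I. - g i) = - lin I y g"
        by (simp add: lin_minus_right[symmetric] cong: lin_cong)
      then show "?h (-1) (\<lambda>i\<in>I. - g i) = ?h 1 g"
        using assms(3)[of g] \<open>g \<in> space ?G\<close> by (simp add: indicator_def space_gauss)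
    qed
    finally show ?thesis .
  qed
  have "2 * (ennreal ?c * emeasure ?G {g\<in>space ?G. K g}) = (\<integral>\<^sup>+g. ennreal (2 * ?c) * ?f g \<partial>?G)"
    by (subst nn_integral_cmult) (auto simp: ennreal_mult mult.assoc)
  also have "\<dots> \<le> (\<integral>\<^sup>+g. ?h (-1) g + ?h 1 g \<partial>?G)"
  proof (intro nn_integral_mono)
    fix g
    let ?l = "lin I y g" and ?s = "(\<Sum>i\<in>I. (y i)\<^sup>2)/2"
    have "2 * ?c \<le> exp (- ?l - ?s) + exp (?l - ?s)"
    proof -
      have "1 + ?l \<le> exp ?l" "1 + (- ?l) \<le> exp (- ?l)" by (rule exp_ge_add_one_self)+
      then have "2 \<le> exp ?l + exp (- ?l)" by linarith
      then have "2 * exp (- ?s) \<le> (exp ?l + exp (- ?l)) * exp (- ?s)" by (rule mult_right_mono) simp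
      moreover have "(exp ?l + exp (- ?l)) * exp (- ?s) = exp (- ?l - ?s) + exp (?l - ?s)"
        by (simp add: distrib_right mult_exp_exp)
      ultimately show ?thesis by simp
    qed
    then have "ennreal (2 * ?c) \<le> ennreal (exp (- ?l - ?s)) + ennreal (exp (?l - ?s))"
      by (simp add: ennreal_plus[symmetric] ennreal_leI del: ennreal_plus)
    then show "ennreal (2 * ?c) * ?f g \<le> ?h (-1) g + ?h 1 g"
      by (auto simp: indicator_def split: if_splits)
  qed
  also have "\<dots> = (\<integral>\<^sup>+g. ?h (-1) g \<partial>?G) + (\<integral>\<^sup>+g. ?h 1 g \<partial>?G)"
    by (rule nn_integral_add) auto
  also have "\<dots> = 2 * emeasure ?G {g\<in>space ?G. K (\<lambda>i\<in>I. g i - y i)}"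
    unfolding b2[symmetric] b1[symmetric] a by (simp add: mult_2)
  finally have "ennreal (2 * (?c * measure ?G {g\<in>space ?G. K g})) \<le> ennreal (2 * measure ?G {g\<in>space ?G. K (\<lambda>i\<in>I. g i - y i)})"
    by (simp add: emeasure_eq_measure ennreal_mult)
  then show ?thesis by (subst (asm) ennreal_le_iff) auto
qed

section \<open>Gaussian width\<close>

lemma std_gauss_moment_integrable: "integrable std_gauss (\<lambda>x. x ^ k)"
proof -
  have "integrable lborel (\<lambda>x. std_normal_density x *\<^sub>R (x ^ k))"
    using integrable_std_normal_moment[of k] by simp
  then show ?thesis unfolding std_gauss_def by (subst integrable_density) simp_all
qed

lemma std_gauss_integral_eq:
  assumes "(f :: real \<Rightarrow> real) \<in> borel_measurable borel"
  shows "(\<integral>x. f x \<partial>std_gauss) = (\<integral>x. std_normal_density x * f x \<partial>lborel)"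
  unfolding std_gauss_def using assms by (subst integral_density) simp_all

lemma std_gauss_mean: "(\<integral>x. x \<partial>std_gauss) = 0"
proof -
  have "(\<integral>x. std_normal_density x * x ^ (2 * 0 + 1) \<partial>lborel) = 0"
    by (rule integral_std_normal_moment_odd)
  then show ?thesis by (subst std_gauss_integral_eq) simp_all
qed

lemma std_gauss_second_moment: "(\<integral>x. x * x \<partial>std_gauss) = 1"
proof -
  have "(\<integral>x. std_normal_density x * x ^ (2 * 1) \<partial>lborel) = fact (2 * 1) / (2 ^ 1 * fact 1)"
    by (rule integral_std_normal_moment_even)
  then have "(\<integral>x. std_normal_density x * x\<^sup>2 \<partial>lborel) = 1" by simp
  then show ?thesis by (subst std_gauss_integral_eq) (simp_all add: power2_eq_square)
qed
lemma gauss_coord_prod: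
  fixes I :: "'i set"
  assumes "finite I" "i \<in> I" "j \<in> I"
  shows "integrable (gauss I) (\<lambda>g. g i * g j)" "(\<integral>g. g i * g j \<partial>gauss I) = (if i = j then 1 else 0)"
proof -
  interpret product_sigma_finite "\<lambda>_::'i. std_gauss" by (rule product_sigma_finite_std_gauss)
  interpret std_gauss: prob_space std_gauss by (rule prob_std_gauss)
  \<comment> \<open>One factor per coordinate serves both cases: x * x where
    \<open>k = i = j\<close>, x at a single match, 1 elsewhere, so that the product formula for
    independent coordinates applies uniformly.\<close>
  let ?f = "\<lambda>k x. (if k = i then x else 1) * (if k = j then x else 1 :: real)"
  note m = std_gauss_moment_integrable
  note e1 = std_gauss_mean
  note e2 = std_gauss_second_moment
  have int: "integrable std_gauss (?f k)" for k
    using m[of 0] m[of 1] m[of 2] by (cases "k = i"; cases "k = j"; simp add: power2_eq_square)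
  have pr: "(\<Prod>k\<in>I. ?f k (g k)) = g i * g j" for g :: "'i \<Rightarrow> real"
    using assms by (simp add: prod.distrib prod.delta)
  show "integrable (gauss I) (\<lambda>g. g i * g j)"
    using product_integrable_prod[OF assms(1), of ?f] int unfolding pr gauss_std_gauss by blast
  have "(\<integral>g. g i * g j \<partial>gauss I) = (\<Prod>k\<in>I. integral\<^sup>L std_gauss (?f k))"
    using product_integral_prod[OF assms(1), of ?f] int unfolding pr gauss_std_gauss by blast
  also have "\<dots> = (if i = j then 1 else 0)"
  proof (cases "i = j")
    case True
    then have "integral\<^sup>L std_gauss (?f k) = 1" for k by (cases "k = i") (simp_all add: e2 std_gauss.prob_space[simplified])
    then show ?thesis using True by simp
  next
    case False
    then have "integral\<^sup>L std_gauss (?f i) = 0" by (simp add: e1)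
    then show ?thesis using False assms(2) by (simp add: prod_zero[OF assms(1)] bexI[of _ i])
  qed
  finally show "(\<integral>g. g i * g j \<partial>gauss I) = (if i = j then 1 else 0)" .
qed

lemma gauss_coord:
  fixes I :: "'i set"
  assumes "finite I" "i \<in> I"
  shows "integrable (gauss I) (\<lambda>g. g i)" "(\<integral>g. g i \<partial>gauss I) = 0"
proof -
  interpret product_sigma_finite "\<lambda>_::'i. std_gauss" by (rule product_sigma_finite_std_gauss)
  interpret std_gauss: prob_space std_gauss by (rule prob_std_gauss)
  let ?f = "\<lambda>k x. (if k = i then x else 1 :: real)"
  note m = std_gauss_moment_integrable
  note e1 = std_gauss_mean
  have int: "integrable std_gauss (?f k)" for k
    using m[of 0] m[of 1] by (cases "k = i"; simp)
  have pr: "(\<Prod>k\<in>I. ?f k (g k)) = g i" for g :: "'i \<Rightarrow> real"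
    using assms by (simp add: prod.delta)
  show "integrable (gauss I) (\<lambda>g. g i)"
    using product_integrable_prod[OF assms(1), of ?f] int unfolding pr gauss_std_gauss by blast
  have "(\<integral>g. g i \<partial>gauss I) = (\<Prod>k\<in>I. integral\<^sup>L std_gauss (?f k))"
    using product_integral_prod[OF assms(1), of ?f] int unfolding pr gauss_std_gauss by blast
  also have "\<dots> = 0" by (rule prod_zero[OF assms(1)]) (use assms(2) e1 in \<open>auto intro!: bexI[of _ i]\<close>)
  finally show "(\<integral>g. g i \<partial>gauss I) = 0" .
qed

lemma lin_integrable: "finite I \<Longrightarrow> integrable (gauss I) (lin I v)"
  unfolding lin_def[abs_def]
  by (intro Bochner_Integration.integrable_sum integrable_mult_right gauss_coord)

lemma lin_integral: "finite I \<Longrightarrow> (\<integral>g. lin I v g \<partial>gauss I) = 0"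
  unfolding lin_def[abs_def] by (subst Bochner_Integration.integral_sum) (auto simp: gauss_coord)

lemma lin_sq:
  assumes "finite I"
  shows "integrable (gauss I) (\<lambda>g. (lin I v g)\<^sup>2)" "(\<integral>g. (lin I v g)\<^sup>2 \<partial>gauss I) = (\<Sum>i\<in>I. (v i)\<^sup>2)"
proof -
  have eq: "(lin I v g)\<^sup>2 = (\<Sum>i\<in>I. \<Sum>j\<in>I. (v i * v j) * (g i * g j))" for g
    by (simp add: lin_def power2_eq_square sum_product mult_ac)
  show "integrable (gauss I) (\<lambda>g. (lin I v g)\<^sup>2)"
    unfolding eq using assms
    by (intro Bochner_Integration.integrable_sum integrable_mult_right gauss_coord_prod)
  have "(\<integral>g. (lin I v g)\<^sup>2 \<partial>gauss I) = (\<Sum>i\<in>I. \<Sum>j\<in>I. (v i * v j) * (if i = j then 1 else 0))"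
    unfolding eq using assms
    by (simp add: Bochner_Integration.integral_sum Bochner_Integration.integrable_sum gauss_coord_prod
        cong: sum.cong)
  also have "\<dots> = (\<Sum>i\<in>I. (v i)\<^sup>2)"
    using assms
    by (intro sum.cong) (auto simp: if_distrib[of "\<lambda>x. _ * x"] sum.delta power2_eq_square cong: if_cong)
  finally show "(\<integral>g. (lin I v g)\<^sup>2 \<partial>gauss I) = (\<Sum>i\<in>I. (v i)\<^sup>2)" .
qed

section \<open>Expected suprema and their elementary bounds\<close>

definition gauss_width :: "'i set \<Rightarrow> ('i \<Rightarrow> real) set \<Rightarrow> real" where
  "gauss_width I V = (\<integral>g. supf I V g \<partial>gauss I)"

lemma supf_gauss_integrable: "finite I \<Longrightarrow> bounded_fam I V \<Longrightarrow> integrable (gauss I) (supf I V)"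
  by (rule supf_integrable[where Y="\<lambda>g. g"]) (auto intro: gauss_coord(1))

lemma gauss_width_mono: "finite I \<Longrightarrow> bounded_fam I V \<Longrightarrow> W \<noteq> {} \<Longrightarrow> W \<subseteq> V \<Longrightarrow> gauss_width I W \<le> gauss_width I V"
  unfolding gauss_width_def
  by (intro integral_mono supf_gauss_integrable supf_mono) (auto intro: bounded_fam_subset)

lemma gauss_width_image_add:
  assumes "finite I" "bounded_fam I (f ` U)" "bounded_fam I (h ` U)"
  shows "gauss_width I ((\<lambda>u i. f u i + h u i) ` U) \<le> gauss_width I (f ` U) + gauss_width I (h ` U)"
proof -
  have ne: "U \<noteq> {}" using assms(2) by (auto simp: bounded_fam_def)
  have le: "supf I ((\<lambda>u i. f u i + h u i) ` U) g \<le> supf I (f ` U) g + supf I (h ` U) g" for g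
  proof (rule supf_least)
    fix v assume "v \<in> (\<lambda>u i. f u i + h u i) ` U"
    then obtain u where u: "u \<in> U" "v = (\<lambda>i. f u i + h u i)" by auto
    have "lin I v g = lin I (f u) g + lin I (h u) g"
      by (simp add: u lin_def distrib_right sum.distrib)
    then show "lin I v g \<le> supf I (f ` U) g + supf I (h ` U) g"
      using u by (auto intro!: add_mono lin_le_supf assms)
  qed (use ne in auto)
  have b: "bounded_fam I ((\<lambda>u i. f u i + h u i) ` U)"
  proof -
    obtain R1 R2 where "\<forall>v\<in>f`U. \<forall>i\<in>I. \<bar>v i\<bar> \<le> R1" "\<forall>v\<in>h`U. \<forall>i\<in>I. \<bar>v i\<bar> \<le> R2"
      using assms by (auto simp: bounded_fam_def)
    then have "\<forall>v\<in>(\<lambda>u i. f u i + h u i) ` U. \<forall>i\<in>I. \<bar>v i\<bar> \<le> R1 + R2"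
      by (auto intro!: order_trans[OF abs_triangle_ineq] add_mono)
    then show ?thesis using ne unfolding bounded_fam_def by blast
  qed
  have "gauss_width I ((\<lambda>u i. f u i + h u i) ` U) \<le> (\<integral>g. supf I (f ` U) g + supf I (h ` U) g \<partial>gauss I)"
    unfolding gauss_width_def using le b assms
    by (intro integral_mono Bochner_Integration.integrable_add supf_gauss_integrable) auto
  also have "\<dots> = gauss_width I (f ` U) + gauss_width I (h ` U)"
    unfolding gauss_width_def using assms by (intro Bochner_Integration.integral_add supf_gauss_integrable)
  finally show ?thesis .
qed

lemma integral_L2_set_lin_le:
  assumes "finite I" "finite J"
  shows "integrable (gauss I) (\<lambda>g. L2_set (\<lambda>j. lin I (c j) g) J)"
    "(\<integral>g. L2_set (\<lambda>j. lin I (c j) g) J \<partial>gauss I) \<le> sqrt (\<Sum>j\<in>J. \<Sum>i\<in>I. (c j i)\<^sup>2)"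
proof -
  interpret prob_space "gauss I" by (rule prob_gauss)
  let ?X = "\<lambda>g. L2_set (\<lambda>j. lin I (c j) g) J" and ?s = "\<Sum>j\<in>J. \<Sum>i\<in>I. (c j i)\<^sup>2"
  have lm[measurable]: "lin I v \<in> borel_measurable (gauss I)" for v
    using lin_integrable[OF assms(1)] by auto
  have i1: "integrable (gauss I) (\<lambda>g. \<Sum>j\<in>J. \<bar>lin I (c j) g\<bar>)"
    using assms by (auto intro!: lin_integrable)
  show iX: "integrable (gauss I) ?X"
  proof (rule Bochner_Integration.integrable_bound[OF i1])
    show "?X \<in> borel_measurable (gauss I)" unfolding L2_set_def by measurable
    show "AE g in gauss I. norm (?X g) \<le> norm (\<Sum>j\<in>J. \<bar>lin I (c j) g\<bar>)"
      using L2_set_le_sum_abs by (intro AE_I2) (simp add: sum_nonneg L2_set_nonneg)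
  qed
  have X2: "(?X g)\<^sup>2 = (\<Sum>j\<in>J. (lin I (c j) g)\<^sup>2)" for g
    unfolding L2_set_def by (simp add: sum_nonneg)
  have iX2: "integrable (gauss I) (\<lambda>g. (?X g)\<^sup>2)" and eX2: "(\<integral>g. (?X g)\<^sup>2 \<partial>gauss I) = ?s"
    unfolding X2 using assms by (auto simp: lin_sq)
  show "integral\<^sup>L (gauss I) ?X \<le> sqrt ?s"
  \<comment> \<open>Jensen's inequality for the square root, through X \<le> (X^2/a + a)/2. Taking
    \<open>a\<close> strictly above the root keeps it positive even if the sum of squares
    vanishes.\<close>
  proof (rule dense_ge)
    fix a assume a: "sqrt ?s < a"
    have s0: "0 \<le> ?s" by (intro sum_nonneg) auto
    then have a0: "0 < a" using a by (meson le_less_trans real_sqrt_ge_zero)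
    have "?X g \<le> ((?X g)\<^sup>2 / a + a) / 2" for g
    proof -
      have "0 \<le> (?X g - a)\<^sup>2 / a" using a0 by simp
      then show ?thesis using a0 by (simp add: power2_eq_square field_simps)
    qed
    then have "integral\<^sup>L (gauss I) ?X \<le> (\<integral>g. ((?X g)\<^sup>2 / a + a) / 2 \<partial>gauss I)"
      using iX iX2 by (intro integral_mono) auto
    also have "\<dots> = (?s / a + a) / 2" using iX2 by (simp add: eX2 prob_space)
    also have "\<dots> \<le> a"
    proof -
      have "?s \<le> a\<^sup>2" using a s0 by (metis less_imp_le real_sqrt_le_iff real_sqrt_abs abs_of_pos a0)
      then show ?thesis using a0 by (simp add: power2_eq_square field_simps)
    qed
    finally show "integral\<^sup>L (gauss I) ?X \<le> a" .
  qed
qed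

text \<open>\<open>V\<close> lies in the image of a Euclidean unit ball under the matrix
  \<open>c\<close>. The supremum is therefore at most the norm of the vector of the forms
  \<open>lin I (c j) g\<close>, and the second moment of that norm is the squared Hilbert--Schmidt
  norm of \<open>c\<close>.\<close>

lemma gauss_width_le_HS:
  assumes "finite I" "finite J" "V \<noteq> {}"
    and "\<And>v. v \<in> V \<Longrightarrow> \<exists>z. L2_set z J \<le> 1 \<and> (\<forall>i\<in>I. v i = (\<Sum>j\<in>J. z j * c j i))"
  shows "bounded_fam I V" "gauss_width I V \<le> sqrt (\<Sum>j\<in>J. \<Sum>i\<in>I. (c j i)\<^sup>2)"
proof -
  have l: "lin I v g \<le> L2_set (\<lambda>j. lin I (c j) g) J" if vV: "v \<in> V" for v g
  proof -
    obtain z where z: "L2_set z J \<le> 1" "\<forall>i\<in>I. v i = (\<Sum>j\<in>J. z j * c j i)" using assms(4)[OF vV] by auto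
    have "lin I v g = (\<Sum>i\<in>I. (\<Sum>j\<in>J. z j * c j i * g i))" using z by (simp add: lin_def sum_distrib_right)
    also have "\<dots> = lin J z (\<lambda>j. lin I (c j) g)"
      by (subst sum.swap) (simp add: lin_def sum_distrib_left mult.assoc)
    also have "\<dots> \<le> L2_set z J * L2_set (\<lambda>j. lin I (c j) g) J" by (rule lin_le_L2)
    also have "\<dots> \<le> 1 * L2_set (\<lambda>j. lin I (c j) g) J" by (intro mult_right_mono z L2_set_nonneg)
    finally show ?thesis by simp
  qed
  have b: "\<bar>v i\<bar> \<le> (\<Sum>i\<in>I. \<Sum>j\<in>J. \<bar>c j i\<bar>)" if vV: "v \<in> V" and iI: "i \<in> I" for v i
  proof -
    obtain z where z: "L2_set z J \<le> 1" "\<forall>i\<in>I. v i = (\<Sum>j\<in>J. z j * c j i)" using assms(4)[OF vV] by auto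
    have "\<bar>z j\<bar> \<le> 1" if "j \<in> J" for j
    proof -
      have "\<bar>z j\<bar> \<le> L2_set (\<lambda>j. \<bar>z j\<bar>) J" by (rule member_le_L2_set[OF assms(2) that])
      also have "L2_set (\<lambda>j. \<bar>z j\<bar>) J = L2_set z J" by (simp add: L2_set_def)
      finally show ?thesis using z(1) by linarith
    qed
    then have "\<bar>v i\<bar> \<le> (\<Sum>j\<in>J. \<bar>c j i\<bar>)" unfolding z(2)[rule_format, OF iI]
      by (intro order_trans[OF sum_abs] sum_mono) (simp add: abs_mult mult_left_le_one_le)
    also have "\<dots> \<le> (\<Sum>i\<in>I. \<Sum>j\<in>J. \<bar>c j i\<bar>)" using assms(1) iI
      by (intro member_le_sum[of i I "\<lambda>i. \<Sum>j\<in>J. \<bar>c j i\<bar>"]) (auto intro: sum_nonneg)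
    finally show ?thesis .
  qed
  show bounded_contractions: "bounded_fam I V" using b assms(3) unfolding bounded_fam_def by blast
  have "gauss_width I V \<le> (\<integral>g. L2_set (\<lambda>j. lin I (c j) g) J \<partial>gauss I)"
    unfolding gauss_width_def
    by (intro integral_mono supf_gauss_integrable integral_L2_set_lin_le supf_least assms bounded_contractions l)
  also have "\<dots> \<le> sqrt (\<Sum>j\<in>J. \<Sum>i\<in>I. (c j i)\<^sup>2)" by (rule integral_L2_set_lin_le[OF assms(1,2)])
  finally show "gauss_width I V \<le> sqrt (\<Sum>j\<in>J. \<Sum>i\<in>I. (c j i)\<^sup>2)" .
qed

text \<open>Relative to a fixed member, whose linear form has mean zero, the supremum is at most
  Delta times the norm of g. The dimensional factor is harmless: the bound serves the zero family
  and the remainder after N halvings of the scale, which tends to zero.\<close>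

lemma gauss_width_le_diam:
  assumes "finite I" "bounded_fam I V" "\<And>v w. v \<in> V \<Longrightarrow> w \<in> V \<Longrightarrow> L2_set (\<lambda>i. v i - w i) I \<le> \<Delta>"
  shows "gauss_width I V \<le> \<Delta> * sqrt (card I)"
proof -
  obtain w where w: "w \<in> V" using assms(2) by (auto simp: bounded_fam_def)
  have \<Delta>: "0 \<le> \<Delta>" using order_trans[OF L2_set_nonneg assms(3)[OF w w]] .
  have e: "lin I (\<lambda>i. if i = j then 1 else 0) g = g j" if "j \<in> I" for j and g :: "'a \<Rightarrow> real"
    using that assms(1) by (simp add: lin_def if_distrib[of "\<lambda>x. x * _"] cong: if_cong)
  let ?N = "\<lambda>g. L2_set (\<lambda>j. lin I (\<lambda>i. if i = j then 1 else 0) g) I"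
  have "supf I V g \<le> lin I w g + \<Delta> * ?N g" for g
  proof (rule supf_least)
    fix v assume v: "v \<in> V"
    have "lin I v g - lin I w g \<le> L2_set (\<lambda>i. v i - w i) I * L2_set g I"
      unfolding lin_diff by (rule lin_le_L2)
    also have "\<dots> \<le> \<Delta> * L2_set g I" by (intro mult_right_mono assms v w L2_set_nonneg)
    also have "L2_set g I = ?N g" by (intro L2_set_cong) (auto simp: e)
    finally show "lin I v g \<le> lin I w g + \<Delta> * ?N g" by simp
  qed (use w in auto)
  then have "gauss_width I V \<le> (\<integral>g. lin I w g + \<Delta> * ?N g \<partial>gauss I)"
    unfolding gauss_width_def
    by (intro integral_mono supf_gauss_integrable assms Bochner_Integration.integrable_add lin_integrable
        integrable_mult_right integral_L2_set_lin_le)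
  also have "\<dots> = \<Delta> * (\<integral>g. ?N g \<partial>gauss I)"
    by (subst Bochner_Integration.integral_add)
       (auto intro!: lin_integrable integrable_mult_right integral_L2_set_lin_le assms simp: lin_integral assms)
  also have "\<dots> \<le> \<Delta> * sqrt (\<Sum>j\<in>I. \<Sum>i\<in>I. (if i = j then 1 else 0)\<^sup>2)"
    by (intro mult_left_mono integral_L2_set_lin_le assms \<Delta>)
  also have "(\<Sum>j\<in>I. \<Sum>i\<in>I. (if i = j then 1 else 0::real)\<^sup>2) = card I"
    using assms(1) by (simp add: if_distrib[of "\<lambda>x. x^2"] cong: if_cong)
  finally show ?thesis .
qed

section \<open>Sudakov minoration and its dual\<close>

text \<open>A labelling by natural numbers rather than a cover by sets: labellings restrict to
  subsets, combine by pairing labels, and give disjoint classes even though \<open>R\<close> need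
  not be transitive.\<close>

definition few_classes :: "'u set \<Rightarrow> ('u \<Rightarrow> 'u \<Rightarrow> bool) \<Rightarrow> real \<Rightarrow> bool" where
  "few_classes U R K \<longleftrightarrow> (\<exists>f :: 'u \<Rightarrow> nat. finite (f ` U) \<and> real (card (f ` U)) \<le> K
      \<and> (\<forall>u\<in>U. \<forall>v\<in>U. f u = f v \<longrightarrow> R u v))"

lemma few_classes_mono:
  assumes "few_classes U R K" "W \<subseteq> U" "K \<le> K'" "\<And>u v. u \<in> W \<Longrightarrow> v \<in> W \<Longrightarrow> R u v \<Longrightarrow> R' u v"
  shows "few_classes W R' K'"
proof -
  obtain f :: "'a \<Rightarrow> nat" where f: "finite (f ` U)" "real (card (f ` U)) \<le> K"
    "\<forall>u\<in>U. \<forall>v\<in>U. f u = f v \<longrightarrow> R u v"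
    using assms(1) unfolding few_classes_def by blast
  have sub: "f ` W \<subseteq> f ` U" using assms(2) by auto
  have "finite (f ` W)" using finite_subset[OF sub f(1)] .
  moreover have "real (card (f ` W)) \<le> K'" using card_mono[OF f(1) sub] f(2) assms(3) by linarith
  moreover have "\<forall>u\<in>W. \<forall>v\<in>W. f u = f v \<longrightarrow> R' u v" using f(3) assms(2,4) by blast
  ultimately show ?thesis unfolding few_classes_def by (intro exI[of _ f] conjI)
qed

lemma few_classes_trivial: "(\<And>u v. u \<in> U \<Longrightarrow> v \<in> U \<Longrightarrow> R u v) \<Longrightarrow> 1 \<le> K \<Longrightarrow> few_classes U R K"
  unfolding few_classes_def
  by (rule exI[of _ "\<lambda>_. 0"], cases "U = {}") (auto simp: image_constant_conv)

lemma few_classes_refine: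
  assumes "few_classes U R K"
    and "\<And>W. W \<subseteq> U \<Longrightarrow> (\<And>u v. u \<in> W \<Longrightarrow> v \<in> W \<Longrightarrow> R u v) \<Longrightarrow> few_classes W R' K'"
  shows "few_classes U (\<lambda>u v. R u v \<and> R' u v) (K * K')"
proof -
  obtain f :: "'a \<Rightarrow> nat" where f: "finite (f ` U)" "real (card (f ` U)) \<le> K"
    "\<forall>u\<in>U. \<forall>v\<in>U. f u = f v \<longrightarrow> R u v"
    using assms(1) unfolding few_classes_def by blast
  let ?W = "\<lambda>a. {u\<in>U. f u = a}"
  have cW: "few_classes (?W a) R' K'" for a by (rule assms(2)) (use f(3) in auto)
  define P where "P = (\<lambda>a (h :: 'a \<Rightarrow> nat). finite (h ` ?W a) \<and> real (card (h ` ?W a)) \<le> K'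
      \<and> (\<forall>u\<in>?W a. \<forall>v\<in>?W a. h u = h v \<longrightarrow> R' u v))"
  have "\<forall>a. \<exists>h. P a h" using cW unfolding few_classes_def P_def by blast
  then obtain h where P: "\<And>a. P a (h a)" using choice[of P] by blast
  have h: "finite (h a ` ?W a)" "real (card (h a ` ?W a)) \<le> K'" for a
    using P[of a] unfolding P_def by blast+
  have h3: "R' u v" if "u \<in> ?W a" "v \<in> ?W a" "h a u = h a v" for a u v
    using P[of a] that unfolding P_def by blast
  have K'0: "0 \<le> K'" using h(2)[of 0] by (meson of_nat_0_le_iff order_trans)
  let ?g = "\<lambda>u. prod_encode (f u, h (f u) u)"
  have sub: "?g ` U \<subseteq> (\<Union>a\<in>f ` U. (\<lambda>b. prod_encode (a, b)) ` h a ` ?W a)" by auto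
  have fin: "finite (\<Union>a\<in>f ` U. (\<lambda>b. prod_encode (a, b)) ` h a ` ?W a)" by (intro finite_UN_I finite_imageI f(1) h(1))
  have "card (?g ` U) \<le> card (\<Union>a\<in>f ` U. (\<lambda>b. prod_encode (a, b)) ` h a ` ?W a)"
    by (rule card_mono[OF fin sub])
  also have "\<dots> \<le> (\<Sum>a\<in>f ` U. card ((\<lambda>b. prod_encode (a, b)) ` h a ` ?W a))"
    by (rule card_UN_le[OF f(1)])
  also have "\<dots> \<le> (\<Sum>a\<in>f ` U. card (h a ` ?W a))"
    by (intro sum_mono card_image_le h(1))
  finally have "real (card (?g ` U)) \<le> (\<Sum>a\<in>f ` U. real (card (h a ` ?W a)))"
    by (simp only: of_nat_sum[symmetric] of_nat_le_iff)
  also have "\<dots> \<le> (\<Sum>a\<in>f ` U. K')" by (intro sum_mono h(2))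
  also have "\<dots> \<le> K * K'" using f(2) K'0 by (simp add: mult_right_mono)
  finally have c: "real (card (?g ` U)) \<le> K * K'" .
  have "finite (?g ` U)" using finite_subset[OF sub fin] .
  moreover have "R u v \<and> R' u v" if "u \<in> U" "v \<in> U" "?g u = ?g v" for u v
    using that f(3) h3[of u "f u" v] by (auto simp: prod_encode_eq)
  ultimately show ?thesis unfolding few_classes_def using c by (intro exI[of _ ?g]) blast
qed

lemma few_classes_conj:
  assumes "few_classes U R K" "few_classes U R' K'"
  shows "few_classes U (\<lambda>u v. R u v \<and> R' u v) (K * K')"
  by (rule few_classes_refine[OF assms(1)]) (use assms(2) in \<open>auto intro: few_classes_mono\<close>)

lemma few_classes_card_le:
  assumes "few_classes U R K" "S \<subseteq> U" "\<And>u v. u \<in> S \<Longrightarrow> v \<in> S \<Longrightarrow> u \<noteq> v \<Longrightarrow> \<not> R u v"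
  shows "real (card S) \<le> K"
proof -
  obtain f :: "'a \<Rightarrow> nat" where f: "finite (f ` U)" "real (card (f ` U)) \<le> K"
    "\<forall>u\<in>U. \<forall>v\<in>U. f u = f v \<longrightarrow> R u v"
    using assms(1) unfolding few_classes_def by blast
  have "inj_on f S" using f(3) assms(2,3) by (intro inj_onI) blast
  then have "card S = card (f ` S)" by (simp add: card_image)
  also have "\<dots> \<le> card (f ` U)" using f(1) assms(2) by (intro card_mono) auto
  finally show ?thesis using f(2) by linarith
qed

text \<open>A separated set of greatest cardinality exists because \<open>K\<close> bounds all of
  them. By maximality each point is related to one of its members, and this member is the label. Two
  points with equal labels are thus related to a common point of \<open>U\<close>, not necessarily
  to each other.\<close>

lemma few_classes_from_packing:
  assumes "\<And>u. u \<in> U \<Longrightarrow> R u u" "\<And>u v. R u v \<Longrightarrow> R v u"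
    and "\<And>S. finite S \<Longrightarrow> S \<subseteq> U \<Longrightarrow> (\<And>u v. u \<in> S \<Longrightarrow> v \<in> S \<Longrightarrow> u \<noteq> v \<Longrightarrow> \<not> R u v) \<Longrightarrow> real (card S) \<le> K"
  shows "few_classes U (\<lambda>u v. \<exists>c\<in>U. R u c \<and> R v c) K"
proof -
  define P where "P = (\<lambda>S. finite S \<and> S \<subseteq> U \<and> (\<forall>u\<in>S. \<forall>v\<in>S. u \<noteq> v \<longrightarrow> \<not> R u v))"
  have P0: "P {}" by (simp add: P_def)
  have bound: "card S < Suc (nat \<lfloor>K\<rfloor>)" if "P S" for S
  proof -
    have "real (card S) \<le> K" by (rule assms(3)) (use that in \<open>auto simp: P_def\<close>)
    then show ?thesis by linarith
  qed
  obtain S where PS: "P S" and max: "\<And>S'. P S' \<Longrightarrow> card S' \<le> card S"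
    using ex_has_greatest_nat[of P "{}" card "Suc (nat \<lfloor>K\<rfloor>)"] P0 bound by blast
  have S: "finite S" "S \<subseteq> U" "\<And>u v. u \<in> S \<Longrightarrow> v \<in> S \<Longrightarrow> u \<noteq> v \<Longrightarrow> \<not> R u v"
    using PS by (auto simp: P_def)
  have ex: "\<exists>c\<in>S. R u c" if u: "u \<in> U" for u
  proof (rule ccontr)
    assume n: "\<not> ?thesis"
    then have uS: "u \<notin> S" using assms(1)[OF u] by blast
    have "P (insert u S)" unfolding P_def using S u n assms(2) by blast
    then have "card (insert u S) \<le> card S" by (rule max)
    then show False using uS S(1) by simp
  qed
  define c where "c = (\<lambda>u. SOME c. c \<in> S \<and> R u c)"
  have c: "c u \<in> S \<and> R u (c u)" if "u \<in> U" for u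
    unfolding c_def by (rule someI_ex) (use ex[OF that] in blast)
  let ?f = "\<lambda>u. to_nat_on S (c u)"
  have inj: "inj_on (to_nat_on S) S" using S by (intro inj_on_to_nat_on countable_finite) auto
  have sub: "?f ` U \<subseteq> to_nat_on S ` S" using c by auto
  have "card (?f ` U) \<le> card S"
    using card_mono[OF finite_imageI sub] S card_image_le[of S "to_nat_on S"] by (auto intro: order_trans)
  moreover have "real (card S) \<le> K" by (rule assms(3)[OF S])
  moreover have "finite (?f ` U)" using sub S by (intro finite_subset[OF sub]) auto
  moreover have "\<exists>d\<in>U. R u d \<and> R v d" if "u \<in> U" "v \<in> U" "?f u = ?f v" for u v
  proof -
    have "c u = c v" using inj_onD[OF inj that(3)] c that by blast
    then show ?thesis using c[OF that(1)] c[OF that(2)] S by (intro bexI[of _ "c u"]) auto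
  qed
  ultimately show ?thesis unfolding few_classes_def by (intro exI[of _ ?f]) auto
qed

text \<open>The volumetric half of the dual Sudakov inequality: by Cameron--Martin every translate of the
  symmetric set where the support function is at most four times its mean keeps a definite part of its
  Gaussian measure, so many of the translates overlap.\<close>

lemma common_point:
  fixes x :: "'u \<Rightarrow> 'i \<Rightarrow> real"
  assumes "finite S" "finite I" "\<kappa> > 0" "\<delta> > 0"
    and V: "\<And>u. u \<in> S \<Longrightarrow> bounded_fam I (V u)" "\<And>u. u \<in> S \<Longrightarrow> sym_fam (V u)" "\<And>u. u \<in> S \<Longrightarrow> gauss_width I (V u) \<le> \<kappa>"
    and x: "\<And>u. u \<in> S \<Longrightarrow> L2_set (x u) I \<le> \<rho>"
  obtains y where "real (card S) * (3/4 * exp (- \<rho>\<^sup>2 / (2 * \<delta>\<^sup>2)))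
    \<le> real (card {u\<in>S. supf I (V u) (\<lambda>i. y i - x u i) \<le> 4 * \<delta> * \<kappa>})"
proof -
  interpret prob_space "gauss I" by (rule prob_gauss)
  let ?G = "gauss I"
  \<comment> \<open>The level is four times the bound on the mean, so by Markov's inequality the
    event has probability at least 3/4.\<close>
  define K where "K = (\<lambda>u g. supf I (V u) g \<le> 4 * \<kappa>)"
  \<comment> \<open>Translating by x / delta instead of x lowers the loss to exp (- rho^2 / (2
    delta^2)); scaling back turns the level \<open>4 * \<kappa>\<close> into
    \<open>4 * \<delta> * \<kappa>\<close>.\<close>
  let ?A = "\<lambda>u. {g\<in>space ?G. K u (\<lambda>i\<in>I. g i - x u i / \<delta>)}"
  have Km[measurable]: "Measurable.pred ?G (K u)" if "u \<in> S" for u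
    unfolding K_def using supf_gauss_integrable[OF assms(2) V(1)[OF that]] by auto
  have Ksym: "K u (\<lambda>i\<in>I. - g i) \<longleftrightarrow> K u g" if "u \<in> S" for u g
  proof -
    have "supf I (V u) (\<lambda>i\<in>I. - g i) = supf I (V u) (\<lambda>i. - g i)" by (rule supf_cong) auto
    then show ?thesis unfolding K_def using supf_uminus[OF V(1,2)[OF that]] by simp
  qed
  have "measurable ?G ?G = measurable (PiM I (\<lambda>_. std_gauss)) (PiM I (\<lambda>_. std_gauss))" by (simp add: gauss_std_gauss)
  have sub: "(\<lambda>g. \<lambda>i\<in>I. g i - y i) \<in> measurable ?G ?G" for y :: "'i \<Rightarrow> real"
    unfolding gauss_std_gauss by measurable
  have Am: "?A u \<in> sets ?G" if "u \<in> S" for u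
    using measurable_compose[OF sub Km[OF that], of "\<lambda>i. x u i / \<delta>"] by simp
  have PK: "3/4 \<le> measure ?G {g\<in>space ?G. K u g}" if u: "u \<in> S" for u
  proof -
    have "measure ?G {g\<in>space ?G. 4 * \<kappa> \<le> supf I (V u) g} \<le> (\<integral>g. supf I (V u) g \<partial>?G) / (4 * \<kappa>)"
      using assms(3) supf_gauss_integrable[OF assms(2) V(1)[OF u]] supf_nonneg[OF V(1,2)[OF u]]
      by (intro integral_Markov_inequality_measure[where A = "{}"]) auto
    also have "\<dots> \<le> \<kappa> / (4 * \<kappa>)"
      using V(3)[OF u] assms(3) unfolding gauss_width_def by (intro divide_right_mono) auto
    finally have m: "measure ?G {g\<in>space ?G. 4 * \<kappa> \<le> supf I (V u) g} \<le> 1/4" using assms(3) by simp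
    have "{g\<in>space ?G. \<not> K u g} \<subseteq> {g\<in>space ?G. 4 * \<kappa> \<le> supf I (V u) g}" unfolding K_def by auto
    moreover have "{g\<in>space ?G. 4 * \<kappa> \<le> supf I (V u) g} \<in> sets ?G"
      using supf_gauss_integrable[OF assms(2) V(1)[OF u]] by auto
    ultimately have "measure ?G {g\<in>space ?G. \<not> K u g} \<le> 1/4"
      using finite_measure_mono m by (meson order_trans)
    moreover have "measure ?G {g\<in>space ?G. \<not> K u g} = 1 - measure ?G {g\<in>space ?G. K u g}"
      using Km[OF u] by (intro prob_neg) simp
    ultimately show ?thesis by linarith
  qed
  have PA: "3/4 * exp (- \<rho>\<^sup>2 / (2 * \<delta>\<^sup>2)) \<le> measure ?G (?A u)" if u: "u \<in> S" for u
  proof -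
    have "(\<Sum>i\<in>I. (x u i / \<delta>)\<^sup>2) = (L2_set (x u) I)\<^sup>2 / \<delta>\<^sup>2"
      by (simp add: L2_set_def sum_nonneg power_divide sum_divide_distrib)
    also have "\<dots> \<le> \<rho>\<^sup>2 / \<delta>\<^sup>2" by (intro divide_right_mono power_mono x u L2_set_nonneg) auto
    finally have "exp (- \<rho>\<^sup>2 / (2 * \<delta>\<^sup>2)) \<le> exp (- (\<Sum>i\<in>I. (x u i / \<delta>)\<^sup>2)/2)" by (simp add: field_simps)
    then have "3/4 * exp (- \<rho>\<^sup>2 / (2 * \<delta>\<^sup>2)) \<le> measure ?G {g\<in>space ?G. K u g} * exp (- (\<Sum>i\<in>I. (x u i / \<delta>)\<^sup>2)/2)"
      by (intro mult_mono PK u) auto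
    also have "\<dots> = exp (- (\<Sum>i\<in>I. (x u i / \<delta>)\<^sup>2)/2) * measure ?G {g\<in>space ?G. K u g}"
      by (rule mult.commute)
    also have "\<dots> \<le> measure ?G (?A u)"
      by (rule symmetric_shift_prob[OF assms(2) Km[OF u] Ksym[OF u]])
    finally show ?thesis .
  qed
  \<comment> \<open>\<open>N g\<close> counts the translates that contain g. Its mean is at least
    the left-hand side of the claim, and as it takes finitely many values its maximum is attained,
    at a point no worse than the mean.\<close>
  define N where "N = (\<lambda>g. card {u\<in>S. g \<in> ?A u})"
  have N: "real (N g) = (\<Sum>u\<in>S. indicator (?A u) g)" for g
    unfolding N_def using assms(1) by (simp add: indicator_def sum.If_cases Int_def)
  have "real (card S) * (3/4 * exp (- \<rho>\<^sup>2 / (2 * \<delta>\<^sup>2))) \<le> (\<Sum>u\<in>S. measure ?G (?A u))"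
  proof -
    have "(\<Sum>u\<in>S. 3/4 * exp (- \<rho>\<^sup>2 / (2 * \<delta>\<^sup>2))) \<le> (\<Sum>u\<in>S. measure ?G (?A u))"
      by (intro sum_mono PA)
    then show ?thesis by simp
  qed
  also have "\<dots> = (\<integral>g. real (N g) \<partial>?G)"
    unfolding N using Am by (subst Bochner_Integration.integral_sum) (auto simp: emeasure_eq_measure)
  finally have 1: "real (card S) * (3/4 * exp (- \<rho>\<^sup>2 / (2 * \<delta>\<^sup>2))) \<le> (\<integral>g. real (N g) \<partial>?G)" .
  have "\<exists>g. \<forall>h. N h \<le> N g"
    using ex_has_greatest_nat[of "\<lambda>_. True" undefined N "Suc (card S)"] assms(1)
    by (auto simp: N_def less_Suc_eq_le intro: card_mono)
  then obtain g where g: "\<And>h. N h \<le> N g" by blast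
  have "integrable ?G (\<lambda>h. real (N h))"
    unfolding N using Am by (auto simp: emeasure_eq_measure)
  then have "(\<integral>h. real (N h) \<partial>?G) \<le> (\<integral>h. real (N g) \<partial>?G)"
    by (intro integral_mono) (auto simp: g)
  also have "\<dots> = real (N g)" by (simp add: prob_space)
  finally have 2: "real (card S) * (3/4 * exp (- \<rho>\<^sup>2 / (2 * \<delta>\<^sup>2))) \<le> real (N g)" using 1 by linarith
  have "{u\<in>S. g \<in> ?A u} \<subseteq> {u\<in>S. supf I (V u) (\<lambda>i. \<delta> * g i - x u i) \<le> 4 * \<delta> * \<kappa>}"
  proof (intro subsetI CollectI conjI)
    fix u assume u: "u \<in> {u\<in>S. g \<in> ?A u}"
    then show "u \<in> S" by simp
    have "supf I (V u) (\<lambda>i\<in>I. g i - x u i / \<delta>) = supf I (V u) (\<lambda>i. g i - x u i / \<delta>)" by (rule supf_cong) auto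
    then have le: "supf I (V u) (\<lambda>i. g i - x u i / \<delta>) \<le> 4 * \<kappa>" using u unfolding K_def by simp
    have "supf I (V u) (\<lambda>i. \<delta> * g i - x u i) = supf I (V u) (\<lambda>i. \<delta> * (g i - x u i / \<delta>))"
      using assms(4) by (simp add: right_diff_distrib)
    also have "\<dots> \<le> \<delta> * supf I (V u) (\<lambda>i. g i - x u i / \<delta>)"
      using u assms(4) by (intro supf_cmult V(1)) auto
    also have "\<dots> \<le> \<delta> * (4 * \<kappa>)" using le assms(4) by (intro mult_left_mono) auto
    finally show "supf I (V u) (\<lambda>i. \<delta> * g i - x u i) \<le> 4 * \<delta> * \<kappa>" by (simp add: mult_ac)
  qed
  then have "N g \<le> card {u\<in>S. supf I (V u) (\<lambda>i. \<delta> * g i - x u i) \<le> 4 * \<delta> * \<kappa>}"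
    unfolding N_def using assms(1) by (intro card_mono) auto
  then show ?thesis using 2 that[of "\<lambda>i. \<delta> * g i"] by linarith
qed

lemma le_mult_exp: "(a::real) * (3/4 * exp (- x)) \<le> K \<Longrightarrow> a \<le> 4/3 * exp x * K"
  by (simp add: exp_minus field_simps)

text \<open>Among pairwise unrelated points a proportion of at least 3/4 exp (- rho^2 / (2 delta^2))
  lies near one common \<open>y\<close>, and the cover assumed near \<open>y\<close> leaves room for
  at most \<open>K\<close> of them. The families \<open>V u\<close> may vary with the point; the
  Hilbert--Schmidt families make use of that.\<close>

lemma few_classes_smoothing:
  fixes x :: "'u \<Rightarrow> 'i \<Rightarrow> real"
  assumes "finite I" "\<kappa> > 0" "\<delta> > 0"
    and V: "\<And>u. u \<in> U \<Longrightarrow> bounded_fam I (V u)" "\<And>u. u \<in> U \<Longrightarrow> sym_fam (V u)" "\<And>u. u \<in> U \<Longrightarrow> gauss_width I (V u) \<le> \<kappa>"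
    and x: "\<And>u. u \<in> U \<Longrightarrow> L2_set (x u) I \<le> \<rho>"
    and R: "\<And>u. u \<in> U \<Longrightarrow> R u u" "\<And>u v. R u v \<Longrightarrow> R v u"
    and cov: "\<And>y. few_classes {u\<in>U. supf I (V u) (\<lambda>i. y i - x u i) \<le> 4 * \<delta> * \<kappa>} R K"
  shows "few_classes U (\<lambda>u v. \<exists>c\<in>U. R u c \<and> R v c) (4/3 * exp (\<rho>\<^sup>2 / (2 * \<delta>\<^sup>2)) * K)"
proof (rule few_classes_from_packing[OF R])
  fix S assume S: "finite S" "S \<subseteq> U" "\<And>u v. u \<in> S \<Longrightarrow> v \<in> S \<Longrightarrow> u \<noteq> v \<Longrightarrow> \<not> R u v"
  have "\<exists>y. real (card S) * (3/4 * exp (- \<rho>\<^sup>2 / (2 * \<delta>\<^sup>2)))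
    \<le> real (card {u\<in>S. supf I (V u) (\<lambda>i. y i - x u i) \<le> 4 * \<delta> * \<kappa>})"
  proof (rule common_point[of S I \<kappa> \<delta> V x \<rho>, OF S(1) assms(1-3)])
    fix u assume "u \<in> S"
    then have u: "u \<in> U" using S(2) by blast
    show "bounded_fam I (V u)" "sym_fam (V u)" "gauss_width I (V u) \<le> \<kappa>" "L2_set (x u) I \<le> \<rho>"
      by (rule V[OF u] x[OF u])+
  qed (rule exI)
  then obtain y where y: "real (card S) * (3/4 * exp (- \<rho>\<^sup>2 / (2 * \<delta>\<^sup>2)))
    \<le> real (card {u\<in>S. supf I (V u) (\<lambda>i. y i - x u i) \<le> 4 * \<delta> * \<kappa>})" ..
  have "real (card {u\<in>S. supf I (V u) (\<lambda>i. y i - x u i) \<le> 4 * \<delta> * \<kappa>}) \<le> K"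
    by (rule few_classes_card_le[OF cov[of y]]) (use S in auto)
  then have "real (card S) * (3/4 * exp (- \<rho>\<^sup>2 / (2 * \<delta>\<^sup>2))) \<le> K" using y by linarith
  then show "real (card S) \<le> 4/3 * exp (\<rho>\<^sup>2 / (2 * \<delta>\<^sup>2)) * K"
    by (intro le_mult_exp) simp
qed


section \<open>Sudakov minoration for the Euclidean distance\<close>

lemma L2_set_power2: "(L2_set x I)\<^sup>2 = (\<Sum>i\<in>I. (x i)\<^sup>2)"
  by (simp add: L2_set_def sum_nonneg)

lemma lin_self: "lin I x x = (L2_set x I)\<^sup>2"
  unfolding L2_set_power2 lin_def by (simp add: power2_eq_square)

lemma L2_set_zero [simp]: "L2_set (\<lambda>i. 0) I = 0"
  by (simp add: L2_set_def)

lemma L2_set_cmult: "L2_set (\<lambda>i. c * x i) I = \<bar>c\<bar> * L2_set x I"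
  by (simp add: L2_set_def power_mult_distrib sum_distrib_left[symmetric] real_sqrt_mult)

lemma L2_set_diff_commute: "L2_set (\<lambda>i. x i - y i) I = L2_set (\<lambda>i. y i - x i) I"
  by (simp add: L2_set_def power2_commute)

lemma L2_set_diff_triangle:
  "L2_set (\<lambda>i. x i - z i) I \<le> L2_set (\<lambda>i. x i - y i) I + L2_set (\<lambda>i. y i - z i) I"
  using L2_set_triangle_ineq[of "\<lambda>i. x i - y i" "\<lambda>i. y i - z i" I] by simp

text \<open>If \<open>y\<close> is close to both shifts, mu (t - s) has small support function. The
  members \<open>t\<close> and -s of \<open>T\<close> itself are tested against it, and their
  pairings with t - s add up to the squared distance: \<open>T\<close> is at once the set of points
  and the set of linear forms. The centre \<open>c\<close> cancels.\<close>

lemma shared_shift_close: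
  assumes "bounded_fam I T" "sym_fam T" "t \<in> T" "s \<in> T" "\<mu> > 0"
    and "supf I T (\<lambda>i. y i - \<mu> * (t i - c i)) \<le> 4 * \<kappa>" "supf I T (\<lambda>i. y i - \<mu> * (s i - c i)) \<le> 4 * \<kappa>"
  shows "\<mu> * (L2_set (\<lambda>i. t i - s i) I)\<^sup>2 \<le> 16 * \<kappa>"
proof -
  let ?d = "\<lambda>i. t i - s i"
  have "supf I T (\<lambda>i. (y i - \<mu> * (s i - c i)) - (y i - \<mu> * (t i - c i))) \<le> 8 * \<kappa>"
    using supf_diff_le[OF assms(1,2), of "\<lambda>i. y i - \<mu> * (s i - c i)" "\<lambda>i. y i - \<mu> * (t i - c i)"] assms(6,7)
    by linarith
  moreover have "(\<lambda>i. (y i - \<mu> * (s i - c i)) - (y i - \<mu> * (t i - c i))) = (\<lambda>i. \<mu> * ?d i)"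
    by (simp add: fun_eq_iff algebra_simps)
  ultimately have s8: "supf I T (\<lambda>i. \<mu> * ?d i) \<le> 8 * \<kappa>" by simp
  have "lin I t (\<lambda>i. \<mu> * ?d i) \<le> 8 * \<kappa>" "lin I (\<lambda>i. - s i) (\<lambda>i. \<mu> * ?d i) \<le> 8 * \<kappa>"
    using lin_le_supf[OF assms(1,3)] lin_le_supf[OF assms(1), of "\<lambda>i. - s i"] assms(2,4) s8
    by (auto simp: sym_fam_def intro: order_trans)
  then have "lin I t (\<lambda>i. \<mu> * ?d i) - lin I s (\<lambda>i. \<mu> * ?d i) \<le> 16 * \<kappa>" by (simp add: lin_minus_left)
  then show ?thesis by (simp only: lin_cmult_right right_diff_distrib[symmetric] lin_diff lin_self)
qed

lemma diam_le_gauss_width: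
  assumes "finite I" "bounded_fam I T" "sym_fam T" "gauss_width I T \<le> \<kappa>" "\<kappa> > 0" "t \<in> T" "s \<in> T"
  shows "L2_set (\<lambda>i. t i - s i) I \<le> 32 * \<kappa>"
proof (cases "L2_set (\<lambda>i. t i - s i) I = 0")
  case True then show ?thesis using assms(5) by simp
next
  case False
  let ?e = "L2_set (\<lambda>i. t i - s i) I"
  have e: "?e > 0" using False L2_set_nonneg[of "\<lambda>i. t i - s i" I] by linarith
  have ts: "t \<noteq> s" using False by auto
  \<comment> \<open>With this scaling both shifts have norm at most 1/2, and 2 * 3/4 * exp (-1/8)
    exceeds 1, so the two translates have a common point; \<open>shared_shift_close\<close> then
    reads \<open>?e / 2 \<le> 16 * \<kappa>\<close>.\<close>
  let ?\<mu> = "1 / (2 * ?e)"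
  have \<mu>: "?\<mu> > 0" using e by simp
  have x: "L2_set (\<lambda>i. ?\<mu> * (u i - s i)) I \<le> 1/2" if "u \<in> {t, s}" for u
    using that e unfolding L2_set_cmult by auto
  have "\<exists>y. real (card {t,s}) * (3/4 * exp (- (1/2)\<^sup>2 / (2 * 1\<^sup>2)))
    \<le> real (card {u\<in>{t,s}. supf I T (\<lambda>i. y i - ?\<mu> * (u i - s i)) \<le> 4 * 1 * \<kappa>})"
    by (rule common_point[of "{t,s}" I \<kappa> 1 "\<lambda>_. T" "\<lambda>u i. ?\<mu> * (u i - s i)" "1/2"])
       (use assms x in \<open>auto simp del: L2_set_nonneg\<close>)
  then obtain y where y: "real (card {t,s}) * (3/4 * exp (- (1/2)\<^sup>2 / (2 * 1\<^sup>2)))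
    \<le> real (card {u\<in>{t,s}. supf I T (\<lambda>i. y i - ?\<mu> * (u i - s i)) \<le> 4 * 1 * \<kappa>})" ..
  let ?B = "{u\<in>{t,s}. supf I T (\<lambda>i. y i - ?\<mu> * (u i - s i)) \<le> 4 * 1 * \<kappa>}"
  have "(7/8::real) \<le> exp (- (1/8))" using exp_ge_add_one_self[of "- (1/8)::real"] by simp
  then have "1 < real (card {t,s}) * (3/4 * exp (- (1/2)\<^sup>2 / (2 * 1\<^sup>2)))"
    using ts by (simp add: power2_eq_square)
  then have c1: "1 < card ?B" using y by linarith
  have "?B = {t,s}"
  proof (rule ccontr)
    assume "?B \<noteq> {t,s}"
    then have "?B \<subset> {t,s}" by blast
    then have "card ?B < card {t,s}" by (intro psubset_card_mono) auto
    then show False using c1 ts by simp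
  qed
  then have "t \<in> ?B" "s \<in> ?B" by blast+
  then have "supf I T (\<lambda>i. y i - ?\<mu> * (t i - s i)) \<le> 4 * \<kappa>" "supf I T (\<lambda>i. y i - ?\<mu> * (s i - s i)) \<le> 4 * \<kappa>"
    unfolding mem_Collect_eq mult_1_right by blast+
  from shared_shift_close[OF assms(2,3,6,7) \<mu> this] show ?thesis
    using e by (simp add: power2_eq_square field_simps)
qed

text \<open>One halving of the diameter. Knowing that \<open>W\<close> has diameter at most eta
  bounds the shifts towards a fixed point of \<open>W\<close>, and with them the exponential loss in
  \<open>common_point\<close>.\<close>

lemma Sudakov_local:
  assumes "finite I" "bounded_fam I T" "sym_fam T" "gauss_width I T \<le> \<kappa>" "\<kappa> > 0" "\<eta> > 0"
    and W: "W \<subseteq> T" "\<And>t s. t \<in> W \<Longrightarrow> s \<in> W \<Longrightarrow> L2_set (\<lambda>i. t i - s i) I \<le> \<eta>"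
  shows "few_classes W (\<lambda>t s. L2_set (\<lambda>i. t i - s i) I \<le> \<eta> / 2) (4/3 * exp (32768 * \<kappa>\<^sup>2 / \<eta>\<^sup>2))"
proof -
  let ?d = "\<lambda>t s. L2_set (\<lambda>i. t i - s i) I"
  let ?K = "4/3 * exp (32768 * \<kappa>\<^sup>2 / \<eta>\<^sup>2)"
  have "few_classes W (\<lambda>t s. \<exists>c\<in>W. ?d t c \<le> \<eta>/4 \<and> ?d s c \<le> \<eta>/4) ?K"
  proof (rule few_classes_from_packing)
    show "?d t t \<le> \<eta>/4" for t using assms(6) by (simp add: L2_set_0')
    show "?d s t \<le> \<eta>/4" if "?d t s \<le> \<eta>/4" for s t
      using that by (subst L2_set_diff_commute)
    fix S assume S: "finite S" "S \<subseteq> W" "\<And>t s. t \<in> S \<Longrightarrow> s \<in> S \<Longrightarrow> t \<noteq> s \<Longrightarrow> \<not> ?d t s \<le> \<eta>/4"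
    show "real (card S) \<le> ?K"
    proof (cases "S = {}")
      case False
      then obtain c where c: "c \<in> S" by auto
      \<comment> \<open>Chosen so that mu (eta/4)^2 = 16 kappa: points farther apart than eta/4
        cannot share a cluster. The shifts have norm at most mu eta, whence the exponent (mu eta)^2
        / 2 = 32768 kappa^2 / eta^2.\<close>
      define \<mu> where "\<mu> = 256 * \<kappa> / \<eta>\<^sup>2"
      have \<mu>: "\<mu> > 0" using assms(5,6) by (simp add: \<mu>_def)
      have x: "L2_set (\<lambda>i. \<mu> * (u i - c i)) I \<le> \<mu> * \<eta>" if "u \<in> S" for u
        unfolding L2_set_cmult using \<mu> W(2)[of u c] that c S(2) by auto
      have "\<exists>y. real (card S) * (3/4 * exp (- (\<mu> * \<eta>)\<^sup>2 / (2 * 1\<^sup>2)))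
        \<le> real (card {u\<in>S. supf I T (\<lambda>i. y i - \<mu> * (u i - c i)) \<le> 4 * 1 * \<kappa>})"
        by (rule common_point[of S I \<kappa> 1 "\<lambda>_. T" "\<lambda>u i. \<mu> * (u i - c i)" "\<mu> * \<eta>"])
           (use assms(1-5) x S(1) in auto)
      then obtain y where y: "real (card S) * (3/4 * exp (- (\<mu> * \<eta>)\<^sup>2 / (2 * 1\<^sup>2)))
        \<le> real (card {u\<in>S. supf I T (\<lambda>i. y i - \<mu> * (u i - c i)) \<le> 4 * 1 * \<kappa>})" ..
      let ?B = "{u\<in>S. supf I T (\<lambda>i. y i - \<mu> * (u i - c i)) \<le> 4 * 1 * \<kappa>}"
      have "card ?B \<le> 1"
      proof (rule ccontr)
        assume n: "\<not> card ?B \<le> 1"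
        have fin: "finite ?B" using S(1) by simp
        have "\<not> (\<forall>t\<in>?B. \<forall>s\<in>?B. t = s)"
        proof
          assume "\<forall>t\<in>?B. \<forall>s\<in>?B. t = s"
          then have "card ?B \<le> Suc 0" by (rule iffD2[OF card_le_Suc0_iff_eq[OF fin]])
          then show False using n by simp
        qed
        then obtain t s where ts: "t \<in> ?B" "s \<in> ?B" "t \<noteq> s" by blast
        have tsS: "t \<in> S" "s \<in> S" using ts by blast+
        have "t \<in> T" "s \<in> T" using tsS S(2) W(1) by blast+
        moreover have "supf I T (\<lambda>i. y i - \<mu> * (t i - c i)) \<le> 4 * \<kappa>" "supf I T (\<lambda>i. y i - \<mu> * (s i - c i)) \<le> 4 * \<kappa>"
          using ts(1,2) unfolding mem_Collect_eq mult_1_right by blast+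
        ultimately have "\<mu> * (?d t s)\<^sup>2 \<le> 16 * \<kappa>"
          by (rule shared_shift_close[OF assms(2,3) _ _ \<mu>])
        moreover have "\<eta>/4 < ?d t s" using S(3)[OF tsS ts(3)] by (simp only: not_le)
        then have "(\<eta>/4)\<^sup>2 < (?d t s)\<^sup>2"
          using assms(6) by (intro power_strict_mono) auto
        ultimately have "\<mu> * (\<eta>/4)\<^sup>2 < 16 * \<kappa>" 
          using mult_strict_left_mono[OF _ \<mu>] less_le_trans by blast
        then show False using assms(6) by (simp add: \<mu>_def power_divide)
      qed
      then have "real (card ?B) \<le> 1" by linarith
      from order_trans[OF y this] have "real (card S) * (3/4 * exp (- ((\<mu> * \<eta>)\<^sup>2 / 2))) \<le> 1"
        by (simp only: one_power2 mult_1_right minus_divide_left)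
      then have "real (card S) \<le> 4/3 * exp ((\<mu> * \<eta>)\<^sup>2 / 2) * 1" by (rule le_mult_exp)
      moreover have "(\<mu> * \<eta>)\<^sup>2 / 2 = 32768 * \<kappa>\<^sup>2 / \<eta>\<^sup>2"
        using assms(6) by (simp add: \<mu>_def power2_eq_square field_simps)
      ultimately show ?thesis by simp
    qed auto
  qed
  then show ?thesis
  proof (rule few_classes_mono)
    fix t s assume "\<exists>c\<in>W. ?d t c \<le> \<eta>/4 \<and> ?d s c \<le> \<eta>/4"
    then obtain c where "?d t c \<le> \<eta>/4" "?d s c \<le> \<eta>/4" by blast
    then show "?d t s \<le> \<eta>/2"
      using L2_set_diff_triangle[of t s I c] L2_set_diff_commute[of s c I] by linarith
  qed auto
qed

text \<open>The local estimate is iterated downwards from the diameter \<open>32 * \<kappa>\<close>.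
  The exponents of the halvings form a geometric series dominated by its last term.\<close>

lemma Sudakov:
  assumes "finite I" "bounded_fam I T" "sym_fam T" "gauss_width I T \<le> \<kappa>" "\<kappa> > 0" "\<epsilon> > 0"
  shows "few_classes T (\<lambda>t s. L2_set (\<lambda>i. t i - s i) I \<le> \<epsilon>) (exp (180224 * \<kappa>\<^sup>2 / \<epsilon>\<^sup>2))"
proof -
  let ?d = "\<lambda>t s. L2_set (\<lambda>i. t i - s i) I"
  \<comment> \<open>Halving at radius 32 kappa / 2^j costs at most the factor exp (1 + 32 * 4^j),
    with 4/3 absorbed; the claimed exponent grows by 132 * 4^j, which covers it.\<close>
  have step: "few_classes T (\<lambda>t s. ?d t s \<le> 32 * \<kappa> / 2 ^ j) (exp (44 * (4 ^ j - 1)))" for j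
  proof (induction j)
    case 0
    then show ?case using diam_le_gauss_width[OF assms(1-5)] by (intro few_classes_trivial) auto
  next
    case (Suc j)
    let ?\<eta> = "32 * \<kappa> / 2 ^ j"
    have \<eta>: "?\<eta> > 0" using assms(5) by simp
    have "few_classes T (\<lambda>t s. ?d t s \<le> ?\<eta> \<and> ?d t s \<le> ?\<eta> / 2)
        (exp (44 * (4 ^ j - 1)) * (4/3 * exp (32768 * \<kappa>\<^sup>2 / ?\<eta>\<^sup>2)))"
      by (rule few_classes_refine[OF Suc Sudakov_local[OF assms(1-5) \<eta>]])
    then show ?case
    proof (rule few_classes_mono)
      have "(2 ^ j)\<^sup>2 = (4::real) ^ j" by (simp add: power2_eq_square power_mult_distrib[symmetric])
      then have "32768 * \<kappa>\<^sup>2 / ?\<eta>\<^sup>2 = 32 * 4 ^ j"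
        using assms(5) by (simp add: power_divide power_mult_distrib)
      moreover have "(4/3::real) \<le> exp 1" using exp_ge_add_one_self[of "1::real"] by simp
      ultimately have "exp (44 * (4 ^ j - 1)) * (4/3 * exp (32768 * \<kappa>\<^sup>2 / ?\<eta>\<^sup>2))
         \<le> exp (44 * (4 ^ j - 1)) * (exp 1 * exp (32 * 4 ^ j))"
        by (intro mult_left_mono mult_right_mono) auto
      also have "\<dots> = exp (76 * 4 ^ j - 43)" by (simp add: mult_exp_exp algebra_simps)
      also have "\<dots> \<le> exp (44 * (4 ^ Suc j - 1))"
      proof -
        have "(1::real) \<le> 4 ^ j" by simp
        then have "1 \<le> 100 * (4::real) ^ j" by linarith
        then show ?thesis by (simp add: algebra_simps)
      qed
      finally show "exp (44 * (4 ^ j - 1)) * (4/3 * exp (32768 * \<kappa>\<^sup>2 / ?\<eta>\<^sup>2)) \<le> exp (44 * (4 ^ Suc j - 1))" .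
    qed auto
  qed
  obtain j where j: "32 * \<kappa> / \<epsilon> \<le> 2 ^ j" "j = 0 \<or> 2 ^ (j - 1) < 32 * \<kappa> / \<epsilon>"
  proof -
    obtain n where "32 * \<kappa> / \<epsilon> < 2 ^ n" using real_arch_pow[of 2] by auto
    then have ex: "\<exists>n. 32 * \<kappa> / \<epsilon> \<le> 2 ^ n" by (auto intro: less_imp_le)
    let ?j = "LEAST n. 32 * \<kappa> / \<epsilon> \<le> 2 ^ n"
    have "32 * \<kappa> / \<epsilon> \<le> 2 ^ ?j" using LeastI_ex[OF ex] .
    moreover have "?j = 0 \<or> 2 ^ (?j - 1) < 32 * \<kappa> / \<epsilon>"
    proof (cases "?j = 0")
      case False
      then have "?j - 1 < ?j" by linarith
      from not_less_Least[OF this] show ?thesis by (intro disjI2) (simp only: not_le)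
    qed blast
    ultimately show ?thesis by (rule that)
  qed
  show ?thesis
  proof (rule few_classes_mono[OF step[of j]])
    have "32 * \<kappa> / 2 ^ j \<le> \<epsilon>" using j(1) assms(6) by (simp add: field_simps)
    then show "?d t s \<le> \<epsilon>" if "?d t s \<le> 32 * \<kappa> / 2 ^ j" for t s
      using that by linarith
  next
    \<comment> \<open>By minimality of \<open>j\<close>, 4^(j-1) is at most 1024 kappa^2 /
      epsilon^2, and 44 * 4 * 1024 = 180224.\<close>
    have "44 * (4 ^ j - 1) \<le> (180224 * \<kappa>\<^sup>2 / \<epsilon>\<^sup>2 :: real)"
    proof (cases "j = 0")
      case False
      then obtain i where i: "j = Suc i" by (cases j) auto
      then have "(2 ^ i)\<^sup>2 \<le> (32 * \<kappa> / \<epsilon>)\<^sup>2" using j(2) by (intro power_mono) auto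
      moreover have "(2 ^ i)\<^sup>2 = (4::real) ^ i" by (simp add: power2_eq_square power_mult_distrib[symmetric])
      ultimately have "4 ^ i \<le> 1024 * \<kappa>\<^sup>2 / \<epsilon>\<^sup>2"
        by (simp add: power_divide power_mult_distrib)
      then show ?thesis using i by simp
    qed auto
    then show "exp (44 * (4 ^ j - 1)) \<le> exp (180224 * \<kappa>\<^sup>2 / \<epsilon>\<^sup>2)" by simp
  qed auto
qed

section \<open>Gaussian concentration\<close>

text \<open>The substitution is made in one variable at a time: u = c x + s y for fixed y, then v =
  (y - s u) / c for fixed u. The Jacobians 1/c and c cancel, and the product of the two densities
  depends only on the radius.\<close>

lemma std_gauss_rotation:
  assumes f[measurable]: "case_prod f \<in> borel_measurable (borel \<Otimes>\<^sub>M borel)"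
    and cs: "c\<^sup>2 + s\<^sup>2 = (1::real)" "c > 0"
  shows "(\<integral>\<^sup>+x. \<integral>\<^sup>+y. f (c * x + s * y) (c * y - s * x) \<partial>std_gauss \<partial>std_gauss) = (\<integral>\<^sup>+x. \<integral>\<^sup>+y. f x y \<partial>std_gauss \<partial>std_gauss)"
proof -
  let ?\<phi> = std_normal_density
  define h where "h = (\<lambda>u v. ennreal (?\<phi> u * ?\<phi> v) * f u v)"
  have h[measurable]: "case_prod h \<in> borel_measurable (borel \<Otimes>\<^sub>M borel)" unfolding h_def by measurable
  have rot: "?\<phi> (c * x + s * y) * ?\<phi> (c * y - s * x) = ?\<phi> x * ?\<phi> y" for x y
  proof -
    have "(c * x + s * y)\<^sup>2 + (c * y - s * x)\<^sup>2 = (c\<^sup>2 + s\<^sup>2) * (x\<^sup>2 + y\<^sup>2)"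
      by (simp add: power2_eq_square algebra_simps)
    then have "(c * x + s * y)\<^sup>2 + (c * y - s * x)\<^sup>2 = x\<^sup>2 + y\<^sup>2" by (simp add: cs)
    then have "- (c * x + s * y)\<^sup>2 / 2 + - (c * y - s * x)\<^sup>2 / 2 = - x\<^sup>2 / 2 + - y\<^sup>2 / 2" by (simp add: field_simps)
    then have "exp (- (c * x + s * y)\<^sup>2 / 2) * exp (- (c * y - s * x)\<^sup>2 / 2) = exp (- x\<^sup>2 / 2) * exp (- y\<^sup>2 / 2)"
      by (simp only: exp_add[symmetric])
    then show ?thesis unfolding std_normal_density_def by simp
  qed
  have dbl: "(\<integral>\<^sup>+x. \<integral>\<^sup>+y. k x y \<partial>std_gauss \<partial>std_gauss) = (\<integral>\<^sup>+x. \<integral>\<^sup>+y. ennreal (?\<phi> x * ?\<phi> y) * k x y \<partial>lborel \<partial>lborel)"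
    if [measurable]: "case_prod k \<in> borel_measurable (borel \<Otimes>\<^sub>M borel)" for k
  proof -
    have "(\<integral>\<^sup>+x. \<integral>\<^sup>+y. k x y \<partial>std_gauss \<partial>std_gauss) = (\<integral>\<^sup>+x. \<integral>\<^sup>+y. ennreal (?\<phi> y) * k x y \<partial>lborel \<partial>std_gauss)"
      by (subst nn_integral_std_gauss) auto
    also have "\<dots> = (\<integral>\<^sup>+x. ennreal (?\<phi> x) * (\<integral>\<^sup>+y. ennreal (?\<phi> y) * k x y \<partial>lborel) \<partial>lborel)"
      by (subst nn_integral_std_gauss) auto
    also have "\<dots> = (\<integral>\<^sup>+x. \<integral>\<^sup>+y. ennreal (?\<phi> x * ?\<phi> y) * k x y \<partial>lborel \<partial>lborel)"
      by (intro nn_integral_cong) (auto simp: nn_integral_cmult[symmetric] ennreal_mult mult.assoc)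
    finally show ?thesis .
  qed
  have "(\<integral>\<^sup>+x. \<integral>\<^sup>+y. f (c * x + s * y) (c * y - s * x) \<partial>std_gauss \<partial>std_gauss)
      = (\<integral>\<^sup>+x. \<integral>\<^sup>+y. h (c * x + s * y) (c * y - s * x) \<partial>lborel \<partial>lborel)"
    by (subst dbl) (auto simp: h_def rot)
  also have "\<dots> = (\<integral>\<^sup>+y. \<integral>\<^sup>+x. h (c * x + s * y) (c * y - s * x) \<partial>lborel \<partial>lborel)"
    by (rule lborel_pair.Fubini') auto
  also have "\<dots> = (\<integral>\<^sup>+y. ennreal (1/c) * (\<integral>\<^sup>+u. h u ((y - s * u) / c) \<partial>lborel) \<partial>lborel)"
  proof (rule nn_integral_cong)
    fix y
    have "(\<integral>\<^sup>+x. h (c * x + s * y) (c * y - s * x) \<partial>lborel)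
      = ennreal \<bar>1/c\<bar> * (\<integral>\<^sup>+u. h (c * (- s * y / c + 1/c * u) + s * y) (c * y - s * (- s * y / c + 1/c * u)) \<partial>lborel)"
      using cs by (intro nn_integral_real_affine) auto
    also have "(\<lambda>u. h (c * (- s * y / c + 1/c * u) + s * y) (c * y - s * (- s * y / c + 1/c * u))) = (\<lambda>u. h u ((y - s * u) / c))"
    proof
      fix u
      have a: "c * (- s * y / c + 1/c * u) + s * y = u" using cs by (simp add: field_simps)
      have "c * y - s * (- s * y / c + 1/c * u) = ((c\<^sup>2 + s\<^sup>2) * y - s * u) / c"
        using cs(2) by (simp add: field_simps power2_eq_square)
      then have b: "c * y - s * (- s * y / c + 1/c * u) = (y - s * u) / c" by (simp add: cs)
      show "h (c * (- s * y / c + 1/c * u) + s * y) (c * y - s * (- s * y / c + 1/c * u)) = h u ((y - s * u) / c)"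
        unfolding a b ..
    qed
    finally show "(\<integral>\<^sup>+x. h (c * x + s * y) (c * y - s * x) \<partial>lborel) = ennreal (1/c) * (\<integral>\<^sup>+u. h u ((y - s * u) / c) \<partial>lborel)"
      using cs by simp
  qed
  also have "\<dots> = ennreal (1/c) * (\<integral>\<^sup>+y. \<integral>\<^sup>+u. h u ((y - s * u) / c) \<partial>lborel \<partial>lborel)"
    by (rule nn_integral_cmult) auto
  also have "(\<integral>\<^sup>+y. \<integral>\<^sup>+u. h u ((y - s * u) / c) \<partial>lborel \<partial>lborel) = (\<integral>\<^sup>+u. \<integral>\<^sup>+y. h u ((y - s * u) / c) \<partial>lborel \<partial>lborel)"
    by (rule lborel_pair.Fubini') auto
  also have "\<dots> = (\<integral>\<^sup>+u. ennreal c * (\<integral>\<^sup>+v. h u v \<partial>lborel) \<partial>lborel)"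
  proof (rule nn_integral_cong)
    fix u
    have "(\<integral>\<^sup>+y. h u ((y - s * u) / c) \<partial>lborel) = ennreal \<bar>c\<bar> * (\<integral>\<^sup>+v. h u ((s * u + c * v - s * u) / c) \<partial>lborel)"
      using cs by (intro nn_integral_real_affine) auto
    then show "(\<integral>\<^sup>+y. h u ((y - s * u) / c) \<partial>lborel) = ennreal c * (\<integral>\<^sup>+v. h u v \<partial>lborel)"
      using cs by simp
  qed
  also have "\<dots> = ennreal c * (\<integral>\<^sup>+u. \<integral>\<^sup>+v. h u v \<partial>lborel \<partial>lborel)"
    by (rule nn_integral_cmult) auto
  also have "ennreal (1/c) * (ennreal c * (\<integral>\<^sup>+u. \<integral>\<^sup>+v. h u v \<partial>lborel \<partial>lborel)) = (\<integral>\<^sup>+u. \<integral>\<^sup>+v. h u v \<partial>lborel \<partial>lborel)"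
    using cs by (simp add: mult.assoc[symmetric] ennreal_mult[symmetric])
  also have "\<dots> = (\<integral>\<^sup>+x. \<integral>\<^sup>+y. f x y \<partial>std_gauss \<partial>std_gauss)"
    by (subst dbl) (auto simp: h_def)
  finally show ?thesis .
qed

definition rot :: "'i set \<Rightarrow> real \<Rightarrow> real \<Rightarrow> ('i \<Rightarrow> real) \<times> ('i \<Rightarrow> real) \<Rightarrow> ('i \<Rightarrow> real) \<times> ('i \<Rightarrow> real)" where
  "rot I c s z = (\<lambda>i\<in>I. c * fst z i + s * snd z i, \<lambda>i\<in>I. c * snd z i - s * fst z i)"

lemma rot_measurable[measurable]: "rot I c s \<in> measurable (PiM I (\<lambda>_. std_gauss) \<Otimes>\<^sub>M PiM I (\<lambda>_. std_gauss)) (PiM I (\<lambda>_. std_gauss) \<Otimes>\<^sub>M PiM I (\<lambda>_. std_gauss))"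
  unfolding rot_def[abs_def] by measurable

lemma gauss_rotation:
  fixes I :: "'i set"
  assumes "finite I" and cs: "c\<^sup>2 + s\<^sup>2 = (1::real)" "c > 0"
    and "f \<in> borel_measurable (PiM I (\<lambda>_. std_gauss) \<Otimes>\<^sub>M PiM I (\<lambda>_. std_gauss))"
  shows "(\<integral>\<^sup>+g. \<integral>\<^sup>+h. f (rot I c s (g, h)) \<partial>PiM I (\<lambda>_. std_gauss) \<partial>PiM I (\<lambda>_. std_gauss))
    = (\<integral>\<^sup>+g. \<integral>\<^sup>+h. f (g, h) \<partial>PiM I (\<lambda>_. std_gauss) \<partial>PiM I (\<lambda>_. std_gauss))"
  using assms(1,4)
proof (induction I arbitrary: f rule: finite_induct)
  case empty
  interpret product_sigma_finite "\<lambda>_::'i. std_gauss" by (rule product_sigma_finite_std_gauss)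
  show ?case using prob_space.emeasure_space_1[OF prob_gauss[of "{} :: 'i set", unfolded gauss_std_gauss]]
    by (simp add: nn_integral_empty rot_def restrict_def)
next
  case (insert i I)
  interpret product_sigma_finite "\<lambda>_::'i. std_gauss" by (rule product_sigma_finite_std_gauss)
  interpret N: sigma_finite_measure std_gauss by (rule sigma_finite_std_gauss)
  interpret G: sigma_finite_measure "PiM I (\<lambda>_. std_gauss)" by (rule sigma_finite[OF insert.hyps(1)])
  interpret PG: sigma_finite_measure "PiM (insert i I) (\<lambda>_. std_gauss)" by (rule sigma_finite) (use insert.hyps in auto)
  interpret NG: pair_sigma_finite std_gauss "PiM I (\<lambda>_. std_gauss)" ..
  let ?G = "PiM I (\<lambda>_. std_gauss)" and ?H = "PiM (insert i I) (\<lambda>_. std_gauss)"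
  note [measurable] = insert.prems
  have upd: "rot (insert i I) c s (x(i := a), y(i := b))
     = ((fst (rot I c s (x, y)))(i := c * a + s * b), (snd (rot I c s (x, y)))(i := c * b - s * a))" for x y a b
    using insert.hyps by (auto simp: rot_def restrict_def fun_eq_iff)
  define F where "F = (\<lambda>z. \<integral>\<^sup>+a. \<integral>\<^sup>+b. f ((fst z)(i := a), (snd z)(i := b)) \<partial>std_gauss \<partial>std_gauss)"
  have [measurable]: "F \<in> borel_measurable (?G \<Otimes>\<^sub>M ?G)" unfolding F_def by measurable
  \<comment> \<open>Fubini brings the two \<open>i\<close>-th coordinates next to each other, so
    that the planar rotation acts on the inner double integral.\<close>
  have iter: "(\<integral>\<^sup>+g. \<integral>\<^sup>+h. k (g, h) \<partial>?H \<partial>?H) = (\<integral>\<^sup>+x. \<integral>\<^sup>+y. \<integral>\<^sup>+a. \<integral>\<^sup>+b. k (x(i := a), y(i := b)) \<partial>std_gauss \<partial>std_gauss \<partial>?G \<partial>?G)"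
    if [measurable]: "k \<in> borel_measurable (?H \<Otimes>\<^sub>M ?H)" for k
  proof -
    have "(\<integral>\<^sup>+g. \<integral>\<^sup>+h. k (g, h) \<partial>?H \<partial>?H) = (\<integral>\<^sup>+x. \<integral>\<^sup>+a. \<integral>\<^sup>+h. k (x(i := a), h) \<partial>?H \<partial>std_gauss \<partial>?G)"
      by (subst product_nn_integral_insert[OF insert.hyps]) auto
    also have "\<dots> = (\<integral>\<^sup>+x. \<integral>\<^sup>+a. \<integral>\<^sup>+y. \<integral>\<^sup>+b. k (x(i := a), y(i := b)) \<partial>std_gauss \<partial>?G \<partial>std_gauss \<partial>?G)"
    proof (intro nn_integral_cong)
      fix x a assume x: "x \<in> space ?G"
      have "x(i := a) \<in> space ?H" using x by (auto simp: space_PiM PiE_def extensional_def)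
      then show "(\<integral>\<^sup>+h. k (x(i := a), h) \<partial>?H) = (\<integral>\<^sup>+y. \<integral>\<^sup>+b. k (x(i := a), y(i := b)) \<partial>std_gauss \<partial>?G)"
        by (intro product_nn_integral_insert[OF insert.hyps]) measurable
    qed
    also have "\<dots> = (\<integral>\<^sup>+x. \<integral>\<^sup>+y. \<integral>\<^sup>+a. \<integral>\<^sup>+b. k (x(i := a), y(i := b)) \<partial>std_gauss \<partial>std_gauss \<partial>?G \<partial>?G)"
    proof (intro nn_integral_cong NG.Fubini'[symmetric])
      fix x assume [measurable]: "x \<in> space ?G"
      show "(\<lambda>(a, y). \<integral>\<^sup>+b. k (x(i := a), y(i := b)) \<partial>std_gauss) \<in> borel_measurable (std_gauss \<Otimes>\<^sub>M ?G)"
        by measurable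
    qed
    finally show ?thesis .
  qed
  have "(\<integral>\<^sup>+g. \<integral>\<^sup>+h. f (rot (insert i I) c s (g, h)) \<partial>?H \<partial>?H)
     = (\<integral>\<^sup>+x. \<integral>\<^sup>+y. \<integral>\<^sup>+a. \<integral>\<^sup>+b. f ((fst (rot I c s (x, y)))(i := c * a + s * b), (snd (rot I c s (x, y)))(i := c * b - s * a)) \<partial>std_gauss \<partial>std_gauss \<partial>?G \<partial>?G)"
    by (subst iter[of "\<lambda>z. f (rot (insert i I) c s z)"]) (measurable, simp only: upd)
  also have "\<dots> = (\<integral>\<^sup>+x. \<integral>\<^sup>+y. F (rot I c s (x, y)) \<partial>?G \<partial>?G)"
  proof (intro nn_integral_cong)
    fix x y assume "x \<in> space ?G" "y \<in> space ?G"
    then have "rot I c s (x, y) \<in> space (?G \<Otimes>\<^sub>M ?G)"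
      by (intro measurable_space[OF rot_measurable]) (simp add: space_pair_measure)
    then have [measurable]: "fst (rot I c s (x, y)) \<in> space ?G" "snd (rot I c s (x, y)) \<in> space ?G"
      by (auto simp: space_pair_measure)
    have [measurable]: "case_prod (\<lambda>a b. f ((fst (rot I c s (x, y)))(i := a), (snd (rot I c s (x, y)))(i := b))) \<in> borel_measurable (borel \<Otimes>\<^sub>M borel)"
      by measurable
    show "(\<integral>\<^sup>+a. \<integral>\<^sup>+b. f ((fst (rot I c s (x, y)))(i := c * a + s * b), (snd (rot I c s (x, y)))(i := c * b - s * a)) \<partial>std_gauss \<partial>std_gauss) = F (rot I c s (x, y))"
      unfolding F_def
      by (rule std_gauss_rotation[of "\<lambda>a b. f ((fst (rot I c s (x, y)))(i := a), (snd (rot I c s (x, y)))(i := b))", OF _ cs]) measurable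
  qed
  also have "\<dots> = (\<integral>\<^sup>+x. \<integral>\<^sup>+y. F (x, y) \<partial>?G \<partial>?G)" by (rule insert.IH) measurable
  also have "\<dots> = (\<integral>\<^sup>+g. \<integral>\<^sup>+h. f (g, h) \<partial>?H \<partial>?H)"
    by (subst iter) (measurable, simp add: F_def)
  finally show ?case .
qed

lemma exp_average_le:
  fixes \<xi> :: "nat \<Rightarrow> real" assumes "m > 0"
  shows "exp (\<Sum>k<m. \<xi> k) \<le> (1 / real m) * (\<Sum>k<m. exp (real m * \<xi> k))"
proof -
  have "exp (\<Sum>k<m. (1 / real m) *\<^sub>R (real m * \<xi> k)) \<le> (\<Sum>k<m. (1 / real m) * exp (real m * \<xi> k))"
    by (rule convex_on_sum[OF _ _ exp_convex]) (use assms in auto)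
  then show ?thesis using assms by (simp add: sum_distrib_left)
qed


lemma gauss_rotation_iterate:
  fixes I :: "'i set"
  assumes "finite I" "c\<^sup>2 + s\<^sup>2 = (1::real)" "c > 0"
    and "f \<in> borel_measurable (PiM I (\<lambda>_. std_gauss) \<Otimes>\<^sub>M PiM I (\<lambda>_. std_gauss))"
  shows "(\<integral>\<^sup>+g. \<integral>\<^sup>+h. f ((rot I c s ^^ k) (g, h)) \<partial>PiM I (\<lambda>_. std_gauss) \<partial>PiM I (\<lambda>_. std_gauss))
    = (\<integral>\<^sup>+g. \<integral>\<^sup>+h. f (g, h) \<partial>PiM I (\<lambda>_. std_gauss) \<partial>PiM I (\<lambda>_. std_gauss))"
  using assms(4)
proof (induction k arbitrary: f)
  case (Suc k)
  note [measurable] = Suc.prems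
  have "(\<integral>\<^sup>+g. \<integral>\<^sup>+h. f ((rot I c s ^^ Suc k) (g, h)) \<partial>PiM I (\<lambda>_. std_gauss) \<partial>PiM I (\<lambda>_. std_gauss))
    = (\<integral>\<^sup>+g. \<integral>\<^sup>+h. (\<lambda>z. f (rot I c s z)) ((rot I c s ^^ k) (g, h)) \<partial>PiM I (\<lambda>_. std_gauss) \<partial>PiM I (\<lambda>_. std_gauss))"
    by simp
  also have "\<dots> = (\<integral>\<^sup>+g. \<integral>\<^sup>+h. f (rot I c s (g, h)) \<partial>PiM I (\<lambda>_. std_gauss) \<partial>PiM I (\<lambda>_. std_gauss))"
    by (rule Suc.IH) measurable
  also have "\<dots> = (\<integral>\<^sup>+g. \<integral>\<^sup>+h. f (g, h) \<partial>PiM I (\<lambda>_. std_gauss) \<partial>PiM I (\<lambda>_. std_gauss))"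
    by (rule gauss_rotation) (use assms Suc.prems in auto)
  finally show ?case .
qed simp

lemma rot_component:
  assumes "i \<in> I"
  shows "fst (rot I c s z) i = c * fst z i + s * snd z i" "snd (rot I c s z) i = c * snd z i - s * fst z i"
  using assms by (auto simp: rot_def)

lemma rot_iterate_eq:
  assumes "i \<in> I"
  shows "fst ((rot I (cos \<eta>) (sin \<eta>) ^^ k) (g, h)) i = cos (real k * \<eta>) * g i + sin (real k * \<eta>) * h i
    \<and> snd ((rot I (cos \<eta>) (sin \<eta>) ^^ k) (g, h)) i = cos (real k * \<eta>) * h i - sin (real k * \<eta>) * g i"
proof (induction k)
  case (Suc k)
  have e: "real (Suc k) * \<eta> = \<eta> + real k * \<eta>" by (simp add: algebra_simps)
  show ?case unfolding funpow.simps o_def e cos_add sin_add rot_component[OF assms]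
      Suc[THEN conjunct1] Suc[THEN conjunct2]
    by (simp add: algebra_simps)
qed simp

section \<open>Exponential moments of suprema and the rotation argument\<close>

lemma exp_lin_integrable:
  assumes "finite I" shows "integrable (gauss I) (\<lambda>g. exp (lin I v g))"
proof (rule integrableI_nn_integral_finite)
  show "(\<lambda>g. exp (lin I v g)) \<in> borel_measurable (gauss I)"
    using borel_measurable_integrable[OF lin_integrable[OF assms, of v]] by measurable
  show "(\<integral>\<^sup>+g. ennreal (exp (lin I v g)) \<partial>gauss I) = ennreal (exp ((\<Sum>i\<in>I. (v i)\<^sup>2)/2))"
    by (rule gauss_mgf[OF assms])
qed auto

text \<open>For a finite family the supremum is attained, so its exponential is dominated by a
  finite sum of exponentials of linear forms, whatever the sign of \<open>a\<close>.\<close>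

lemma exp_supf_integrable:
  assumes "finite I" "finite V" "V \<noteq> {}"
  shows "integrable (gauss I) (\<lambda>g. exp (a * supf I V g))"
proof (rule Bochner_Integration.integrable_bound)
  show "integrable (gauss I) (\<lambda>g. \<Sum>v\<in>V. exp (lin I (\<lambda>i. a * v i) g))"
    by (intro Bochner_Integration.integrable_sum exp_lin_integrable assms)
  show "(\<lambda>g. exp (a * supf I V g)) \<in> borel_measurable (gauss I)"
    using borel_measurable_integrable[OF supf_gauss_integrable[OF assms(1) bounded_fam_finite[OF assms]]] by measurable
  show "AE g in gauss I. norm (exp (a * supf I V g)) \<le> norm (\<Sum>v\<in>V. exp (lin I (\<lambda>i. a * v i) g))"
  proof (intro AE_I2)
    fix g
    have "supf I V g \<in> (\<lambda>v. lin I v g) ` V" unfolding supf_def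
      using assms by (subst cSup_eq_Max) (auto intro!: Max_in)
    then obtain v where v: "v \<in> V" "supf I V g = lin I v g" by auto
    have "exp (a * supf I V g) = exp (lin I (\<lambda>i. a * v i) g)" by (simp add: v lin_cmult_left)
    also have "\<dots> \<le> (\<Sum>v\<in>V. exp (lin I (\<lambda>i. a * v i) g))"
      by (rule member_le_sum[OF v(1)]) (use assms in auto)
    finally show "norm (exp (a * supf I V g)) \<le> norm (\<Sum>v\<in>V. exp (lin I (\<lambda>i. a * v i) g))"
      by (simp add: sum_nonneg)
  qed
qed

lemma one_minus_cos_le: "1 - cos x \<le> x\<^sup>2 / 2" for x :: real
proof -
  have "cos x = 1 - 2 * (sin (x/2))\<^sup>2" using cos_double_sin[of "x/2"] by simp
  moreover have "(sin (x/2))\<^sup>2 \<le> (x/2)\<^sup>2" using abs_sin_x_le_abs_x[of "x/2"]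
    by (simp only: abs_le_square_iff)
  ultimately show ?thesis by (simp add: power_divide)
qed

text \<open>Maurey--Pisier argument: rotate \<^term>\<open>g\<close> into the independent copy \<^term>\<open>h\<close> in \<^term>\<open>m\<close> small steps.
  The increment of the support function along a step is at most the increment of the linear form
  selected at the end point, which conditionally on the end point is Gaussian up to a drift of order
  \<open>1/m\<close>.\<close>

lemma Maurey_Pisier_step:
  fixes I :: "'i set"
  assumes "finite I" "finite V" "V \<noteq> {}" "\<And>v. v \<in> V \<Longrightarrow> L2_set v I \<le> D" "\<theta> \<ge> 0"
    and m: "m \<ge> 2" "2 * \<theta> \<le> real m"
  shows "(\<integral>g. exp (\<theta> * supf I V g) \<partial>gauss I) * (\<integral>g. exp (- \<theta> * supf I V g) \<partial>gauss I)
    \<le> exp (2 * \<theta>\<^sup>2 * D\<^sup>2) * (1 + 2 * \<theta> / real m * (\<integral>g. exp (supf I V g) \<partial>gauss I))"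
proof -
  interpret prob_space "gauss I" by (rule prob_gauss)
  let ?G = "gauss I" and ?Z = "supf I V"
  \<comment> \<open>The \<open>m\<close> steps add up to a quarter turn, which carries the first
    component from \<open>g\<close> to \<open>h\<close>.\<close>
  define \<eta> where "\<eta> = pi / (2 * real m)"
  let ?c = "cos \<eta>" and ?s = "sin \<eta>"
  have \<eta>: "0 < \<eta>" "\<eta> \<le> pi / 4" "real m * \<eta> = pi / 2" using m(1) by (auto simp: \<eta>_def field_simps)
  have c0: "?c > 0" using \<eta> by (intro cos_gt_zero_pi) auto
  have cs: "?c\<^sup>2 + ?s\<^sup>2 = 1" by simp
  have bV: "bounded_fam I V" by (rule bounded_fam_finite[OF assms(1-3)])
  have [measurable]: "?Z \<in> borel_measurable ?G" using supf_gauss_integrable[OF assms(1) bV] by auto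
  obtain e :: "nat \<Rightarrow> 'i \<Rightarrow> real" and \<kappa> where e: "range e \<subseteq> V" and \<kappa>[measurable]: "\<kappa> \<in> measurable ?G (count_space UNIV)"
    and arg: "\<And>g. lin I (e (\<kappa> g)) g = ?Z g"
    by (rule supf_argmax[OF assms(2,3), of I "\<lambda>g. g" ?G]) (auto intro: measurable_coord)
  \<comment> \<open>The bound for an increment depends on the end point of the step alone. By
    rotation invariance all end points have the law of (g, h), so the \<open>m\<close> summands have
    equal integrals.\<close>
  define \<Phi> where "\<Phi> = (\<lambda>z. exp (real m * (\<theta> * ((1 - ?c) * ?Z (fst z) + ?s * lin I (e (\<kappa> (fst z))) (snd z)))))"
  have [measurable]: "(\<lambda>z. lin I (e (\<kappa> (fst z))) (snd z)) \<in> borel_measurable (?G \<Otimes>\<^sub>M ?G)"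
    unfolding lin_def
  proof (intro borel_measurable_sum borel_measurable_times)
    fix i assume "i \<in> I"
    then have [measurable]: "(\<lambda>g. g i) \<in> borel_measurable ?G" by (rule measurable_coord)
    show "(\<lambda>z. snd z i) \<in> borel_measurable (?G \<Otimes>\<^sub>M ?G)" by measurable
    have "(\<lambda>z. \<kappa> (fst z)) \<in> measurable (?G \<Otimes>\<^sub>M ?G) (count_space UNIV)"
      by (rule measurable_compose[OF measurable_fst \<kappa>])
    then show "(\<lambda>z. e (\<kappa> (fst z)) i) \<in> borel_measurable (?G \<Otimes>\<^sub>M ?G)"
      by (rule measurable_compose[of _ _ _ "\<lambda>k. e k i"]) simp
  qed
  have [measurable]: "\<Phi> \<in> borel_measurable (?G \<Otimes>\<^sub>M ?G)" unfolding \<Phi>_def by measurable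
  have rm[measurable]: "rot I ?c ?s \<in> measurable (?G \<Otimes>\<^sub>M ?G) (?G \<Otimes>\<^sub>M ?G)" unfolding gauss_std_gauss by measurable
  have [measurable]: "(rot I ?c ?s ^^ k) \<in> measurable (?G \<Otimes>\<^sub>M ?G) (?G \<Otimes>\<^sub>M ?G)" for k
    by (rule measurable_compose_n) (rule rm)
  have pw: "exp (\<theta> * (?Z h - ?Z g)) \<le> (1 / real m) * (\<Sum>k<m. \<Phi> ((rot I ?c ?s ^^ Suc k) (g, h)))" for g h
  proof -
    let ?z = "\<lambda>k. (rot I ?c ?s ^^ k) (g, h)"
    have z0: "?Z (fst (?z 0)) = ?Z g" by simp
    have zm: "?Z (fst (?z m)) = ?Z h"
      by (rule supf_cong) (use rot_iterate_eq[of _ I m \<eta> g h] \<eta>(3) in auto)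
    let ?\<xi> = "\<lambda>k. \<theta> * ((1 - ?c) * ?Z (fst (?z (Suc k))) + ?s * lin I (e (\<kappa> (fst (?z (Suc k))))) (snd (?z (Suc k))))"
    \<comment> \<open>Seen from the end point z, the step started at
      \<open>c * fst z - s * snd z\<close>. Evaluating there the form that is maximal at the end
      point bounds the old supremum from below.\<close>
    have inc: "\<theta> * (?Z (fst (?z (Suc k))) - ?Z (fst (?z k))) \<le> ?\<xi> k" for k
    proof -
      let ?v = "e (\<kappa> (fst (?z (Suc k))))"
      have "lin I ?v (fst (?z k)) \<le> ?Z (fst (?z k))" by (rule lin_le_supf[OF bV]) (use e in auto)
      moreover have "lin I ?v (fst (?z k)) = lin I ?v (\<lambda>i. ?c * fst (?z (Suc k)) i - ?s * snd (?z (Suc k)) i)"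
      proof (rule lin_cong[OF refl])
        fix i assume i: "i \<in> I"
        have "?c * fst (?z (Suc k)) i - ?s * snd (?z (Suc k)) i
          = (?c\<^sup>2 + ?s\<^sup>2) * fst (?z k) i"
          unfolding funpow.simps o_def rot_component[OF i] by (simp only: power2_eq_square) algebra
        then show "fst (?z k) i = ?c * fst (?z (Suc k)) i - ?s * snd (?z (Suc k)) i" by (simp only: cs mult_1_left)
      qed
      moreover have "\<dots> = ?c * ?Z (fst (?z (Suc k))) - ?s * lin I ?v (snd (?z (Suc k)))"
        by (simp only: lin_diff_right lin_cmult_right arg)
      ultimately have "?Z (fst (?z (Suc k))) - ?Z (fst (?z k))
          \<le> (1 - ?c) * ?Z (fst (?z (Suc k))) + ?s * lin I ?v (snd (?z (Suc k)))"
        by (simp only: left_diff_distrib mult_1_left)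
      then show ?thesis using assms(5) by (rule mult_left_mono)
    qed
    have "\<theta> * (?Z h - ?Z g) = (\<Sum>k<m. \<theta> * (?Z (fst (?z (Suc k))) - ?Z (fst (?z k))))"
      by (simp only: sum_distrib_left[symmetric] sum_lessThan_telescope[of "\<lambda>k. ?Z (fst (?z k))"] z0 zm)
    also have "\<dots> \<le> (\<Sum>k<m. ?\<xi> k)" by (intro sum_mono inc)
    finally have "exp (\<theta> * (?Z h - ?Z g)) \<le> exp (\<Sum>k<m. ?\<xi> k)" by simp
    also have "\<dots> \<le> (1 / real m) * (\<Sum>k<m. exp (real m * ?\<xi> k))" by (rule exp_average_le) (use m in auto)
    finally show ?thesis unfolding \<Phi>_def .
  qed
  have I\<Phi>: "(\<integral>\<^sup>+g. \<integral>\<^sup>+h. ennreal (\<Phi> ((rot I ?c ?s ^^ k) (g, h))) \<partial>?G \<partial>?G) = (\<integral>\<^sup>+g. \<integral>\<^sup>+h. ennreal (\<Phi> (g, h)) \<partial>?G \<partial>?G)" for k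
    unfolding gauss_std_gauss by (rule gauss_rotation_iterate[OF assms(1) cs c0]) (use \<open>\<Phi> \<in> _\<close> in \<open>simp add: gauss_std_gauss\<close>)
  have "(\<integral>\<^sup>+g. \<integral>\<^sup>+h. ennreal (exp (\<theta> * (?Z h - ?Z g))) \<partial>?G \<partial>?G)
     \<le> (\<integral>\<^sup>+g. \<integral>\<^sup>+h. (\<Sum>k<m. ennreal (1 / real m) * ennreal (\<Phi> ((rot I ?c ?s ^^ Suc k) (g, h)))) \<partial>?G \<partial>?G)"
  proof (intro nn_integral_mono)
    fix g h
    have "ennreal (exp (\<theta> * (?Z h - ?Z g))) \<le> ennreal ((1 / real m) * (\<Sum>k<m. \<Phi> ((rot I ?c ?s ^^ Suc k) (g, h))))"
      by (rule ennreal_leI[OF pw])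
    also have "\<dots> = (\<Sum>k<m. ennreal ((1 / real m) * \<Phi> ((rot I ?c ?s ^^ Suc k) (g, h))))"
      unfolding sum_distrib_left by (rule sum_ennreal[symmetric]) (simp add: \<Phi>_def)
    also have "\<dots> = (\<Sum>k<m. ennreal (1 / real m) * ennreal (\<Phi> ((rot I ?c ?s ^^ Suc k) (g, h))))"
      by (intro sum.cong refl ennreal_mult) (auto simp: \<Phi>_def)
    finally show "ennreal (exp (\<theta> * (?Z h - ?Z g))) \<le> (\<Sum>k<m. ennreal (1 / real m) * ennreal (\<Phi> ((rot I ?c ?s ^^ Suc k) (g, h))))" .
  qed
  also have "\<dots> = (\<integral>\<^sup>+g. (\<Sum>k<m. ennreal (1 / real m) * (\<integral>\<^sup>+h. ennreal (\<Phi> ((rot I ?c ?s ^^ Suc k) (g, h))) \<partial>?G)) \<partial>?G)"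
  proof (intro nn_integral_cong)
    fix g assume [measurable]: "g \<in> space ?G"
    have [measurable]: "(\<lambda>h. ennreal (\<Phi> ((rot I ?c ?s ^^ k) (g, h)))) \<in> borel_measurable ?G" for k by measurable
    show "(\<integral>\<^sup>+h. (\<Sum>k<m. ennreal (1 / real m) * ennreal (\<Phi> ((rot I ?c ?s ^^ Suc k) (g, h)))) \<partial>?G)
      = (\<Sum>k<m. ennreal (1 / real m) * (\<integral>\<^sup>+h. ennreal (\<Phi> ((rot I ?c ?s ^^ Suc k) (g, h))) \<partial>?G))"
      by (subst nn_integral_sum, measurable, intro sum.cong refl nn_integral_cmult, measurable)
  qed
  also have "\<dots> = (\<Sum>k<m. ennreal (1 / real m) * (\<integral>\<^sup>+g. \<integral>\<^sup>+h. ennreal (\<Phi> ((rot I ?c ?s ^^ Suc k) (g, h))) \<partial>?G \<partial>?G))"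
    by (subst nn_integral_sum, measurable, intro sum.cong refl nn_integral_cmult, measurable)
  also have "\<dots> = (\<integral>\<^sup>+g. \<integral>\<^sup>+h. ennreal (\<Phi> (g, h)) \<partial>?G \<partial>?G)"
  proof -
    have "ennreal (real m) * ennreal (1 / real m) = 1" using m(1) by (simp add: ennreal_mult[symmetric])
    then show ?thesis unfolding I\<Phi> by (simp add: mult.assoc[symmetric] ennreal_of_nat_eq_real_of_nat)
  qed
  also have "\<dots> \<le> (\<integral>\<^sup>+g. ennreal (exp (2 * \<theta>\<^sup>2 * D\<^sup>2)) * ennreal (1 + 2 * \<theta> / real m * exp (?Z g)) \<partial>?G)"
  proof (intro nn_integral_mono)
    fix g assume "g \<in> space ?G"
    let ?v = "e (\<kappa> g)" and ?a = "real m * \<theta> * (1 - ?c)" and ?b = "real m * \<theta> * ?s"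
    have D0: "0 \<le> D" using assms(3,4) L2_set_nonneg order_trans by blast
    have [measurable]: "lin I v \<in> borel_measurable ?G" for v
      using borel_measurable_integrable[OF lin_integrable[OF assms(1)]] .
    have "(\<integral>\<^sup>+h. ennreal (\<Phi> (g, h)) \<partial>?G) = (\<integral>\<^sup>+h. ennreal (exp (?a * ?Z g)) * ennreal (exp (lin I (\<lambda>i. ?b * ?v i) h)) \<partial>?G)"
      unfolding \<Phi>_def
      by (intro nn_integral_cong) (simp add: lin_cmult_left ennreal_mult[symmetric] exp_add[symmetric] algebra_simps)
    also have "\<dots> = ennreal (exp (?a * ?Z g)) * ennreal (exp ((\<Sum>i\<in>I. (?b * ?v i)\<^sup>2)/2))"
      by (subst nn_integral_cmult) (auto simp: gauss_mgf[OF assms(1)])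
    also have "\<dots> \<le> ennreal (1 + 2 * \<theta> / real m * exp (?Z g)) * ennreal (exp (2 * \<theta>\<^sup>2 * D\<^sup>2))"
    proof (intro mult_mono ennreal_leI)
      \<comment> \<open>The drift coefficient m theta (1 - cos eta) is of order theta/m. Convexity
        interpolates its exponential between the exponents 0 and 1, so only exp of the supremum
        itself has to be integrable and the error vanishes as m grows.\<close>
      have "1 - ?c \<le> \<eta>\<^sup>2 / 2" by (rule one_minus_cos_le)
      then have "real m * (1 - ?c) \<le> real m * (\<eta>\<^sup>2 / 2)" by (rule mult_left_mono) simp
      also have "real m * (\<eta>\<^sup>2 / 2) = (pi / 2)\<^sup>2 / (2 * real m)"
        using m(1) by (simp add: \<eta>_def power2_eq_square field_simps)
      also have "\<dots> \<le> 2\<^sup>2 / (2 * real m)"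
        using pi_less_4 by (intro divide_right_mono power_mono) auto
      finally have "real m * (1 - ?c) \<le> 2 / real m" by simp
      then have "\<theta> * (real m * (1 - ?c)) \<le> \<theta> * (2 / real m)" using assms(5) by (rule mult_left_mono)
      then have a: "?a \<le> 2 * \<theta> / real m" by (simp add: mult_ac)
      have a0: "0 \<le> ?a" using assms(5) by simp
      have a1: "?a \<le> 1" using a m by (auto intro: order_trans simp: divide_le_eq)
      have "exp (?a * ?Z g) = exp ((1 - ?a) *\<^sub>R 0 + ?a *\<^sub>R ?Z g)" by simp
      also have "\<dots> \<le> (1 - ?a) * exp 0 + ?a * exp (?Z g)"
        by (rule convex_onD[OF exp_convex]) (use a0 a1 in auto)
      also have "\<dots> \<le> 1 + 2 * \<theta> / real m * exp (?Z g)"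
        using a a0 mult_right_mono[OF a, of "exp (?Z g)"] by simp
      finally show "exp (?a * ?Z g) \<le> 1 + 2 * \<theta> / real m * exp (?Z g)" .
      \<comment> \<open>m sin eta \<le> m eta = pi/2 \<le> 2 bounds the Gaussian part; its moment
        generating function yields the exponent 2 theta^2 D^2.\<close>
      have "?b\<^sup>2 \<le> (2 * \<theta>)\<^sup>2"
      proof (rule power_mono)
        have "?s \<le> \<eta>" using \<eta> by (intro sin_x_le_x) auto
        then have "real m * ?s \<le> real m * \<eta>" by (rule mult_left_mono) simp
        then have "real m * ?s \<le> 2" using \<eta>(3) pi_less_4 by linarith
        then have "\<theta> * (real m * ?s) \<le> \<theta> * 2" using assms(5) by (rule mult_left_mono)
        then show "?b \<le> 2 * \<theta>" by (simp add: mult_ac)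
        show "0 \<le> ?b" using assms(5) \<eta> by (intro mult_nonneg_nonneg sin_ge_zero) auto
      qed
      moreover have "(\<Sum>i\<in>I. (?v i)\<^sup>2) \<le> D\<^sup>2"
        using assms(4)[of ?v] e L2_set_power2[of ?v I] by (metis L2_set_nonneg power_mono rangeI subsetD)
      ultimately have "?b\<^sup>2 * (\<Sum>i\<in>I. (?v i)\<^sup>2) \<le> (2 * \<theta>)\<^sup>2 * D\<^sup>2"
        by (intro mult_mono) (auto intro: sum_nonneg)
      then show "exp ((\<Sum>i\<in>I. (?b * ?v i)\<^sup>2)/2) \<le> exp (2 * \<theta>\<^sup>2 * D\<^sup>2)"
        by (simp only: exp_le_cancel_iff power_mult_distrib sum_distrib_left[symmetric]) simp
    qed auto
    finally show "(\<integral>\<^sup>+h. ennreal (\<Phi> (g, h)) \<partial>?G) \<le> ennreal (exp (2 * \<theta>\<^sup>2 * D\<^sup>2)) * ennreal (1 + 2 * \<theta> / real m * exp (?Z g))"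
      by (simp only: mult.commute)
  qed
  also have "\<dots> = ennreal (exp (2 * \<theta>\<^sup>2 * D\<^sup>2) * (1 + 2 * \<theta> / real m * (\<integral>g. exp (?Z g) \<partial>?G)))"
  proof -
    have i: "integrable ?G (\<lambda>g. exp (?Z g))" using exp_supf_integrable[OF assms(1-3), of 1] by simp
    have "(\<integral>\<^sup>+g. ennreal (exp (2 * \<theta>\<^sup>2 * D\<^sup>2)) * ennreal (1 + 2 * \<theta> / real m * exp (?Z g)) \<partial>?G)
      = (\<integral>\<^sup>+g. ennreal (exp (2 * \<theta>\<^sup>2 * D\<^sup>2) * (1 + 2 * \<theta> / real m * exp (?Z g))) \<partial>?G)"
      using assms(5) by (intro nn_integral_cong) (simp add: ennreal_mult)
    also have "\<dots> = ennreal (\<integral>g. exp (2 * \<theta>\<^sup>2 * D\<^sup>2) * (1 + 2 * \<theta> / real m * exp (?Z g)) \<partial>?G)"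
      using i assms(5) by (intro nn_integral_eq_integral) auto
    also have "(\<integral>g. exp (2 * \<theta>\<^sup>2 * D\<^sup>2) * (1 + 2 * \<theta> / real m * exp (?Z g)) \<partial>?G)
        = exp (2 * \<theta>\<^sup>2 * D\<^sup>2) * (1 + 2 * \<theta> / real m * (\<integral>g. exp (?Z g) \<partial>?G))"
      using i by (simp add: prob_space)
    finally show ?thesis .
  qed
  also have "(\<integral>\<^sup>+g. \<integral>\<^sup>+h. ennreal (exp (\<theta> * (?Z h - ?Z g))) \<partial>?G \<partial>?G)
     = ennreal ((\<integral>g. exp (\<theta> * ?Z g) \<partial>?G) * (\<integral>g. exp (- \<theta> * ?Z g) \<partial>?G))"
  proof -
    have "(\<integral>\<^sup>+g. \<integral>\<^sup>+h. ennreal (exp (\<theta> * (?Z h - ?Z g))) \<partial>?G \<partial>?G)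
      = (\<integral>\<^sup>+g. \<integral>\<^sup>+h. ennreal (exp (- \<theta> * ?Z g)) * ennreal (exp (\<theta> * ?Z h)) \<partial>?G \<partial>?G)"
      by (intro nn_integral_cong) (simp add: ennreal_mult[symmetric] exp_add[symmetric] algebra_simps)
    also have "\<dots> = (\<integral>\<^sup>+h. ennreal (exp (\<theta> * ?Z h)) \<partial>?G) * (\<integral>\<^sup>+g. ennreal (exp (- \<theta> * ?Z g)) \<partial>?G)"
      by (simp add: nn_integral_cmult nn_integral_multc mult.commute)
    also have "(\<integral>\<^sup>+h. ennreal (exp (\<theta> * ?Z h)) \<partial>?G) = ennreal (\<integral>g. exp (\<theta> * ?Z g) \<partial>?G)"
      by (intro nn_integral_eq_integral exp_supf_integrable assms) auto
    also have "(\<integral>\<^sup>+h. ennreal (exp (- \<theta> * ?Z h)) \<partial>?G) = ennreal (\<integral>g. exp (- \<theta> * ?Z g) \<partial>?G)"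
      by (intro nn_integral_eq_integral exp_supf_integrable assms) auto
    finally show ?thesis by (simp add: ennreal_mult)
  qed
  finally show ?thesis
    using assms(5) by (subst (asm) ennreal_le_iff) (auto intro!: mult_nonneg_nonneg add_nonneg_nonneg)
qed

section \<open>Unions of few families\<close>

text \<open>The limit of infinitely many rotation steps: the drift term is of order 1/m, since exp
  of a finite supremum is integrable.\<close>

lemma exp_moments_prod_le:
  fixes I :: "'i set"
  assumes "finite I" "finite V" "V \<noteq> {}" "\<And>v. v \<in> V \<Longrightarrow> L2_set v I \<le> D" "\<theta> \<ge> 0"
  shows "(\<integral>g. exp (\<theta> * supf I V g) \<partial>gauss I) * (\<integral>g. exp (- \<theta> * supf I V g) \<partial>gauss I)
    \<le> exp (2 * \<theta>\<^sup>2 * D\<^sup>2)"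
proof (rule LIMSEQ_le_const)
  let ?B = "\<integral>g. exp (supf I V g) \<partial>gauss I"
  have "(\<lambda>m. exp (2 * \<theta>\<^sup>2 * D\<^sup>2) * (1 + 2 * \<theta> * (1 / real m) * ?B))
      \<longlonglongrightarrow> exp (2 * \<theta>\<^sup>2 * D\<^sup>2) * (1 + 2 * \<theta> * 0 * ?B)"
    by (intro tendsto_intros lim_1_over_n)
  then show "(\<lambda>m. exp (2 * \<theta>\<^sup>2 * D\<^sup>2) * (1 + 2 * \<theta> / real m * ?B)) \<longlonglongrightarrow> exp (2 * \<theta>\<^sup>2 * D\<^sup>2)" by simp
  show "\<exists>N. \<forall>m\<ge>N. (\<integral>g. exp (\<theta> * supf I V g) \<partial>gauss I) * (\<integral>g. exp (- \<theta> * supf I V g) \<partial>gauss I)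
     \<le> exp (2 * \<theta>\<^sup>2 * D\<^sup>2) * (1 + 2 * \<theta> / real m * ?B)"
  proof (intro exI allI impI)
    fix m assume m: "max 2 (nat \<lceil>2 * \<theta>\<rceil>) \<le> m"
    show "(\<integral>g. exp (\<theta> * supf I V g) \<partial>gauss I) * (\<integral>g. exp (- \<theta> * supf I V g) \<partial>gauss I)
     \<le> exp (2 * \<theta>\<^sup>2 * D\<^sup>2) * (1 + 2 * \<theta> / real m * ?B)"
      by (rule Maurey_Pisier_step[OF assms]) (use m in linarith)+
  qed
qed

text \<open>Jensen's inequality, from 1 + x \<le> exp x, bounds the moment at -theta from below by
  exp (- theta E Z); the decoupled product then controls the centred moment at theta.\<close>

lemma centred_exp_moment_le:
  fixes I :: "'i set"
  assumes "finite I" "finite V" "V \<noteq> {}" "\<And>v. v \<in> V \<Longrightarrow> L2_set v I \<le> D" "\<theta> \<ge> 0"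
  shows "(\<integral>g. exp (\<theta> * (supf I V g - gauss_width I V)) \<partial>gauss I) \<le> exp (2 * \<theta>\<^sup>2 * D\<^sup>2)"
proof -
  interpret prob_space "gauss I" by (rule prob_gauss)
  let ?P = "\<integral>g. exp (\<theta> * supf I V g) \<partial>gauss I" and ?N = "\<integral>g. exp (- \<theta> * supf I V g) \<partial>gauss I"
  let ?w = "gauss_width I V"
  have iZ: "integrable (gauss I) (supf I V)"
    by (rule supf_gauss_integrable[OF assms(1) bounded_fam_finite[OF assms(1-3)]])
  have "exp (- \<theta> * ?w) = (\<integral>g. exp (- \<theta> * ?w) * (1 + (- \<theta> * supf I V g + \<theta> * ?w)) \<partial>gauss I)"
    using iZ by (simp add: prob_space gauss_width_def)
  also have "\<dots> \<le> ?N"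
  proof (rule integral_mono)
    show "integrable (gauss I) (\<lambda>g. exp (- \<theta> * ?w) * (1 + (- \<theta> * supf I V g + \<theta> * ?w)))"
      using iZ by auto
    show "integrable (gauss I) (\<lambda>g. exp (- \<theta> * supf I V g))" by (rule exp_supf_integrable[OF assms(1-3)])
    fix g
    have "exp (- \<theta> * ?w) * (1 + (- \<theta> * supf I V g + \<theta> * ?w)) \<le> exp (- \<theta> * ?w) * exp (- \<theta> * supf I V g + \<theta> * ?w)"
      by (intro mult_left_mono exp_ge_add_one_self) simp
    then show "exp (- \<theta> * ?w) * (1 + (- \<theta> * supf I V g + \<theta> * ?w)) \<le> exp (- \<theta> * supf I V g)"
      by (simp add: mult_exp_exp)
  qed
  finally have N: "exp (- \<theta> * ?w) \<le> ?N" .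
  have "(\<integral>g. exp (\<theta> * (supf I V g - ?w)) \<partial>gauss I) = (\<integral>g. exp (\<theta> * supf I V g) * exp (- \<theta> * ?w) \<partial>gauss I)"
    by (intro Bochner_Integration.integral_cong refl) (simp add: mult_exp_exp right_diff_distrib)
  also have "\<dots> = ?P * exp (- \<theta> * ?w)" by simp
  also have "\<dots> \<le> ?P * ?N" by (intro mult_left_mono N integral_nonneg_AE) auto
  also have "\<dots> \<le> exp (2 * \<theta>\<^sup>2 * D\<^sup>2)" by (rule exp_moments_prod_le[OF assms])
  finally show ?thesis .
qed

lemma supf_image_shift:
  assumes "bounded_fam I V" "bounded_fam I ((\<lambda>v i. v i - c i) ` V)"
  shows "supf I ((\<lambda>v i. v i - c i) ` V) g = supf I V g - lin I c g"
proof (rule antisym)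
  show "supf I ((\<lambda>v i. v i - c i) ` V) g \<le> supf I V g - lin I c g"
    by (rule supf_least)
       (use assms lin_le_supf[OF assms(1)] in \<open>auto simp: lin_diff[symmetric] bounded_fam_def\<close>)
  have "supf I V g \<le> supf I ((\<lambda>v i. v i - c i) ` V) g + lin I c g"
  proof (rule supf_least)
    fix v assume "v \<in> V"
    then have "lin I (\<lambda>i. v i - c i) g \<le> supf I ((\<lambda>v i. v i - c i) ` V) g"
      by (intro lin_le_supf[OF assms(2)]) auto
    then show "lin I v g \<le> supf I ((\<lambda>v i. v i - c i) ` V) g + lin I c g" by (simp add: lin_diff[symmetric])
  qed (use assms in \<open>auto simp: bounded_fam_def\<close>)
  then show "supf I V g - lin I c g \<le> supf I ((\<lambda>v i. v i - c i) ` V) g" by linarith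
qed

text \<open>Each family fluctuates around its own width with Gaussian upper tails of order Delta, so
  the maximum over exp (s^2) families exceeds the largest width by a multiple of s Delta
  only.\<close>

lemma gauss_width_UN_le:
  fixes I :: "'i set"
  assumes "finite I" "finite A" "A \<noteq> {}" and V: "\<And>a. a \<in> A \<Longrightarrow> finite (V a)" "\<And>a. a \<in> A \<Longrightarrow> V a \<noteq> {}"
    "\<And>a. a \<in> A \<Longrightarrow> gauss_width I (V a) \<le> B"
    and \<Delta>: "\<And>v w. v \<in> (\<Union>a\<in>A. V a) \<Longrightarrow> w \<in> (\<Union>a\<in>A. V a) \<Longrightarrow> L2_set (\<lambda>i. v i - w i) I \<le> \<Delta>" "\<Delta> > 0"
    and s: "s > 0" "real (card A) \<le> exp (s\<^sup>2)"
  shows "gauss_width I (\<Union>a\<in>A. V a) \<le> B + 3 * s * \<Delta>"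
proof -
  interpret prob_space "gauss I" by (rule prob_gauss)
  \<comment> \<open>Subtracting one common vector brings all members into the ball of radius Delta;
    its linear form has mean zero, so no width changes.\<close>
  obtain c where c: "c \<in> (\<Union>a\<in>A. V a)" using assms(3) V(2) by blast
  let ?V = "\<lambda>a. (\<lambda>v i. v i - c i) ` V a"
  have fV: "finite (?V a)" "?V a \<noteq> {}" if "a \<in> A" for a using V that by auto
  have bV: "bounded_fam I (V a)" if "a \<in> A" for a using bounded_fam_finite[OF assms(1) V(1,2)[OF that]] .
  have DV: "L2_set v I \<le> \<Delta>" if "a \<in> A" "v \<in> ?V a" for a v using that \<Delta>(1) c by auto
  have sh: "supf I (?V a) g = supf I (V a) g - lin I c g" if "a \<in> A" for a g
    by (rule supf_image_shift[OF bV[OF that] bounded_fam_finite[OF assms(1) fV[OF that]]])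
  have w: "gauss_width I (?V a) \<le> B" if a: "a \<in> A" for a
  proof -
    have "gauss_width I (?V a) = (\<integral>g. supf I (V a) g - lin I c g \<partial>gauss I)"
      unfolding gauss_width_def by (rule Bochner_Integration.integral_cong[OF refl sh[OF a]])
    also have "\<dots> = gauss_width I (V a)" unfolding gauss_width_def
      by (subst Bochner_Integration.integral_diff)
         (auto intro!: supf_gauss_integrable lin_integrable assms bV a simp: lin_integral assms)
    finally show ?thesis using V(3)[OF a] by simp
  qed
  \<comment> \<open>At this parameter each centred exponential moment is at most exp (2 s^2); with
    exp (s^2) families the total is exp (3 s^2), that is, exp of \<open>?L\<close>.\<close>
  let ?\<theta> = "s / \<Delta>"
  have \<theta>: "?\<theta> > 0" using s \<Delta> by simp
  let ?L = "3 * s\<^sup>2"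
  let ?E = "\<lambda>a g. exp (?\<theta> * (supf I (?V a) g - gauss_width I (?V a)))"
  have iE: "integrable (gauss I) (?E a)" if a: "a \<in> A" for a
  proof -
    have "integrable (gauss I) (\<lambda>g. exp (?\<theta> * supf I (?V a) g) * exp (- ?\<theta> * gauss_width I (?V a)))"
      by (intro integrable_mult_left exp_supf_integrable assms fV a)
    then show ?thesis by (simp add: mult_exp_exp right_diff_distrib)
  qed
  have E: "(\<integral>g. ?E a g \<partial>gauss I) \<le> exp (2 * s\<^sup>2)" if a: "a \<in> A" for a
  proof -
    have "(\<integral>g. ?E a g \<partial>gauss I) \<le> exp (2 * ?\<theta>\<^sup>2 * \<Delta>\<^sup>2)"
      by (rule centred_exp_moment_le[OF assms(1) fV[OF a] DV[OF a]]) (use \<theta> in auto)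
    then show ?thesis using \<Delta>(2) by (simp add: power_divide)
  qed
  let ?U = "\<Union>a\<in>A. V a"
  have bU: "bounded_fam I ?U" by (rule bounded_fam_finite) (use assms(1,2,3) V in auto)
  \<comment> \<open>The union bound. Comparing exponents with \<open>?L\<close> through 1 + x \<le>
    exp x avoids the logarithm of an expectation.\<close>
  have pw: "supf I ?U g \<le> lin I c g + B + (1 / ?\<theta>) * (?L - 1 + (\<Sum>a\<in>A. ?E a g) / exp ?L)" for g
  proof (rule supf_least)
    show "?U \<noteq> {}" using c by blast
    fix v assume "v \<in> ?U"
    then obtain a where a: "a \<in> A" "v \<in> V a" by auto
    let ?x = "?\<theta> * (supf I (?V a) g - gauss_width I (?V a))"
    have "1 + (?x - ?L) \<le> exp (?x - ?L)" by (rule exp_ge_add_one_self)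
    also have "exp (?x - ?L) = ?E a g / exp ?L" by (rule exp_diff)
    also have "\<dots> \<le> (\<Sum>a\<in>A. ?E a g) / exp ?L"
      by (intro divide_right_mono member_le_sum[OF a(1)]) (use assms in auto)
    finally have "?x \<le> ?L - 1 + (\<Sum>a\<in>A. ?E a g) / exp ?L" by linarith
    moreover have "x \<le> (1 / t) * y" if "t * x \<le> y" "t > 0" for t x y :: real
      using that by (simp add: field_simps)
    ultimately have "supf I (?V a) g - gauss_width I (?V a) \<le> (1 / ?\<theta>) * (?L - 1 + (\<Sum>a\<in>A. ?E a g) / exp ?L)"
      using \<theta> by blast
    moreover have "lin I v g \<le> supf I (V a) g" by (rule lin_le_supf[OF bV[OF a(1)] a(2)])
    ultimately show "lin I v g \<le> lin I c g + B + (1 / ?\<theta>) * (?L - 1 + (\<Sum>a\<in>A. ?E a g) / exp ?L)"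
      using sh[OF a(1), of g] w[OF a(1)] by linarith
  qed
  have iS: "integrable (gauss I) (\<lambda>g. (\<Sum>a\<in>A. ?E a g))" by (intro Bochner_Integration.integrable_sum iE)
  have "gauss_width I ?U \<le> (\<integral>g. lin I c g + (B + (1 / ?\<theta>) * (?L - 1 + (\<Sum>a\<in>A. ?E a g) / exp ?L)) \<partial>gauss I)"
    unfolding gauss_width_def[of I ?U]
  proof (rule integral_mono)
    show "integrable (gauss I) (\<lambda>g. lin I c g + (B + (1 / ?\<theta>) * (?L - 1 + (\<Sum>a\<in>A. ?E a g) / exp ?L)))"
      using iS lin_integrable[OF assms(1), of c] by auto
  qed (use pw supf_gauss_integrable[OF assms(1) bU] in \<open>auto simp: add.assoc\<close>)
  also have "\<dots> = B + (1 / ?\<theta>) * (?L - 1 + (\<integral>g. (\<Sum>a\<in>A. ?E a g) \<partial>gauss I) / exp ?L)"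
    using iS lin_integrable[OF assms(1), of c] lin_integral[OF assms(1), of c] by (simp add: prob_space)
  also have "\<dots> \<le> B + (1 / ?\<theta>) * ?L"
  proof -
    have "(\<integral>g. (\<Sum>a\<in>A. ?E a g) \<partial>gauss I) = (\<Sum>a\<in>A. \<integral>g. ?E a g \<partial>gauss I)"
      by (intro Bochner_Integration.integral_sum iE)
    also have "\<dots> \<le> (\<Sum>a\<in>A. exp (2 * s\<^sup>2))" by (intro sum_mono E)
    also have "\<dots> \<le> exp (s\<^sup>2) * exp (2 * s\<^sup>2)" using s(2) by simp
    also have "\<dots> = exp ?L" by (simp add: mult_exp_exp)
    finally have "(\<integral>g. (\<Sum>a\<in>A. ?E a g) \<partial>gauss I) / exp ?L \<le> 1" by (simp add: divide_le_eq)
    then have "(1 / ?\<theta>) * (?L - 1 + (\<integral>g. (\<Sum>a\<in>A. ?E a g) \<partial>gauss I) / exp ?L) \<le> (1 / ?\<theta>) * ?L"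
      using \<theta> s(1) \<Delta>(2) by (intro mult_left_mono) auto
    then show ?thesis by linarith
  qed
  also have "(1 / ?\<theta>) * ?L = 3 * s * \<Delta>" using s by (simp add: power2_eq_square)
  finally show ?thesis .
qed

text \<open>Concentration is available for finite families, so a finite subfamily that nearly
  attains the width is grouped by class.\<close>

lemma gauss_width_few_classes:
  fixes I :: "'i set"
  assumes "finite I" "bounded_fam I (f ` U)" "few_classes U R (exp (s\<^sup>2))" "s > 0"
    and \<Delta>: "\<And>u v. u \<in> U \<Longrightarrow> v \<in> U \<Longrightarrow> L2_set (\<lambda>i. f u i - f v i) I \<le> \<Delta>"
    and B: "\<And>W. W \<subseteq> U \<Longrightarrow> W \<noteq> {} \<Longrightarrow> (\<And>u v. u \<in> W \<Longrightarrow> v \<in> W \<Longrightarrow> R u v) \<Longrightarrow> gauss_width I (f ` W) \<le> B"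
  shows "gauss_width I (f ` U) \<le> B + 3 * s * \<Delta>"
proof (rule field_le_epsilon)
  fix \<epsilon> :: real assume \<epsilon>: "\<epsilon> > 0"
  \<comment> \<open>The added summand makes the diameter positive and costs
    \<open>3 * s * (\<epsilon> / (6 * s))\<close>, half of epsilon; the other half pays for the
    finite approximation.\<close>
  let ?\<Delta> = "\<Delta> + \<epsilon> / (6 * s)"
  obtain u0 where "u0 \<in> U" using assms(2) by (auto simp: bounded_fam_def)
  then have "0 \<le> \<Delta>" using order_trans[OF L2_set_nonneg \<Delta>] by blast
  then have \<Delta>0: "?\<Delta> > 0" using \<epsilon> assms(4) by (simp add: add_nonneg_pos)
  obtain \<phi> :: "_ \<Rightarrow> nat" where \<phi>: "finite (\<phi> ` U)" "real (card (\<phi> ` U)) \<le> exp (s\<^sup>2)"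
    "\<forall>u\<in>U. \<forall>v\<in>U. \<phi> u = \<phi> v \<longrightarrow> R u v"
    using assms(3) unfolding few_classes_def by blast
  have "\<exists>F. finite F \<and> F \<noteq> {} \<and> F \<subseteq> f ` U \<and> (\<integral>g. supf I (f ` U) g \<partial>gauss I) \<le> (\<integral>g. supf I F g \<partial>gauss I) + \<epsilon>/2"
    by (rule supf_finite_approx[OF assms(2,1), of "gauss I" "\<lambda>g. g" "\<epsilon>/2"])
       (use \<epsilon> in \<open>auto intro: gauss_coord assms\<close>)
  then obtain F where F: "finite F" "F \<noteq> {}" "F \<subseteq> f ` U" "gauss_width I (f ` U) \<le> gauss_width I F + \<epsilon>/2"
    unfolding gauss_width_def by blast
  obtain U0 where U0: "U0 \<subseteq> U" "finite U0" "F = f ` U0" using finite_subset_image[OF F(1,3)] by blast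
  let ?A = "\<phi> ` U0" and ?W = "\<lambda>a. {u\<in>U0. \<phi> u = a}"
  have FU: "F = (\<Union>a\<in>?A. f ` ?W a)" using U0(3) by auto
  have "gauss_width I (\<Union>a\<in>?A. f ` ?W a) \<le> B + 3 * s * ?\<Delta>"
  proof (rule gauss_width_UN_le[OF assms(1)])
    show "finite ?A" "?A \<noteq> {}" using U0 F(2) by auto
    show "finite (f ` ?W a)" for a using U0 by auto
    show "f ` ?W a \<noteq> {}" if "a \<in> ?A" for a using that by auto
    show "gauss_width I (f ` ?W a) \<le> B" if "a \<in> ?A" for a
    proof (rule B)
      show "?W a \<subseteq> U" "?W a \<noteq> {}" using U0(1) that by auto
      show "R u v" if "u \<in> ?W a" "v \<in> ?W a" for u v using \<phi>(3) U0(1) that by (metis (mono_tags) mem_Collect_eq subsetD)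
    qed
    show "?\<Delta> > 0" "s > 0" by fact+
    have "card ?A \<le> card (\<phi> ` U)" using U0(1) \<phi>(1) by (intro card_mono image_mono) auto
    then show "real (card ?A) \<le> exp (s\<^sup>2)" using \<phi>(2) by linarith
    fix v w assume "v \<in> (\<Union>a\<in>?A. f ` ?W a)" "w \<in> (\<Union>a\<in>?A. f ` ?W a)"
    then obtain u u' where "u \<in> U" "u' \<in> U" "v = f u" "w = f u'" using U0(1) by blast
    then have "L2_set (\<lambda>i. v i - w i) I \<le> \<Delta>" using \<Delta> by blast
    moreover have "0 \<le> \<epsilon> / (6 * s)" using \<epsilon> assms(4) by simp
    ultimately show "L2_set (\<lambda>i. v i - w i) I \<le> ?\<Delta>" by linarith
  qed
  then have "gauss_width I (f ` U) \<le> B + 3 * s * ?\<Delta> + \<epsilon>/2" using F(4) unfolding FU by linarith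
  also have "3 * s * ?\<Delta> = 3 * s * \<Delta> + \<epsilon>/2" using assms(4) by (simp add: distrib_left)
  finally show "gauss_width I (f ` U) \<le> B + 3 * s * \<Delta> + \<epsilon>" by linarith
qed

section \<open>Tensors and contractions\<close>

type_synonym ten = "(nat \<Rightarrow> nat) \<Rightarrow> real"

definition Ix :: "nat \<Rightarrow> nat set \<Rightarrow> (nat \<Rightarrow> nat) set" where
  "Ix n L = PiE L (\<lambda>_. {1..n})"

definition merge_idx :: "nat set \<Rightarrow> (nat \<Rightarrow> nat) \<Rightarrow> (nat \<Rightarrow> nat) \<Rightarrow> nat \<Rightarrow> nat" where
  "merge_idx K i j = (\<lambda>l. if l \<in> K then i l else j l)"

text \<open>The factor attached to a block \<open>B\<close> sees only the part \<open>restrict i B\<close> of the multi-index \<open>i\<close>.\<close>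

definition tensor_prod :: "nat set set \<Rightarrow> (nat set \<Rightarrow> ten) \<Rightarrow> ten" where
  "tensor_prod P x i = (\<Prod>B\<in>P. x B (restrict i B))"

text \<open>The result is meant for multi-indices \<open>j\<close> on the remaining coordinates; the
  values of \<open>j\<close> on \<open>K\<close> are overwritten by
  \<open>merge_idx\<close>.\<close>

definition contract :: "nat \<Rightarrow> nat set \<Rightarrow> ten \<Rightarrow> ten \<Rightarrow> ten" where
  "contract n K z \<tau> = (\<lambda>j. \<Sum>i\<in>Ix n K. \<tau> (merge_idx K i j) * z i)"

lemma finite_Ix[intro, simp]: "finite L \<Longrightarrow> finite (Ix n L)"
  unfolding Ix_def by (intro finite_PiE) auto

lemma restrict_Ix: "i \<in> Ix n L \<Longrightarrow> B \<subseteq> L \<Longrightarrow> restrict i B \<in> Ix n B"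
  unfolding Ix_def by (auto simp: PiE_iff)

lemma restrict_Ix_id: "i \<in> Ix n L \<Longrightarrow> restrict i L = i"
  unfolding Ix_def by (auto simp: PiE_restrict)

lemma merge_idx_Ix: "i \<in> Ix n K \<Longrightarrow> j \<in> Ix n L \<Longrightarrow> merge_idx K i j \<in> Ix n (K \<union> L)"
  unfolding Ix_def merge_idx_def by (auto simp: PiE_iff extensional_def)

lemma restrict_merge_idx_left: "B \<subseteq> K \<Longrightarrow> restrict (merge_idx K i j) B = restrict i B"
  unfolding merge_idx_def restrict_def by (auto simp: fun_eq_iff)

lemma restrict_merge_idx_right: "B \<inter> K = {} \<Longrightarrow> restrict (merge_idx K i j) B = restrict j B"
  unfolding merge_idx_def restrict_def by (auto simp: fun_eq_iff)

lemma merge_idx_merge_idx: "K1 \<inter> K2 = {} \<Longrightarrow> merge_idx (K1 \<union> K2) (merge_idx K1 i i') j = merge_idx K1 i (merge_idx K2 i' j)"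
  unfolding merge_idx_def by (auto simp: fun_eq_iff)

lemma sum_Ix_split:
  assumes "K \<inter> L = {}"
  shows "(\<Sum>i\<in>Ix n (K \<union> L). f i) = (\<Sum>i\<in>Ix n K. \<Sum>j\<in>Ix n L. f (merge_idx K i j))"
proof -
  have "(\<Sum>i\<in>Ix n (K \<union> L). f i) = (\<Sum>(i,j)\<in>Ix n K \<times> Ix n L. f (merge_idx K i j))"
  proof (rule sum.reindex_bij_witness[of _ "\<lambda>(i,j). merge_idx K i j" "\<lambda>i. (restrict i K, restrict i L)"])
    fix i assume i: "i \<in> Ix n (K \<union> L)"
    have "merge_idx K (restrict i K) (restrict i L) = restrict i (K \<union> L)" by (auto simp: merge_idx_def fun_eq_iff)
    then show e: "(case (restrict i K, restrict i L) of (i, j) \<Rightarrow> merge_idx K i j) = i" using restrict_Ix_id[OF i] by simp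
    show "(restrict i K, restrict i L) \<in> Ix n K \<times> Ix n L" using restrict_Ix[OF i] by auto
    show "(case (restrict i K, restrict i L) of (i, j) \<Rightarrow> f (merge_idx K i j)) = f i" using e by simp
  next
    fix z assume "z \<in> Ix n K \<times> Ix n L"
    then obtain i j where z: "z = (i, j)" "i \<in> Ix n K" "j \<in> Ix n L" by auto
    show "(restrict (case z of (i, j) \<Rightarrow> merge_idx K i j) K, restrict (case z of (i, j) \<Rightarrow> merge_idx K i j) L) = z"
      using z assms by (simp add: restrict_merge_idx_left restrict_merge_idx_right Int_commute restrict_Ix_id)
    show "(case z of (i, j) \<Rightarrow> merge_idx K i j) \<in> Ix n (K \<union> L)" using z by (auto intro: merge_idx_Ix)
  qed
  then show ?thesis by (simp add: sum.cartesian_product)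
qed

lemma lin_contract:
  assumes "K \<inter> L = {}" "\<And>i j. i \<in> Ix n K \<Longrightarrow> j \<in> Ix n L \<Longrightarrow> f (merge_idx K i j) = z i * w j"
  shows "lin (Ix n (K \<union> L)) \<tau> f = lin (Ix n L) (contract n K z \<tau>) w"
proof -
  have "lin (Ix n (K \<union> L)) \<tau> f = (\<Sum>i\<in>Ix n K. \<Sum>j\<in>Ix n L. \<tau> (merge_idx K i j) * z i * w j)"
    unfolding lin_def sum_Ix_split[OF assms(1)] by (intro sum.cong refl) (simp add: assms(2) mult.assoc)
  also have "\<dots> = lin (Ix n L) (contract n K z \<tau>) w"
    unfolding lin_def contract_def sum_distrib_right by (rule sum.swap)
  finally show ?thesis .
qed

lemma contract_contract:
  assumes "K1 \<inter> K2 = {}" "\<And>i j. i \<in> Ix n K1 \<Longrightarrow> j \<in> Ix n K2 \<Longrightarrow> f (merge_idx K1 i j) = z1 i * z2 j"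
  shows "contract n (K1 \<union> K2) f \<tau> = contract n K2 z2 (contract n K1 z1 \<tau>)"
proof
  fix j
  have "contract n (K1 \<union> K2) f \<tau> j = (\<Sum>i\<in>Ix n K1. \<Sum>i'\<in>Ix n K2. \<tau> (merge_idx K1 i (merge_idx K2 i' j)) * z1 i * z2 i')"
    unfolding contract_def sum_Ix_split[OF assms(1)]
    by (intro sum.cong refl) (simp add: assms(2) merge_idx_merge_idx[OF assms(1)] mult.assoc)
  also have "\<dots> = contract n K2 z2 (contract n K1 z1 \<tau>) j"
    unfolding contract_def sum_distrib_right by (rule sum.swap)
  finally show "contract n (K1 \<union> K2) f \<tau> j = contract n K2 z2 (contract n K1 z1 \<tau>) j" .
qed

lemma contract_uminus: "contract n K z (\<lambda>i. - \<tau> i) = (\<lambda>j. - contract n K z \<tau> j)"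
  by (simp add: contract_def sum_negf)

lemma contract_diff: "contract n K z (\<lambda>i. \<tau> i - \<sigma> i) = (\<lambda>j. contract n K z \<tau> j - contract n K z \<sigma> j)"
  by (simp add: contract_def sum_subtractf left_diff_distrib)

lemma contract_diff_left: "contract n K (\<lambda>i. z i - w i) \<tau> j = contract n K z \<tau> j - contract n K w \<tau> j"
  by (simp add: contract_def sum_subtractf right_diff_distrib)

lemma contract_cmult_left: "contract n K (\<lambda>i. c * z i) \<tau> j = c * contract n K z \<tau> j"
  by (simp add: contract_def sum_distrib_left algebra_simps)

lemma contract_cong_left: "(\<And>i. i \<in> Ix n K \<Longrightarrow> z i = w i) \<Longrightarrow> contract n K z \<tau> = contract n K w \<tau>"
  by (auto simp: contract_def intro!: ext sum.cong)

lemma contract_empty: "contract n {} z \<tau> = (\<lambda>j. \<tau> j * z (\<lambda>_. undefined))"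
  by (simp add: contract_def Ix_def merge_idx_def)

lemma tensor_prod_empty[simp]: "tensor_prod {} x i = 1" by (simp add: tensor_prod_def)

lemma tensor_prod_union: "finite P \<Longrightarrow> finite Q \<Longrightarrow> P \<inter> Q = {} \<Longrightarrow> tensor_prod (P \<union> Q) x i = tensor_prod P x i * tensor_prod Q x i"
  by (simp add: tensor_prod_def prod.union_disjoint)

lemma tensor_prod_insert: "finite P \<Longrightarrow> B \<notin> P \<Longrightarrow> tensor_prod (insert B P) x i = x B (restrict i B) * tensor_prod P x i"
  by (simp add: tensor_prod_def)

lemma tensor_prod_merge_idx_left: "\<Union>P \<subseteq> K \<Longrightarrow> tensor_prod P x (merge_idx K i j) = tensor_prod P x i"
  unfolding tensor_prod_def by (intro prod.cong refl) (auto intro!: arg_cong[where f="x _"] restrict_merge_idx_left)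

lemma tensor_prod_merge_idx_right: "\<Union>P \<inter> K = {} \<Longrightarrow> tensor_prod P x (merge_idx K i j) = tensor_prod P x j"
  unfolding tensor_prod_def by (intro prod.cong refl) (auto intro!: arg_cong[where f="x _"] restrict_merge_idx_right)

lemma tensor_prod_cong: "(\<And>B. B \<in> P \<Longrightarrow> x B (restrict i B) = y B (restrict i B)) \<Longrightarrow> tensor_prod P x i = tensor_prod P y i"
  unfolding tensor_prod_def by (auto intro: prod.cong)

lemma tensor_prod_cmult: "tensor_prod P (\<lambda>B i. c * x B i) i = c ^ card P * tensor_prod P x i"
  by (simp add: tensor_prod_def prod.distrib)

section \<open>Symmetric bounded tensor families and mixed expectations\<close>

definition tensor_fam :: "nat \<Rightarrow> nat set \<Rightarrow> ten set \<Rightarrow> bool" where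
  "tensor_fam n L \<T> \<longleftrightarrow> bounded_fam (Ix n L) \<T> \<and> sym_fam \<T>"

lemma tensor_fam_contract:
  assumes "tensor_fam n (K \<union> L) \<T>" "K \<inter> L = {}"
  shows "tensor_fam n L (contract n K z ` \<T>)"
proof -
  obtain R where R: "\<forall>v\<in>\<T>. \<forall>i\<in>Ix n (K \<union> L). \<bar>v i\<bar> \<le> R" and ne: "\<T> \<noteq> {}"
    using assms(1) unfolding tensor_fam_def bounded_fam_def by blast
  have "\<bar>contract n K z v j\<bar> \<le> (\<Sum>i\<in>Ix n K. R * \<bar>z i\<bar>)" if "v \<in> \<T>" "j \<in> Ix n L" for v j
    unfolding contract_def using R that merge_idx_Ix
    by (intro order_trans[OF sum_abs] sum_mono) (auto simp: abs_mult intro!: mult_right_mono)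
  then have "bounded_fam (Ix n L) (contract n K z ` \<T>)" unfolding bounded_fam_def using ne by blast
  moreover have "sym_fam (contract n K z ` \<T>)"
    using assms(1) unfolding sym_fam_def tensor_fam_def by (auto simp: contract_uminus[symmetric])
  ultimately show ?thesis by (simp add: tensor_fam_def)
qed

abbreviation cur :: "(nat set \<times> (nat \<Rightarrow> nat) \<Rightarrow> real) \<Rightarrow> nat set \<Rightarrow> ten" where
  "cur g \<equiv> (\<lambda>J i. g (J, i))"

definition block_gauss :: "nat \<Rightarrow> nat set set \<Rightarrow> (nat set \<times> (nat \<Rightarrow> nat) \<Rightarrow> real) measure" where
  "block_gauss n P' = gauss (SIGMA J:P'. Ix n J)"

text \<open>For \<open>z = tensor_prod P x\<close> this is the expectation inside the supremum that
  defines the norm of P' | P. The deterministic factor is left general so that it can absorb frozen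
  Gaussian factors and contracted vectors.\<close>

definition mean_sup :: "nat \<Rightarrow> nat set set \<Rightarrow> nat set \<Rightarrow> ten set \<Rightarrow> ten \<Rightarrow> real" where
  "mean_sup n P' L \<T> z = (\<integral>g. supf (Ix n L) \<T> (\<lambda>i. z i * tensor_prod P' (cur g) i) \<partial>block_gauss n P')"

lemma prob_block_gauss: "prob_space (block_gauss n P')" unfolding block_gauss_def by (rule prob_gauss)

text \<open>The block is part of the key of a Gaussian coordinate, so different blocks use different
  coordinates and the product has independent integrable factors.\<close>

lemma tensor_prod_gauss_integrable:
  assumes "finite P'" "\<And>J. J \<in> P' \<Longrightarrow> finite J" "\<And>J. J \<in> P' \<Longrightarrow> restrict i J \<in> Ix n J"
  shows "integrable (block_gauss n P') (\<lambda>g. tensor_prod P' (cur g) i)"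
proof -
  let ?C = "SIGMA J:P'. Ix n J" and ?h = "\<lambda>J. (J, restrict i J)"
  interpret product_sigma_finite "\<lambda>_::nat set \<times> (nat \<Rightarrow> nat). std_gauss" by (rule product_sigma_finite_std_gauss)
  have fC: "finite ?C" using assms by auto
  have sub: "?h ` P' \<subseteq> ?C" using assms(3) by auto
  have "tensor_prod P' (cur g) i = (\<Prod>c\<in>?C. if c \<in> ?h ` P' then g c else 1)" for g
  proof -
    have "(\<Prod>c\<in>?C. if c \<in> ?h ` P' then g c else 1) = (\<Prod>c\<in>?C \<inter> ?h ` P'. g c)"
      by (rule prod.inter_restrict[symmetric, OF fC])
    also have "?C \<inter> ?h ` P' = ?h ` P'" using sub by blast
    also have "(\<Prod>c\<in>?h ` P'. g c) = (\<Prod>J\<in>P'. g (?h J))" by (subst prod.reindex) (auto intro: inj_onI)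
    finally show ?thesis unfolding tensor_prod_def by (rule sym)
  qed
  moreover have "integrable (block_gauss n P') (\<lambda>g. \<Prod>c\<in>?C. (\<lambda>x. if c \<in> ?h ` P' then x else 1) (g c))"
    unfolding block_gauss_def gauss_std_gauss
  proof (rule product_integrable_prod[OF fC])
    interpret std_gauss: prob_space std_gauss by (rule prob_std_gauss)
    show "integrable std_gauss (\<lambda>x. if c \<in> ?h ` P' then x else 1)" for c
      using std_gauss_moment_integrable[of 1] by (cases "c \<in> ?h ` P'") auto
  qed
  ultimately show ?thesis by simp
qed

lemma mean_sup_empty: "mean_sup n {} L \<T> z = supf (Ix n L) \<T> z"
proof -
  interpret prob_space "block_gauss n {}" by (rule prob_block_gauss)
  show ?thesis by (simp add: mean_sup_def prob_space)
qed

lemma gauss_reindex: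
  assumes "finite I" "inj_on f I" "f ` I \<subseteq> K" "F \<in> borel_measurable (gauss I)"
  shows "(\<integral>w. F (\<lambda>i\<in>I. w (f i)) \<partial>gauss K) = (\<integral>g. (F g :: real) \<partial>gauss I)"
proof -
  have d: "distr (gauss K) (gauss I) (\<lambda>w. \<lambda>i\<in>I. w (f i)) = gauss I"
    unfolding gauss_std_gauss
    using distr_PiM_reindex[of K "\<lambda>_. std_gauss" f I] assms prob_std_gauss by auto
  have m: "(\<lambda>w. \<lambda>i\<in>I. w (f i)) \<in> measurable (gauss K) (gauss I)"
    unfolding gauss_std_gauss using assms(3) by (intro measurable_restrict) auto
  have "(\<integral>g. F g \<partial>gauss I) = (\<integral>g. F g \<partial>distr (gauss K) (gauss I) (\<lambda>w. \<lambda>i\<in>I. w (f i)))"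
    by (simp add: d)
  also have "\<dots> = (\<integral>w. F (\<lambda>i\<in>I. w (f i)) \<partial>gauss K)"
    by (rule integral_distr[OF m assms(4)])
  finally show ?thesis by simp
qed

lemma mean_sup_single:
  assumes "finite b" "bounded_fam (Ix n b) \<T>"
  shows "mean_sup n {b} b \<T> (\<lambda>_. 1) = gauss_width (Ix n b) \<T>"
proof -
  have "mean_sup n {b} b \<T> (\<lambda>_. 1) = (\<integral>g. supf (Ix n b) \<T> (\<lambda>i\<in>Ix n b. g (b, i)) \<partial>block_gauss n {b})"
    unfolding mean_sup_def
    by (intro Bochner_Integration.integral_cong refl supf_cong) (simp add: tensor_prod_def restrict_Ix_id)
  also have "\<dots> = gauss_width (Ix n b) \<T>"
    unfolding gauss_width_def block_gauss_def
    by (rule gauss_reindex)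
       (use assms supf_gauss_integrable[OF _ assms(2)] in \<open>auto intro: inj_onI\<close>)
  finally show ?thesis .
qed

text \<open>Gaussian families of disjoint sets of blocks are independent: those of \<open>Q\<close>
  are frozen and join the deterministic factor while those of \<open>P'\<close> are
  integrated.\<close>

lemma mean_sup_union:
  assumes fin: "finite Q" "finite P'" "finite L" "\<Union>(Q \<union> P') \<subseteq> L" "Q \<inter> P' = {}" and b: "bounded_fam (Ix n L) \<T>"
  shows "mean_sup n (Q \<union> P') L \<T> z = (\<integral>x. mean_sup n P' L \<T> (\<lambda>i. z i * tensor_prod Q (cur x) i) \<partial>block_gauss n Q)"
proof -
  let ?A = "SIGMA J:Q. Ix n J" and ?B = "SIGMA J:P'. Ix n J"
  interpret product_sigma_finite "\<lambda>_::nat set \<times> (nat \<Rightarrow> nat). std_gauss" by (rule product_sigma_finite_std_gauss)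
  have un: "(SIGMA J:Q \<union> P'. Ix n J) = ?A \<union> ?B" by auto
  have fJ: "finite J" if "J \<in> Q \<union> P'" for J using that fin by (meson Union_upper finite_subset)
  have fA: "finite ?A" "finite ?B" "?A \<inter> ?B = {}" using fin fJ by auto
  let ?F = "\<lambda>g. supf (Ix n L) \<T> (\<lambda>i. z i * tensor_prod (Q \<union> P') (cur g) i)"
  have "integrable (block_gauss n (Q \<union> P')) ?F"
  proof (rule supf_integrable[OF b])
    show "finite (Ix n L)" using fin by auto
    fix i assume i: "i \<in> Ix n L"
    show "integrable (block_gauss n (Q \<union> P')) (\<lambda>g. z i * tensor_prod (Q \<union> P') (cur g) i)"
      using fin fJ i by (intro integrable_mult_right tensor_prod_gauss_integrable) (auto intro!: restrict_Ix[OF i])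
  qed
  then have int: "integrable (PiM (?A \<union> ?B) (\<lambda>_. std_gauss)) ?F" by (simp add: block_gauss_def gauss_std_gauss un)
  have "mean_sup n (Q \<union> P') L \<T> z = (\<integral>x. \<integral>y. ?F (merge ?A ?B (x, y)) \<partial>PiM ?B (\<lambda>_. std_gauss) \<partial>PiM ?A (\<lambda>_. std_gauss))"
    unfolding mean_sup_def block_gauss_def gauss_std_gauss un by (rule product_integral_fold[OF fA(3,1,2) int])
  also have "\<dots> = (\<integral>x. mean_sup n P' L \<T> (\<lambda>i. z i * tensor_prod Q (cur x) i) \<partial>block_gauss n Q)"
    unfolding mean_sup_def block_gauss_def gauss_std_gauss
  proof (intro Bochner_Integration.integral_cong refl supf_cong)
    fix x y i assume i: "i \<in> Ix n L"
    have r: "restrict i J \<in> Ix n J" if "J \<in> Q \<union> P'" for J using i fin(4) that by (intro restrict_Ix[OF i]) auto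
    have "tensor_prod Q (cur (merge ?A ?B (x, y))) i = tensor_prod Q (cur x) i"
      by (rule tensor_prod_cong) (use r in \<open>auto simp: merge_def\<close>)
    moreover have "tensor_prod P' (cur (merge ?A ?B (x, y))) i = tensor_prod P' (cur y) i"
      by (rule tensor_prod_cong) (use r fin(5) in \<open>auto simp: merge_def\<close>)
    ultimately show "z i * tensor_prod (Q \<union> P') (cur (merge ?A ?B (x, y))) i = z i * tensor_prod Q (cur x) i * tensor_prod P' (cur y) i"
      using fin by (simp add: tensor_prod_union)
  qed
  finally show ?thesis .
qed

section \<open>Averages over Gaussian blocks\<close>

text \<open>\<open>partial_mean n P' \<T>\<close> collects the tensors obtained by contracting a measurably
  selected element of \<open>\<T>\<close> with the Gaussians of the blocks in \<open>P'\<close> and averaging. Its support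
  function is the expected supremum (\<open>mean_sup_partial_mean\<close>), which turns
  expectations of suprema inside a supremum into a plain supremum over another family of tensors.\<close>

definition partial_mean :: "nat \<Rightarrow> nat set set \<Rightarrow> ten set \<Rightarrow> ten set" where
  "partial_mean n P' \<T> = {(\<lambda>j. \<integral>g. contract n (\<Union>P') (tensor_prod P' (cur g)) (e (\<kappa> g)) j \<partial>block_gauss n P') | e \<kappa>.
     range (e :: nat \<Rightarrow> ten) \<subseteq> \<T> \<and> \<kappa> \<in> measurable (block_gauss n P') (count_space UNIV)}"

lemma tensor_prod_integrable_Ix:
  assumes "finite L" "finite P'" "\<Union>P' \<subseteq> L" "i \<in> Ix n L"
  shows "integrable (block_gauss n P') (\<lambda>g. tensor_prod P' (cur g) i)"
proof (rule tensor_prod_gauss_integrable[OF assms(2)])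
  fix J assume "J \<in> P'"
  then have J: "J \<subseteq> L" using assms(3) by blast
  show "finite J" by (rule finite_subset[OF J assms(1)])
  show "restrict i J \<in> Ix n J" by (rule restrict_Ix[OF assms(4) J])
qed

lemma selector_integrable:
  assumes "range e \<subseteq> \<T>" "\<kappa> \<in> measurable (block_gauss n P') (count_space UNIV)" "bounded_fam (Ix n L) \<T>"
    and "finite L" "finite P'" "\<Union>P' \<subseteq> L" "i \<in> Ix n L"
  shows "integrable (block_gauss n P') (\<lambda>g. e (\<kappa> g) i * tensor_prod P' (cur g) i)"
proof -
  obtain R where R: "\<forall>v\<in>\<T>. \<forall>i\<in>Ix n L. \<bar>v i\<bar> \<le> R" using assms(3) unfolding bounded_fam_def by blast
  have it: "integrable (block_gauss n P') (\<lambda>g. tensor_prod P' (cur g) i)"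
    by (rule tensor_prod_integrable_Ix[OF assms(4-7)])
  have m: "(\<lambda>g. e (\<kappa> g) i) \<in> borel_measurable (block_gauss n P')"
    by (rule measurable_compose[OF assms(2), of "\<lambda>k. e k i"]) simp
  show ?thesis
  proof (rule Bochner_Integration.integrable_bound)
    show "integrable (block_gauss n P') (\<lambda>g. R * \<bar>tensor_prod P' (cur g) i\<bar>)" using it by auto
    show "(\<lambda>g. e (\<kappa> g) i * tensor_prod P' (cur g) i) \<in> borel_measurable (block_gauss n P')" using m it by auto
    have e: "\<bar>e k i\<bar> \<le> R" for k using R assms(1,7) by blast
    then have "0 \<le> R" using order_trans[OF abs_ge_zero] by blast
    with e show "AE g in block_gauss n P'. norm (e (\<kappa> g) i * tensor_prod P' (cur g) i) \<le> norm (R * \<bar>tensor_prod P' (cur g) i\<bar>)"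
      by (intro AE_I2) (simp add: abs_mult mult_right_mono)
  qed
qed

lemma contract_selector_integrable:
  assumes "range e \<subseteq> \<T>" "\<kappa> \<in> measurable (block_gauss n P') (count_space UNIV)" "bounded_fam (Ix n (\<Union>P' \<union> L')) \<T>"
    and "finite (\<Union>P' \<union> L')" "finite P'" "j \<in> Ix n L'"
  shows "integrable (block_gauss n P') (\<lambda>g. contract n (\<Union>P') (tensor_prod P' (cur g)) (e (\<kappa> g)) j)"
  unfolding contract_def
proof (rule Bochner_Integration.integrable_sum)
  fix i assume "i \<in> Ix n (\<Union>P')"
  then have "merge_idx (\<Union>P') i j \<in> Ix n (\<Union>P' \<union> L')" using assms(6) by (rule merge_idx_Ix)
  from selector_integrable[OF assms(1-5) _ this]
  show "integrable (block_gauss n P') (\<lambda>g. e (\<kappa> g) (merge_idx (\<Union>P') i j) * tensor_prod P' (cur g) i)"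
    by (simp add: tensor_prod_merge_idx_left)
qed

text \<open>All index sets are finite, so pairing with the deterministic \<open>w\<close> commutes
  with the average over the Gaussians.\<close>

lemma lin_selector:
  assumes "range e \<subseteq> \<T>" "\<kappa> \<in> measurable (block_gauss n P') (count_space UNIV)" "bounded_fam (Ix n (\<Union>P' \<union> L')) \<T>"
    and "finite (\<Union>P' \<union> L')" "finite P'" "\<Union>P' \<inter> L' = {}"
    and "\<And>i j. i \<in> Ix n (\<Union>P') \<Longrightarrow> j \<in> Ix n L' \<Longrightarrow> z (merge_idx (\<Union>P') i j) = w j"
  shows "lin (Ix n L') (\<lambda>j. \<integral>g. contract n (\<Union>P') (tensor_prod P' (cur g)) (e (\<kappa> g)) j \<partial>block_gauss n P') w
    = (\<integral>g. lin (Ix n (\<Union>P' \<union> L')) (e (\<kappa> g)) (\<lambda>i. z i * tensor_prod P' (cur g) i) \<partial>block_gauss n P')"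
proof -
  have "lin (Ix n (\<Union>P' \<union> L')) (e (\<kappa> g)) (\<lambda>i. z i * tensor_prod P' (cur g) i)
     = (\<Sum>j\<in>Ix n L'. contract n (\<Union>P') (tensor_prod P' (cur g)) (e (\<kappa> g)) j * w j)" for g
    by (subst lin_contract[OF assms(6), where z="tensor_prod P' (cur g)" and w=w])
       (simp_all add: assms(7) tensor_prod_merge_idx_left lin_def)
  then show ?thesis
    using contract_selector_integrable[OF assms(1-5)]
    by (simp add: lin_def Bochner_Integration.integral_sum)
qed

text \<open>Constant selectors give nonemptiness and negated selectors symmetry; the bound holds
  because the selected tensors are uniformly bounded and the Gaussian products have finite first
  moments.\<close>

lemma tensor_fam_partial_mean:
  assumes "tensor_fam n (\<Union>P' \<union> L') \<T>" "finite (\<Union>P' \<union> L')" "finite P'"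
  shows "tensor_fam n L' (partial_mean n P' \<T>)"
proof -
  have b: "bounded_fam (Ix n (\<Union>P' \<union> L')) \<T>" and sy: "sym_fam \<T>" using assms(1) by (auto simp: tensor_fam_def)
  obtain R where R: "\<forall>v\<in>\<T>. \<forall>i\<in>Ix n (\<Union>P' \<union> L'). \<bar>v i\<bar> \<le> R" using b unfolding bounded_fam_def by blast
  obtain t where t: "t \<in> \<T>" using b by (auto simp: bounded_fam_def)
  let ?g = "block_gauss n P'"
  have "(\<lambda>j. \<integral>g. contract n (\<Union>P') (tensor_prod P' (cur g)) ((\<lambda>_::nat. t) ((\<lambda>_. 0) g)) j \<partial>?g) \<in> partial_mean n P' \<T>"
    unfolding partial_mean_def using t by (intro CollectI exI[of _ "\<lambda>_::nat. t"] exI[of _ "\<lambda>_. 0"]) auto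
  then have ne: "partial_mean n P' \<T> \<noteq> {}" by blast
  have bd: "\<bar>\<theta> j\<bar> \<le> (\<Sum>i\<in>Ix n (\<Union>P'). R * (\<integral>g. \<bar>tensor_prod P' (cur g) i\<bar> \<partial>?g))" if \<theta>: "\<theta> \<in> partial_mean n P' \<T>" and j: "j \<in> Ix n L'" for \<theta> j
  proof -
    obtain e \<kappa> where e: "range (e :: nat \<Rightarrow> ten) \<subseteq> \<T>" "\<kappa> \<in> measurable ?g (count_space UNIV)"
      "\<theta> = (\<lambda>j. \<integral>g. contract n (\<Union>P') (tensor_prod P' (cur g)) (e (\<kappa> g)) j \<partial>?g)"
      using \<theta> unfolding partial_mean_def by blast
    have it: "integrable ?g (\<lambda>g. tensor_prod P' (cur g) i)" if "i \<in> Ix n (\<Union>P')" for i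
      by (rule tensor_prod_integrable_Ix[OF _ assms(3) order_refl that]) (use assms(2) in auto)
    have "\<bar>\<theta> j\<bar> \<le> (\<integral>g. \<bar>contract n (\<Union>P') (tensor_prod P' (cur g)) (e (\<kappa> g)) j\<bar> \<partial>?g)"
      unfolding e(3) by (rule integral_abs_bound)
    also have "\<dots> \<le> (\<integral>g. (\<Sum>i\<in>Ix n (\<Union>P'). R * \<bar>tensor_prod P' (cur g) i\<bar>) \<partial>?g)"
    proof (rule integral_mono)
      show "integrable ?g (\<lambda>g. \<bar>contract n (\<Union>P') (tensor_prod P' (cur g)) (e (\<kappa> g)) j\<bar>)"
        using contract_selector_integrable[OF e(1,2) b assms(2,3) j] by auto
      show "integrable ?g (\<lambda>g. \<Sum>i\<in>Ix n (\<Union>P'). R * \<bar>tensor_prod P' (cur g) i\<bar>)" using it by auto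
      fix g
      have "\<bar>e (\<kappa> g) (merge_idx (\<Union>P') i j) * tensor_prod P' (cur g) i\<bar> \<le> R * \<bar>tensor_prod P' (cur g) i\<bar>"
        if i: "i \<in> Ix n (\<Union>P')" for i
      proof -
        have "e (\<kappa> g) \<in> \<T>" by (rule subsetD[OF e(1) rangeI])
        then have "\<bar>e (\<kappa> g) (merge_idx (\<Union>P') i j)\<bar> \<le> R" by (rule R[rule_format]) (rule merge_idx_Ix[OF i j])
        then show ?thesis by (simp add: abs_mult mult_right_mono)
      qed
      then have "(\<Sum>i\<in>Ix n (\<Union>P'). \<bar>e (\<kappa> g) (merge_idx (\<Union>P') i j) * tensor_prod P' (cur g) i\<bar>)
          \<le> (\<Sum>i\<in>Ix n (\<Union>P'). R * \<bar>tensor_prod P' (cur g) i\<bar>)"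
        by (rule sum_mono)
      then show "\<bar>contract n (\<Union>P') (tensor_prod P' (cur g)) (e (\<kappa> g)) j\<bar> \<le> (\<Sum>i\<in>Ix n (\<Union>P'). R * \<bar>tensor_prod P' (cur g) i\<bar>)"
        unfolding contract_def by (rule order_trans[OF sum_abs])
    qed
    also have "\<dots> = (\<Sum>i\<in>Ix n (\<Union>P'). R * (\<integral>g. \<bar>tensor_prod P' (cur g) i\<bar> \<partial>?g))"
      using it by (subst Bochner_Integration.integral_sum) auto
    finally show ?thesis .
  qed
  have "sym_fam (partial_mean n P' \<T>)" unfolding sym_fam_def
  proof
    fix \<theta> assume "\<theta> \<in> partial_mean n P' \<T>"
    then obtain e \<kappa> where e: "range (e :: nat \<Rightarrow> ten) \<subseteq> \<T>" "\<kappa> \<in> measurable ?g (count_space UNIV)"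
      "\<theta> = (\<lambda>j. \<integral>g. contract n (\<Union>P') (tensor_prod P' (cur g)) (e (\<kappa> g)) j \<partial>?g)"
      unfolding partial_mean_def by blast
    have "(\<lambda>i. - \<theta> i) = (\<lambda>j. \<integral>g. contract n (\<Union>P') (tensor_prod P' (cur g)) ((\<lambda>k i. - e k i) (\<kappa> g)) j \<partial>?g)"
      by (simp add: e(3) contract_uminus)
    moreover have "range (\<lambda>k i. - e k i) \<subseteq> \<T>" using e(1) sy unfolding sym_fam_def by blast
    ultimately show "(\<lambda>i. - \<theta> i) \<in> partial_mean n P' \<T>" unfolding partial_mean_def using e(2)
      by (intro CollectI exI[of _ "\<lambda>k i. - e k i"] exI[of _ \<kappa>] conjI)
  qed
  moreover have "bounded_fam (Ix n L') (partial_mean n P' \<T>)" unfolding bounded_fam_def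
    by (intro conjI ne exI ballI) (rule bd)
  ultimately show ?thesis by (simp add: tensor_fam_def)
qed

text \<open>A selected tensor stays below the supremum pointwise, hence on average. Conversely, a
  measurable maximiser over a finite subfamily that loses at most epsilon produces a member of the
  averaged family.\<close>

lemma mean_sup_partial_mean:
  assumes "tensor_fam n (\<Union>P' \<union> L') \<T>" "finite (\<Union>P' \<union> L')" "finite P'" "\<Union>P' \<inter> L' = {}"
    and z: "\<And>i j. i \<in> Ix n (\<Union>P') \<Longrightarrow> j \<in> Ix n L' \<Longrightarrow> z (merge_idx (\<Union>P') i j) = w j"
  shows "mean_sup n P' (\<Union>P' \<union> L') \<T> z = supf (Ix n L') (partial_mean n P' \<T>) w"
proof (rule antisym)
  let ?g = "block_gauss n P'" and ?L = "\<Union>P' \<union> L'"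
  let ?Y = "\<lambda>g i. z i * tensor_prod P' (cur g) i"
  have b: "bounded_fam (Ix n ?L) \<T>" using assms(1) by (auto simp: tensor_fam_def)
  have ba: "bounded_fam (Ix n L') (partial_mean n P' \<T>)" using tensor_fam_partial_mean[OF assms(1-3)] by (auto simp: tensor_fam_def)
  have fI: "finite (Ix n ?L)" using assms(2) by auto
  have iY: "integrable ?g (\<lambda>g. ?Y g i)" if i: "i \<in> Ix n ?L" for i
    by (rule integrable_mult_right[OF tensor_prod_integrable_Ix[OF assms(2,3) _ i]]) auto
  show "supf (Ix n L') (partial_mean n P' \<T>) w \<le> mean_sup n P' ?L \<T> z"
  proof (rule supf_least)
    show "partial_mean n P' \<T> \<noteq> {}" using ba by (auto simp: bounded_fam_def)
    fix \<theta> assume "\<theta> \<in> partial_mean n P' \<T>"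
    then obtain e \<kappa> where e: "range (e :: nat \<Rightarrow> ten) \<subseteq> \<T>" "\<kappa> \<in> measurable ?g (count_space UNIV)"
      "\<theta> = (\<lambda>j. \<integral>g. contract n (\<Union>P') (tensor_prod P' (cur g)) (e (\<kappa> g)) j \<partial>?g)"
      unfolding partial_mean_def by blast
    have "lin (Ix n L') \<theta> w = (\<integral>g. lin (Ix n ?L) (e (\<kappa> g)) (?Y g) \<partial>?g)"
      unfolding e(3) by (rule lin_selector[where z=z and w=w, OF e(1,2) b assms(2-4) z])
    also have "\<dots> \<le> mean_sup n P' ?L \<T> z" unfolding mean_sup_def
    proof (rule integral_mono)
      have eq: "lin (Ix n ?L) (e (\<kappa> g)) (?Y g) = (\<Sum>i\<in>Ix n ?L. z i * (e (\<kappa> g) i * tensor_prod P' (cur g) i))" for g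
        by (simp add: lin_def mult_ac)
      show "integrable ?g (\<lambda>g. lin (Ix n ?L) (e (\<kappa> g)) (?Y g))"
        unfolding eq
        by (intro Bochner_Integration.integrable_sum integrable_mult_right selector_integrable[OF e(1,2) b assms(2,3)]) auto
      show "integrable ?g (\<lambda>g. supf (Ix n ?L) \<T> (?Y g))" by (rule supf_integrable[OF b fI iY])
      show "lin (Ix n ?L) (e (\<kappa> g)) (?Y g) \<le> supf (Ix n ?L) \<T> (?Y g)" for g
        by (rule lin_le_supf[OF b]) (use e(1) in auto)
    qed
    finally show "lin (Ix n L') \<theta> w \<le> mean_sup n P' ?L \<T> z" .
  qed
  show "mean_sup n P' ?L \<T> z \<le> supf (Ix n L') (partial_mean n P' \<T>) w"
  proof (rule field_le_epsilon)
    fix \<epsilon> :: real assume \<epsilon>: "\<epsilon> > 0"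
    have "\<exists>F. finite F \<and> F \<noteq> {} \<and> F \<subseteq> \<T> \<and> mean_sup n P' ?L \<T> z \<le> (\<integral>g. supf (Ix n ?L) F (?Y g) \<partial>?g) + \<epsilon>"
      unfolding mean_sup_def by (rule supf_finite_approx[OF b fI iY \<epsilon>]) blast+
    then obtain F where F: "finite F" "F \<noteq> {}" "F \<subseteq> \<T>" "mean_sup n P' ?L \<T> z \<le> (\<integral>g. supf (Ix n ?L) F (?Y g) \<partial>?g) + \<epsilon>"
      by blast
    obtain e :: "nat \<Rightarrow> ten" and \<kappa> where e: "range e \<subseteq> F" "\<kappa> \<in> measurable ?g (count_space UNIV)"
      "\<And>g. lin (Ix n ?L) (e (\<kappa> g)) (?Y g) = supf (Ix n ?L) F (?Y g)"
      by (rule supf_argmax[OF F(1,2), of "Ix n ?L" ?Y ?g]) (blast intro: borel_measurable_integrable iY)+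
    have eT: "range e \<subseteq> \<T>" using e(1) F(3) by blast
    let ?\<theta> = "\<lambda>j. \<integral>g. contract n (\<Union>P') (tensor_prod P' (cur g)) (e (\<kappa> g)) j \<partial>?g"
    have "?\<theta> \<in> partial_mean n P' \<T>" unfolding partial_mean_def using eT e(2) by blast
    then have "lin (Ix n L') ?\<theta> w \<le> supf (Ix n L') (partial_mean n P' \<T>) w" by (rule lin_le_supf[OF ba])
    moreover have "lin (Ix n L') ?\<theta> w = (\<integral>g. lin (Ix n ?L) (e (\<kappa> g)) (?Y g) \<partial>?g)"
      by (rule lin_selector[where z=z and w=w, OF eT e(2) b assms(2-4) z])
    ultimately show "mean_sup n P' ?L \<T> z \<le> supf (Ix n L') (partial_mean n P' \<T>) w + \<epsilon>" using F(4) by (simp add: e(3))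
  qed
qed

text \<open>A mixed expectation of the averaged family is one of the original family with
  \<open>P'\<close> adjoined to the Gaussian blocks; this is how norm bounds pass to
  \<open>partial_mean\<close>.\<close>

lemma mean_sup_of_partial_mean:
  assumes "tensor_fam n (\<Union>P' \<union> L') \<T>" "finite (\<Union>P' \<union> L')" "finite P'" "\<Union>P' \<inter> L' = {}"
    and Q: "finite Q'" "\<Union>Q' \<subseteq> L'" "Q' \<inter> P' = {}"
    and z: "\<And>i j. i \<in> Ix n (\<Union>P') \<Longrightarrow> j \<in> Ix n L' \<Longrightarrow> z (merge_idx (\<Union>P') i j) = w j"
  shows "mean_sup n Q' L' (partial_mean n P' \<T>) w = mean_sup n (Q' \<union> P') (\<Union>P' \<union> L') \<T> z"
proof -
  have "mean_sup n (Q' \<union> P') (\<Union>P' \<union> L') \<T> z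
     = (\<integral>x. mean_sup n P' (\<Union>P' \<union> L') \<T> (\<lambda>i. z i * tensor_prod Q' (cur x) i) \<partial>block_gauss n Q')"
    by (rule mean_sup_union) (use assms in \<open>auto simp: tensor_fam_def\<close>)
  also have "\<dots> = mean_sup n Q' L' (partial_mean n P' \<T>) w"
    unfolding mean_sup_def[of n Q']
  proof (intro Bochner_Integration.integral_cong refl mean_sup_partial_mean[OF assms(1-4)])
    fix x i j assume "i \<in> Ix n (\<Union>P')" "j \<in> Ix n L'"
    moreover have "\<Union>Q' \<inter> \<Union>P' = {}" using Q(2) assms(4) by blast
    ultimately show "z (merge_idx (\<Union>P') i j) * tensor_prod Q' (cur x) (merge_idx (\<Union>P') i j) = w j * tensor_prod Q' (cur x) j"
      by (simp add: z tensor_prod_merge_idx_right)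
  qed
  finally show ?thesis by simp
qed

lemma supf_contract:
  assumes "K \<inter> L' = {}" "\<And>i j. i \<in> Ix n K \<Longrightarrow> j \<in> Ix n L' \<Longrightarrow> f (merge_idx K i j) = y i * w j"
  shows "supf (Ix n L') (contract n K y ` \<T>) w = supf (Ix n (K \<union> L')) \<T> f"
  unfolding supf_def image_image by (intro SUP_cong refl lin_contract[symmetric] assms)

text \<open>Contraction with \<open>y\<close> acts as a further deterministic factor on
  \<open>K\<close>; this is how norm bounds pass to contracted families.\<close>

lemma mean_sup_contract:
  assumes "K \<inter> L' = {}" "\<Union>P' \<subseteq> L'" "\<And>i j. i \<in> Ix n K \<Longrightarrow> j \<in> Ix n L' \<Longrightarrow> z (merge_idx K i j) = y i * w j"
  shows "mean_sup n P' L' (contract n K y ` \<T>) w = mean_sup n P' (K \<union> L') \<T> z"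
  unfolding mean_sup_def
proof (intro Bochner_Integration.integral_cong refl supf_contract assms(1))
  fix g i j assume "i \<in> Ix n K" "j \<in> Ix n L'"
  moreover have "\<Union>P' \<inter> K = {}" using assms(1,2) by blast
  ultimately show "z (merge_idx K i j) * tensor_prod P' (cur g) (merge_idx K i j) = y i * (w j * tensor_prod P' (cur g) j)"
    by (simp add: assms(3) tensor_prod_merge_idx_right)
qed

section \<open>Coarsenings and mixed norms\<close>

definition blocks :: "nat set set \<Rightarrow> bool" where
  "blocks \<K> \<longleftrightarrow> finite \<K> \<and> (\<forall>k\<in>\<K>. finite k \<and> k \<noteq> {}) \<and> (\<forall>k\<in>\<K>. \<forall>l\<in>\<K>. k \<noteq> l \<longrightarrow> k \<inter> l = {})"

text \<open>A coordinate of a tensor is a block of original indices, so that tensors in which several indices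
  have been merged are again in the class. The pairs \<open>(P, P')\<close> of the mixed norms are the splittings
  of the coarsenings of \<open>\<K>\<close>.\<close>

definition coarsening :: "nat set set \<Rightarrow> nat set set \<Rightarrow> nat set set \<Rightarrow> bool" where
  "coarsening \<K> P P' \<longleftrightarrow> partition_on (\<Union>\<K>) (P \<union> P') \<and> P \<inter> P' = {} \<and> (\<forall>k\<in>\<K>. \<exists>B\<in>P \<union> P'. k \<subseteq> B)"

definition in_balls :: "nat \<Rightarrow> real \<Rightarrow> nat set set \<Rightarrow> (nat set \<Rightarrow> ten) \<Rightarrow> bool" where
  "in_balls n r D x \<longleftrightarrow> (\<forall>B\<in>D. L2_set (x B) (Ix n B) \<le> r)"

text \<open>With \<open>r = sqrt p\<close> and vectors of length at most \<open>r\<close>, all the norms \<open>p\<^sup>k\<^sup>/\<^sup>2 \<parallel>A\<parallel>\<close> with fewer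
  deterministic blocks than coordinates are at most \<open>M\<close>.\<close>

definition norms_le :: "nat \<Rightarrow> real \<Rightarrow> nat set set \<Rightarrow> ten set \<Rightarrow> real \<Rightarrow> bool" where
  "norms_le n r \<K> \<T> M \<longleftrightarrow> (\<forall>P P' x. coarsening \<K> P P' \<and> card P < card \<K> \<and> in_balls n r P x
     \<longrightarrow> mean_sup n P' (\<Union>\<K>) \<T> (tensor_prod P x) \<le> M)"

definition contract_blocks :: "nat \<Rightarrow> nat set set \<Rightarrow> (nat set \<Rightarrow> ten) \<Rightarrow> ten \<Rightarrow> ten" where
  "contract_blocks n D x \<tau> = contract n (\<Union>D) (tensor_prod D x) \<tau>"

lemma blocks_finite_Union: "blocks \<K> \<Longrightarrow> finite (\<Union>\<K>)" by (auto simp: blocks_def)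

lemma blocksD:
  assumes "blocks \<K>"
  shows "finite \<K>" "k \<in> \<K> \<Longrightarrow> finite k" "k \<in> \<K> \<Longrightarrow> k \<noteq> {}"
    "k \<in> \<K> \<Longrightarrow> l \<in> \<K> \<Longrightarrow> k \<noteq> l \<Longrightarrow> k \<inter> l = {}"
  using assms unfolding blocks_def by simp_all

lemma blocks_subset: assumes "blocks \<K>" "D \<subseteq> \<K>" shows "blocks D"
  unfolding blocks_def
proof (intro conjI ballI impI)
  show "finite D" by (rule finite_subset[OF assms(2) blocksD(1)[OF assms(1)]])
next
  fix k assume "k \<in> D"
  then show "finite k" "k \<noteq> {}" using blocksD(2,3)[OF assms(1)] assms(2) by auto
next
  fix k l assume "k \<in> D" "l \<in> D" "k \<noteq> l"
  then show "k \<inter> l = {}" using blocksD(4)[OF assms(1) subsetD[OF assms(2)] subsetD[OF assms(2)]] by simp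
qed

lemma blocks_disjoint:
  assumes "blocks \<K>" "C \<subseteq> \<K>" "D \<subseteq> \<K>" "C \<inter> D = {}"
  shows "\<Union>C \<inter> \<Union>D = {}"
proof -
  have False if "c \<in> C" "d \<in> D" "i \<in> c" "i \<in> d" for c d i
  proof -
    have "c \<noteq> d" "c \<in> \<K>" "d \<in> \<K>" using that assms by auto
    then have "c \<inter> d = {}" using assms(1) unfolding blocks_def by simp
    then show False using that by auto
  qed
  then show ?thesis by auto
qed

lemma blocks_disjoint_single:
  assumes "blocks \<K>" "k \<in> \<K>" shows "k \<inter> \<Union>(\<K> - {k}) = {}" "\<Union>(\<K> - {k}) \<inter> k = {}" "k \<union> \<Union>(\<K> - {k}) = \<Union>\<K>"
  using blocks_disjoint[OF assms(1), of "{k}" "\<K> - {k}"] assms(2) by auto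

lemma coarseningD:
  assumes "coarsening \<K> P P'"
  shows "partition_on (\<Union>\<K>) (P \<union> P')" "\<Union>(P \<union> P') = \<Union>\<K>" "disjoint (P \<union> P')" "{} \<notin> P \<union> P'" "P \<inter> P' = {}"
    "\<forall>k\<in>\<K>. \<exists>B\<in>P \<union> P'. k \<subseteq> B"
proof -
  note c = assms[unfolded coarsening_def]
  show p: "partition_on (\<Union>\<K>) (P \<union> P')" by (rule conjunct1[OF c])
  from partition_onD1[OF p] show "\<Union>(P \<union> P') = \<Union>\<K>" by (rule sym)
  show "disjoint (P \<union> P')" "{} \<notin> P \<union> P'" by (rule partition_onD2[OF p] partition_onD3[OF p])+
  show "P \<inter> P' = {}" by (rule conjunct1[OF conjunct2[OF c]])
  show "\<forall>k\<in>\<K>. \<exists>B\<in>P \<union> P'. k \<subseteq> B" by (rule conjunct2[OF conjunct2[OF c]])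
qed

lemma coarsening_blocks:
  assumes "finite (\<Union>\<K>)" "coarsening \<K> P P'"
  shows "finite P" "finite P'" "\<Union>P \<union> \<Union>P' = \<Union>\<K>" "\<Union>P \<inter> \<Union>P' = {}" "blocks (P \<union> P')" "blocks P" "blocks P'"
proof -
  note p = coarseningD(1)[OF assms(2)] and d = coarseningD(5)[OF assms(2)]
  have f: "finite (P \<union> P')" by (rule finite_elements[OF assms(1) p])
  then show "finite P" "finite P'" by auto
  show u: "\<Union>P \<union> \<Union>P' = \<Union>\<K>" using coarseningD(2)[OF assms(2)] by (simp only: Union_Un_distrib)
  note dj = disjointD[OF coarseningD(3)[OF assms(2)]]
  show b: "blocks (P \<union> P')" unfolding blocks_def
  proof (intro conjI ballI impI)
    fix B assume B: "B \<in> P \<union> P'"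
    then have "B \<subseteq> \<Union>\<K>" using u by blast
    then show "finite B" using assms(1) by (rule finite_subset)
    show "B \<noteq> {}" using coarseningD(4)[OF assms(2)] B by auto
  next
    fix B C assume "B \<in> P \<union> P'" "C \<in> P \<union> P'" "B \<noteq> C"
    then show "B \<inter> C = {}" by (rule dj)
  qed (rule f)
  show "\<Union>P \<inter> \<Union>P' = {}" by (rule blocks_disjoint[OF b _ _ d]) auto
  show "blocks P" "blocks P'" using blocks_subset[OF b] by auto
qed

text \<open>A contracted coordinate counts as a deterministic block of its own.\<close>

lemma coarsening_insert:
  assumes "blocks \<K>" "k \<in> \<K>" "coarsening (\<K> - {k}) P P'"
  shows "coarsening \<K> (insert k P) P'" "k \<notin> P" "k \<notin> P'" "k \<inter> \<Union>P = {}" "k \<inter> \<Union>P' = {}"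
proof -
  note p = coarseningD(1)[OF assms(3)] and d = coarseningD(5)[OF assms(3)] and r = coarseningD(6)[OF assms(3)]
  have k: "k \<noteq> {}" "k \<inter> \<Union>(\<K> - {k}) = {}" "k \<union> \<Union>(\<K> - {k}) = \<Union>\<K>"
    using assms blocks_disjoint_single[OF assms(1,2)] by (auto simp: blocks_def)
  note u = coarseningD(2)[OF assms(3)]
  show kd: "k \<inter> \<Union>P = {}" "k \<inter> \<Union>P' = {}" using u k(2) by auto
  show kP: "k \<notin> P" "k \<notin> P'" using kd k(1) by auto
  have "partition_on (\<Union>\<K>) (insert k P \<union> P')"
    unfolding partition_on_def
  proof (intro conjI)
    show "\<Union>(insert k P \<union> P') = \<Union>\<K>" using u k(3) by simp
    show "disjoint (insert k P \<union> P')"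
    proof (rule disjointI)
      fix B C assume B: "B \<in> insert k P \<union> P'" "C \<in> insert k P \<union> P'" "B \<noteq> C"
      have dj: "disjoint (P \<union> P')" using p by (simp add: partition_on_def)
      have kB: "k \<inter> B = {}" if "B \<in> P \<union> P'" for B using that kd by blast
      consider "B = k" "C \<in> P \<union> P'" | "C = k" "B \<in> P \<union> P'" | "B \<in> P \<union> P'" "C \<in> P \<union> P'"
        using B by blast
      then show "B \<inter> C = {}"
      proof cases
        case 1 then show ?thesis using kB by simp
      next
        case 2 then show ?thesis using kB[of B] by (simp add: Int_commute)
      next
        case 3 then show ?thesis using disjointD[OF dj _ _ B(3)] by simp
      qed
    qed
    show "{} \<notin> insert k P \<union> P'" using coarseningD(4)[OF assms(3)] k(1) by simp
  qed
  moreover have "insert k P \<inter> P' = {}" using d kP by simp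
  moreover have "\<exists>B\<in>insert k P \<union> P'. l \<subseteq> B" if "l \<in> \<K>" for l
  proof (cases "l = k")
    case False
    then have "l \<in> \<K> - {k}" using that by simp
    with r obtain B where "B \<in> P \<union> P'" "l \<subseteq> B" by blast
    then show ?thesis by (intro bexI[of _ B]) auto
  qed (intro bexI[of _ k], auto)
  ultimately show "coarsening \<K> (insert k P) P'" unfolding coarsening_def by (intro conjI ballI)
qed

text \<open>The coordinates of \<open>partial_mean n P' \<T>\<close> are \<open>insert k P\<close>.
  Coarsening these and returning \<open>P'\<close> to the Gaussian side gives a coarsening of the
  original coordinates with the same deterministic part \<open>Q\<close>.\<close>

lemma coarsening_compose:
  assumes "blocks \<K>" "k \<in> \<K>" "coarsening (\<K> - {k}) P P'" "coarsening (insert k P) Q Q'"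
  shows "coarsening \<K> Q (Q' \<union> P')" "Q' \<inter> P' = {}" "\<Union>Q \<union> \<Union>Q' = k \<union> \<Union>P" "\<Union>P' \<inter> (k \<union> \<Union>P) = {}"
proof -
  have fin: "finite (\<Union>(\<K> - {k}))" by (rule blocks_finite_Union[OF blocks_subset[OF assms(1) Diff_subset]])
  have a: "coarsening \<K> (insert k P) P'" "k \<inter> \<Union>P' = {}" using coarsening_insert[OF assms(1-3)] by auto
  note b = coarsening_blocks[OF fin assms(3)]
  have "\<Union>(Q \<union> Q') = \<Union>(insert k P)" by (rule coarseningD(2)[OF assms(4)])
  then have u2: "\<Union>(Q \<union> Q') = k \<union> \<Union>P" by simp
  then show "\<Union>Q \<union> \<Union>Q' = k \<union> \<Union>P" by (simp only: Union_Un_distrib)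
  show d: "\<Union>P' \<inter> (k \<union> \<Union>P) = {}"
    using a(2) b(4) by (simp only: Int_Un_distrib Int_commute[of k] Int_commute[of "\<Union>P"] Un_empty)
  have "\<Union>(insert k P \<union> P') = \<Union>\<K>" by (rule coarseningD(2)[OF a(1)])
  then have u1: "k \<union> \<Union>P \<union> \<Union>P' = \<Union>\<K>" by (simp only: Union_Un_distrib Union_insert)
  note dQ = coarseningD(3-5)[OF assms(4)]
  have dP: "disjoint P'" by (rule pairwise_subset[OF coarseningD(3)[OF a(1)]]) auto
  have dP2: "{} \<notin> P'" using coarseningD(4)[OF a(1)] by simp
  have cross: "B \<inter> C = {}" if "B \<in> Q \<union> Q'" "C \<in> P'" for B C
  proof -
    have "B \<subseteq> k \<union> \<Union>P" using Union_upper[OF that(1)] unfolding u2 .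
    then have "C \<inter> B \<subseteq> \<Union>P' \<inter> (k \<union> \<Union>P)" by (rule Int_mono[OF Union_upper[OF that(2)]])
    then show ?thesis unfolding d by (simp only: subset_empty Int_commute)
  qed
  have ne: "B \<notin> P'" if "B \<in> Q \<union> Q'" for B
  proof
    assume "B \<in> P'"
    from cross[OF that this] have "B = {}" by simp
    then show False using that dQ(2) by simp
  qed
  show "Q' \<inter> P' = {}" using ne by (simp add: disjoint_iff)
  have "disjoint (Q \<union> (Q' \<union> P'))"
  proof (rule disjointI)
    fix B C assume "B \<in> Q \<union> (Q' \<union> P')" "C \<in> Q \<union> (Q' \<union> P')" "B \<noteq> C"
    then consider "B \<in> Q \<union> Q'" "C \<in> Q \<union> Q'" | "B \<in> Q \<union> Q'" "C \<in> P'" | "C \<in> Q \<union> Q'" "B \<in> P'" | "B \<in> P'" "C \<in> P'"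
      by blast
    then show "B \<inter> C = {}"
    proof cases
      case 1 then show ?thesis using disjointD[OF dQ(1) _ _ \<open>B \<noteq> C\<close>] by simp
    next
      case 2 then show ?thesis by (rule cross)
    next
      case 3 then show ?thesis using cross[of C B] by (simp add: Int_commute)
    next
      case 4 then show ?thesis using disjointD[OF dP _ _ \<open>B \<noteq> C\<close>] by simp
    qed
  qed
  moreover have "\<Union>(Q \<union> (Q' \<union> P')) = \<Union>\<K>"
    using u1 u2 by (simp only: Union_Un_distrib Un_assoc[symmetric])
  moreover have "\<exists>B\<in>Q \<union> (Q' \<union> P'). l \<subseteq> B" if l: "l \<in> \<K>" for l
  proof -
    obtain B where B: "B \<in> insert k P \<union> P'" "l \<subseteq> B" using coarseningD(6)[OF a(1)] l by blast
    note r = coarseningD(6)[OF assms(4)]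
    show ?thesis
    proof (cases "B \<in> P'")
      case False
      then have "B \<in> insert k P" using B(1) by simp
      with r obtain C where "C \<in> Q \<union> Q'" "B \<subseteq> C" by blast
      then show ?thesis using B(2) by (intro bexI[of _ C]) auto
    next
      case True
      then show ?thesis using B(2) by (intro bexI[of _ B]) auto
    qed
  qed
  moreover have "{} \<notin> Q \<union> (Q' \<union> P')" using dQ(2) dP2 by simp
  moreover have "Q \<inter> (Q' \<union> P') = {}" using dQ(3) ne by (simp add: Int_Un_distrib disjoint_iff)
  ultimately show "coarsening \<K> Q (Q' \<union> P')" unfolding coarsening_def partition_on_def by (intro conjI ballI)
qed

text \<open>Each block of a coarsening is a union of coordinates, so with d coordinates there are at
  most 2^d candidates for a block, and two sets of candidates can be chosen in at most 4^(2^d) ways.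
  What matters is that the bound depends on d alone.\<close>

lemma coarsening_finite_card:
  assumes "finite \<K>"
  shows "finite {PP. coarsening \<K> (fst PP) (snd PP)}" "card {PP. coarsening \<K> (fst PP) (snd PP)} \<le> 4 ^ (2 ^ card \<K>)"
proof -
  let ?S = "Union ` Pow \<K>"
  have fS: "finite ?S" using assms by auto
  have "card ?S \<le> 2 ^ card \<K>" using card_image_le[of "Pow \<K>" Union] assms by (simp add: card_Pow)
  have B: "B \<in> ?S" if a: "coarsening \<K> P P'" and B: "B \<in> P \<union> P'" for P P' B
  proof -
    note p = coarseningD(2,3)[OF a] and r = coarseningD(6)[OF a]
    have "B = \<Union>{k\<in>\<K>. k \<subseteq> B}"
    proof (intro equalityI subsetI)
      fix i assume i: "i \<in> B"
      then have "i \<in> \<Union>\<K>" unfolding p(1)[symmetric] using B by (rule UnionI[rotated])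
      then obtain k where k: "k \<in> \<K>" "i \<in> k" by (rule UnionE)
      then obtain C where C: "C \<in> P \<union> P'" "k \<subseteq> C" using bspec[OF r k(1)] by (elim bexE)
      have "C = B"
      proof (rule ccontr)
        assume "C \<noteq> B"
        then have "C \<inter> B = {}" by (rule disjointD[OF p(2) C(1) B])
        then show False using i k(2) C(2) by auto
      qed
      then show "i \<in> \<Union>{k\<in>\<K>. k \<subseteq> B}" using C k by blast
    qed blast
    moreover have "{k\<in>\<K>. k \<subseteq> B} \<in> Pow \<K>" by simp
    ultimately show ?thesis by (rule image_eqI)
  qed
  have sub: "{PP. coarsening \<K> (fst PP) (snd PP)} \<subseteq> Pow ?S \<times> Pow ?S"
  proof
    fix PP assume "PP \<in> {PP. coarsening \<K> (fst PP) (snd PP)}"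
    then have "coarsening \<K> (fst PP) (snd PP)" by simp
    then have "fst PP \<union> snd PP \<subseteq> ?S" by (intro subsetI) (rule B)
    then show "PP \<in> Pow ?S \<times> Pow ?S" by (simp only: mem_Times_iff Pow_iff Un_subset_iff)
  qed
  have fP: "finite (Pow ?S \<times> Pow ?S)" using fS by auto
  show "finite {PP. coarsening \<K> (fst PP) (snd PP)}" by (rule finite_subset[OF sub fP])
  have "card {PP. coarsening \<K> (fst PP) (snd PP)} \<le> card (Pow ?S \<times> Pow ?S)" by (rule card_mono[OF fP sub])
  also have "\<dots> = (2 * 2) ^ card ?S"
    using fS by (simp only: card_cartesian_product card_Pow power_mult_distrib)
  also have "\<dots> \<le> 4 ^ (2 ^ card \<K>)" using \<open>card ?S \<le> 2 ^ card \<K>\<close> by (simp add: power_increasing)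
  finally show "card {PP. coarsening \<K> (fst PP) (snd PP)} \<le> 4 ^ (2 ^ card \<K>)" .
qed

section \<open>Contractions with vectors from balls and the dual families\<close>

lemma in_balls_abs_le: "in_balls n r D x \<Longrightarrow> B \<in> D \<Longrightarrow> finite B \<Longrightarrow> i \<in> Ix n B \<Longrightarrow> \<bar>x B i\<bar> \<le> r"
proof -
  assume a: "in_balls n r D x" "B \<in> D" "finite B" "i \<in> Ix n B"
  have "\<bar>x B i\<bar> \<le> L2_set (\<lambda>i. \<bar>x B i\<bar>) (Ix n B)" by (rule member_le_L2_set) (use a in auto)
  also have "\<dots> = L2_set (x B) (Ix n B)" by (simp add: L2_set_def)
  finally show ?thesis using a unfolding in_balls_def by fastforce
qed

lemma abs_tensor_prod_le:
  assumes "in_balls n r P x" "blocks P" "i \<in> Ix n (\<Union>P)"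
  shows "\<bar>tensor_prod P x i\<bar> \<le> r ^ card P"
proof -
  have "\<bar>tensor_prod P x i\<bar> = (\<Prod>B\<in>P. \<bar>x B (restrict i B)\<bar>)" by (simp add: tensor_prod_def abs_prod)
  also have "\<dots> \<le> (\<Prod>B\<in>P. r)"
  proof (rule prod_mono)
    fix B assume B: "B \<in> P"
    have "restrict i B \<in> Ix n B" by (rule restrict_Ix[OF assms(3) Union_upper[OF B]])
    then have "\<bar>x B (restrict i B)\<bar> \<le> r" by (rule in_balls_abs_le[OF assms(1) B blocksD(2)[OF assms(2) B]])
    then show "0 \<le> \<bar>x B (restrict i B)\<bar> \<and> \<bar>x B (restrict i B)\<bar> \<le> r" by simp
  qed
  finally show ?thesis by simp
qed

lemma bounded_fam_contract_blocks:
  assumes "tensor_fam n (\<Union>D \<union> L') \<T>" "blocks D" "\<Union>D \<inter> L' = {}" "U \<noteq> {}"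
    and "\<And>u. u \<in> U \<Longrightarrow> T u \<in> \<T>" "\<And>u. u \<in> U \<Longrightarrow> in_balls n r D (X u)"
  shows "bounded_fam (Ix n L') ((\<lambda>u. contract_blocks n D (X u) (T u)) ` U)"
proof -
  obtain R where R: "\<forall>v\<in>\<T>. \<forall>i\<in>Ix n (\<Union>D \<union> L'). \<bar>v i\<bar> \<le> R" using assms(1) unfolding tensor_fam_def bounded_fam_def by blast
  have "\<bar>contract_blocks n D (X u) (T u) j\<bar> \<le> (\<Sum>i\<in>Ix n (\<Union>D). R * r ^ card D)" if u: "u \<in> U" and j: "j \<in> Ix n L'" for u j
  proof -
    have "\<bar>T u (merge_idx (\<Union>D) i j) * tensor_prod D (X u) i\<bar> \<le> R * r ^ card D" if i: "i \<in> Ix n (\<Union>D)" for i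
    proof -
      have a: "\<bar>T u (merge_idx (\<Union>D) i j)\<bar> \<le> R" by (rule R[rule_format, OF assms(5)[OF u] merge_idx_Ix[OF i j]])
      have b: "\<bar>tensor_prod D (X u) i\<bar> \<le> r ^ card D" by (rule abs_tensor_prod_le[OF assms(6)[OF u] assms(2) i])
      show ?thesis unfolding abs_mult
        by (rule mult_mono[OF a b order_trans[OF abs_ge_zero a] abs_ge_zero])
    qed
    then have "(\<Sum>i\<in>Ix n (\<Union>D). \<bar>T u (merge_idx (\<Union>D) i j) * tensor_prod D (X u) i\<bar>) \<le> (\<Sum>i\<in>Ix n (\<Union>D). R * r ^ card D)"
      by (rule sum_mono)
    then show ?thesis unfolding contract_blocks_def contract_def by (rule order_trans[OF sum_abs])
  qed
  then have "\<forall>v\<in>(\<lambda>u. contract_blocks n D (X u) (T u)) ` U. \<forall>i\<in>Ix n L'. \<bar>v i\<bar> \<le> (\<Sum>i\<in>Ix n (\<Union>D). R * r ^ card D)"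
    by auto
  then show ?thesis unfolding bounded_fam_def using assms(4) by (intro conjI exI) simp_all
qed

definition contraction_fam :: "nat \<Rightarrow> real \<Rightarrow> nat set set \<Rightarrow> ten set \<Rightarrow> ten set" where
  "contraction_fam n r P \<T> = (\<lambda>u. contract_blocks n P (fst u) (snd u)) ` {u. snd u \<in> \<T> \<and> in_balls n r P (fst u)}"

text \<open>The support function of this family at \<open>y\<close> dominates all the mixed norms of the tensors contracted
  with \<open>y\<close> in the coordinate \<open>k\<close>.\<close>

definition dual_fam :: "nat \<Rightarrow> real \<Rightarrow> nat set set \<Rightarrow> nat set \<Rightarrow> ten set \<Rightarrow> ten set" where
  "dual_fam n r \<K> k \<T> = (\<Union>PP\<in>{PP. coarsening (\<K> - {k}) (fst PP) (snd PP) \<and> card (fst PP) < card (\<K> - {k})}.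
     contraction_fam n r (fst PP) (partial_mean n (snd PP) \<T>))"

lemma in_balls_zero: "r \<ge> 0 \<Longrightarrow> in_balls n r P (\<lambda>B i. 0)" by (simp add: in_balls_def)

lemma contract_blocks_uminus: "contract_blocks n D x (\<lambda>i. - \<tau> i) = (\<lambda>j. - contract_blocks n D x \<tau> j)" by (simp add: contract_blocks_def contract_uminus)

lemma tensor_fam_contraction_fam:
  assumes "tensor_fam n (\<Union>P \<union> L') \<T>" "blocks P" "\<Union>P \<inter> L' = {}" "r \<ge> 0"
  shows "tensor_fam n L' (contraction_fam n r P \<T>)"
proof -
  obtain t where "t \<in> \<T>" using assms(1) by (auto simp: tensor_fam_def bounded_fam_def)
  then have "{u. snd u \<in> \<T> \<and> in_balls n r P (fst u)} \<noteq> {}" using in_balls_zero[OF assms(4), of n P] by auto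
  then have "bounded_fam (Ix n L') (contraction_fam n r P \<T>)" unfolding contraction_fam_def by (intro bounded_fam_contract_blocks[OF assms(1-3)]) auto
  moreover have "sym_fam (contraction_fam n r P \<T>)" unfolding sym_fam_def contraction_fam_def
  proof
    fix v assume "v \<in> (\<lambda>u. contract_blocks n P (fst u) (snd u)) ` {u. snd u \<in> \<T> \<and> in_balls n r P (fst u)}"
    then obtain x \<tau> where "v = contract_blocks n P x \<tau>" "\<tau> \<in> \<T>" "in_balls n r P x" by auto
    moreover from this have "(\<lambda>i. - \<tau> i) \<in> \<T>" using assms(1) by (auto simp: tensor_fam_def sym_fam_def)
    ultimately show "(\<lambda>i. - v i) \<in> (\<lambda>u. contract_blocks n P (fst u) (snd u)) ` {u. snd u \<in> \<T> \<and> in_balls n r P (fst u)}"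
      by (intro image_eqI[of _ _ "(x, \<lambda>i. - \<tau> i)"]) (auto simp: contract_blocks_uminus)
  qed
  ultimately show ?thesis by (simp add: tensor_fam_def)
qed

lemma tensor_fam_UN:
  assumes "finite A" "A \<noteq> {}" "\<And>a. a \<in> A \<Longrightarrow> tensor_fam n L (V a)"
  shows "tensor_fam n L (\<Union>a\<in>A. V a)"
proof -
  have "\<forall>a\<in>A. \<exists>R. \<forall>v\<in>V a. \<forall>i\<in>Ix n L. \<bar>v i\<bar> \<le> R" using assms(3) by (auto simp: tensor_fam_def bounded_fam_def)
  from bchoice[OF this] obtain R where R: "\<And>a v i. a \<in> A \<Longrightarrow> v \<in> V a \<Longrightarrow> i \<in> Ix n L \<Longrightarrow> \<bar>v i\<bar> \<le> R a"
    by blast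
  have "\<bar>v i\<bar> \<le> (\<Sum>a\<in>A. \<bar>R a\<bar>)" if a: "a \<in> A" and v: "v \<in> V a" and i: "i \<in> Ix n L" for a v i
  proof -
    have "\<bar>v i\<bar> \<le> \<bar>R a\<bar>" using R[OF a v i] by linarith
    also have "\<dots> \<le> (\<Sum>a\<in>A. \<bar>R a\<bar>)" by (rule member_le_sum[OF a]) (use assms(1) in auto)
    finally show ?thesis .
  qed
  then have "\<forall>v\<in>(\<Union>a\<in>A. V a). \<forall>i\<in>Ix n L. \<bar>v i\<bar> \<le> (\<Sum>a\<in>A. \<bar>R a\<bar>)" by blast
  moreover have "(\<Union>a\<in>A. V a) \<noteq> {}" using assms(2,3) by (fastforce simp: tensor_fam_def bounded_fam_def)
  moreover have "sym_fam (\<Union>a\<in>A. V a)" using assms(3) by (fastforce simp: tensor_fam_def sym_fam_def)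
  ultimately show ?thesis unfolding tensor_fam_def bounded_fam_def by blast
qed

lemma gauss_width_UN_sum:
  assumes "finite L" "finite A" "A \<noteq> {}" "\<And>a. a \<in> A \<Longrightarrow> tensor_fam n L (V a)"
  shows "gauss_width (Ix n L) (\<Union>a\<in>A. V a) \<le> (\<Sum>a\<in>A. gauss_width (Ix n L) (V a))"
proof -
  have f: "tensor_fam n L (\<Union>a\<in>A. V a)" by (rule tensor_fam_UN[OF assms(2-4)])
  have b: "bounded_fam (Ix n L) (V a)" "sym_fam (V a)" if "a \<in> A" for a using assms(4)[OF that] by (auto simp: tensor_fam_def)
  have le: "supf (Ix n L) (\<Union>a\<in>A. V a) g \<le> (\<Sum>a\<in>A. supf (Ix n L) (V a) g)" for g
  proof (rule supf_least)
    show "(\<Union>a\<in>A. V a) \<noteq> {}" using f by (auto simp: tensor_fam_def bounded_fam_def)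
    fix v assume "v \<in> (\<Union>a\<in>A. V a)"
    then obtain a where a: "a \<in> A" "v \<in> V a" by auto
    have "lin (Ix n L) v g \<le> supf (Ix n L) (V a) g" by (rule lin_le_supf[OF b(1)[OF a(1)] a(2)])
    also have "\<dots> \<le> (\<Sum>a\<in>A. supf (Ix n L) (V a) g)"
      by (rule member_le_sum[OF a(1)]) (use assms(2) supf_nonneg[OF b] in auto)
    finally show "lin (Ix n L) v g \<le> (\<Sum>a\<in>A. supf (Ix n L) (V a) g)" .
  qed
  have "gauss_width (Ix n L) (\<Union>a\<in>A. V a) \<le> (\<integral>g. (\<Sum>a\<in>A. supf (Ix n L) (V a) g) \<partial>gauss (Ix n L))"
    unfolding gauss_width_def
  proof (rule integral_mono)
    show "integrable (gauss (Ix n L)) (supf (Ix n L) (\<Union>a\<in>A. V a))"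
      by (rule supf_gauss_integrable[OF finite_Ix[OF assms(1)] conjunct1[OF f[unfolded tensor_fam_def]]])
    show "integrable (gauss (Ix n L)) (\<lambda>g. \<Sum>a\<in>A. supf (Ix n L) (V a) g)"
      by (rule Bochner_Integration.integrable_sum) (rule supf_gauss_integrable[OF finite_Ix[OF assms(1)] b(1)])
  qed (rule le)
  also have "\<dots> = (\<Sum>a\<in>A. gauss_width (Ix n L) (V a))"
    unfolding gauss_width_def
    by (rule Bochner_Integration.integral_sum) (rule supf_gauss_integrable[OF finite_Ix[OF assms(1)] b(1)])
  finally show ?thesis .
qed

lemma coarsening_singletons: "blocks \<K> \<Longrightarrow> coarsening \<K> {} \<K>"
  unfolding coarsening_def partition_on_def disjoint_def blocks_def by auto

text \<open>The vector \<open>y\<close> is reinterpreted as the vector of a deterministic block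
  \<open>k\<close>. One block and one coordinate are added, so the strict inequality between their
  numbers is preserved.\<close>

lemma norms_le_contract:
  assumes "blocks \<K>" "k \<in> \<K>" "norms_le n r \<K> \<T> M" "L2_set y (Ix n k) \<le> r"
  shows "norms_le n r (\<K> - {k}) (contract n k y ` \<T>) M"
  unfolding norms_le_def
proof (intro allI impI, elim conjE)
  fix P P' x assume a: "coarsening (\<K> - {k}) P P'" "card P < card (\<K> - {k})" "in_balls n r P x"
  note ai = coarsening_insert[OF assms(1,2) a(1)]
  have fin: "finite (\<Union>(\<K> - {k}))" by (rule blocks_finite_Union[OF blocks_subset[OF assms(1) Diff_subset]])
  note ab = coarsening_blocks[OF fin a(1)]
  have cK: "card (\<K> - {k}) = card \<K> - 1" "card \<K> > 0"
    using assms(1,2) by (auto simp: blocks_def card_gt_0_iff)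
  let ?x = "x(k := y)"
  have "mean_sup n P' (k \<union> \<Union>(\<K> - {k})) \<T> (tensor_prod (insert k P) ?x) \<le> M"
    unfolding blocks_disjoint_single(3)[OF assms(1,2)]
    using assms(3) ai(1) a(2,3) cK ab(1) ai(2) assms(4)
    unfolding norms_le_def by (auto simp: in_balls_def)
  moreover have "mean_sup n P' (\<Union>(\<K> - {k})) (contract n k y ` \<T>) (tensor_prod P x) = mean_sup n P' (k \<union> \<Union>(\<K> - {k})) \<T> (tensor_prod (insert k P) ?x)"
  proof (rule mean_sup_contract)
    show "k \<inter> \<Union>(\<K> - {k}) = {}" by (rule blocks_disjoint_single[OF assms(1,2)])
    show "\<Union>P' \<subseteq> \<Union>(\<K> - {k})" using ab(3) by blast
    fix i j assume i: "i \<in> Ix n k" and j: "j \<in> Ix n (\<Union>(\<K> - {k}))"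
    have "tensor_prod P ?x (merge_idx k i j) = tensor_prod P x j"
    proof -
      have "tensor_prod P ?x (merge_idx k i j) = tensor_prod P ?x j" using ai(4) by (intro tensor_prod_merge_idx_right) blast
      also have "\<dots> = tensor_prod P x j" using ai(2) by (intro tensor_prod_cong) auto
      finally show ?thesis .
    qed
    then show "tensor_prod (insert k P) ?x (merge_idx k i j) = y i * tensor_prod P x j"
      using ab(1) ai(2) i by (simp add: tensor_prod_insert restrict_merge_idx_left restrict_Ix_id)
  qed
  ultimately show "mean_sup n P' (\<Union>(\<K> - {k})) (contract n k y ` \<T>) (tensor_prod P x) \<le> M" by simp
qed

text \<open>The second claim is the purpose of the family: averages over Gaussian blocks are suprema
  over \<open>partial_mean\<close>, and deterministic blocks are contracted away, so each mixed
  expectation of the contraction with \<open>y\<close> is bounded by pairings of \<open>y\<close>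
  with members of \<open>dual_fam\<close>.\<close>

lemma dual_fam_facts:
  assumes "blocks \<K>" "k \<in> \<K>" "card \<K> \<ge> 2" "tensor_fam n (\<Union>\<K>) \<T>" "r \<ge> 0"
  shows "tensor_fam n k (dual_fam n r \<K> k \<T>)"
    and "\<And>y c. supf (Ix n k) (dual_fam n r \<K> k \<T>) y \<le> c \<Longrightarrow> norms_le n r (\<K> - {k}) (contract n k y ` \<T>) c"
    and "gauss_width (Ix n k) (dual_fam n r \<K> k \<T>) \<le> (\<Sum>PP\<in>{PP. coarsening (\<K> - {k}) (fst PP) (snd PP) \<and> card (fst PP) < card (\<K> - {k})}.
       gauss_width (Ix n k) (contraction_fam n r (fst PP) (partial_mean n (snd PP) \<T>)))"
proof -
  have bK: "blocks (\<K> - {k})" by (rule blocks_subset[OF assms(1)]) auto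
  have fin: "finite (\<Union>(\<K> - {k}))" by (rule blocks_finite_Union[OF bK])
  have fk: "finite k" using assms(1,2) by (auto simp: blocks_def)
  let ?A = "{PP. coarsening (\<K> - {k}) (fst PP) (snd PP) \<and> card (fst PP) < card (\<K> - {k})}"
  have cK: "card (\<K> - {k}) = card \<K> - 1" using assms(1,2) by (auto simp: blocks_def)
  have fA: "finite ?A"
    by (rule finite_subset[OF _ coarsening_finite_card(1)[of "\<K> - {k}"]]) (use bK in \<open>auto simp: blocks_def\<close>)
  \<comment> \<open>With at least two coordinates the fully Gaussian coarsening is admissible, so
    the union is not empty.\<close>
  have "({}, \<K> - {k}) \<in> ?A" using coarsening_singletons[OF bK] cK assms(3) by auto
  then have neA: "?A \<noteq> {}" by blast
  have un: "\<Union>(snd PP) \<union> (\<Union>(fst PP) \<union> k) = \<Union>\<K>" "\<Union>(snd PP) \<inter> (\<Union>(fst PP) \<union> k) = {}" "\<Union>(fst PP) \<inter> k = {}"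
    if "PP \<in> ?A" for PP
  proof -
    have a: "coarsening (\<K> - {k}) (fst PP) (snd PP)" using that by simp
    note ab = coarsening_blocks[OF fin a] and ai = coarsening_insert[OF assms(1,2) a]
    show "\<Union>(snd PP) \<union> (\<Union>(fst PP) \<union> k) = \<Union>\<K>"
      unfolding blocks_disjoint_single(3)[OF assms(1,2), symmetric] ab(3)[symmetric]
      by (simp only: Un_ac)
    show "\<Union>(snd PP) \<inter> (\<Union>(fst PP) \<union> k) = {}" "\<Union>(fst PP) \<inter> k = {}" using ab(4) ai(4,5) by auto
  qed
  have fav: "tensor_fam n (\<Union>(fst PP) \<union> k) (partial_mean n (snd PP) \<T>)" if P: "PP \<in> ?A" for PP
  proof (rule tensor_fam_partial_mean)
    have a: "coarsening (\<K> - {k}) (fst PP) (snd PP)" using P by simp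
    note ab = coarsening_blocks[OF fin a]
    show "tensor_fam n (\<Union>(snd PP) \<union> (\<Union>(fst PP) \<union> k)) \<T>" unfolding un(1)[OF P] by (rule assms(4))
    show "finite (\<Union>(snd PP) \<union> (\<Union>(fst PP) \<union> k))" unfolding un(1)[OF P] by (rule blocks_finite_Union[OF assms(1)])
    show "finite (snd PP)" by (rule ab)
  qed
  have fV: "tensor_fam n k (contraction_fam n r (fst PP) (partial_mean n (snd PP) \<T>))" if P: "PP \<in> ?A" for PP
    by (rule tensor_fam_contraction_fam[OF fav[OF P] _ un(3)[OF P] assms(5)]) (use P coarsening_blocks[OF fin] in auto)
  show F: "tensor_fam n k (dual_fam n r \<K> k \<T>)" unfolding dual_fam_def by (rule tensor_fam_UN[OF fA neA fV])
  show "gauss_width (Ix n k) (dual_fam n r \<K> k \<T>) \<le> (\<Sum>PP\<in>?A. gauss_width (Ix n k) (contraction_fam n r (fst PP) (partial_mean n (snd PP) \<T>)))"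
    unfolding dual_fam_def by (rule gauss_width_UN_sum[OF fk fA neA fV])
  fix y c assume c: "supf (Ix n k) (dual_fam n r \<K> k \<T>) y \<le> c"
  show "norms_le n r (\<K> - {k}) (contract n k y ` \<T>) c"
    unfolding norms_le_def
  proof (intro allI impI, elim conjE)
    fix P P' x assume a: "coarsening (\<K> - {k}) P P'" "card P < card (\<K> - {k})" "in_balls n r P x"
    then have PP: "(P, P') \<in> ?A" by simp
    note ai = coarsening_insert[OF assms(1,2) a(1)] and ab = coarsening_blocks[OF fin a(1)] and u = un[OF PP, simplified]
    let ?z = "\<lambda>i. y (restrict i k) * tensor_prod P x i"
    have "mean_sup n P' (\<Union>(\<K> - {k})) (contract n k y ` \<T>) (tensor_prod P x) = mean_sup n P' (k \<union> \<Union>(\<K> - {k})) \<T> ?z"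
    proof (rule mean_sup_contract)
      show "k \<inter> \<Union>(\<K> - {k}) = {}" by (rule blocks_disjoint_single[OF assms(1,2)])
      show "\<Union>P' \<subseteq> \<Union>(\<K> - {k})" using ab(3) by blast
      fix i j assume "i \<in> Ix n k"
      then show "?z (merge_idx k i j) = y i * tensor_prod P x j"
        using u(3) by (simp add: restrict_merge_idx_left restrict_Ix_id tensor_prod_merge_idx_right)
    qed
    also have "k \<union> \<Union>(\<K> - {k}) = \<Union>P' \<union> (\<Union>P \<union> k)" using u(1) blocks_disjoint_single(3)[OF assms(1,2)] by simp
    also have "mean_sup n P' (\<Union>P' \<union> (\<Union>P \<union> k)) \<T> ?z = supf (Ix n (\<Union>P \<union> k)) (partial_mean n P' \<T>) ?z"
    proof (rule mean_sup_partial_mean)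
      show "tensor_fam n (\<Union>P' \<union> (\<Union>P \<union> k)) \<T>" unfolding u(1) by (rule assms(4))
      show "finite (\<Union>P' \<union> (\<Union>P \<union> k))" unfolding u(1) by (rule blocks_finite_Union[OF assms(1)])
      show "finite P'" "\<Union>P' \<inter> (\<Union>P \<union> k) = {}" by (rule ab u)+
      fix i j
      have "k \<inter> \<Union>P' = {}" "\<Union>P \<inter> \<Union>P' = {}" by (rule ai ab)+
      then show "?z (merge_idx (\<Union>P') i j) = ?z j" by (simp add: restrict_merge_idx_right tensor_prod_merge_idx_right)
    qed
    also have "\<dots> \<le> supf (Ix n k) (dual_fam n r \<K> k \<T>) y"
    proof (rule supf_least)
      show "partial_mean n P' \<T> \<noteq> {}" using fav[OF PP] by (auto simp: tensor_fam_def bounded_fam_def)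
      fix \<theta> assume \<theta>: "\<theta> \<in> partial_mean n P' \<T>"
      have "lin (Ix n (\<Union>P \<union> k)) \<theta> ?z = lin (Ix n k) (contract n (\<Union>P) (tensor_prod P x) \<theta>) y"
      proof (rule lin_contract[OF u(3)])
        fix i j assume "j \<in> Ix n k"
        then show "?z (merge_idx (\<Union>P) i j) = tensor_prod P x i * y j"
          using ai(4) by (simp add: restrict_merge_idx_right restrict_Ix_id tensor_prod_merge_idx_left)
      qed
      also have "\<dots> \<le> supf (Ix n k) (dual_fam n r \<K> k \<T>) y"
      proof (rule lin_le_supf)
        show "bounded_fam (Ix n k) (dual_fam n r \<K> k \<T>)" using F by (simp add: tensor_fam_def)
        have "contract n (\<Union>P) (tensor_prod P x) \<theta> \<in> contraction_fam n r P (partial_mean n P' \<T>)"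
          unfolding contraction_fam_def contract_blocks_def using \<theta> a(3) by (intro image_eqI[of _ _ "(x, \<theta>)"]) auto
        then show "contract n (\<Union>P) (tensor_prod P x) \<theta> \<in> dual_fam n r \<K> k \<T>" unfolding dual_fam_def using PP by force
      qed
      finally show "lin (Ix n (\<Union>P \<union> k)) \<theta> ?z \<le> supf (Ix n k) (dual_fam n r \<K> k \<T>) y" .
    qed
    also note c
    finally show "mean_sup n P' (\<Union>(\<K> - {k})) (contract n k y ` \<T>) (tensor_prod P x) \<le> c" .
  qed
qed

section \<open>The inductive statement\<close>

definition rho :: "nat \<Rightarrow> nat set \<Rightarrow> nat set set \<Rightarrow> (nat set \<Rightarrow> ten) \<times> ten \<Rightarrow> (nat set \<Rightarrow> ten) \<times> ten \<Rightarrow> real" where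
  "rho n b D u v = L2_set (\<lambda>j. contract_blocks n D (fst u) (snd u) j - contract_blocks n D (fst v) (snd v) j) (Ix n b)"

text \<open>The coordinate \<open>b\<close> is the one paired with the Gaussian vector; a point \<open>u = (x, \<tau>)\<close> consists of vectors
  \<open>x\<close> for the other coordinates and a tensor \<open>\<tau>\<close>.\<close>

definition width_bound :: "nat \<Rightarrow> real \<Rightarrow> bool" where
  "width_bound d C \<longleftrightarrow> (\<forall>n r \<K> b \<T> M U \<Delta>.
     blocks \<K> \<longrightarrow> card \<K> = d \<longrightarrow> b \<in> \<K> \<longrightarrow> tensor_fam n (\<Union>\<K>) \<T> \<longrightarrow> 1 \<le> r \<longrightarrow> 0 < M \<longrightarrow> norms_le n r \<K> \<T> M \<longrightarrow>
     U \<noteq> {} \<longrightarrow> (\<forall>u\<in>U. snd u \<in> \<T> \<and> in_balls n r (\<K> - {b}) (fst u)) \<longrightarrow>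
     (\<forall>u\<in>U. \<forall>v\<in>U. rho n b (\<K> - {b}) u v \<le> \<Delta>) \<longrightarrow>
     gauss_width (Ix n b) ((\<lambda>u. contract_blocks n (\<K> - {b}) (fst u) (snd u)) ` U) \<le> C * (r * \<Delta> + M))"

lemma width_boundD:
  assumes "width_bound d C" "blocks \<K>" "card \<K> = d" "b \<in> \<K>" "tensor_fam n (\<Union>\<K>) \<T>" "1 \<le> r" "0 < M" "norms_le n r \<K> \<T> M"
    and "U \<noteq> {}" "\<And>u. u \<in> U \<Longrightarrow> snd u \<in> \<T>" "\<And>u. u \<in> U \<Longrightarrow> in_balls n r (\<K> - {b}) (fst u)"
    and "\<And>u v. u \<in> U \<Longrightarrow> v \<in> U \<Longrightarrow> rho n b (\<K> - {b}) u v \<le> \<Delta>"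
  shows "gauss_width (Ix n b) ((\<lambda>u. contract_blocks n (\<K> - {b}) (fst u) (snd u)) ` U) \<le> C * (r * \<Delta> + M)"
proof -
  have 1: "\<forall>u\<in>U. snd u \<in> \<T> \<and> in_balls n r (\<K> - {b}) (fst u)" using assms(10,11) by simp
  have 2: "\<forall>u\<in>U. \<forall>v\<in>U. rho n b (\<K> - {b}) u v \<le> \<Delta>" using assms(12) by simp
  note * = assms(1)[unfolded width_bound_def, THEN spec[of _ n], THEN spec[of _ r], THEN spec[of _ \<K>], THEN spec[of _ b],
      THEN spec[of _ \<T>], THEN spec[of _ M], THEN spec[of _ U], THEN spec[of _ \<Delta>]]
  show ?thesis
    using *[THEN mp, OF assms(2), THEN mp, OF assms(3), THEN mp, OF assms(4), THEN mp, OF assms(5), THEN mp, OF assms(6),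
        THEN mp, OF assms(7), THEN mp, OF assms(8), THEN mp, OF assms(9), THEN mp, OF 1, THEN mp, OF 2] .
qed

lemma norms_leD:
  assumes "norms_le n r \<K> \<T> M" "coarsening \<K> P P'" "card P < card \<K>" "in_balls n r P x"
  shows "mean_sup n P' (\<Union>\<K>) \<T> (tensor_prod P x) \<le> M"
  using assms unfolding norms_le_def by simp

lemma contract_blocks_empty: "contract_blocks n {} x \<tau> = \<tau>"
  by (simp add: contract_blocks_def contract_empty)

text \<open>With one coordinate there is nothing to contract, and the norm with the single Gaussian
  block \<open>b\<close> is the width of the whole family.\<close>

lemma width_bound_1: "width_bound 1 1"
  unfolding width_bound_def
proof (intro allI impI)
  fix n r \<K> b \<T> M \<Delta> and U :: "((nat set \<Rightarrow> ten) \<times> ten) set"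
  assume a: "blocks \<K>" "card \<K> = 1" "b \<in> \<K>" "tensor_fam n (\<Union>\<K>) \<T>" "1 \<le> r" "0 < M" "norms_le n r \<K> \<T> M" "U \<noteq> {}"
    "\<forall>u\<in>U. snd u \<in> \<T> \<and> in_balls n r (\<K> - {b}) (fst u)" "\<forall>u\<in>U. \<forall>v\<in>U. rho n b (\<K> - {b}) u v \<le> \<Delta>"
  have K: "\<K> = {b}" using a(2,3) by (auto simp: card_1_singleton_iff)
  have fb: "finite b" using blocksD(2)[OF a(1,3)] .
  have bounded_contractions: "bounded_fam (Ix n b) \<T>" using a(4) by (simp add: tensor_fam_def K)
  obtain u where "u \<in> U" using a(8) by blast
  then have "0 \<le> \<Delta>" using a(10) order_trans[OF L2_set_nonneg] unfolding rho_def by blast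
  then have "0 \<le> r * \<Delta>" using a(5) by simp
  have "gauss_width (Ix n b) ((\<lambda>u. contract_blocks n (\<K> - {b}) (fst u) (snd u)) ` U) \<le> gauss_width (Ix n b) \<T>"
    using a(8,9) by (intro gauss_width_mono finite_Ix fb bounded_contractions) (auto simp: K contract_blocks_empty)
  also have "\<dots> = mean_sup n {b} (\<Union>\<K>) \<T> (tensor_prod {} (\<lambda>_ _. 0))"
    using mean_sup_single[OF fb bounded_contractions] by (simp add: K tensor_prod_def[abs_def])
  also have "\<dots> \<le> M"
    by (rule norms_leD[OF a(7)]) (use coarsening_singletons[OF a(1)] in \<open>auto simp: K in_balls_def\<close>)
  finally show "gauss_width (Ix n b) ((\<lambda>u. contract_blocks n (\<K> - {b}) (fst u) (snd u)) ` U) \<le> 1 * (r * \<Delta> + M)"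
    using \<open>0 \<le> r * \<Delta>\<close> by simp
qed

section \<open>Widths of the dual families from the induction hypothesis\<close>

lemma contract_blocks_lin:
  assumes "finite P" "k \<notin> P" "\<Union>P \<inter> k = {}"
  shows "lin (Ix n (\<Union>P \<union> k)) \<theta> (tensor_prod (insert k P) x) = lin (Ix n k) (contract_blocks n P x \<theta>) (x k)"
  unfolding contract_blocks_def
proof (rule lin_contract[OF assms(3)])
  fix i j assume "i \<in> Ix n (\<Union>P)" "j \<in> Ix n k"
  then show "tensor_prod (insert k P) x (merge_idx (\<Union>P) i j) = tensor_prod P x i * x k j"
    using assms by (simp add: tensor_prod_insert restrict_merge_idx_right restrict_Ix_id tensor_prod_merge_idx_left Int_commute)
qed

lemma L2_set_uminus [simp]: "L2_set (\<lambda>i. - x i) I = L2_set x I"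
  by (simp add: L2_set_def)

text \<open>Duality: the contraction, rescaled to length \<open>r\<close>, is an admissible vector
  for the coordinate \<open>k\<close>, and pairing with it gives r times the norm.\<close>

lemma L2_contract_blocks_le:
  assumes "finite P" "k \<notin> P" "\<Union>P \<inter> k = {}" "bounded_fam (Ix n (\<Union>P \<union> k)) \<Theta>" "\<theta> \<in> \<Theta>" "in_balls n r P x" "r \<ge> 0" "0 \<le> M"
    and "\<And>x'. in_balls n r (insert k P) x' \<Longrightarrow> supf (Ix n (\<Union>P \<union> k)) \<Theta> (tensor_prod (insert k P) x') \<le> M"
  shows "r * L2_set (contract_blocks n P x \<theta>) (Ix n k) \<le> M"
proof (cases "L2_set (contract_blocks n P x \<theta>) (Ix n k) = 0")
  case True then show ?thesis using assms(8) by simp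
next
  case False
  let ?l = "L2_set (contract_blocks n P x \<theta>) (Ix n k)"
  have l: "?l > 0" using False L2_set_nonneg[of "contract_blocks n P x \<theta>" "Ix n k"] by linarith
  let ?y = "\<lambda>i. (r / ?l) * contract_blocks n P x \<theta> i"
  let ?x = "x(k := ?y)"
  have y: "L2_set ?y (Ix n k) = r" unfolding L2_set_cmult using l assms(7) by simp
  have ib: "in_balls n r (insert k P) ?x" using assms(2,6) y unfolding in_balls_def by auto
  have "contract_blocks n P ?x \<theta> = contract_blocks n P x \<theta>"
    unfolding contract_blocks_def using assms(2) by (intro contract_cong_left tensor_prod_cong) auto
  then have "lin (Ix n (\<Union>P \<union> k)) \<theta> (tensor_prod (insert k P) ?x) = (r / ?l) * ?l\<^sup>2"
    by (simp only: contract_blocks_lin[OF assms(1-3)] fun_upd_same lin_cmult_right lin_self)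
  also have "\<dots> = r * ?l" using l by (simp add: power2_eq_square)
  finally have "r * ?l \<le> supf (Ix n (\<Union>P \<union> k)) \<Theta> (tensor_prod (insert k P) ?x)"
    using lin_le_supf[OF assms(4,5), of "tensor_prod (insert k P) ?x"] by simp
  then show ?thesis using assms(9)[OF ib] by linarith
qed

text \<open>Coarsenings of \<open>insert k P\<close> compose with \<open>P'\<close> to coarsenings
  of the original coordinates. Since \<open>P\<close> has fewer blocks than
  \<open>\<K> - {k}\<close> has coordinates, the number of deterministic blocks stays below
  \<open>card \<K>\<close>.\<close>

lemma norms_le_partial_mean:
  assumes "blocks \<K>" "k \<in> \<K>" "tensor_fam n (\<Union>\<K>) \<T>" "norms_le n r \<K> \<T> M" "coarsening (\<K> - {k}) P P'" "card P < card (\<K> - {k})"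
  shows "norms_le n r (insert k P) (partial_mean n P' \<T>) M"
  unfolding norms_le_def
proof (intro allI impI, elim conjE)
  fix Q Q' x assume q: "coarsening (insert k P) Q Q'" "card Q < card (insert k P)" "in_balls n r Q x"
  note ac = coarsening_compose[OF assms(1,2,5) q(1)] and ai = coarsening_insert[OF assms(1,2,5)]
  have fK: "finite (\<Union>\<K>)" by (rule blocks_finite_Union[OF assms(1)])
  note ab = coarsening_blocks[OF fK ai(1)]
  have fq: "finite (\<Union>(insert k P))" by (rule finite_subset[OF _ fK]) (use ab(3) in auto)
  note qb = coarsening_blocks[OF fq q(1)]
  have un: "\<Union>P' \<union> (k \<union> \<Union>P) = \<Union>\<K>" using ab(3) by (simp add: Un_commute)
  have c: "card Q < card \<K>"
    using q(2) assms(6) card_insert_le_m1 card_Suc_Diff1[OF blocksD(1)[OF assms(1)] assms(2)] ab(1) ai(2) by simp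
  have "mean_sup n Q' (k \<union> \<Union>P) (partial_mean n P' \<T>) (tensor_prod Q x) = mean_sup n (Q' \<union> P') (\<Union>P' \<union> (k \<union> \<Union>P)) \<T> (tensor_prod Q x)"
  proof (rule mean_sup_of_partial_mean)
    show "tensor_fam n (\<Union>P' \<union> (k \<union> \<Union>P)) \<T>" "finite (\<Union>P' \<union> (k \<union> \<Union>P))" unfolding un by (rule assms(3) fK)+
    show "finite P'" "finite Q'" by (rule ab qb)+
    show "\<Union>P' \<inter> (k \<union> \<Union>P) = {}" "Q' \<inter> P' = {}" by (rule ac)+
    show "\<Union>Q' \<subseteq> k \<union> \<Union>P" using ac(3) by blast
    fix i j
    have "\<Union>Q \<inter> \<Union>P' = {}" using ac(3,4) by blast
    then show "tensor_prod Q x (merge_idx (\<Union>P') i j) = tensor_prod Q x j" by (rule tensor_prod_merge_idx_right)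
  qed
  also have "\<dots> \<le> M" unfolding un by (rule norms_leD[OF assms(4) ac(1) c q(3)])
  finally show "mean_sup n Q' (\<Union>(insert k P)) (partial_mean n P' \<T>) (tensor_prod Q x) \<le> M" by simp
qed

text \<open>Here all blocks of \<open>insert k P\<close> are deterministic. That there are still
  fewer of them than coordinates is due to the restriction on \<open>card P\<close>, the one built
  into \<open>dual_fam\<close>.\<close>

lemma supf_partial_mean_le:
  assumes "blocks \<K>" "k \<in> \<K>" "tensor_fam n (\<Union>\<K>) \<T>" "norms_le n r \<K> \<T> M" "coarsening (\<K> - {k}) P P'" "card P < card (\<K> - {k})"
    and x: "in_balls n r (insert k P) x"
  shows "supf (Ix n (\<Union>P \<union> k)) (partial_mean n P' \<T>) (tensor_prod (insert k P) x) \<le> M"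
proof -
  note ai = coarsening_insert[OF assms(1,2,5)]
  have fK: "finite (\<Union>\<K>)" by (rule blocks_finite_Union[OF assms(1)])
  note ab = coarsening_blocks[OF fK ai(1)]
  have un: "\<Union>P' \<union> (\<Union>P \<union> k) = \<Union>\<K>" using ab(3) by (simp add: Un_ac)
  have c: "card (insert k P) < card \<K>"
    using assms(6) card_Suc_Diff1[OF blocksD(1)[OF assms(1)] assms(2)] ab(1) ai(2) by simp
  have d: "\<Union>P' \<inter> (\<Union>P \<union> k) = {}" using ab(4) by (simp add: Int_Un_distrib Int_commute)
  have "supf (Ix n (\<Union>P \<union> k)) (partial_mean n P' \<T>) (tensor_prod (insert k P) x) = mean_sup n P' (\<Union>P' \<union> (\<Union>P \<union> k)) \<T> (tensor_prod (insert k P) x)"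
  proof (rule mean_sup_partial_mean[symmetric])
    show "tensor_fam n (\<Union>P' \<union> (\<Union>P \<union> k)) \<T>" "finite (\<Union>P' \<union> (\<Union>P \<union> k))" unfolding un by (rule assms(3) fK)+
    show "finite P'" "\<Union>P' \<inter> (\<Union>P \<union> k) = {}" by (rule ab d)+
    fix i j
    have "\<Union>(insert k P) \<inter> \<Union>P' = {}" by (rule ab)
    then show "tensor_prod (insert k P) x (merge_idx (\<Union>P') i j) = tensor_prod (insert k P) x j" by (rule tensor_prod_merge_idx_right)
  qed
  also have "\<dots> \<le> M" unfolding un by (rule norms_leD[OF assms(4) ai(1) c x])
  finally show ?thesis .
qed

text \<open>The averaged tensors form a family over the coordinates \<open>insert k P\<close>, fewer
  than \<open>card \<K>\<close> of them, so the induction hypothesis applies. Duality bounds the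
  contractions by M/r in norm, hence the diameter by 2 M / r, and C (r * 2 M / r + M) = 3 C
  M.\<close>

lemma gauss_width_contraction_fam_le:
  assumes "blocks \<K>" "k \<in> \<K>" "tensor_fam n (\<Union>\<K>) \<T>" "norms_le n r \<K> \<T> M" "coarsening (\<K> - {k}) P P'" "card P < card (\<K> - {k})"
    and "1 \<le> r" "0 < M" "width_bound (Suc (card P)) C"
  shows "gauss_width (Ix n k) (contraction_fam n r P (partial_mean n P' \<T>)) \<le> 3 * C * M"
proof -
  note ai = coarsening_insert[OF assms(1,2,5)]
  have fK: "finite (\<Union>\<K>)" by (rule blocks_finite_Union[OF assms(1)])
  note ab = coarsening_blocks[OF fK ai(1)]
  let ?U = "{u. snd u \<in> partial_mean n P' \<T> \<and> in_balls n r P (fst u)}"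
  have finP: "finite P" using ab(1) by simp
  have un: "\<Union>P' \<union> (\<Union>P \<union> k) = \<Union>\<K>" using ab(3) by (simp add: Un_ac)
  have fa: "tensor_fam n (\<Union>P \<union> k) (partial_mean n P' \<T>)"
    by (rule tensor_fam_partial_mean) (use un assms(3) fK ab in auto)
  have Pk: "insert k P - {k} = P" using ai(2) by auto
  have dj: "\<Union>P \<inter> k = {}" using ai(4) by (simp add: Int_commute)
  have nU: "?U \<noteq> {}"
    using fa in_balls_zero[of r n P] assms(7) by (auto simp: tensor_fam_def bounded_fam_def)
  have L2: "L2_set (contract_blocks n P (fst u) (snd u)) (Ix n k) \<le> M / r" if u: "u \<in> ?U" for u
  proof -
    have "r * L2_set (contract_blocks n P (fst u) (snd u)) (Ix n k) \<le> M"
      by (rule L2_contract_blocks_le[OF finP ai(2) dj, of n "partial_mean n P' \<T>"])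
         (use fa u assms(7,8) supf_partial_mean_le[OF assms(1-6)] in \<open>auto simp: tensor_fam_def\<close>)
    then show ?thesis using assms(7) by (simp add: field_simps)
  qed
  have "gauss_width (Ix n k) ((\<lambda>u. contract_blocks n (insert k P - {k}) (fst u) (snd u)) ` ?U) \<le> C * (r * (2 * M / r) + M)"
  proof (rule width_boundD[OF assms(9)])
    show "blocks (insert k P)" by (rule ab)
    show "card (insert k P) = Suc (card P)" using finP ai(2) by simp
    show "tensor_fam n (\<Union>(insert k P)) (partial_mean n P' \<T>)" using fa by (simp add: Un_commute)
    show "norms_le n r (insert k P) (partial_mean n P' \<T>) M" by (rule norms_le_partial_mean[OF assms(1-6)])
    fix u v assume u: "u \<in> ?U" and v: "v \<in> ?U"
    show "rho n k (insert k P - {k}) u v \<le> 2 * M / r"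
    proof -
      have "rho n k P u v \<le> L2_set (contract_blocks n P (fst u) (snd u)) (Ix n k) + L2_set (contract_blocks n P (fst v) (snd v)) (Ix n k)"
        using L2_set_diff_triangle[of "contract_blocks n P (fst u) (snd u)" "contract_blocks n P (fst v) (snd v)" "Ix n k" "\<lambda>_. 0"]
        unfolding rho_def by simp
      then show ?thesis using L2[OF u] L2[OF v] unfolding Pk by simp
    qed
  qed (use assms nU Pk in auto)
  then show ?thesis using assms(7) unfolding Pk contraction_fam_def by simp
qed

text \<open>One term 3 C M for each admissible coarsening, whose number is bounded in terms of the
  number of coordinates.\<close>

lemma gauss_width_dual_fam_le:
  assumes "blocks \<K>" "k \<in> \<K>" "card \<K> \<ge> 2" "tensor_fam n (\<Union>\<K>) \<T>" "norms_le n r \<K> \<T> M" "1 \<le> r" "0 < M"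
    and width_bound: "\<And>d. 1 \<le> d \<Longrightarrow> d < card \<K> \<Longrightarrow> width_bound d C" and "0 \<le> C"
  shows "gauss_width (Ix n k) (dual_fam n r \<K> k \<T>) \<le> 4 ^ (2 ^ card \<K>) * (3 * C * M)"
proof -
  let ?A = "{PP. coarsening (\<K> - {k}) (fst PP) (snd PP) \<and> card (fst PP) < card (\<K> - {k})}"
  have cK: "Suc (card (\<K> - {k})) = card \<K>" by (rule card_Suc_Diff1[OF blocksD(1)[OF assms(1)] assms(2)])
  have fK: "finite (\<K> - {k})" using blocksD(1)[OF assms(1)] by simp
  have "gauss_width (Ix n k) (dual_fam n r \<K> k \<T>) \<le> (\<Sum>PP\<in>?A. gauss_width (Ix n k) (contraction_fam n r (fst PP) (partial_mean n (snd PP) \<T>)))"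
    by (rule dual_fam_facts(3)[OF assms(1-4)]) (use assms(6) in simp)
  also have "\<dots> \<le> (\<Sum>PP\<in>?A. 3 * C * M)"
  proof (rule sum_mono)
    fix PP assume "PP \<in> ?A"
    then have PP: "coarsening (\<K> - {k}) (fst PP) (snd PP)" "card (fst PP) < card (\<K> - {k})" by auto
    show "gauss_width (Ix n k) (contraction_fam n r (fst PP) (partial_mean n (snd PP) \<T>)) \<le> 3 * C * M"
      by (rule gauss_width_contraction_fam_le[OF assms(1,2,4,5) PP assms(6,7) width_bound]) (use PP(2) cK in auto)
  qed
  also have "\<dots> = real (card ?A) * (3 * C * M)" by simp
  also have "\<dots> \<le> 4 ^ (2 ^ card \<K>) * (3 * C * M)"
  proof (rule mult_right_mono)
    have "card ?A \<le> card {PP. coarsening (\<K> - {k}) (fst PP) (snd PP)}"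
      by (rule card_mono[OF coarsening_finite_card(1)[OF fK]]) auto
    also have "\<dots> \<le> 4 ^ (2 ^ card (\<K> - {k}))" by (rule coarsening_finite_card(2)[OF fK])
    also have "\<dots> \<le> 4 ^ (2 ^ card \<K>)" using cK by (intro power_increasing) auto
    finally have "real (card ?A) \<le> real (4 ^ (2 ^ card \<K>))" by (simp only: of_nat_le_iff)
    then show "real (card ?A) \<le> 4 ^ (2 ^ card \<K>)" by simp
  qed (use assms in simp)
  finally show ?thesis .
qed

text \<open>Vectors of length at most \<open>r\<close> satisfy the smallness condition at scale 1;
  this starts both the entropy estimate and the chaining.\<close>

lemma supf_dual_fam_le:
  assumes "blocks \<K>" "k \<in> \<K>" "card \<K> \<ge> 2" "tensor_fam n (\<Union>\<K>) \<T>" "norms_le n r \<K> \<T> M" "1 \<le> r" "L2_set y (Ix n k) \<le> r"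
  shows "supf (Ix n k) (dual_fam n r \<K> k \<T>) y \<le> M"
proof (rule supf_least)
  have r0: "0 \<le> r" using assms(6) by simp
  show "dual_fam n r \<K> k \<T> \<noteq> {}" using dual_fam_facts(1)[OF assms(1-4) r0] by (auto simp: tensor_fam_def bounded_fam_def)
  fix v assume "v \<in> dual_fam n r \<K> k \<T>"
  then obtain P P' x \<theta> where P: "coarsening (\<K> - {k}) P P'" "card P < card (\<K> - {k})" "\<theta> \<in> partial_mean n P' \<T>" "in_balls n r P x" "v = contract_blocks n P x \<theta>"
    unfolding dual_fam_def contraction_fam_def by auto
  note ai = coarsening_insert[OF assms(1,2) P(1)]
  have fK: "finite (\<Union>\<K>)" by (rule blocks_finite_Union[OF assms(1)])
  note ab = coarsening_blocks[OF fK ai(1)]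
  have un: "\<Union>P' \<union> (\<Union>P \<union> k) = \<Union>\<K>" using ab(3) by (simp add: Un_ac)
  have fa: "tensor_fam n (\<Union>P \<union> k) (partial_mean n P' \<T>)"
    by (rule tensor_fam_partial_mean) (use un assms(4) fK ab in auto)
  let ?x = "x(k := y)"
  have "contract_blocks n P ?x \<theta> = contract_blocks n P x \<theta>"
    unfolding contract_blocks_def using ai(2) by (intro contract_cong_left tensor_prod_cong) auto
  then have "lin (Ix n k) v y = lin (Ix n (\<Union>P \<union> k)) \<theta> (tensor_prod (insert k P) ?x)"
    using contract_blocks_lin[of P k n \<theta> ?x] ab(1) ai(2,4) P(5) by (simp add: Int_commute)
  also have "\<dots> \<le> supf (Ix n (\<Union>P \<union> k)) (partial_mean n P' \<T>) (tensor_prod (insert k P) ?x)"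
    by (rule lin_le_supf[OF _ P(3)]) (use fa in \<open>simp add: tensor_fam_def\<close>)
  also have "\<dots> \<le> M"
    by (rule supf_partial_mean_le[OF assms(1,2,4,5) P(1,2)]) (use P(4) assms(7) in \<open>auto simp: in_balls_def\<close>)
  finally show "lin (Ix n k) v y \<le> M" .
qed

section \<open>Entropy numbers\<close>

lemma contract_blocks_insert:
  assumes "finite D" "k \<notin> D" "\<Union>D \<inter> k = {}"
  shows "contract_blocks n (insert k D) x \<tau> = contract_blocks n D x (contract n k (x k) \<tau>)"
    and "contract_blocks n (insert k D) x \<tau> = contract n k (x k) (contract_blocks n D x \<tau>)"
proof -
  have "contract n (k \<union> \<Union>D) (tensor_prod (insert k D) x) \<tau> = contract n (\<Union>D) (tensor_prod D x) (contract n k (x k) \<tau>)"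
  proof (rule contract_contract)
    show "k \<inter> \<Union>D = {}" using assms(3) by (simp add: Int_commute)
    fix i j assume "i \<in> Ix n k"
    then show "tensor_prod (insert k D) x (merge_idx k i j) = x k i * tensor_prod D x j"
      using assms by (simp add: tensor_prod_insert restrict_merge_idx_left restrict_Ix_id tensor_prod_merge_idx_right)
  qed
  then show "contract_blocks n (insert k D) x \<tau> = contract_blocks n D x (contract n k (x k) \<tau>)" by (simp add: contract_blocks_def)
  have "contract n (\<Union>D \<union> k) (tensor_prod (insert k D) x) \<tau> = contract n k (x k) (contract n (\<Union>D) (tensor_prod D x) \<tau>)"
  proof (rule contract_contract[OF assms(3)])
    fix i j assume "j \<in> Ix n k"
    then show "tensor_prod (insert k D) x (merge_idx (\<Union>D) i j) = tensor_prod D x i * x k j"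
      using assms by (simp add: tensor_prod_insert restrict_merge_idx_right restrict_Ix_id tensor_prod_merge_idx_left Int_commute)
  qed
  then show "contract_blocks n (insert k D) x \<tau> = contract n k (x k) (contract_blocks n D x \<tau>)" by (simp add: contract_blocks_def Un_commute)
qed

lemma contract_blocks_cong: "(\<And>B. B \<in> D \<Longrightarrow> x B = y B) \<Longrightarrow> contract_blocks n D x \<tau> = contract_blocks n D y \<tau>"
  unfolding contract_blocks_def by (intro contract_cong_left tensor_prod_cong) simp

lemma contract_blocks_contract_commute:
  assumes "finite D" "k \<notin> D" "\<Union>D \<inter> k = {}"
  shows "contract_blocks n D x (contract n k y \<tau>) = contract n k y (contract_blocks n D x \<tau>)"
proof -
  have e: "contract_blocks n D (x(k := y)) \<sigma> = contract_blocks n D x \<sigma>" for \<sigma> by (rule contract_blocks_cong) (use assms(2) in auto)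
  show ?thesis using contract_blocks_insert[OF assms, of n "x(k := y)" \<tau>] unfolding e by simp
qed

lemma L2_Ix_Un:
  assumes "finite K" "finite L" "K \<inter> L = {}"
  shows "(L2_set w (Ix n (K \<union> L)))\<^sup>2 = (\<Sum>i\<in>Ix n K. \<Sum>j\<in>Ix n L. (w (merge_idx K i j))\<^sup>2)"
  unfolding L2_set_power2 by (rule sum_Ix_split[OF assms(3)])

text \<open>The support function at \<open>y\<close> is the Hilbert--Schmidt norm of \<open>w\<close> contracted with \<open>y\<close>.\<close>

definition HS_fam :: "nat \<Rightarrow> nat set \<Rightarrow> nat set \<Rightarrow> ten \<Rightarrow> ten set" where
  "HS_fam n k b w = (\<lambda>z i. \<Sum>j\<in>Ix n b. z j * w (merge_idx k i j)) ` {z. L2_set z (Ix n b) \<le> 1}"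

lemma HS_fam_facts:
  assumes "finite k" "finite b" "k \<inter> b = {}"
  shows "tensor_fam n k (HS_fam n k b w)" "gauss_width (Ix n k) (HS_fam n k b w) \<le> L2_set w (Ix n (k \<union> b))"
    and "L2_set (contract n k y w) (Ix n b) \<le> supf (Ix n k) (HS_fam n k b w) y"
proof -
  have ne: "HS_fam n k b w \<noteq> {}" unfolding HS_fam_def by (auto intro!: exI[of _ "\<lambda>_. 0"])
  have ex: "\<exists>z. L2_set z (Ix n b) \<le> 1 \<and> (\<forall>i\<in>Ix n k. v i = (\<Sum>j\<in>Ix n b. z j * w (merge_idx k i j)))" if "v \<in> HS_fam n k b w" for v
    using that unfolding HS_fam_def by auto
  note hs = gauss_width_le_HS[where c="\<lambda>j i. w (merge_idx k i j)", OF finite_Ix[OF assms(1)] finite_Ix[OF assms(2)] ne ex]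
  have sy: "sym_fam (HS_fam n k b w)" unfolding sym_fam_def
  proof
    fix v assume "v \<in> HS_fam n k b w"
    then obtain z where z: "L2_set z (Ix n b) \<le> 1" "v = (\<lambda>i. \<Sum>j\<in>Ix n b. z j * w (merge_idx k i j))" unfolding HS_fam_def by auto
    have "(\<lambda>i. - v i) = (\<lambda>i. \<Sum>j\<in>Ix n b. (- z j) * w (merge_idx k i j))" by (simp add: z(2) sum_negf)
    then show "(\<lambda>i. - v i) \<in> HS_fam n k b w" unfolding HS_fam_def
      by (intro image_eqI[of _ _ "\<lambda>j. - z j"]) (use z(1) in auto)
  qed
  show F: "tensor_fam n k (HS_fam n k b w)" using hs(1) sy by (simp add: tensor_fam_def)
  have "(\<Sum>j\<in>Ix n b. \<Sum>i\<in>Ix n k. (w (merge_idx k i j))\<^sup>2) = (L2_set w (Ix n (k \<union> b)))\<^sup>2"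
    unfolding L2_Ix_Un[OF assms] by (rule sum.swap)
  then show "gauss_width (Ix n k) (HS_fam n k b w) \<le> L2_set w (Ix n (k \<union> b))" using hs(2) by simp
  let ?c = "contract n k y w" let ?l = "L2_set ?c (Ix n b)"
  show "?l \<le> supf (Ix n k) (HS_fam n k b w) y"
  proof (cases "?l = 0")
    case True
    then show ?thesis using supf_nonneg[of "Ix n k" "HS_fam n k b w" y] F by (simp add: tensor_fam_def)
  next
    case False
    then have l: "?l > 0" using L2_set_nonneg[of ?c "Ix n b"] by linarith
    let ?z = "\<lambda>j. (1 / ?l) * ?c j"
    have z: "L2_set ?z (Ix n b) = 1" unfolding L2_set_cmult using l by simp
    let ?v = "\<lambda>i. \<Sum>j\<in>Ix n b. ?z j * w (merge_idx k i j)"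
    have "?v \<in> HS_fam n k b w" unfolding HS_fam_def using z by (intro imageI) simp
    then have "lin (Ix n k) ?v y \<le> supf (Ix n k) (HS_fam n k b w) y" using F by (intro lin_le_supf) (auto simp: tensor_fam_def)
    moreover have "lin (Ix n k) ?v y = lin (Ix n b) ?z ?c"
    proof -
      have "lin (Ix n k) ?v y = (\<Sum>i\<in>Ix n k. \<Sum>j\<in>Ix n b. ?z j * (w (merge_idx k i j) * y i))"
        unfolding lin_def sum_distrib_right by (intro sum.cong refl) (simp add: mult.assoc)
      also have "\<dots> = (\<Sum>j\<in>Ix n b. \<Sum>i\<in>Ix n k. ?z j * (w (merge_idx k i j) * y i))" by (rule sum.swap)
      also have "\<dots> = lin (Ix n b) ?z ?c" by (simp add: lin_def contract_def sum_distrib_left)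
      finally show ?thesis .
    qed
    moreover have "lin (Ix n b) ?z ?c = (1 / ?l) * ?l\<^sup>2" by (simp only: lin_cmult_left lin_self)
    moreover have "(1 / ?l) * ?l\<^sup>2 = ?l" using l by (simp add: power2_eq_square)
    ultimately show ?thesis by linarith
  qed
qed

lemma scaled_facts:
  assumes "finite k" "tensor_fam n k V" "c > 0"
  shows "tensor_fam n k ((\<lambda>v i. c * v i) ` V)" "gauss_width (Ix n k) ((\<lambda>v i. c * v i) ` V) \<le> c * gauss_width (Ix n k) V"
    and "c * supf (Ix n k) V y \<le> supf (Ix n k) ((\<lambda>v i. c * v i) ` V) y"
proof -
  let ?V = "(\<lambda>v i. c * v i) ` V"
  obtain R where R: "\<forall>v\<in>V. \<forall>i\<in>Ix n k. \<bar>v i\<bar> \<le> R" and ne: "V \<noteq> {}" and sy: "sym_fam V" and bV: "bounded_fam (Ix n k) V"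
    using assms(2) unfolding tensor_fam_def bounded_fam_def by blast
  have "\<forall>v\<in>?V. \<forall>i\<in>Ix n k. \<bar>v i\<bar> \<le> c * R" using R assms(3) by (auto simp: abs_mult)
  then have b: "bounded_fam (Ix n k) ?V" unfolding bounded_fam_def using ne by (intro conjI exI) simp_all
  have "sym_fam ?V" unfolding sym_fam_def
  proof
    fix v assume "v \<in> ?V"
    then obtain w where w: "w \<in> V" "v = (\<lambda>i. c * w i)" by auto
    then have "(\<lambda>i. - w i) \<in> V" using sy by (auto simp: sym_fam_def)
    then show "(\<lambda>i. - v i) \<in> ?V" by (rule image_eqI[rotated]) (simp add: w(2))
  qed
  then show f: "tensor_fam n k ?V" using b by (simp add: tensor_fam_def)
  have le: "supf (Ix n k) ?V g \<le> c * supf (Ix n k) V g" for g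
  proof (rule supf_least)
    show "?V \<noteq> {}" using ne by simp
    fix v assume "v \<in> ?V"
    then obtain w where w: "w \<in> V" "v = (\<lambda>i. c * w i)" by auto
    then show "lin (Ix n k) v g \<le> c * supf (Ix n k) V g"
      using lin_le_supf[OF bV w(1), of g] assms(3) by (simp add: lin_cmult_left)
  qed
  have "gauss_width (Ix n k) ?V \<le> (\<integral>g. c * supf (Ix n k) V g \<partial>gauss (Ix n k))"
    unfolding gauss_width_def
  proof (rule integral_mono)
    show "integrable (gauss (Ix n k)) (supf (Ix n k) ?V)" by (rule supf_gauss_integrable[OF finite_Ix[OF assms(1)] b])
    show "integrable (gauss (Ix n k)) (\<lambda>g. c * supf (Ix n k) V g)"
      by (rule integrable_mult_right) (rule supf_gauss_integrable[OF finite_Ix[OF assms(1)] bV])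
  qed (rule le)
  then show "gauss_width (Ix n k) ?V \<le> c * gauss_width (Ix n k) V" by (simp add: gauss_width_def)
  have "supf (Ix n k) V y \<le> supf (Ix n k) ?V y / c"
  proof (rule supf_least[OF ne])
    fix w assume "w \<in> V"
    then have "lin (Ix n k) (\<lambda>i. c * w i) y \<le> supf (Ix n k) ?V y" by (intro lin_le_supf[OF b]) auto
    then show "lin (Ix n k) w y \<le> supf (Ix n k) ?V y / c" using assms(3) by (simp add: lin_cmult_left field_simps)
  qed
  then show "c * supf (Ix n k) V y \<le> supf (Ix n k) ?V y" using assms(3) by (simp add: field_simps)
qed

text \<open>Merging \<open>k\<close> and \<open>b\<close> into one deterministic block gives a
  coarsening with one block fewer than coordinates and no Gaussian block. Its norm, tested by
  duality, is the Hilbert--Schmidt norm in the two merged coordinates.\<close>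

lemma HS_le:
  assumes "blocks \<K>" "b \<in> \<K>" "k \<in> \<K>" "b \<noteq> k" "tensor_fam n (\<Union>\<K>) \<T>" "norms_le n r \<K> \<T> M" "1 \<le> r" "0 \<le> M"
    and "\<tau> \<in> \<T>" "in_balls n r (\<K> - {b, k}) x"
  shows "r * L2_set (contract_blocks n (\<K> - {b, k}) x \<tau>) (Ix n (k \<union> b)) \<le> M"
proof -
  let ?P = "\<K> - {b, k}"
  have fP: "finite ?P" using blocksD(1)[OF assms(1)] by simp
  have dj: "\<Union>?P \<inter> (k \<union> b) = {}"
    using blocks_disjoint[OF assms(1), of ?P "{b, k}"] assms(2,3) by (simp add: Int_Un_distrib Un_commute)
  have un: "\<Union>?P \<union> (k \<union> b) = \<Union>\<K>" using assms(2,3) by blast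
  have ne: "k \<union> b \<noteq> {}" using blocksD(3)[OF assms(1,2)] by simp
  have kP: "k \<union> b \<notin> ?P"
  proof
    assume "k \<union> b \<in> ?P"
    then have "k \<union> b \<subseteq> \<Union>?P" by (rule Union_upper)
    then show False using dj ne by (simp add: Int_absorb1)
  qed
  have a: "coarsening \<K> (insert (k \<union> b) ?P) {}"
    unfolding coarsening_def
  proof (intro conjI ballI)
    show "partition_on (\<Union>\<K>) (insert (k \<union> b) ?P \<union> {})"
      unfolding partition_on_def
    proof (intro conjI)
      show "\<Union>(insert (k \<union> b) ?P \<union> {}) = \<Union>\<K>" using un by (simp add: Un_commute)
      show "disjoint (insert (k \<union> b) ?P \<union> {})"
      proof (rule disjointI)
        fix B C assume BC: "B \<in> insert (k \<union> b) ?P \<union> {}" "C \<in> insert (k \<union> b) ?P \<union> {}" "B \<noteq> C"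
        have d1: "B \<inter> (k \<union> b) = {}" if "B \<in> ?P" for B
          using dj Union_upper[OF that] by (simp add: disjoint_iff subset_iff)
        consider "B = k \<union> b" "C \<in> ?P" | "C = k \<union> b" "B \<in> ?P" | "B \<in> ?P" "C \<in> ?P" using BC by auto
        then show "B \<inter> C = {}"
        proof cases
          case 1 then show ?thesis using d1[of C] by (simp only: Int_commute)
        next
          case 2 then show ?thesis using d1[of B] by simp
        next
          case 3 then show ?thesis using blocksD(4)[OF assms(1) _ _ BC(3)] by simp
        qed
      qed
      show "{} \<notin> insert (k \<union> b) ?P \<union> {}" using ne blocksD(3)[OF assms(1)] by auto
    qed
    show "insert (k \<union> b) ?P \<inter> {} = {}" by simp
    fix l assume "l \<in> \<K>"
    then show "\<exists>B\<in>insert (k \<union> b) ?P \<union> {}. l \<subseteq> B" by (cases "l = b \<or> l = k") auto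
  qed
  have c: "card (insert (k \<union> b) ?P) < card \<K>"
  proof -
    have "card ?P = card \<K> - 2" using blocksD(1)[OF assms(1)] assms(2-4) by (subst card_Diff_subset) auto
    moreover have "2 \<le> card \<K>"
      using card_mono[OF blocksD(1)[OF assms(1)], of "{b, k}"] assms(2-4) by simp
    ultimately show ?thesis using fP kP by simp
  qed
  show ?thesis
  proof (rule L2_contract_blocks_le[OF fP kP dj, of n \<T>])
    show "bounded_fam (Ix n (\<Union>?P \<union> (k \<union> b))) \<T>" unfolding un using assms(5) by (simp add: tensor_fam_def)
    fix x' assume x': "in_balls n r (insert (k \<union> b) ?P) x'"
    have "mean_sup n {} (\<Union>\<K>) \<T> (tensor_prod (insert (k \<union> b) ?P) x') \<le> M" by (rule norms_leD[OF assms(6) a c x'])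
    then show "supf (Ix n (\<Union>?P \<union> (k \<union> b))) \<T> (tensor_prod (insert (k \<union> b) ?P) x') \<le> M" unfolding un mean_sup_empty .
  qed (use assms in auto)
qed

lemma few_classes_vimage: "few_classes (h ` U) R K \<Longrightarrow> few_classes U (\<lambda>u v. R (h u) (h v)) K"
proof -
  assume "few_classes (h ` U) R K"
  then obtain f :: "_ \<Rightarrow> nat" where "finite (f ` h ` U)" "real (card (f ` h ` U)) \<le> K"
    "\<forall>u\<in>h ` U. \<forall>v\<in>h ` U. f u = f v \<longrightarrow> R u v" unfolding few_classes_def by blast
  then show ?thesis unfolding few_classes_def by (intro exI[of _ "\<lambda>u. f (h u)"]) (auto simp: image_image)
qed

text \<open>Sudakov's estimate for a family of width M has, at radius delta M / r, an exponent of
  order (r/delta)^2; the definition asks for the same in every order. One constant in both places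
  keeps the induction simple.\<close>

definition entropy_bound :: "nat \<Rightarrow> real \<Rightarrow> bool" where
  "entropy_bound d C \<longleftrightarrow> (\<forall>n r \<K> b \<T> M \<delta> U.
     blocks \<K> \<longrightarrow> card \<K> = d \<longrightarrow> b \<in> \<K> \<longrightarrow> tensor_fam n (\<Union>\<K>) \<T> \<longrightarrow> 1 \<le> r \<longrightarrow> 0 < M \<longrightarrow> norms_le n r \<K> \<T> M \<longrightarrow>
     0 < \<delta> \<longrightarrow> \<delta> \<le> 1 \<longrightarrow> (\<forall>u\<in>U. snd u \<in> \<T> \<and> in_balls n r (\<K> - {b}) (fst u)) \<longrightarrow>
     few_classes U (\<lambda>u v. rho n b (\<K> - {b}) u v \<le> C * \<delta> * M / r) (exp (C * (r / \<delta>)\<^sup>2)))"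

lemma entropy_boundD:
  assumes "entropy_bound d C" "blocks \<K>" "card \<K> = d" "b \<in> \<K>" "tensor_fam n (\<Union>\<K>) \<T>" "1 \<le> r" "0 < M" "norms_le n r \<K> \<T> M"
    and "0 < \<delta>" "\<delta> \<le> 1" "\<And>u. u \<in> U \<Longrightarrow> snd u \<in> \<T>" "\<And>u. u \<in> U \<Longrightarrow> in_balls n r (\<K> - {b}) (fst u)"
  shows "few_classes U (\<lambda>u v. rho n b (\<K> - {b}) u v \<le> C * \<delta> * M / r) (exp (C * (r / \<delta>)\<^sup>2))"
proof -
  have 1: "\<forall>u\<in>U. snd u \<in> \<T> \<and> in_balls n r (\<K> - {b}) (fst u)" using assms(11,12) by simp
  note * = assms(1)[unfolded entropy_bound_def, THEN spec[of _ n], THEN spec[of _ r], THEN spec[of _ \<K>], THEN spec[of _ b],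
      THEN spec[of _ \<T>], THEN spec[of _ M], THEN spec[of _ \<delta>], THEN spec[of _ U]]
  show ?thesis
    using *[THEN mp, OF assms(2), THEN mp, OF assms(3), THEN mp, OF assms(4), THEN mp, OF assms(5), THEN mp, OF assms(6),
        THEN mp, OF assms(7), THEN mp, OF assms(8), THEN mp, OF assms(9), THEN mp, OF assms(10), THEN mp, OF 1] .
qed

text \<open>For a single coordinate the points are members of the family, whose width is at most M,
  and Sudakov's minoration applies at radius delta M / r.\<close>

lemma entropy_bound_1: "entropy_bound 1 180224"
  unfolding entropy_bound_def
proof (intro allI impI)
  fix n r \<K> b \<T> M and \<delta> :: real and U :: "((nat set \<Rightarrow> ten) \<times> ten) set"
  assume a: "blocks \<K>" "card \<K> = 1" "b \<in> \<K>" "tensor_fam n (\<Union>\<K>) \<T>" "1 \<le> r" "0 < M" "norms_le n r \<K> \<T> M" "0 < \<delta>" "\<delta> \<le> 1"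
    "\<forall>u\<in>U. snd u \<in> \<T> \<and> in_balls n r (\<K> - {b}) (fst u)"
  have K: "\<K> = {b}" using a(2,3) by (auto simp: card_1_singleton_iff)
  have fb: "finite b" using blocksD(2)[OF a(1,3)] .
  have bounded_contractions: "bounded_fam (Ix n b) \<T>" "sym_fam \<T>" using a(4) by (auto simp: tensor_fam_def K)
  have "gauss_width (Ix n b) \<T> = mean_sup n {b} (\<Union>\<K>) \<T> (tensor_prod {} (\<lambda>_ _. 0))"
    using mean_sup_single[OF fb bounded_contractions(1)] by (simp add: K tensor_prod_def[abs_def])
  also have "\<dots> \<le> M"
    by (rule norms_leD[OF a(7)]) (use coarsening_singletons[OF a(1)] in \<open>auto simp: K in_balls_def\<close>)
  finally have w: "gauss_width (Ix n b) \<T> \<le> M" .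
  have e: "0 < \<delta> * M / r" using a by simp
  have c: "few_classes \<T> (\<lambda>t s. L2_set (\<lambda>i. t i - s i) (Ix n b) \<le> \<delta> * M / r) (exp (180224 * M\<^sup>2 / (\<delta> * M / r)\<^sup>2))"
    by (rule Sudakov[OF finite_Ix[OF fb] bounded_contractions w a(6) e])
  have e2: "180224 * M\<^sup>2 / (\<delta> * M / r)\<^sup>2 = 180224 * (r / \<delta>)\<^sup>2"
    using a by (simp add: power_divide power_mult_distrib)
  have "few_classes (snd ` U) (\<lambda>t s. L2_set (\<lambda>i. t i - s i) (Ix n b) \<le> \<delta> * M / r) (exp (180224 * M\<^sup>2 / (\<delta> * M / r)\<^sup>2))"
    by (rule few_classes_mono[OF c]) (use a(10) in auto)
  from few_classes_vimage[OF this] show "few_classes U (\<lambda>u v. rho n b (\<K> - {b}) u v \<le> 180224 * \<delta> * M / r) (exp (180224 * (r / \<delta>)\<^sup>2))"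
    unfolding e2
  proof (rule few_classes_mono)
    have le: "\<delta> * M / r \<le> 180224 * \<delta> * M / r" using a(5,6,8) by (simp add: field_simps)
    fix u v :: "(nat set \<Rightarrow> ten) \<times> ten"
    assume "L2_set (\<lambda>i. snd u i - snd v i) (Ix n b) \<le> \<delta> * M / r"
    then show "rho n b (\<K> - {b}) u v \<le> 180224 * \<delta> * M / r"
      using le by (simp add: rho_def K contract_blocks_empty)
  qed auto
qed

lemma rho_commute: "rho n b D u v = rho n b D v u"
  unfolding rho_def by (rule L2_set_diff_commute)

lemma rho_self: "rho n b D u u = 0" by (simp add: rho_def)

lemma rho_triangle: "rho n b D u w \<le> rho n b D u v + rho n b D v w"
  unfolding rho_def by (rule L2_set_diff_triangle)

lemma tensor_fam_Un_gauss_width: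
  assumes "finite k" "tensor_fam n k V" "tensor_fam n k V'"
  shows "tensor_fam n k (V \<union> V')" "gauss_width (Ix n k) (V \<union> V') \<le> gauss_width (Ix n k) V + gauss_width (Ix n k) V'"
proof -
  have e: "V \<union> V' = (\<Union>a\<in>{True, False}. if a then V else V')" by auto
  have f: "tensor_fam n k (if a then V else V')" for a using assms by simp
  show "tensor_fam n k (V \<union> V')" unfolding e by (rule tensor_fam_UN) (use f in auto)
  show "gauss_width (Ix n k) (V \<union> V') \<le> gauss_width (Ix n k) V + gauss_width (Ix n k) V'"
    unfolding e using gauss_width_UN_sum[OF assms(1), of "{True, False}" n "\<lambda>a. if a then V else V'"] f by simp
qed

text \<open>One smoothing step: \<open>common_point\<close> replaces the \<open>k\<close>-th coordinate of many points by a single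
  vector \<open>y\<close>, after which they only differ in a tensor of lower order.\<close>

lemma entropy_bound_step:
  fixes C1 C2 :: real
  assumes K: "blocks \<K>" "card \<K> = Suc d" "1 \<le> d" "b \<in> \<K>" "k \<in> \<K>" "b \<noteq> k" "tensor_fam n (\<Union>\<K>) \<T>" "1 \<le> r"
    and M: "0 < M" and \<delta>: "0 < \<delta>" "\<delta> \<le> 1" and \<kappa>: "0 < \<kappa>"
    and U: "\<And>u. u \<in> U \<Longrightarrow> snd u \<in> \<T>" "\<And>u. u \<in> U \<Longrightarrow> in_balls n r (\<K> - {b}) (fst u)"
    and hV: "\<And>u. u \<in> U \<Longrightarrow> supf (Ix n k) (dual_fam n r \<K> k \<T>) (fst u k) \<le> \<kappa>"
    and hH: "\<And>u. u \<in> U \<Longrightarrow> r * L2_set (contract_blocks n (\<K> - {b, k}) (fst u) (snd u)) (Ix n (k \<union> b)) \<le> \<kappa>"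
    and C1: "0 < C1" "gauss_width (Ix n k) (dual_fam n r \<K> k \<T>) \<le> C1 * M" and C2: "0 \<le> C2" "entropy_bound d C2"
  shows "few_classes U (\<lambda>u v. rho n b (\<K> - {b}) u v \<le> (32 + 2 * C2 * (1 + 8 * C1)) * \<delta> * (\<kappa> + \<delta> * M) / r)
    (exp ((C2 + 2) * (r / \<delta>)\<^sup>2))"
proof -
  let ?D = "\<K> - {b, k}"
  have D: "finite ?D" "k \<notin> ?D" "insert k ?D = \<K> - {b}" "\<K> - {k} - {b} = ?D"
    using blocksD(1)[OF K(1)] K(5,6) by auto
  have D_coord: "\<Union>?D \<inter> k = {}" using blocks_disjoint[OF K(1), of ?D "{k}"] K(5) by simp
  have kb: "k \<inter> b = {}" by (rule blocksD(4)[OF K(1,5,4)]) (use K(6) in simp)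
  have fk: "finite k" "finite b" by (rule blocksD(2)[OF K(1)], fact)+
  have r0: "0 \<le> r" "0 < r" using K(8) by auto
  have c2: "2 \<le> card \<K>" using K(2,3) by simp
  note vf = dual_fam_facts(1,2)[OF K(1,5) c2 K(7) r0(1)]
  let ?dual_fam = "dual_fam n r \<K> k \<T>"
  let ?w = "\<lambda>u. contract_blocks n ?D (fst u) (snd u)"
  let ?H = "\<lambda>u. HS_fam n k b (?w u)"
  \<comment> \<open>Scaled so that each of the two families has width at most 1/2. One common point
    for their union then controls two things at once: the mixed norms after the \<open>k\<close>-th
    vector is replaced, and the Hilbert--Schmidt error of the replacement.\<close>
  let ?c1 = "1 / (2 * C1 * M)" and ?c2 = "r / (2 * \<kappa>)"
  have c12: "?c1 > 0" "?c2 > 0" using C1 M r0 \<kappa> by auto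
  define V where "V = (\<lambda>u. (\<lambda>v i. ?c1 * v i) ` ?dual_fam \<union> (\<lambda>v i. ?c2 * v i) ` ?H u)"
  note s1 = scaled_facts[OF fk(1) vf(1) c12(1)]
  have s2: "tensor_fam n k ((\<lambda>v i. ?c2 * v i) ` ?H u)" "gauss_width (Ix n k) ((\<lambda>v i. ?c2 * v i) ` ?H u) \<le> ?c2 * gauss_width (Ix n k) (?H u)"
    "?c2 * supf (Ix n k) (?H u) y \<le> supf (Ix n k) ((\<lambda>v i. ?c2 * v i) ` ?H u) y" for u y
    by (rule scaled_facts[OF fk(1) HS_fam_facts(1)[OF fk kb] c12(2)])+
  have fV: "tensor_fam n k (V u)" for u unfolding V_def by (rule tensor_fam_Un_gauss_width(1)[OF fk(1) s1(1) s2(1)])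
  have wV: "gauss_width (Ix n k) (V u) \<le> 1" if u: "u \<in> U" for u
  proof -
    have "gauss_width (Ix n k) (V u) \<le> ?c1 * gauss_width (Ix n k) ?dual_fam + ?c2 * gauss_width (Ix n k) (?H u)"
      using tensor_fam_Un_gauss_width(2)[OF fk(1) s1(1) s2(1)[of u]] s1(2) s2(2)[of u] unfolding V_def by linarith
    also have "\<dots> \<le> ?c1 * (C1 * M) + ?c2 * (\<kappa> / r)"
    proof (intro add_mono mult_left_mono)
      have "gauss_width (Ix n k) (?H u) \<le> L2_set (?w u) (Ix n (k \<union> b))" by (rule HS_fam_facts(2)[OF fk kb])
      also have "\<dots> \<le> \<kappa> / r" using hH[OF u] r0 by (simp add: field_simps)
      finally show "gauss_width (Ix n k) (?H u) \<le> \<kappa> / r" .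
    qed (use c12 C1 in auto)
    also have "\<dots> = 1" using C1 M r0 \<kappa> by (simp add: field_simps)
    finally show ?thesis .
  qed
  \<comment> \<open>Bound for the mixed norms of the tensors contracted with \<open>y\<close>: kappa
    comes from the replaced vector, the rest from its distance to \<open>y\<close>.\<close>
  let ?M' = "\<kappa> + 8 * C1 * M * \<delta>"
  have M'0: "0 < ?M'" using \<kappa> C1 M \<delta> by (simp add: add_pos_nonneg)
  define \<eta> where "\<eta> = 16 * \<delta> * \<kappa> / r + C2 * \<delta> * ?M' / r"
  let ?R = "\<lambda>u v. rho n b (\<K> - {b}) u v \<le> \<eta>"
  have \<eta>0: "0 \<le> \<eta>" unfolding \<eta>_def using \<delta> \<kappa> r0 C2 M'0 by simp
  let ?S = "\<lambda>y. {u\<in>U. supf (Ix n k) (V u) (\<lambda>i. y i - fst u k i) \<le> 4 * \<delta> * 1}"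
  have cov: "few_classes (?S y) ?R (exp (C2 * (r / \<delta>)\<^sup>2))" for y
  proof (cases "?S y = {}")
    case True
    show ?thesis unfolding True by (rule few_classes_trivial) (use C2 in auto)
  next
    case False
    have sV: "supf (Ix n k) ?dual_fam (\<lambda>i. y i - fst u k i) \<le> 8 * C1 * M * \<delta>"
      and sH: "supf (Ix n k) (?H u) (\<lambda>i. y i - fst u k i) \<le> 8 * \<delta> * \<kappa> / r" if u: "u \<in> ?S y" for u
    proof -
      let ?z = "\<lambda>i. y i - fst u k i"
      have bV: "bounded_fam (Ix n k) (V u)" using fV by (simp add: tensor_fam_def)
      have m1: "supf (Ix n k) ((\<lambda>v i. ?c1 * v i) ` ?dual_fam) ?z \<le> supf (Ix n k) (V u) ?z"
        by (rule supf_mono[OF bV]) (use s1(1) in \<open>auto simp: V_def tensor_fam_def bounded_fam_def\<close>)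
      have m2: "supf (Ix n k) ((\<lambda>v i. ?c2 * v i) ` ?H u) ?z \<le> supf (Ix n k) (V u) ?z"
        by (rule supf_mono[OF bV]) (use s2(1)[of u] in \<open>auto simp: V_def tensor_fam_def bounded_fam_def\<close>)
      have "?c1 * supf (Ix n k) ?dual_fam ?z \<le> 4 * \<delta>" using s1(3)[of ?z] m1 u by simp
      then show "supf (Ix n k) ?dual_fam ?z \<le> 8 * C1 * M * \<delta>" using C1 M by (simp add: field_simps)
      have "?c2 * supf (Ix n k) (?H u) ?z \<le> 4 * \<delta>" using s2(3)[of u ?z] m2 u by simp
      then show "supf (Ix n k) (?H u) ?z \<le> 8 * \<delta> * \<kappa> / r" using r0 \<kappa> by (simp add: field_simps)
    qed
    obtain u0 where u0: "u0 \<in> ?S y" using False by blast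
    then have u0U: "u0 \<in> U" by simp
    have "supf (Ix n k) ?dual_fam y \<le> supf (Ix n k) ?dual_fam (fst u0 k) + supf (Ix n k) ?dual_fam (\<lambda>i. y i - fst u0 k i)"
      using supf_add[of "Ix n k" ?dual_fam "fst u0 k" "\<lambda>i. y i - fst u0 k i"] vf(1) by (simp add: tensor_fam_def)
    then have "supf (Ix n k) ?dual_fam y \<le> ?M'" using hV[OF u0U] sV[OF u0] by linarith
    from vf(2)[OF this] have B: "norms_le n r (\<K> - {k}) (contract n k y ` \<T>) ?M'" .
    let ?h = "\<lambda>u. (fst u, contract n k y (snd u))"
    have "few_classes (?h ` ?S y) (\<lambda>u v. rho n b (\<K> - {k} - {b}) u v \<le> C2 * \<delta> * ?M' / r) (exp (C2 * (r / \<delta>)\<^sup>2))"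
    proof (rule entropy_boundD[OF C2(2) _ _ _ _ K(8) M'0 B \<delta>])
      show "blocks (\<K> - {k})" by (rule blocks_subset[OF K(1) Diff_subset])
      show "card (\<K> - {k}) = d" using blocksD(1)[OF K(1)] K(2,5) by simp
      show "b \<in> \<K> - {k}" using K(4,6) by simp
      show "tensor_fam n (\<Union>(\<K> - {k})) (contract n k y ` \<T>)"
        by (rule tensor_fam_contract) (use K(7) blocks_disjoint_single[OF K(1,5)] in auto)
      fix u assume "u \<in> ?h ` ?S y"
      then obtain v where v: "v \<in> U" "u = ?h v" by auto
      then show "snd u \<in> contract n k y ` \<T>" using U(1) by simp
      show "in_balls n r (\<K> - {k} - {b}) (fst u)" using U(2)[OF v(1)] v(2) by (auto simp: in_balls_def)
    qed
    from few_classes_vimage[OF this] show ?thesis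
    proof (rule few_classes_mono)
      fix u v assume u: "u \<in> ?S y" and v: "v \<in> ?S y" and le: "rho n b (\<K> - {k} - {b}) (?h u) (?h v) \<le> C2 * \<delta> * ?M' / r"
      let ?f = "\<lambda>u. contract_blocks n (\<K> - {b}) (fst u) (snd u)" and ?g = "\<lambda>u. contract_blocks n ?D (fst u) (contract n k y (snd u))"
      \<comment> \<open>The replacement error is, up to sign, the contraction of \<open>?w u\<close>
        with \<open>y\<close> minus the old vector; the Hilbert--Schmidt family of
        \<open>?w u\<close> was included to bound it.\<close>
      have e: "L2_set (\<lambda>j. ?f u j - ?g u j) (Ix n b) \<le> 8 * \<delta> * \<kappa> / r" if u: "u \<in> ?S y" for u
      proof -
        have "?f u j - ?g u j = - contract n k (\<lambda>i. y i - fst u k i) (?w u) j" for j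
          unfolding D(3)[symmetric] contract_blocks_insert(2)[OF D(1,2) D_coord] contract_blocks_contract_commute[OF D(1,2) D_coord] contract_diff_left
          by simp
        then have "L2_set (\<lambda>j. ?f u j - ?g u j) (Ix n b) = L2_set (contract n k (\<lambda>i. y i - fst u k i) (?w u)) (Ix n b)"
          by simp
        also have "\<dots> \<le> supf (Ix n k) (?H u) (\<lambda>i. y i - fst u k i)" by (rule HS_fam_facts(3)[OF fk kb])
        also have "\<dots> \<le> 8 * \<delta> * \<kappa> / r" by (rule sH[OF u])
        finally show ?thesis .
      qed
      have g: "L2_set (\<lambda>j. ?g u j - ?g v j) (Ix n b) \<le> C2 * \<delta> * ?M' / r"
        using le unfolding rho_def D(4) by simp
      have "rho n b (\<K> - {b}) u v = L2_set (\<lambda>j. ?f u j - ?f v j) (Ix n b)" by (simp add: rho_def)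
      also have "\<dots> \<le> L2_set (\<lambda>j. ?f u j - ?g u j) (Ix n b) + L2_set (\<lambda>j. ?g u j - ?f v j) (Ix n b)"
        by (rule L2_set_diff_triangle)
      also have "L2_set (\<lambda>j. ?g u j - ?f v j) (Ix n b) \<le> L2_set (\<lambda>j. ?g u j - ?g v j) (Ix n b) + L2_set (\<lambda>j. ?g v j - ?f v j) (Ix n b)"
        by (rule L2_set_diff_triangle)
      also have "L2_set (\<lambda>j. ?g v j - ?f v j) (Ix n b) = L2_set (\<lambda>j. ?f v j - ?g v j) (Ix n b)"
        by (rule L2_set_diff_commute)
      finally have "rho n b (\<K> - {b}) u v \<le> 8 * \<delta> * \<kappa> / r + (C2 * \<delta> * ?M' / r + 8 * \<delta> * \<kappa> / r)"
        using e[OF u] e[OF v] g by linarith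
      then show "rho n b (\<K> - {b}) u v \<le> \<eta>" unfolding \<eta>_def by simp
    qed auto
  qed
  have "few_classes U (\<lambda>u v. \<exists>c\<in>U. ?R u c \<and> ?R v c) (4/3 * exp (r\<^sup>2 / (2 * \<delta>\<^sup>2)) * exp (C2 * (r / \<delta>)\<^sup>2))"
  proof (rule few_classes_smoothing[where x="\<lambda>u. fst u k" and V=V and \<kappa>=1 and \<delta>=\<delta> and I="Ix n k"])
    show "few_classes (?S y) ?R (exp (C2 * (r / \<delta>)\<^sup>2))" for y by (rule cov)
    show "L2_set (fst u k) (Ix n k) \<le> r" if "u \<in> U" for u
      using U(2)[OF that] K(5,6) by (simp add: in_balls_def)
    show "?R v u" if "?R u v" for u v using that by (simp add: rho_commute)
  qed (use fk fV wV \<delta> \<eta>0 in \<open>auto simp: tensor_fam_def rho_self\<close>)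
  then show ?thesis
  proof (rule few_classes_mono)
    \<comment> \<open>As r / delta is at least 1, the factor 4/3 and the loss from smoothing fit
      into one factor exp ((r/delta)^2) each.\<close>
    show "4/3 * exp (r\<^sup>2 / (2 * \<delta>\<^sup>2)) * exp (C2 * (r / \<delta>)\<^sup>2) \<le> exp ((C2 + 2) * (r / \<delta>)\<^sup>2)"
    proof -
      have "1 \<le> r / \<delta>" using K(8) \<delta> by simp
      then have q1: "1 \<le> (r / \<delta>)\<^sup>2" by simp
      have "(4/3::real) \<le> exp 1" using exp_ge_add_one_self[of "1::real"] by simp
      also have "\<dots> \<le> exp ((r / \<delta>)\<^sup>2)" using q1 by simp
      finally have a: "4/3 \<le> exp ((r / \<delta>)\<^sup>2)" .
      have h: "r\<^sup>2 / (2 * \<delta>\<^sup>2) = (r / \<delta>)\<^sup>2 / 2" by (simp add: power_divide)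
      have b: "exp (r\<^sup>2 / (2 * \<delta>\<^sup>2)) \<le> exp ((r / \<delta>)\<^sup>2)" unfolding h using q1 by (simp only: exp_le_cancel_iff)
      have "4/3 * exp (r\<^sup>2 / (2 * \<delta>\<^sup>2)) * exp (C2 * (r / \<delta>)\<^sup>2) \<le> exp ((r / \<delta>)\<^sup>2) * exp ((r / \<delta>)\<^sup>2) * exp (C2 * (r / \<delta>)\<^sup>2)"
        by (rule mult_right_mono[OF mult_mono[OF a b]]) auto
      also have "\<dots> = exp ((C2 + 2) * (r / \<delta>)\<^sup>2)" by (simp add: mult_exp_exp algebra_simps)
      finally show ?thesis .
    qed
    fix u v assume "\<exists>c\<in>U. ?R u c \<and> ?R v c"
    then obtain c where "?R u c" "?R v c" by blast
    then have "rho n b (\<K> - {b}) u v \<le> 2 * \<eta>"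
      using rho_triangle[of n b "\<K> - {b}" u v c] rho_commute[of n b "\<K> - {b}" c v] by linarith
    also have "2 * \<eta> \<le> (32 + 2 * C2 * (1 + 8 * C1)) * \<delta> * (\<kappa> + \<delta> * M) / r"
    proof -
      have "2 * \<eta> = (32 * \<kappa> + 2 * C2 * (\<kappa> + 8 * C1 * (\<delta> * M))) * \<delta> / r"
        unfolding \<eta>_def by (simp add: add_divide_distrib[symmetric] algebra_simps)
      also have "\<dots> \<le> ((32 + 2 * C2 * (1 + 8 * C1)) * (\<kappa> + \<delta> * M)) * \<delta> / r"
      proof (intro divide_right_mono mult_right_mono)
        have "0 \<le> \<delta> * M" "0 \<le> \<kappa>" using \<delta> M \<kappa> by auto
        then have "0 \<le> 32 * (\<delta> * M)" "0 \<le> 2 * C2 * (\<delta> * M)" "0 \<le> 2 * C2 * (8 * C1 * \<kappa>)" using C1 C2 by auto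
        then show "32 * \<kappa> + 2 * C2 * (\<kappa> + 8 * C1 * (\<delta> * M)) \<le> (32 + 2 * C2 * (1 + 8 * C1)) * (\<kappa> + \<delta> * M)"
          by (simp add: algebra_simps)
      qed (use \<delta> r0 in auto)
      finally show ?thesis by (simp add: mult_ac)
    qed
    finally show "rho n b (\<K> - {b}) u v \<le> (32 + 2 * C2 * (1 + 8 * C1)) * \<delta> * (\<kappa> + \<delta> * M) / r" .
  qed auto
qed

lemma entropy_bound_mono:
  assumes "entropy_bound d C" "C \<le> C'" shows "entropy_bound d C'"
  unfolding entropy_bound_def
proof (intro allI impI)
  fix n r \<K> b \<T> M and \<delta> :: real and U :: "((nat set \<Rightarrow> ten) \<times> ten) set"
  assume a: "blocks \<K>" "card \<K> = d" "b \<in> \<K>" "tensor_fam n (\<Union>\<K>) \<T>" "1 \<le> r" "0 < M" "norms_le n r \<K> \<T> M" "0 < \<delta>" "\<delta> \<le> 1"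
    "\<forall>u\<in>U. snd u \<in> \<T> \<and> in_balls n r (\<K> - {b}) (fst u)"
  have "few_classes U (\<lambda>u v. rho n b (\<K> - {b}) u v \<le> C * \<delta> * M / r) (exp (C * (r / \<delta>)\<^sup>2))"
    by (rule entropy_boundD[OF assms(1) a(1-9)]) (use a(10) in auto)
  then show "few_classes U (\<lambda>u v. rho n b (\<K> - {b}) u v \<le> C' * \<delta> * M / r) (exp (C' * (r / \<delta>)\<^sup>2))"
  proof (rule few_classes_mono)
    show "exp (C * (r / \<delta>)\<^sup>2) \<le> exp (C' * (r / \<delta>)\<^sup>2)" using assms(2) by (simp add: mult_right_mono)
    have "C * \<delta> * M / r \<le> C' * \<delta> * M / r"
      using assms(2) a by (intro divide_right_mono mult_right_mono) auto
    then show "rho n b (\<K> - {b}) u v \<le> C' * \<delta> * M / r" if "rho n b (\<K> - {b}) u v \<le> C * \<delta> * M / r" for u v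
      using that by linarith
  qed auto
qed

text \<open>In the full balls of radius \<open>r\<close> both smallness hypotheses of
  \<open>entropy_bound_step\<close> hold with kappa = M, and M + delta M \<le> 2 M accounts for the
  factor 2 in the constant.\<close>

lemma entropy_bound_Suc:
  assumes "1 \<le> d" "entropy_bound d C2" "0 \<le> C2" "0 < C" and width_bound: "\<And>d'. 1 \<le> d' \<Longrightarrow> d' < Suc d \<Longrightarrow> width_bound d' C"
  shows "\<exists>C'\<ge>C2. entropy_bound (Suc d) C'"
proof -
  let ?C1 = "4 ^ (2 ^ Suc d) * (3 * C)"
  let ?C3 = "2 * (32 + 2 * C2 * (1 + 8 * ?C1))"
  have C1: "0 < ?C1" using assms(4) by simp
  have C30: "0 \<le> 32 + 2 * C2 * (1 + 8 * ?C1)" using C1 assms(3) by simp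
  let ?C' = "max ?C3 (C2 + 2)"
  have "entropy_bound (Suc d) ?C'" unfolding entropy_bound_def
  proof (intro allI impI)
    fix n r \<K> b \<T> M and \<delta> :: real and U :: "((nat set \<Rightarrow> ten) \<times> ten) set"
    assume a: "blocks \<K>" "card \<K> = Suc d" "b \<in> \<K>" "tensor_fam n (\<Union>\<K>) \<T>" "1 \<le> r" "0 < M" "norms_le n r \<K> \<T> M" "0 < \<delta>" "\<delta> \<le> 1"
      "\<forall>u\<in>U. snd u \<in> \<T> \<and> in_balls n r (\<K> - {b}) (fst u)"
    have "card (\<K> - {b}) = d" using blocksD(1)[OF a(1)] a(2,3) by simp
    then have "\<K> - {b} \<noteq> {}" using assms(1) by (metis card.empty not_one_le_zero)
    then obtain k where k: "k \<in> \<K>" "b \<noteq> k" by blast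
    have c2: "2 \<le> card \<K>" using a(2) assms(1) by simp
    have w: "gauss_width (Ix n k) (dual_fam n r \<K> k \<T>) \<le> ?C1 * M"
      using gauss_width_dual_fam_le[OF a(1) k(1) c2 a(4,7,5,6) width_bound] a(2) assms(4) by (simp add: mult.assoc)
    have "few_classes U (\<lambda>u v. rho n b (\<K> - {b}) u v \<le> (32 + 2 * C2 * (1 + 8 * ?C1)) * \<delta> * (M + \<delta> * M) / r)
      (exp ((C2 + 2) * (r / \<delta>)\<^sup>2))"
    proof (rule entropy_bound_step[OF a(1,2) assms(1) a(3) k a(4,5,6,8,9,6) _ _ _ _ C1 w assms(3,2)])
      fix u assume u: "u \<in> U"
      show t: "snd u \<in> \<T>" and ib: "in_balls n r (\<K> - {b}) (fst u)" using a(10) u by auto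
      show "supf (Ix n k) (dual_fam n r \<K> k \<T>) (fst u k) \<le> M"
        by (rule supf_dual_fam_le[OF a(1) k(1) c2 a(4,7,5)]) (use ib k in \<open>auto simp: in_balls_def\<close>)
      show "r * L2_set (contract_blocks n (\<K> - {b, k}) (fst u) (snd u)) (Ix n (k \<union> b)) \<le> M"
        by (rule HS_le[OF a(1,3) k a(4,7,5) _ t]) (use ib a(6) in \<open>auto simp: in_balls_def\<close>)
    qed
    then show "few_classes U (\<lambda>u v. rho n b (\<K> - {b}) u v \<le> ?C' * \<delta> * M / r) (exp (?C' * (r / \<delta>)\<^sup>2))"
    proof (rule few_classes_mono)
      have "(32 + 2 * C2 * (1 + 8 * ?C1)) * \<delta> * (M + \<delta> * M) / r \<le> (32 + 2 * C2 * (1 + 8 * ?C1)) * \<delta> * (2 * M) / r"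
        using C30 a by (intro divide_right_mono mult_left_mono) (auto simp: mult_le_cancel_right1)
      also have "\<dots> = ?C3 * \<delta> * M / r" by simp
      also have "\<dots> \<le> ?C' * \<delta> * M / r" using a by (intro divide_right_mono mult_right_mono) auto
      finally show "rho n b (\<K> - {b}) u v \<le> ?C' * \<delta> * M / r"
        if "rho n b (\<K> - {b}) u v \<le> (32 + 2 * C2 * (1 + 8 * ?C1)) * \<delta> * (M + \<delta> * M) / r" for u v
        using that by linarith
    qed (auto intro: mult_right_mono)
  qed
  then show ?thesis by (intro exI[of _ ?C']) auto
qed

text \<open>Through \<open>dual_fam\<close>, entropy of a given order depends only on widths of
  strictly smaller order, so entropy bounds up to order \<open>d\<close> are available as soon as
  the widths below \<open>d\<close> are bounded.\<close>

lemma entropy_bound_all: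
  assumes "1 \<le> d" "0 < C" "\<And>d'. 1 \<le> d' \<Longrightarrow> d' < d \<Longrightarrow> width_bound d' C"
  shows "\<exists>C'>0. \<forall>d'. 1 \<le> d' \<and> d' \<le> d \<longrightarrow> entropy_bound d' C'"
  using assms(1,3)
proof (induction d rule: nat_induct_at_least)
  case base
  show ?case using entropy_bound_1 by (intro exI[of _ 180224]) (auto simp: le_antisym)
next
  case (Suc d)
  then obtain C2 where C2: "0 < C2" "\<forall>d'. 1 \<le> d' \<and> d' \<le> d \<longrightarrow> entropy_bound d' C2" by auto
  have "entropy_bound d C2" using C2(2) Suc.hyps by blast
  then have "\<exists>C'\<ge>C2. entropy_bound (Suc d) C'"
    by (rule entropy_bound_Suc[OF Suc.hyps _ _ assms(2) Suc.prems]) (use C2(1) in auto)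
  then obtain C' where C': "C2 \<le> C'" "entropy_bound (Suc d) C'" by blast
  have "entropy_bound d' C'" if "1 \<le> d' \<and> d' \<le> Suc d" for d'
    using that C' C2(2) entropy_bound_mono[of d' C2 C'] by (cases "d' = Suc d") auto
  then show ?case using C2(1) C'(1) by (intro exI[of _ C']) auto
qed

section \<open>Homogeneity, dual Sudakov and expansion around a centre\<close>

lemma supf_cmult_eq:
  assumes "bounded_fam I V" "c > 0" shows "supf I V (\<lambda>i. c * y i) = c * supf I V y"
proof (rule antisym)
  show "supf I V (\<lambda>i. c * y i) \<le> c * supf I V y" using assms by (intro supf_cmult) auto
  have "supf I V (\<lambda>i. (1/c) * (c * y i)) \<le> (1/c) * supf I V (\<lambda>i. c * y i)" using assms by (intro supf_cmult) auto
  then show "c * supf I V y \<le> supf I V (\<lambda>i. c * y i)" using assms(2) by (simp add: field_simps)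
qed

lemma mean_sup_cmult:
  assumes "bounded_fam (Ix n L) \<T>" "c > 0" shows "mean_sup n P' L \<T> (\<lambda>i. c * z i) = c * mean_sup n P' L \<T> z"
  unfolding mean_sup_def mult.assoc supf_cmult_eq[OF assms] by simp

lemma mean_sup_nonneg: "tensor_fam n L \<T> \<Longrightarrow> 0 \<le> mean_sup n P' L \<T> z"
  unfolding mean_sup_def tensor_fam_def by (intro integral_nonneg_AE AE_I2 supf_nonneg) auto

text \<open>Rescaling costs one power of \<open>c\<close> per deterministic block. It makes room for
  differences of points, whose vectors may be twice as long.\<close>

lemma norms_le_scale:
  assumes "blocks \<K>" "tensor_fam n (\<Union>\<K>) \<T>" "norms_le n r \<K> \<T> M" "1 \<le> c" "0 \<le> M"
  shows "norms_le n (c * r) \<K> \<T> (c ^ card \<K> * M)"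
  unfolding norms_le_def
proof (intro allI impI, elim conjE)
  fix P P' x assume p: "coarsening \<K> P P'" "card P < card \<K>" "in_balls n (c * r) P x"
  let ?x = "\<lambda>B i. (1/c) * x B i"
  have ib: "in_balls n r P ?x" unfolding in_balls_def
  proof
    fix B assume "B \<in> P"
    then have "L2_set (x B) (Ix n B) \<le> c * r" using p(3) by (simp add: in_balls_def)
    then show "L2_set (?x B) (Ix n B) \<le> r" unfolding L2_set_cmult using assms(4) by (simp add: field_simps)
  qed
  have e: "tensor_prod P x = (\<lambda>i. c ^ card P * tensor_prod P ?x i)"
    using tensor_prod_cmult[of P "1/c" x] assms(4) by (simp add: fun_eq_iff power_divide)
  have "mean_sup n P' (\<Union>\<K>) \<T> (tensor_prod P x) = c ^ card P * mean_sup n P' (\<Union>\<K>) \<T> (tensor_prod P ?x)"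
    unfolding e by (rule mean_sup_cmult) (use assms in \<open>auto simp: tensor_fam_def\<close>)
  also have "\<dots> \<le> c ^ card \<K> * M"
    by (intro mult_mono norms_leD[OF assms(3) p(1,2) ib] power_increasing mean_sup_nonneg assms) (use p(2) assms in auto)
  finally show "mean_sup n P' (\<Union>\<K>) \<T> (tensor_prod P x) \<le> c ^ card \<K> * M" .
qed

lemma contract_blocks_Un:
  assumes "finite P" "finite Q" "P \<inter> Q = {}" "\<Union>P \<inter> \<Union>Q = {}"
  shows "contract_blocks n (P \<union> Q) x \<tau> = contract_blocks n Q x (contract_blocks n P x \<tau>)"
proof -
  have "contract n (\<Union>P \<union> \<Union>Q) (tensor_prod (P \<union> Q) x) \<tau> = contract n (\<Union>Q) (tensor_prod Q x) (contract n (\<Union>P) (tensor_prod P x) \<tau>)"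
    by (rule contract_contract[OF assms(4)]) (use assms in \<open>simp add: tensor_prod_union tensor_prod_merge_idx_left tensor_prod_merge_idx_right Int_commute\<close>)
  then show ?thesis by (simp add: contract_blocks_def)
qed

lemma norms_le_contract_blocks:
  assumes "finite R" "blocks \<K>" "R \<subseteq> \<K>" "norms_le n r \<K> \<T> M" "in_balls n r R c"
  shows "norms_le n r (\<K> - R) (contract_blocks n R c ` \<T>) M"
  using assms
proof (induction R rule: finite_induct)
  case empty then show ?case by (simp add: contract_blocks_empty)
next
  case (insert k R)
  have R: "R \<subseteq> \<K>" "k \<in> \<K> - R" using insert by auto
  have "norms_le n r (\<K> - R) (contract_blocks n R c ` \<T>) M" using insert by (auto simp: in_balls_def)
  from norms_le_contract[OF blocks_subset[OF insert.prems(1) Diff_subset] R(2) this, of "c k"]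
  have "norms_le n r (\<K> - R - {k}) (contract n k (c k) ` contract_blocks n R c ` \<T>) M" using insert.prems(4) by (simp add: in_balls_def)
  moreover have "contract n k (c k) ` contract_blocks n R c ` \<T> = contract_blocks n (insert k R) c ` \<T>"
  proof -
    have "\<Union>R \<inter> k = {}" using blocks_disjoint[OF insert.prems(1) R(1), of "{k}"] R(2) insert.hyps(2) by simp
    then show ?thesis using contract_blocks_insert(2)[OF insert.hyps, of n c] by (simp add: image_image)
  qed
  moreover have "\<K> - R - {k} = \<K> - insert k R" by auto
  ultimately show ?case by simp
qed

lemma tensor_fam_contract_blocks:
  assumes "blocks \<K>" "R \<subseteq> \<K>" "tensor_fam n (\<Union>\<K>) \<T>"
  shows "tensor_fam n (\<Union>(\<K> - R)) (contract_blocks n R c ` \<T>)"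
proof -
  have "\<Union>R \<inter> \<Union>(\<K> - R) = {}" by (rule blocks_disjoint[OF assms(1,2)]) auto
  moreover have "\<Union>R \<union> \<Union>(\<K> - R) = \<Union>\<K>" using assms(2) by blast
  ultimately show ?thesis unfolding contract_blocks_def using tensor_fam_contract[of n "\<Union>R" "\<Union>(\<K> - R)" \<T>] assms(3) by simp
qed

lemma few_classes_Ball:
  assumes "finite A" "\<And>a. a \<in> A \<Longrightarrow> few_classes U (R a) K" "1 \<le> K"
  shows "few_classes U (\<lambda>u v. \<forall>a\<in>A. R a u v) (K ^ card A)"
  using assms(1,2)
proof (induction A rule: finite_induct)
  case empty then show ?case by (intro few_classes_trivial) auto
next
  case (insert a A)
  have "few_classes U (\<lambda>u v. R a u v \<and> (\<forall>a\<in>A. R a u v)) (K * K ^ card A)"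
    by (rule few_classes_conj) (use insert in auto)
  then show ?case using insert.hyps by simp
qed

text \<open>Near a common \<open>y\<close> the triangle inequality already relates all points, so no
  further splitting is needed and the cover has one class; passing through a common neighbour
  doubles 8 to 16.\<close>

lemma dual_Sudakov:
  assumes "finite k" "tensor_fam n k V" "gauss_width (Ix n k) V \<le> \<kappa>" "0 < \<kappa>" "0 < \<delta>" "\<And>u. u \<in> U \<Longrightarrow> L2_set (x u) (Ix n k) \<le> r"
  shows "few_classes U (\<lambda>u v. supf (Ix n k) V (\<lambda>i. x u i - x v i) \<le> 16 * \<delta> * \<kappa>) (4/3 * exp (r\<^sup>2 / (2 * \<delta>\<^sup>2)) * 1)"
proof -
  have bV: "bounded_fam (Ix n k) V" "sym_fam V" using assms(2) by (auto simp: tensor_fam_def)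
  let ?s = "supf (Ix n k) V"
  let ?R = "\<lambda>u v. ?s (\<lambda>i. x u i - x v i) \<le> 8 * \<delta> * \<kappa>"
  have sw: "?s (\<lambda>i. a i - b i) = ?s (\<lambda>i. b i - a i)" for a b
    using supf_uminus[OF bV, of "\<lambda>i. a i - b i"] by simp
  have tri: "?s (\<lambda>i. a i - b i) \<le> ?s (\<lambda>i. a i - c i) + ?s (\<lambda>i. b i - c i)" for a b c
    using supf_diff_le[OF bV, of "\<lambda>i. a i - c i" "\<lambda>i. b i - c i"] by simp
  have "few_classes U (\<lambda>u v. \<exists>c\<in>U. ?R u c \<and> ?R v c) (4/3 * exp (r\<^sup>2 / (2 * \<delta>\<^sup>2)) * 1)"
  proof (rule few_classes_smoothing[where x=x and V="\<lambda>_. V" and \<kappa>=\<kappa> and \<delta>=\<delta> and I="Ix n k"])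
    show "?R u u" for u using supf_least[of V "Ix n k" "\<lambda>_. 0" "8 * \<delta> * \<kappa>"] bV assms(4,5) by (simp add: lin_def bounded_fam_def)
    show "?R v u" if "?R u v" for u v using that sw[of "x u" "x v"] by simp
    fix y
    show "few_classes {u\<in>U. ?s (\<lambda>i. y i - x u i) \<le> 4 * \<delta> * \<kappa>} ?R 1"
    proof (rule few_classes_trivial)
      fix u v assume "u \<in> {u\<in>U. ?s (\<lambda>i. y i - x u i) \<le> 4 * \<delta> * \<kappa>}" "v \<in> {u\<in>U. ?s (\<lambda>i. y i - x u i) \<le> 4 * \<delta> * \<kappa>}"
      then show "?R u v" using tri[of "x u" "x v" y] sw[of y "x u"] sw[of y "x v"] by simp
    qed simp
  qed (use assms bV in auto)
  then show ?thesis
  proof (rule few_classes_mono)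
    fix u v assume "\<exists>c\<in>U. ?R u c \<and> ?R v c"
    then obtain c where "?R u c" "?R v c" by blast
    then show "?s (\<lambda>i. x u i - x v i) \<le> 16 * \<delta> * \<kappa>" using tri[of "x u" "x v" "x c"] by linarith
  qed auto
qed

lemma bounded_fam_image_add:
  assumes "bounded_fam I (f ` U)" "bounded_fam I (h ` U)" shows "bounded_fam I ((\<lambda>u i. f u i + h u i) ` U)"
proof -
  obtain R1 R2 where R: "\<forall>v\<in>f`U. \<forall>i\<in>I. \<bar>v i\<bar> \<le> R1" "\<forall>v\<in>h`U. \<forall>i\<in>I. \<bar>v i\<bar> \<le> R2" and ne: "U \<noteq> {}"
    using assms by (auto simp: bounded_fam_def)
  have "\<forall>v\<in>(\<lambda>u i. f u i + h u i) ` U. \<forall>i\<in>I. \<bar>v i\<bar> \<le> R1 + R2"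
    using R by (auto intro!: order_trans[OF abs_triangle_ineq] add_mono)
  then show ?thesis unfolding bounded_fam_def using ne by (intro conjI exI) simp_all
qed

lemma gauss_width_image_sum:
  assumes "finite I" "finite A" "A \<noteq> {}" "\<And>a. a \<in> A \<Longrightarrow> bounded_fam I (f a ` U)"
  shows "bounded_fam I ((\<lambda>u i. \<Sum>a\<in>A. f a u i) ` U) \<and> gauss_width I ((\<lambda>u i. \<Sum>a\<in>A. f a u i) ` U) \<le> (\<Sum>a\<in>A. gauss_width I (f a ` U))"
  using assms(2-4)
proof (induction A rule: finite_ne_induct)
  case (singleton a) then show ?case by simp
next
  case (insert a A)
  have IH: "bounded_fam I ((\<lambda>u i. \<Sum>a\<in>A. f a u i) ` U)" "gauss_width I ((\<lambda>u i. \<Sum>a\<in>A. f a u i) ` U) \<le> (\<Sum>a\<in>A. gauss_width I (f a ` U))"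
    using insert by auto
  have fa: "bounded_fam I (f a ` U)" using insert.prems by simp
  have e: "(\<Sum>a\<in>insert a A. f a u i) = f a u i + (\<Sum>a\<in>A. f a u i)" for u i using insert.hyps by simp
  show ?case unfolding e
    using bounded_fam_image_add[OF fa IH(1)] gauss_width_image_add[OF assms(1) fa IH(1)] IH(2) insert.hyps by auto
qed

lemma tensor_prod_expand:
  assumes "finite D"
  shows "tensor_prod D x i = (\<Sum>R\<in>Pow D. tensor_prod R c i * tensor_prod (D - R) (\<lambda>B j. x B j - c B j) i)"
  using prod_add[OF assms, of "\<lambda>B. c B (restrict i B)" "\<lambda>B. x B (restrict i B) - c B (restrict i B)"]
  by (simp add: tensor_prod_def)

lemma tensor_prod_expand_diff:
  assumes "finite D"
  shows "tensor_prod D (\<lambda>B j. x B j - c B j) i = (\<Sum>Q\<in>Pow D. (-1) ^ card Q * (tensor_prod Q c i * tensor_prod (D - Q) x i))"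
proof -
  have "tensor_prod D (\<lambda>B j. x B j - c B j) i = (\<Sum>Q\<in>Pow D. (\<Prod>B\<in>Q. (-1) * c B (restrict i B)) * (\<Prod>B\<in>D - Q. x B (restrict i B)))"
    using prod_add[OF assms, of "\<lambda>B. (-1) * c B (restrict i B)" "\<lambda>B. x B (restrict i B)"] by (simp add: tensor_prod_def)
  also have "\<dots> = (\<Sum>Q\<in>Pow D. (-1) ^ card Q * (tensor_prod Q c i * tensor_prod (D - Q) x i))"
    by (intro sum.cong refl) (simp add: tensor_prod_def prod.distrib[symmetric] mult.assoc prod_constant[symmetric] del: prod_constant)
  finally show ?thesis .
qed

lemma contract_sum_left: "contract n K (\<lambda>i. \<Sum>a\<in>A. z a i) \<tau> j = (\<Sum>a\<in>A. contract n K (z a) \<tau> j)"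
  unfolding contract_def sum_distrib_left by (rule sum.swap)

lemma contract_blocks_mixed:
  assumes "blocks D" "R \<subseteq> D"
  shows "contract n (\<Union>D) (\<lambda>i. tensor_prod R c i * tensor_prod (D - R) y i) \<tau> = contract_blocks n (D - R) y (contract_blocks n R c \<tau>)"
proof -
  have d: "\<Union>R \<inter> \<Union>(D - R) = {}" by (rule blocks_disjoint[OF assms(1,2)]) auto
  have u: "\<Union>R \<union> \<Union>(D - R) = \<Union>D" using assms(2) by blast
  have "contract n (\<Union>R \<union> \<Union>(D - R)) (\<lambda>i. tensor_prod R c i * tensor_prod (D - R) y i) \<tau> = contract_blocks n (D - R) y (contract_blocks n R c \<tau>)"
    unfolding contract_blocks_def by (rule contract_contract[OF d]) (use d in \<open>simp add: tensor_prod_merge_idx_left tensor_prod_merge_idx_right Int_commute\<close>)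
  then show ?thesis unfolding u .
qed

lemma contract_blocks_expand:
  assumes "blocks D"
  shows "contract_blocks n D x \<tau> j = (\<Sum>R\<in>Pow D. contract_blocks n (D - R) (\<lambda>B j. x B j - c B j) (contract_blocks n R c \<tau>) j)"
proof -
  have "contract_blocks n D x \<tau> j = contract n (\<Union>D) (\<lambda>i. \<Sum>R\<in>Pow D. tensor_prod R c i * tensor_prod (D - R) (\<lambda>B j. x B j - c B j) i) \<tau> j"
    unfolding contract_blocks_def tensor_prod_expand[OF blocksD(1)[OF assms], symmetric] ..
  also have "\<dots> = (\<Sum>R\<in>Pow D. contract_blocks n (D - R) (\<lambda>B j. x B j - c B j) (contract_blocks n R c \<tau>) j)"
    unfolding contract_sum_left by (intro sum.cong refl) (simp add: contract_blocks_mixed[OF assms])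
  finally show ?thesis .
qed

lemma contract_blocks_expand_diff:
  assumes "blocks D"
  shows "contract_blocks n D (\<lambda>B j. x B j - c B j) \<tau> j = (\<Sum>Q\<in>Pow D. (-1) ^ card Q * contract_blocks n (D - Q) x (contract_blocks n Q c \<tau>) j)"
proof -
  have "contract_blocks n D (\<lambda>B j. x B j - c B j) \<tau> j = contract n (\<Union>D) (\<lambda>i. \<Sum>Q\<in>Pow D. (-1) ^ card Q * (tensor_prod Q c i * tensor_prod (D - Q) x i)) \<tau> j"
    unfolding contract_blocks_def tensor_prod_expand_diff[OF blocksD(1)[OF assms], symmetric] ..
  also have "\<dots> = (\<Sum>Q\<in>Pow D. (-1) ^ card Q * contract_blocks n (D - Q) x (contract_blocks n Q c \<tau>) j)"
    unfolding contract_sum_left contract_cmult_left by (intro sum.cong refl) (simp add: contract_blocks_mixed[OF assms])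
  finally show ?thesis .
qed

lemma L2_set_sum_le: "L2_set (\<lambda>j. \<Sum>a\<in>A. f a j) I \<le> (\<Sum>a\<in>A. L2_set (f a) I)"
proof (induction A rule: infinite_finite_induct)
  case (insert a A)
  then show ?case using L2_set_triangle_ineq[of "f a" "\<lambda>j. \<Sum>a\<in>A. f a j" I] by simp
qed auto

text \<open>A contraction with differences x - c expands into contractions of x in which
  \<open>c\<close> fills the coordinates of a subset Q. If all these partial contractions are close,
  so are the recentred points, at the price of 2^(card D) terms.\<close>

lemma rho_shift_le:
  assumes "blocks D" "\<And>Q. Q \<subseteq> D \<Longrightarrow> rho n b (D - Q) (fst u, contract_blocks n Q c (snd u)) (fst v, contract_blocks n Q c (snd v)) \<le> \<epsilon>"
  shows "rho n b D (\<lambda>B j. fst u B j - c B j, snd u) (\<lambda>B j. fst v B j - c B j, snd v) \<le> 2 ^ card D * \<epsilon>"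
proof -
  let ?f = "\<lambda>Q u j. contract_blocks n (D - Q) (fst u) (contract_blocks n Q c (snd u)) j"
  have "rho n b D (\<lambda>B j. fst u B j - c B j, snd u) (\<lambda>B j. fst v B j - c B j, snd v)
    = L2_set (\<lambda>j. \<Sum>Q\<in>Pow D. (-1) ^ card Q * (?f Q u j - ?f Q v j)) (Ix n b)"
    unfolding rho_def fst_conv snd_conv contract_blocks_expand_diff[OF assms(1)]
    by (simp add: sum_subtractf right_diff_distrib)
  also have "\<dots> \<le> (\<Sum>Q\<in>Pow D. L2_set (\<lambda>j. (-1) ^ card Q * (?f Q u j - ?f Q v j)) (Ix n b))"
    by (rule L2_set_sum_le)
  also have "\<dots> = (\<Sum>Q\<in>Pow D. rho n b (D - Q) (fst u, contract_blocks n Q c (snd u)) (fst v, contract_blocks n Q c (snd v)))"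
    unfolding L2_set_cmult by (simp add: rho_def)
  also have "\<dots> \<le> (\<Sum>Q\<in>Pow D. \<epsilon>)" by (rule sum_mono) (use assms(2) in auto)
  also have "\<dots> = 2 ^ card D * \<epsilon>" using blocksD(1)[OF assms(1)] by (simp add: card_Pow)
  finally show ?thesis .
qed

section \<open>Chaining\<close>

text \<open>The width of \<open>dual_fam\<close> in units of M, as bounded by
  \<open>gauss_width_dual_fam_le\<close>.\<close>

definition const_dual :: "nat \<Rightarrow> real \<Rightarrow> real" where
  "const_dual d C = 4 ^ (2 ^ d) * (3 * C)"

text \<open>The constant of \<open>entropy_bound_step\<close> for kappa = delta M; the factor 2
  comes from delta M + theta delta M \<le> 2 delta M.\<close>

definition const_radius :: "nat \<Rightarrow> real \<Rightarrow> real \<Rightarrow> real" where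
  "const_radius d C Ce = 2 * (32 + 2 * Ce * (1 + 8 * const_dual d C))"

text \<open>The solution of 4 theta (2^d const_radius + 16) = 1: the contributions to the diameter
  after recentring then sum to delta^2 M / (4 r), the value prescribed at half the scale.\<close>

definition \<theta>R :: "nat \<Rightarrow> real \<Rightarrow> real \<Rightarrow> real" where
  "\<theta>R d C Ce = 1 / (4 * (2 ^ d * const_radius d C Ce + 16))"

text \<open>A common exponent for all covers at one scale: 720896 = 4 * 180224 is Sudakov's at
  radius delta M / (2 r), 512 = 32^2 / 2 belongs to \<open>cover_dual\<close>, the last term to the
  covers at scale theta delta, and the remaining 1 absorbs factors 4/3.\<close>

definition const_exponent :: "nat \<Rightarrow> real \<Rightarrow> real \<Rightarrow> real" where
  "const_exponent d C Ce = 720897 + 512 * (const_dual d C)\<^sup>2 + (Ce + 2) / (\<theta>R d C Ce)\<^sup>2"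

text \<open>The first two summands are the cost of the expansion around the centre in a cell; the
  root stems from two successive partitions at 3 s Delta each.\<close>

definition const_chain :: "nat \<Rightarrow> real \<Rightarrow> real \<Rightarrow> real" where
  "const_chain d C Ce = 1 + 2 ^ d * (2 * C) + 6 * sqrt ((2 ^ d + 2) * const_exponent d C Ce)"

locale chaining =
  fixes n :: nat and r M C Ce :: real and \<K> :: "nat set set" and b :: "nat set" and \<T> :: "ten set"
  assumes K: "blocks \<K>" "2 \<le> card \<K>" "b \<in> \<K>" and fT: "tensor_fam n (\<Union>\<K>) \<T>" and r: "1 \<le> r" and M: "0 < M"
    and norms_le: "norms_le n r \<K> \<T> M" and C: "1 \<le> C" "1 \<le> Ce"
    and width_bound: "\<And>d. 1 \<le> d \<Longrightarrow> d < card \<K> \<Longrightarrow> width_bound d C"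
    and entropy_bound: "\<And>d. 1 \<le> d \<Longrightarrow> d < card \<K> \<Longrightarrow> entropy_bound d Ce"
begin

abbreviation "D \<equiv> \<K> - {b}"
abbreviation "d \<equiv> card \<K>"
abbreviation "\<theta> \<equiv> \<theta>R d C Ce"
abbreviation "a \<equiv> const_exponent d C Ce"
abbreviation "rV k \<equiv> supf (Ix n k) (dual_fam n r \<K> k \<T>)"

text \<open>The sets met by the chaining at scale \<open>\<delta>\<close>. With two coordinates there is no third one whose
  smallness could be passed on to the Hilbert--Schmidt norm of the tensor, hence the extra condition on
  \<open>snd u\<close>; it forces the tensor to be recentred as well, which is the role of \<open>centre_tensor\<close> below.\<close>

definition chain_class :: "real \<Rightarrow> ((nat set \<Rightarrow> ten) \<times> ten) set \<Rightarrow> bool" where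
  "chain_class \<delta> U \<longleftrightarrow> U \<noteq> {} \<and>
     (\<forall>u\<in>U. snd u \<in> \<T> \<and> in_balls n r D (fst u) \<and> (\<forall>k\<in>D. rV k (fst u k) \<le> \<delta> * M)
        \<and> (d = 2 \<longrightarrow> r * L2_set (snd u) (Ix n (\<Union>\<K>)) \<le> \<delta> * M)) \<and>
     (\<forall>u\<in>U. \<forall>v\<in>U. in_balls n r D (\<lambda>B i. fst u B i - fst v B i) \<and> (d = 2 \<longrightarrow> (\<lambda>i. snd u i - snd v i) \<in> \<T>))"

lemma chain_classD:
  assumes "chain_class \<delta> U"
  shows "U \<noteq> {}" "u \<in> U \<Longrightarrow> snd u \<in> \<T>" "u \<in> U \<Longrightarrow> in_balls n r D (fst u)" "u \<in> U \<Longrightarrow> k \<in> D \<Longrightarrow> rV k (fst u k) \<le> \<delta> * M"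
    "u \<in> U \<Longrightarrow> d = 2 \<Longrightarrow> r * L2_set (snd u) (Ix n (\<Union>\<K>)) \<le> \<delta> * M"
    "u \<in> U \<Longrightarrow> v \<in> U \<Longrightarrow> in_balls n r D (\<lambda>B i. fst u B i - fst v B i)"
    "u \<in> U \<Longrightarrow> v \<in> U \<Longrightarrow> d = 2 \<Longrightarrow> (\<lambda>i. snd u i - snd v i) \<in> \<T>"
  using assms unfolding chain_class_def by simp_all

lemma chain_class_subset: "chain_class \<delta> U \<Longrightarrow> Z \<subseteq> U \<Longrightarrow> Z \<noteq> {} \<Longrightarrow> chain_class \<delta> Z"
  unfolding chain_class_def by (simp add: subset_iff del: split_paired_All)

lemma D: "finite D" "blocks D" "card D = d - 1" "D \<noteq> {}" "b \<notin> D" "finite b"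
proof -
  show f: "finite D" using blocksD(1)[OF K(1)] by simp
  show "blocks D" by (rule blocks_subset[OF K(1)]) auto
  show c: "card D = d - 1" using blocksD(1)[OF K(1)] K(3) by simp
  show "D \<noteq> {}" using c K(2) by (metis card.empty not_one_le_zero ordered_cancel_comm_monoid_diff_class.le_diff_conv2 one_add_one add_leD1)
  show "b \<notin> D" "finite b" using blocksD(2)[OF K(1,3)] by auto
qed

lemma D_coord: assumes "k \<in> D" shows "k \<in> \<K>" "b \<noteq> k" "finite k" "k \<inter> b = {}" "tensor_fam n k (dual_fam n r \<K> k \<T>)"
    "gauss_width (Ix n k) (dual_fam n r \<K> k \<T>) \<le> const_dual d C * M"
proof -
  show k: "k \<in> \<K>" "b \<noteq> k" using assms by auto
  show "finite k" "k \<inter> b = {}" using blocksD(2)[OF K(1) k(1)] blocksD(4)[OF K(1) k(1) K(3)] k(2) by auto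
  show "tensor_fam n k (dual_fam n r \<K> k \<T>)" by (rule dual_fam_facts(1)[OF K(1) k(1) K(2) fT]) (use r in simp)
  show "gauss_width (Ix n k) (dual_fam n r \<K> k \<T>) \<le> const_dual d C * M"
    using gauss_width_dual_fam_le[OF K(1) k(1) K(2) fT norms_le r M width_bound] C by (simp add: const_dual_def mult.assoc)
qed

lemma const_facts: "1 \<le> const_dual d C" "1 \<le> const_radius d C Ce" "Ce \<le> const_radius d C Ce" "0 < \<theta>" "\<theta> \<le> 1" "4 * (\<theta> * (2 ^ d * const_radius d C Ce + 16)) = 1" "720897 \<le> a"
proof -
  have "1 * 1 \<le> 4 ^ (2 ^ d) * (3 * C)" using C by (intro mult_mono) auto
  then show v: "1 \<le> const_dual d C" by (simp add: const_dual_def)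
  have "Ce * 1 \<le> Ce * (1 + 8 * const_dual d C)" using C v by (intro mult_left_mono) auto
  then have R: "64 + 4 * Ce \<le> const_radius d C Ce" unfolding const_radius_def by simp
  then show R1: "1 \<le> const_radius d C Ce" "Ce \<le> const_radius d C Ce" using C by auto
  have "0 \<le> 2 ^ d * const_radius d C Ce" using R1 by simp
  then have p: "1 \<le> 4 * (2 ^ d * const_radius d C Ce + 16)" by simp
  then show t: "0 < \<theta>" "\<theta> \<le> 1" "4 * (\<theta> * (2 ^ d * const_radius d C Ce + 16)) = 1" unfolding \<theta>R_def by (auto simp: field_simps)
  have "0 \<le> (Ce + 2) / \<theta>\<^sup>2" using C by simp
  then show "720897 \<le> a" unfolding const_exponent_def by simp
qed

text \<open>All covers of one scale are brought to the same number of classes; since r / delta is at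
  least 1, constant factors are absorbed into the exponent.\<close>

lemma exp_bound:
  assumes "0 < \<delta>" "\<delta> \<le> 1"
  shows "exp ((Ce + 2) * (r / (\<theta> * \<delta>))\<^sup>2) \<le> exp (a * (r / \<delta>)\<^sup>2)" (is "?e1 \<le> _")
    and "exp (Ce * (r / (\<theta> * \<delta>))\<^sup>2) \<le> exp (a * (r / \<delta>)\<^sup>2)"
    and "4/3 * exp (r\<^sup>2 / (2 * (\<theta> * \<delta>)\<^sup>2)) * 1 \<le> exp (a * (r / \<delta>)\<^sup>2)"
    and "4/3 * exp (r\<^sup>2 / (2 * (\<delta> / (32 * const_dual d C))\<^sup>2)) * 1 \<le> exp (a * (r / \<delta>)\<^sup>2)"
    and "exp (180224 * M\<^sup>2 / (\<delta> * M / (2 * r))\<^sup>2) \<le> exp (a * (r / \<delta>)\<^sup>2)"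
    and "1 \<le> exp (a * (r / \<delta>)\<^sup>2)"
proof -
  have "1 \<le> r / \<delta>" using r assms by simp
  then have q: "1 \<le> (r / \<delta>)\<^sup>2" by simp
  have e: "(r / (\<theta> * \<delta>))\<^sup>2 = (r / \<delta>)\<^sup>2 / \<theta>\<^sup>2" by (simp add: power_divide power_mult_distrib)
  have t: "0 < \<theta>\<^sup>2" using const_facts(4) by simp
  have qt: "0 \<le> (r / \<delta>)\<^sup>2 / \<theta>\<^sup>2" by simp
  have x1: "(Ce + 2) * (r / (\<theta> * \<delta>))\<^sup>2 = (Ce + 2) / \<theta>\<^sup>2 * (r / \<delta>)\<^sup>2" unfolding e by simp
  have x2: "c * (r / \<delta>)\<^sup>2 \<le> a * (r / \<delta>)\<^sup>2" if "c \<le> a" for c using that by (rule mult_right_mono) simp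
  have p: "0 \<le> (Ce + 2) / \<theta>\<^sup>2" using C by simp
  have a1: "(Ce + 2) * (r / (\<theta> * \<delta>))\<^sup>2 \<le> a * (r / \<delta>)\<^sup>2" unfolding x1 by (rule x2) (simp add: const_exponent_def)
  then show "?e1 \<le> exp (a * (r / \<delta>)\<^sup>2)" by (simp only: exp_le_cancel_iff)
  have "Ce * (r / (\<theta> * \<delta>))\<^sup>2 \<le> (Ce + 2) * (r / (\<theta> * \<delta>))\<^sup>2" by (rule mult_right_mono) auto
  then show "exp (Ce * (r / (\<theta> * \<delta>))\<^sup>2) \<le> exp (a * (r / \<delta>)\<^sup>2)" using a1 by (simp only: exp_le_cancel_iff)
  have "(4/3::real) \<le> exp 1" using exp_ge_add_one_self[of "1::real"] by simp
  then have E: "4/3 * exp y * 1 \<le> exp (1 + y)" for y :: real by (simp add: exp_add)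
  have F: "4/3 * exp y * 1 \<le> exp (a * (r / \<delta>)\<^sup>2)" if "y = c * (r / \<delta>)\<^sup>2" "1 + c \<le> a" for y c
  proof -
    have "1 + y \<le> (1 + c) * (r / \<delta>)\<^sup>2" using q that(1) by (simp add: distrib_right)
    also have "\<dots> \<le> a * (r / \<delta>)\<^sup>2" by (rule x2[OF that(2)])
    finally have "exp (1 + y) \<le> exp (a * (r / \<delta>)\<^sup>2)" by (simp only: exp_le_cancel_iff)
    then show ?thesis using E[of y] by linarith
  qed
  show "4/3 * exp (r\<^sup>2 / (2 * (\<theta> * \<delta>)\<^sup>2)) * 1 \<le> exp (a * (r / \<delta>)\<^sup>2)"
  proof (rule F)
    show "r\<^sup>2 / (2 * (\<theta> * \<delta>)\<^sup>2) = (1/2) / \<theta>\<^sup>2 * (r / \<delta>)\<^sup>2" by (simp add: power_divide power_mult_distrib)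
    have "(1/2) / \<theta>\<^sup>2 \<le> (Ce + 2) / \<theta>\<^sup>2" using t C by (intro divide_right_mono) auto
    then show "1 + (1/2) / \<theta>\<^sup>2 \<le> a" unfolding const_exponent_def using zero_le_power2[of "const_dual d C"] by linarith
  qed
  show "4/3 * exp (r\<^sup>2 / (2 * (\<delta> / (32 * const_dual d C))\<^sup>2)) * 1 \<le> exp (a * (r / \<delta>)\<^sup>2)"
  proof (rule F)
    show "r\<^sup>2 / (2 * (\<delta> / (32 * const_dual d C))\<^sup>2) = (512 * (const_dual d C)\<^sup>2) * (r / \<delta>)\<^sup>2" by (simp add: power_divide power_mult_distrib)
    show "1 + 512 * (const_dual d C)\<^sup>2 \<le> a" unfolding const_exponent_def using p by linarith
  qed
  have "180224 * M\<^sup>2 / (\<delta> * M / (2 * r))\<^sup>2 = 720896 * (r / \<delta>)\<^sup>2"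
    using M by (simp add: power_divide power_mult_distrib)
  also have "\<dots> \<le> a * (r / \<delta>)\<^sup>2" by (rule x2) (use const_facts(7) in simp)
  finally show "exp (180224 * M\<^sup>2 / (\<delta> * M / (2 * r))\<^sup>2) \<le> exp (a * (r / \<delta>)\<^sup>2)" by (simp only: exp_le_cancel_iff)
  show "1 \<le> exp (a * (r / \<delta>)\<^sup>2)" using const_facts(7) by simp
qed

text \<open>The parameter delta / (32 const_dual) makes the radius in \<open>dual_Sudakov\<close>,
  namely 16 times the product of this parameter and const_dual M, equal to delta M / 2: the
  smallness required of recentred vectors at the next scale.\<close>

lemma cover_dual:
  assumes "0 < \<delta>" "\<delta> \<le> 1" "chain_class \<delta> U" "k \<in> D"
  shows "few_classes U (\<lambda>u v. rV k (\<lambda>i. fst u k i - fst v k i) \<le> \<delta> * M / 2) (exp (a * (r / \<delta>)\<^sup>2))"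
proof -
  have v: "0 < const_dual d C" using const_facts(1) by simp
  have c0: "few_classes U (\<lambda>u v. rV k (\<lambda>i. fst u k i - fst v k i) \<le> 16 * (\<delta> / (32 * const_dual d C)) * (const_dual d C * M))
    (4/3 * exp (r\<^sup>2 / (2 * (\<delta> / (32 * const_dual d C))\<^sup>2)) * 1)"
    by (rule dual_Sudakov[OF D_coord(3,5,6)[OF assms(4)]])
       (use v M assms(1,4) chain_classD(3)[OF assms(3)] in \<open>auto simp: in_balls_def\<close>)
  have e: "16 * (\<delta> / (32 * const_dual d C)) * (const_dual d C * M) = \<delta> * M / 2" using v by simp
  from c0[unfolded e] show ?thesis by (rule few_classes_mono[OF _ order_refl exp_bound(4)[OF assms(1,2)]])
qed

text \<open>Merging all coordinates into one Gaussian block shows that the width of the tensors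
  themselves is at most M, so Sudakov's minoration covers them in the Hilbert--Schmidt
  distance.\<close>

lemma cover_tensor:
  assumes "0 < \<delta>" "\<delta> \<le> 1" "chain_class \<delta> U"
  shows "few_classes U (\<lambda>u v. r * L2_set (\<lambda>i. snd u i - snd v i) (Ix n (\<Union>\<K>)) \<le> \<delta> * M / 2) (exp (a * (r / \<delta>)\<^sup>2))"
proof -
  have fK: "finite (\<Union>\<K>)" by (rule blocks_finite_Union[OF K(1)])
  have bT: "bounded_fam (Ix n (\<Union>\<K>)) \<T>" "sym_fam \<T>" using fT by (auto simp: tensor_fam_def)
  have ne: "\<Union>\<K> \<noteq> {}" using K(3) blocksD(3)[OF K(1,3)] by blast
  have "gauss_width (Ix n (\<Union>\<K>)) \<T> = mean_sup n {\<Union>\<K>} (\<Union>\<K>) \<T> (tensor_prod {} (\<lambda>_ _. 0))"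
    using mean_sup_single[OF fK bT(1)] by (simp add: tensor_prod_def[abs_def])
  also have "\<dots> \<le> M"
  proof (rule norms_leD[OF norms_le])
    show "coarsening \<K> {} {\<Union>\<K>}" unfolding coarsening_def partition_on_def disjoint_def using ne by auto
  qed (use K(2) in \<open>auto simp: in_balls_def\<close>)
  finally have w: "gauss_width (Ix n (\<Union>\<K>)) \<T> \<le> M" .
  have e: "0 < \<delta> * M / (2 * r)" using assms(1) M r by simp
  have c: "few_classes \<T> (\<lambda>t s. L2_set (\<lambda>i. t i - s i) (Ix n (\<Union>\<K>)) \<le> \<delta> * M / (2 * r)) (exp (180224 * M\<^sup>2 / (\<delta> * M / (2 * r))\<^sup>2))"
    by (rule Sudakov[OF finite_Ix[OF fK] bT w M e])
  have "few_classes (snd ` U) (\<lambda>t s. L2_set (\<lambda>i. t i - s i) (Ix n (\<Union>\<K>)) \<le> \<delta> * M / (2 * r)) (exp (a * (r / \<delta>)\<^sup>2))"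
    by (rule few_classes_mono[OF c _ exp_bound(5)[OF assms(1,2)]]) (use chain_classD(2)[OF assms(3)] in auto)
  from few_classes_vimage[OF this] show ?thesis
    by (rule few_classes_mono) (use r in \<open>auto simp: field_simps\<close>)
qed

text \<open>One contracted coordinate with small \<open>rV\<close> already brings the mixed norms
  down to \<open>M'\<close>; the other vectors of \<open>R\<close> lie in balls of radius
  \<open>r\<close> and do no harm.\<close>

lemma norms_le_shift:
  assumes "R \<subseteq> D" "R \<noteq> {}" "in_balls n r D c" "\<And>k. k \<in> D \<Longrightarrow> rV k (c k) \<le> M'"
  shows "norms_le n r (\<K> - R) (contract_blocks n R c ` \<T>) M'"
proof -
  obtain k where k: "k \<in> R" using assms(2) by blast
  then have kD: "k \<in> D" using assms(1) by blast
  have R: "R \<subseteq> \<K>" "finite R" using assms(1) finite_subset[OF assms(1) D(1)] by auto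
  have "norms_le n r (\<K> - {k}) (contract n k (c k) ` \<T>) M'"
    by (rule dual_fam_facts(2)[OF K(1) D_coord(1)[OF kD] K(2) fT _ assms(4)[OF kD]]) (use r in simp)
  then have "norms_le n r (\<K> - {k} - (R - {k})) (contract_blocks n (R - {k}) c ` contract n k (c k) ` \<T>) M'"
    by (intro norms_le_contract_blocks) (use R assms(1,3) blocks_subset[OF K(1), of "\<K> - {k}"] in \<open>auto simp: in_balls_def\<close>)
  moreover have "\<K> - {k} - (R - {k}) = \<K> - R" using k by auto
  moreover have "contract_blocks n (R - {k}) c ` contract n k (c k) ` \<T> = contract_blocks n R c ` \<T>"
  proof -
    have "\<Union>(R - {k}) \<inter> k = {}" using blocks_disjoint[OF K(1), of "R - {k}" "{k}"] R(1) k by auto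
    then have "contract_blocks n (insert k (R - {k})) c \<tau> = contract_blocks n (R - {k}) c (contract n k (c k) \<tau>)" for \<tau>
      by (intro contract_blocks_insert(1)) (use R(2) in auto)
    then show ?thesis using k by (simp add: image_image insert_absorb)
  qed
  ultimately show ?thesis by simp
qed

text \<open>For d \<ge> 3 there is a third coordinate \<open>l\<close>: contracting with its small
  vector brings the norms down to delta M, and \<open>HS_le\<close> for the contracted family
  transfers this to the Hilbert--Schmidt norm. For d = 2 the claim is part of
  \<open>chain_class\<close>.\<close>

lemma HS_small:
  assumes "chain_class \<delta> U" "0 \<le> \<delta>" "u \<in> U" "k \<in> D"
  shows "r * L2_set (contract_blocks n (\<K> - {b, k}) (fst u) (snd u)) (Ix n (k \<union> b)) \<le> \<delta> * M"
proof (cases "d = 2")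
  case True
  have "card D = 1" unfolding D(3) True by simp
  then obtain l where l: "D = {l}" by (rule card_1_singletonE)
  have "k \<in> {l}" using assms(4) unfolding l .
  then have "D = {k}" unfolding l by simp
  then have "\<K> = {b, k}" using K(3) by blast
  then have e: "\<K> - {b, k} = {}" "k \<union> b = \<Union>\<K>" by auto
  show ?thesis unfolding e contract_blocks_empty by (rule chain_classD(5)[OF assms(1,3) True])
next
  case False
  have "card (D - {k}) = d - 1 - 1" unfolding D(3)[symmetric] by (rule card_Diff_singleton[OF assms(4)])
  then have "card (D - {k}) \<noteq> 0" using False K(2) by linarith
  then obtain l where l: "l \<in> D" "l \<noteq> k" by (metis card.empty DiffE ex_in_conv singletonI)
  have ib: "in_balls n r D (fst u)" by (rule chain_classD(3)[OF assms(1,3)])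
  have lK: "l \<in> \<K>" by (rule D_coord[OF l(1)])
  have B: "norms_le n r (\<K> - {l}) (contract n l (fst u l) ` \<T>) (\<delta> * M)"
    by (rule dual_fam_facts(2)[OF K(1) lK K(2) fT _ chain_classD(4)[OF assms(1,3) l(1)]]) (use r in simp)
  have bK: "blocks (\<K> - {l})" by (rule blocks_subset[OF K(1)]) auto
  have "tensor_fam n (\<Union>(\<K> - {l})) (contract_blocks n {l} (fst u) ` \<T>)" by (rule tensor_fam_contract_blocks[OF K(1) _ fT]) (use lK in auto)
  moreover have "contract_blocks n {l} (fst u) \<tau> = contract n l (fst u l) \<tau>" for \<tau>
    using contract_blocks_insert(1)[of "{}" l n "fst u" \<tau>] by (simp add: contract_blocks_empty)
  ultimately have F: "tensor_fam n (\<Union>(\<K> - {l})) (contract n l (fst u l) ` \<T>)" by simp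
  have "r * L2_set (contract_blocks n (\<K> - {l} - {b, k}) (fst u) (contract n l (fst u l) (snd u))) (Ix n (k \<union> b)) \<le> \<delta> * M"
    by (rule HS_le[OF bK _ _ _ F B r])
       (use assms(2,4) l K(3) M ib chain_classD(2)[OF assms(1,3)] in \<open>auto simp: in_balls_def\<close>)
  moreover have "contract_blocks n (insert l (\<K> - {l} - {b, k})) (fst u) (snd u) = contract_blocks n (\<K> - {l} - {b, k}) (fst u) (contract n l (fst u l) (snd u))"
  proof (rule contract_blocks_insert(1))
    show "\<Union>(\<K> - {l} - {b, k}) \<inter> l = {}" using blocks_disjoint[OF K(1), of "\<K> - {l} - {b, k}" "{l}"] lK by auto
  qed (use blocksD(1)[OF K(1)] in auto)
  moreover have "insert l (\<K> - {l} - {b, k}) = \<K> - {b, k}" using l lK by auto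
  ultimately show ?thesis by simp
qed

text \<open>The gain of the second factor delta: for kappa = delta M the replacement step at scale
  theta delta leaves a radius of order theta delta^2 M / r.\<close>

lemma cover_rho:
  assumes "0 < \<delta>" "\<delta> \<le> 1" "chain_class \<delta> U"
  shows "few_classes U (\<lambda>u v. rho n b D u v \<le> const_radius d C Ce * \<theta> * \<delta>\<^sup>2 * M / r) (exp (a * (r / \<delta>)\<^sup>2))"
proof -
  obtain k where k: "k \<in> D" using D(4) by blast
  note c = const_facts
  have td: "0 < \<theta> * \<delta>" "\<theta> * \<delta> \<le> 1" "\<theta> * \<delta> \<le> \<delta>"
    using c(4,5) assms by (auto simp: mult_le_one mult_left_le_one_le)
  have dM: "0 < \<delta> * M" using assms M by simp
  have dd: "d = Suc (d - 1)" "1 \<le> d - 1" using K(2) by auto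
  let ?c = "32 + 2 * Ce * (1 + 8 * const_dual d C)"
  have c0: "0 \<le> ?c" using C c(1) by simp
  have "few_classes U (\<lambda>u v. rho n b D u v \<le> ?c * (\<theta> * \<delta>) * (\<delta> * M + (\<theta> * \<delta>) * M) / r)
    (exp ((Ce + 2) * (r / (\<theta> * \<delta>))\<^sup>2))"
    by (rule entropy_bound_step[OF K(1) dd K(3) D_coord(1,2)[OF k] fT r M td(1,2) dM chain_classD(2)[OF assms(3)] chain_classD(3)[OF assms(3)]
          chain_classD(4)[OF assms(3) _ k] HS_small[OF assms(3) _ _ k] _ D_coord(6)[OF k] _ entropy_bound])
       (use assms(1) K(2) C c(1) in auto)
  then show ?thesis
  proof (rule few_classes_mono[OF _ order_refl exp_bound(1)[OF assms(1,2)]])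
    have "?c * (\<theta> * \<delta>) * (\<delta> * M + (\<theta> * \<delta>) * M) / r \<le> ?c * (\<theta> * \<delta>) * (\<delta> * M + \<delta> * M) / r"
      using c0 td M r by (intro divide_right_mono mult_left_mono add_left_mono mult_right_mono) auto
    also have "\<dots> = const_radius d C Ce * \<theta> * \<delta>\<^sup>2 * M / r" by (simp add: const_radius_def power2_eq_square)
    finally show "rho n b D u v \<le> const_radius d C Ce * \<theta> * \<delta>\<^sup>2 * M / r"
      if "rho n b D u v \<le> ?c * (\<theta> * \<delta>) * (\<delta> * M + (\<theta> * \<delta>) * M) / r" for u v using that by linarith
  qed
qed

section \<open>Covers adapted to a chosen centre\<close>

definition part_shift :: "nat set set \<Rightarrow> (nat set \<Rightarrow> ten) \<Rightarrow> (nat set \<Rightarrow> ten) \<times> ten \<Rightarrow> (nat set \<Rightarrow> ten) \<times> ten" where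
  "part_shift R c u = (fst u, contract_blocks n R c (snd u))"

text \<open>Contraction with the centre in at least one coordinate leaves tensors of lower order
  with norms at most delta M, so the entropy bound of that order, at scale theta delta, again yields
  delta^2.\<close>

lemma cover_shift:
  assumes "0 < \<delta>" "\<delta> \<le> 1" "chain_class \<delta> U" "c \<in> U" "R \<subseteq> D" "R \<noteq> {}"
  shows "few_classes U (\<lambda>u v. rho n b (D - R) (part_shift R (fst c) u) (part_shift R (fst c) v) \<le> const_radius d C Ce * \<theta> * \<delta>\<^sup>2 * M / r) (exp (a * (r / \<delta>)\<^sup>2))"
proof -
  have td: "0 < \<theta> * \<delta>" "\<theta> * \<delta> \<le> 1" using const_facts(4,5) assms by (auto simp: mult_le_one)
  have dM: "0 < \<delta> * M" using assms M by simp
  have fR: "finite R" "R \<subseteq> \<K>" using assms(5) finite_subset[OF assms(5) D(1)] by auto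
  have bR: "b \<in> \<K> - R" using K(3) assms(5) by auto
  have Dd: "\<K> - R - {b} = D - R" by auto
  have "card R \<le> card D" by (rule card_mono[OF D(1) assms(5)])
  moreover have "card R \<noteq> 0" using fR assms(6) by simp
  moreover have "card (\<K> - R) = d - card R" by (rule card_Diff_subset[OF fR])
  ultimately have const_radius: "1 \<le> card (\<K> - R)" "card (\<K> - R) < d" using K(2) D(3) by auto
  have B: "norms_le n r (\<K> - R) (contract_blocks n R (fst c) ` \<T>) (\<delta> * M)"
    by (rule norms_le_shift[OF assms(5,6) chain_classD(3)[OF assms(3,4)] chain_classD(4)[OF assms(3,4)]])
  have "few_classes (part_shift R (fst c) ` U) (\<lambda>u v. rho n b (\<K> - R - {b}) u v \<le> Ce * (\<theta> * \<delta>) * (\<delta> * M) / r) (exp (Ce * (r / (\<theta> * \<delta>))\<^sup>2))"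
  proof (rule entropy_boundD[OF entropy_bound[OF const_radius] blocks_subset[OF K(1) Diff_subset] refl bR tensor_fam_contract_blocks[OF K(1) fR(2) fT] r dM B td])
    fix u assume "u \<in> part_shift R (fst c) ` U"
    then obtain v where v: "v \<in> U" "u = part_shift R (fst c) v" by auto
    show "snd u \<in> contract_blocks n R (fst c) ` \<T>" using chain_classD(2)[OF assms(3) v(1)] by (simp add: v(2) part_shift_def)
    show "in_balls n r (\<K> - R - {b}) (fst u)" using chain_classD(3)[OF assms(3) v(1)] by (simp add: v(2) part_shift_def in_balls_def)
  qed
  from few_classes_vimage[OF this] show ?thesis unfolding Dd
  proof (rule few_classes_mono[OF _ order_refl exp_bound(2)[OF assms(1,2)]])
    have "Ce * (\<theta> * \<delta>) * (\<delta> * M) / r = Ce * (\<theta> * \<delta>\<^sup>2 * M / r)" by (simp add: power2_eq_square)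
    also have "\<dots> \<le> const_radius d C Ce * (\<theta> * \<delta>\<^sup>2 * M / r)" using const_facts(3,4) M r by (intro mult_right_mono) auto
    finally show "rho n b (D - R) (part_shift R (fst c) u) (part_shift R (fst c) v) \<le> const_radius d C Ce * \<theta> * \<delta>\<^sup>2 * M / r"
      if "rho n b (D - R) (part_shift R (fst c) u) (part_shift R (fst c) v) \<le> Ce * (\<theta> * \<delta>) * (\<delta> * M) / r" for u v using that by simp
  qed
qed

lemma two_coordinates: assumes "d = 2" obtains k where "D = {k}" "k \<in> D" "\<Union>\<K> = k \<union> b" "\<forall>x \<tau>. contract_blocks n D x \<tau> = contract n k (x k) \<tau>"
proof -
  have "card D = 1" unfolding D(3) assms by simp
  then obtain k where k: "D = {k}" by (rule card_1_singletonE)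
  have "\<K> = {b, k}" using k K(3) by blast
  then have u: "\<Union>\<K> = k \<union> b" by auto
  have "contract_blocks n {k} x \<tau> = contract n k (x k) \<tau>" for x \<tau>
    using contract_blocks_insert(1)[of "{}" k n x \<tau>] by (simp add: contract_blocks_empty)
  then show ?thesis by (intro that[of k] u) (simp_all add: k)
qed

definition centre_tensor :: "(nat set \<Rightarrow> ten) \<times> ten \<Rightarrow> ten" where
  "centre_tensor c = (if d = 2 then snd c else (\<lambda>_. 0))"

definition shifted :: "(nat set \<Rightarrow> ten) \<times> ten \<Rightarrow> (nat set \<Rightarrow> ten) \<times> ten \<Rightarrow> (nat set \<Rightarrow> ten)" where
  "shifted c u = (\<lambda>B i. fst u B i - fst c B i)"

lemma contract_blocks_zero: "contract_blocks n P x (\<lambda>_. 0) = (\<lambda>_. 0)" by (simp add: contract_blocks_def contract_def)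

text \<open>Only for d = 2 does recentring leave behind a term with the tensor of the centre. It is
  affine in the single vector of the point, and \<open>dual_Sudakov\<close> for a Hilbert--Schmidt
  family of width at most delta M / r covers it.\<close>

lemma cover_centre:
  assumes "0 < \<delta>" "\<delta> \<le> 1" "chain_class \<delta> U" "c \<in> U"
  shows "few_classes U (\<lambda>u v. L2_set (\<lambda>j. contract_blocks n D (shifted c u) (centre_tensor c) j - contract_blocks n D (shifted c v) (centre_tensor c) j) (Ix n b) \<le> 16 * \<theta> * \<delta>\<^sup>2 * M / r)
    (exp (a * (r / \<delta>)\<^sup>2))"
proof (cases "d = 2")
  case False
  then show ?thesis using exp_bound(6)[OF assms(1,2)] const_facts(4) M r assms(1) by (intro few_classes_trivial) (auto simp: centre_tensor_def contract_blocks_zero)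
next
  case True
  obtain k where k: "D = {k}" "k \<in> D" "\<Union>\<K> = k \<union> b" "\<forall>x \<tau>. contract_blocks n D x \<tau> = contract n k (x k) \<tau>" by (rule two_coordinates[OF True])
  note H = HS_fam_facts[OF D_coord(3)[OF k(2)] D(6) D_coord(4)[OF k(2)], of n]
  have "r * L2_set (snd c) (Ix n (k \<union> b)) \<le> \<delta> * M" using chain_classD(5)[OF assms(3,4) True] k(3) by simp
  then have L: "L2_set (snd c) (Ix n (k \<union> b)) \<le> \<delta> * M / r" using r by (simp add: field_simps)
  have w: "gauss_width (Ix n k) (HS_fam n k b (snd c)) \<le> \<delta> * M / r" by (rule order_trans[OF H(2) L])
  have "few_classes U (\<lambda>u v. supf (Ix n k) (HS_fam n k b (snd c)) (\<lambda>i. fst u k i - fst v k i) \<le> 16 * (\<theta> * \<delta>) * (\<delta> * M / r))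
    (4/3 * exp (r\<^sup>2 / (2 * (\<theta> * \<delta>)\<^sup>2)) * 1)"
    by (rule dual_Sudakov[OF D_coord(3)[OF k(2)] H(1) w])
       (use assms(1) M r const_facts(4) chain_classD(3)[OF assms(3)] k(2) in \<open>auto simp: in_balls_def\<close>)
  then show ?thesis
  proof (rule few_classes_mono[OF _ order_refl exp_bound(3)[OF assms(1,2)]])
    fix u v :: "(nat set \<Rightarrow> ten) \<times> ten"
    assume h: "supf (Ix n k) (HS_fam n k b (snd c)) (\<lambda>i. fst u k i - fst v k i) \<le> 16 * (\<theta> * \<delta>) * (\<delta> * M / r)"
    have "contract n k (shifted c u k) (snd c) j - contract n k (shifted c v k) (snd c) j = contract n k (\<lambda>i. fst u k i - fst v k i) (snd c) j" for j
      by (simp add: shifted_def contract_diff_left)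
    then have "L2_set (\<lambda>j. contract_blocks n D (shifted c u) (centre_tensor c) j - contract_blocks n D (shifted c v) (centre_tensor c) j) (Ix n b)
      = L2_set (contract n k (\<lambda>i. fst u k i - fst v k i) (snd c)) (Ix n b)" using True by (simp add: k(4) centre_tensor_def)
    also have "\<dots> \<le> supf (Ix n k) (HS_fam n k b (snd c)) (\<lambda>i. fst u k i - fst v k i)" by (rule H(3))
    finally show "L2_set (\<lambda>j. contract_blocks n D (shifted c u) (centre_tensor c) j - contract_blocks n D (shifted c v) (centre_tensor c) j) (Ix n b) \<le> 16 * \<theta> * \<delta>\<^sup>2 * M / r"
      using h by (simp add: power2_eq_square)
  qed
qed

text \<open>For d = 2 these are contractions of one fixed tensor with vectors of length at most
  \<open>r\<close>, so the width is at most r times its Hilbert--Schmidt norm.\<close>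

lemma width_centre:
  assumes "chain_class \<delta> U" "0 < \<delta>" "c \<in> U" "Z \<subseteq> U" "Z \<noteq> {}"
  shows "bounded_fam (Ix n b) ((\<lambda>u. contract_blocks n D (shifted c u) (centre_tensor c)) ` Z)"
    and "gauss_width (Ix n b) ((\<lambda>u. contract_blocks n D (shifted c u) (centre_tensor c)) ` Z) \<le> \<delta> * M"
proof -
  have "bounded_fam (Ix n b) ((\<lambda>u. contract_blocks n D (shifted c u) (centre_tensor c)) ` Z) \<and> gauss_width (Ix n b) ((\<lambda>u. contract_blocks n D (shifted c u) (centre_tensor c)) ` Z) \<le> \<delta> * M"
  proof (cases "d = 2")
    case False
    then have e: "(\<lambda>u. contract_blocks n D (shifted c u) (centre_tensor c)) ` Z = {\<lambda>_. 0}" using assms(5) by (auto simp: centre_tensor_def contract_blocks_zero)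
    have bounded_contractions: "bounded_fam (Ix n b) {\<lambda>_. 0}" unfolding bounded_fam_def by (auto intro: exI[of _ 0])
    have "gauss_width (Ix n b) {\<lambda>_. 0} \<le> 0 * sqrt (card (Ix n b))"
      by (rule gauss_width_le_diam[OF finite_Ix[OF D(6)] bounded_contractions]) auto
    also have "\<dots> \<le> \<delta> * M" using assms(2) M by simp
    finally show ?thesis unfolding e using bounded_contractions by simp
  next
    case True
    obtain k where k: "D = {k}" "k \<in> D" "\<Union>\<K> = k \<union> b" "\<forall>x \<tau>. contract_blocks n D x \<tau> = contract n k (x k) \<tau>" by (rule two_coordinates[OF True])
    note fin = finite_Ix[OF D(6)] finite_Ix[OF D_coord(3)[OF k(2)]]
    have r0: "0 < r" using r by simp
    let ?V = "(\<lambda>u. contract_blocks n D (shifted c u) (centre_tensor c)) ` Z"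
    have ex: "\<exists>z. L2_set z (Ix n k) \<le> 1 \<and> (\<forall>j\<in>Ix n b. v j = (\<Sum>i\<in>Ix n k. z i * (r * snd c (merge_idx k i j))))" if v: "v \<in> ?V" for v
    proof -
      obtain u where u: "u \<in> Z" "v = contract_blocks n D (shifted c u) (centre_tensor c)" using v by auto
      have "in_balls n r D (shifted c u)" unfolding shifted_def by (rule chain_classD(6)[OF assms(1)]) (use u assms in auto)
      then have l: "L2_set (shifted c u k) (Ix n k) \<le> r" using k(2) by (simp add: in_balls_def)
      show ?thesis
      proof (intro exI[of _ "\<lambda>i. (1 / r) * shifted c u k i"] conjI ballI)
        show "L2_set (\<lambda>i. (1 / r) * shifted c u k i) (Ix n k) \<le> 1" unfolding L2_set_cmult using l r0 by simp
        fix j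
        show "v j = (\<Sum>i\<in>Ix n k. (1 / r) * shifted c u k i * (r * snd c (merge_idx k i j)))"
          unfolding u(2) k(4)[rule_format] contract_def using True r0 by (intro sum.cong refl) (simp add: centre_tensor_def)
      qed
    qed
    note hs = gauss_width_le_HS[where c="\<lambda>i j. r * snd c (merge_idx k i j)", OF fin _ ex]
    have ne: "?V \<noteq> {}" using assms(5) by simp
    have "(\<Sum>i\<in>Ix n k. \<Sum>j\<in>Ix n b. (r * snd c (merge_idx k i j))\<^sup>2) = (r * L2_set (snd c) (Ix n (k \<union> b)))\<^sup>2"
      by (simp add: power_mult_distrib L2_Ix_Un[OF D_coord(3)[OF k(2)] D(6) D_coord(4)[OF k(2)]] sum_distrib_left)
    then have "sqrt (\<Sum>i\<in>Ix n k. \<Sum>j\<in>Ix n b. (r * snd c (merge_idx k i j))\<^sup>2) = r * L2_set (snd c) (Ix n (k \<union> b))"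
      using r0 by simp
    then show ?thesis using hs[OF ne] chain_classD(5)[OF assms(1,3) True] k(3) by auto
  qed
  then show "bounded_fam (Ix n b) ((\<lambda>u. contract_blocks n D (shifted c u) (centre_tensor c)) ` Z)" "gauss_width (Ix n b) ((\<lambda>u. contract_blocks n D (shifted c u) (centre_tensor c)) ` Z) \<le> \<delta> * M" by auto
qed

definition cell_radius :: "real \<Rightarrow> real" where "cell_radius \<delta> = const_radius d C Ce * \<theta> * \<delta>\<^sup>2 * M / r"

text \<open>Smallness is relative to the centre \<open>c\<close>, closeness is between members of
  \<open>Z\<close>; the centre itself need not belong to \<open>Z\<close>.\<close>

definition cell :: "real \<Rightarrow> (nat set \<Rightarrow> ten) \<times> ten \<Rightarrow> ((nat set \<Rightarrow> ten) \<times> ten) set \<Rightarrow> bool" where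
  "cell \<delta> c Z \<longleftrightarrow>
     (\<forall>u\<in>Z. (\<forall>k\<in>D. rV k (shifted c u k) \<le> \<delta> * M / 2) \<and> r * L2_set (\<lambda>i. snd u i - snd c i) (Ix n (\<Union>\<K>)) \<le> \<delta> * M / 2) \<and>
     (\<forall>u\<in>Z. \<forall>v\<in>Z. rho n b D u v \<le> cell_radius \<delta>
       \<and> (\<forall>R\<in>Pow D - {{}}. rho n b (D - R) (part_shift R (fst c) u) (part_shift R (fst c) v) \<le> cell_radius \<delta>)
       \<and> L2_set (\<lambda>j. contract_blocks n D (shifted c u) (centre_tensor c) j - contract_blocks n D (shifted c v) (centre_tensor c) j) (Ix n b) \<le> 16 * \<theta> * \<delta>\<^sup>2 * M / r)"

lemma cellD:
  assumes "cell \<delta> c Z" "u \<in> Z"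
  shows "k \<in> D \<Longrightarrow> rV k (shifted c u k) \<le> \<delta> * M / 2" "r * L2_set (\<lambda>i. snd u i - snd c i) (Ix n (\<Union>\<K>)) \<le> \<delta> * M / 2"
    "v \<in> Z \<Longrightarrow> rho n b D u v \<le> cell_radius \<delta>"
    "v \<in> Z \<Longrightarrow> R \<subseteq> D \<Longrightarrow> R \<noteq> {} \<Longrightarrow> rho n b (D - R) (part_shift R (fst c) u) (part_shift R (fst c) v) \<le> cell_radius \<delta>"
    "v \<in> Z \<Longrightarrow> L2_set (\<lambda>j. contract_blocks n D (shifted c u) (centre_tensor c) j - contract_blocks n D (shifted c v) (centre_tensor c) j) (Ix n b) \<le> 16 * \<theta> * \<delta>\<^sup>2 * M / r"
  using assms unfolding cell_def by simp_all

lemma D_minus: assumes "R \<subseteq> D" shows "\<Union>(D - R) \<union> b = \<Union>(\<K> - R)" "\<Union>(D - R) \<inter> b = {}" "\<K> - R - {b} = D - R" "finite R" "R \<subseteq> \<K>" "blocks (D - R)"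
    "card (D - R) \<le> d" "R \<noteq> {} \<Longrightarrow> 1 \<le> card (\<K> - R) \<and> card (\<K> - R) < d"
proof -
  show "\<Union>(D - R) \<union> b = \<Union>(\<K> - R)" using assms K(3) by blast
  show "\<Union>(D - R) \<inter> b = {}" using blocks_disjoint[OF K(1), of "D - R" "{b}"] K(3) by auto
  show "\<K> - R - {b} = D - R" "R \<subseteq> \<K>" using assms by auto
  then have fR: "finite R" "R \<subseteq> \<K>" using finite_subset[OF assms D(1)] by auto
  then show "finite R" by simp
  show "blocks (D - R)" by (rule blocks_subset[OF D(2)]) auto
  show "card (D - R) \<le> d" by (rule card_mono[OF blocksD(1)[OF K(1)]]) auto
  assume "R \<noteq> {}"
  have "card R \<le> card D" by (rule card_mono[OF D(1) assms])
  moreover have "card R \<noteq> 0" using fR \<open>R \<noteq> {}\<close> by simp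
  moreover have "card (\<K> - R) = d - card R" by (rule card_Diff_subset[OF fR])
  ultimately show "1 \<le> card (\<K> - R) \<and> card (\<K> - R) < d" using K(2) D(3) by auto
qed

text \<open>The defining equation of theta makes the diameter prescribed at half the scale an exact
  sum of the two contributions.\<close>

lemma cell_radius_bound: "2 ^ d * cell_radius \<delta> + 16 * \<theta> * \<delta>\<^sup>2 * M / r = (\<delta> / 2)\<^sup>2 * M / r" "0 \<le> cell_radius \<delta>" "2 ^ d * cell_radius \<delta> \<le> \<delta>\<^sup>2 * M / r"
proof -
  define X where "X = \<delta>\<^sup>2 * M / r"
  have X: "cell_radius \<delta> = const_radius d C Ce * \<theta> * X" "16 * \<theta> * \<delta>\<^sup>2 * M / r = 16 * \<theta> * X" "(\<delta> / 2)\<^sup>2 * M / r = X / 4"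
    by (simp_all add: cell_radius_def X_def power_divide)
  have "2 ^ d * cell_radius \<delta> + 16 * \<theta> * \<delta>\<^sup>2 * M / r = (4 * (\<theta> * (2 ^ d * const_radius d C Ce + 16))) * ((\<delta> / 2)\<^sup>2 * M / r)"
    unfolding X by (simp add: algebra_simps)
  then show e: "2 ^ d * cell_radius \<delta> + 16 * \<theta> * \<delta>\<^sup>2 * M / r = (\<delta> / 2)\<^sup>2 * M / r" unfolding const_facts(6) by simp
  show "0 \<le> cell_radius \<delta>" unfolding cell_radius_def using const_facts(2,4) M r by simp
  have "0 \<le> 16 * \<theta> * \<delta>\<^sup>2 * M / r" using const_facts(4) M r by simp
  then have "2 ^ d * cell_radius \<delta> \<le> (\<delta> / 2)\<^sup>2 * M / r" using e by linarith
  also have "\<dots> \<le> \<delta>\<^sup>2 * M / r" using M r by (intro divide_right_mono mult_right_mono) (auto simp: power_divide)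
  finally show "2 ^ d * cell_radius \<delta> \<le> \<delta>\<^sup>2 * M / r" .
qed

text \<open>Recentring the coordinates outside \<open>R\<close> produces contractions with the
  centre in further sets Q; each is the contraction for the union of \<open>R\<close> and Q, which
  the cell controls. The empty union is the undisturbed distance, listed separately in
  \<open>cell\<close>.\<close>

lemma shift_rho:
  assumes "cell \<delta> c Z" "u \<in> Z" "v \<in> Z" "R \<subseteq> D"
  shows "rho n b (D - R) (shifted c u, contract_blocks n R (fst c) (snd u)) (shifted c v, contract_blocks n R (fst c) (snd v)) \<le> 2 ^ d * cell_radius \<delta>"
proof -
  note R = D_minus[OF assms(4)]
  have "rho n b (D - R) (\<lambda>B j. fst (part_shift R (fst c) u) B j - fst c B j, snd (part_shift R (fst c) u)) (\<lambda>B j. fst (part_shift R (fst c) v) B j - fst c B j, snd (part_shift R (fst c) v))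
    \<le> 2 ^ card (D - R) * cell_radius \<delta>"
  proof (rule rho_shift_le[OF R(6)])
    fix Q assume Q: "Q \<subseteq> D - R"
    have "finite Q" using finite_subset[OF Q] D(1) by simp
    moreover have "\<Union>R \<inter> \<Union>Q = {}" by (rule blocks_disjoint[OF D(2) assms(4)]) (use Q in auto)
    moreover have "R \<inter> Q = {}" using Q by auto
    ultimately have e: "contract_blocks n Q (fst c) (contract_blocks n R (fst c) \<tau>) = contract_blocks n (R \<union> Q) (fst c) \<tau>" for \<tau>
      using contract_blocks_Un[OF R(4), of Q n "fst c" \<tau>] by simp
    have De: "D - R - Q = D - (R \<union> Q)" by auto
    show "rho n b (D - R - Q) (fst (part_shift R (fst c) u), contract_blocks n Q (fst c) (snd (part_shift R (fst c) u))) (fst (part_shift R (fst c) v), contract_blocks n Q (fst c) (snd (part_shift R (fst c) v))) \<le> cell_radius \<delta>"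
    proof (cases "R \<union> Q = {}")
      case True
      then have "R = {}" "Q = {}" by auto
      then show ?thesis using cellD(3)[OF assms(1-3)] by (simp add: part_shift_def contract_blocks_empty)
    next
      case False
      have "R \<union> Q \<subseteq> D" using Q assms(4) by auto
      then have "rho n b (D - (R \<union> Q)) (part_shift (R \<union> Q) (fst c) u) (part_shift (R \<union> Q) (fst c) v) \<le> cell_radius \<delta>"
        by (rule cellD(4)[OF assms(1-3) _ False])
      then show ?thesis unfolding De by (simp only: part_shift_def fst_conv snd_conv e)
    qed
  qed
  also have "\<dots> \<le> 2 ^ d * cell_radius \<delta>" using R(7) cell_radius_bound(2) by (intro mult_right_mono power_increasing) auto
  finally show ?thesis by (simp add: part_shift_def shifted_def)
qed

section \<open>Recentring a cell and the passage to half the scale\<close>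

abbreviation "f u \<equiv> contract_blocks n D (fst u) (snd u)"

lemma bounded_contractions: assumes "Z \<noteq> {}" "\<And>u. u \<in> Z \<Longrightarrow> X u \<in> \<T>" "\<And>u. u \<in> Z \<Longrightarrow> in_balls n r D (y u)" "R \<subseteq> D"
  shows "bounded_fam (Ix n b) ((\<lambda>u. contract_blocks n (D - R) (y u) (contract_blocks n R z (X u))) ` Z)"
proof (rule bounded_fam_contract_blocks)
  show "tensor_fam n (\<Union>(D - R) \<union> b) (contract_blocks n R z ` \<T>)" unfolding D_minus(1)[OF assms(4)] by (rule tensor_fam_contract_blocks[OF K(1) D_minus(5)[OF assms(4)] fT])
  show "blocks (D - R)" "\<Union>(D - R) \<inter> b = {}" by (rule D_minus[OF assms(4)])+
  fix u assume u: "u \<in> Z"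
  show "contract_blocks n R z (X u) \<in> contract_blocks n R z ` \<T>" using assms(2)[OF u] by simp
  show "in_balls n r (D - R) (y u)" using assms(3)[OF u] by (simp add: in_balls_def)
qed (rule assms(1))

lemma bounded_contractions_full: assumes "Z \<noteq> {}" "\<And>u. u \<in> Z \<Longrightarrow> X u \<in> \<T>" "\<And>u. u \<in> Z \<Longrightarrow> in_balls n r D (y u)"
  shows "bounded_fam (Ix n b) ((\<lambda>u. contract_blocks n D (y u) (X u)) ` Z)"
  using bounded_contractions[OF assms, where R="{}"] by (simp add: contract_blocks_empty)

definition recentre :: "(nat set \<Rightarrow> ten) \<times> ten \<Rightarrow> (nat set \<Rightarrow> ten) \<times> ten \<Rightarrow> (nat set \<Rightarrow> ten) \<times> ten" where
  "recentre c u = (shifted c u, \<lambda>i. snd u i - centre_tensor c i)"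

text \<open>Differences of points are unaffected by recentring, and smallness relative to the centre
  becomes smallness of the recentred point. For the diameter, the term with the tensor of the centre
  is split off and estimated on its own.\<close>

lemma recentre_class:
  assumes "chain_class \<delta> U" "0 < \<delta>" "c \<in> U" "Z \<subseteq> U" "Z \<noteq> {}" "cell \<delta> c Z"
  shows "chain_class (\<delta> / 2) (recentre c ` Z)" "u \<in> recentre c ` Z \<Longrightarrow> v \<in> recentre c ` Z \<Longrightarrow> rho n b D u v \<le> (\<delta> / 2)\<^sup>2 * M / r"
proof -
  have ZU: "u \<in> U" if "u \<in> Z" for u by (rule subsetD[OF assms(4) that])
  have sn: "snd (recentre c u) \<in> \<T>" if "u \<in> Z" for u
    using chain_classD(2)[OF assms(1) ZU[OF that]] chain_classD(7)[OF assms(1) ZU[OF that] assms(3)] by (simp add: recentre_def centre_tensor_def)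
  have dmv: "(\<lambda>B i. fst (recentre c u) B i - fst (recentre c v) B i) = (\<lambda>B i. fst u B i - fst v B i)" for u v
    by (simp add: recentre_def shifted_def)
  have dsn: "(\<lambda>i. snd (recentre c u) i - snd (recentre c v) i) = (\<lambda>i. snd u i - snd v i)" for u v
    by (simp add: recentre_def)
  show "chain_class (\<delta> / 2) (recentre c ` Z)" unfolding chain_class_def
  proof (intro conjI ballI impI)
    show "recentre c ` Z \<noteq> {}" using assms(5) by simp
    fix w assume "w \<in> recentre c ` Z"
    then obtain u where u: "u \<in> Z" "w = recentre c u" by auto
    show "snd w \<in> \<T>" using sn[OF u(1)] by (simp add: u(2))
    show "in_balls n r D (fst w)" using chain_classD(6)[OF assms(1) ZU[OF u(1)] assms(3)] by (simp add: u(2) recentre_def shifted_def)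
    show "rV k (fst w k) \<le> \<delta> / 2 * M" if "k \<in> D" for k using cellD(1)[OF assms(6) u(1) that] by (simp add: u(2) recentre_def)
    show "r * L2_set (snd w) (Ix n (\<Union>\<K>)) \<le> \<delta> / 2 * M" if "d = 2"
      using cellD(2)[OF assms(6) u(1)] that by (simp add: u(2) recentre_def centre_tensor_def)
    fix w' assume "w' \<in> recentre c ` Z"
    then obtain v where v: "v \<in> Z" "w' = recentre c v" by auto
    show "in_balls n r D (\<lambda>B i. fst w B i - fst w' B i)" unfolding u(2) v(2) dmv by (rule chain_classD(6)[OF assms(1) ZU[OF u(1)] ZU[OF v(1)]])
    show "(\<lambda>i. snd w i - snd w' i) \<in> \<T>" if "d = 2" unfolding u(2) v(2) dsn by (rule chain_classD(7)[OF assms(1) ZU[OF u(1)] ZU[OF v(1)] that])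
  qed
  assume "u \<in> recentre c ` Z" "v \<in> recentre c ` Z"
  then obtain u' v' where u: "u' \<in> Z" "u = recentre c u'" and v: "v' \<in> Z" "v = recentre c v'" by auto
  let ?g = "\<lambda>u. contract_blocks n D (shifted c u) (snd u)" and ?h = "\<lambda>u. contract_blocks n D (shifted c u) (centre_tensor c)"
  have e: "contract_blocks n D (fst (recentre c w)) (snd (recentre c w)) j = ?g w j - ?h w j" for w j
    by (simp add: recentre_def contract_blocks_def contract_diff)
  have "rho n b D u v = L2_set (\<lambda>j. (?g u' j - ?g v' j) + (?h v' j - ?h u' j)) (Ix n b)"
    unfolding rho_def u(2) v(2) e by (simp add: algebra_simps)
  also have "\<dots> \<le> L2_set (\<lambda>j. ?g u' j - ?g v' j) (Ix n b) + L2_set (\<lambda>j. ?h v' j - ?h u' j) (Ix n b)"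
    by (rule L2_set_triangle_ineq)
  also have "\<dots> \<le> 2 ^ d * cell_radius \<delta> + 16 * \<theta> * \<delta>\<^sup>2 * M / r"
    using shift_rho[OF assms(6) u(1) v(1), of "{}"] cellD(5)[OF assms(6) v(1) u(1)]
    by (intro add_mono) (simp_all add: rho_def contract_blocks_empty)
  finally show "rho n b D u v \<le> (\<delta> / 2)\<^sup>2 * M / r" unfolding cell_radius_bound(1) .
qed

text \<open>In the expansion around the centre, the term without vectors of the centre is a
  recentred point at scale delta / 2 plus the term with the tensor of the centre. All other terms
  have lower order, norms at most delta M and diameter at most delta^2 M / r, so the induction
  hypothesis gives C (delta^2 M + delta M) \<le> 2 C delta M.\<close>

lemma cell_bound:
  assumes "\<delta> \<le> 1" and "chain_class \<delta> U" "0 < \<delta>" "c \<in> U" "Z \<subseteq> U" "Z \<noteq> {}" "cell \<delta> c Z"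
    and B: "\<And>U'. chain_class (\<delta> / 2) U' \<Longrightarrow> (\<And>u v. u \<in> U' \<Longrightarrow> v \<in> U' \<Longrightarrow> rho n b D u v \<le> (\<delta> / 2)\<^sup>2 * M / r) \<Longrightarrow> gauss_width (Ix n b) (f ` U') \<le> B"
  shows "gauss_width (Ix n b) (f ` Z) \<le> B + (1 + 2 ^ d * (2 * C)) * (\<delta> * M)"
proof -
  have ZU: "u \<in> U" if "u \<in> Z" for u by (rule subsetD[OF assms(5) that])
  have im: "in_balls n r D (shifted c u)" if "u \<in> Z" for u
    unfolding shifted_def by (rule chain_classD(6)[OF assms(2) ZU[OF that] assms(4)])
  have sU: "snd u \<in> \<T>" if "u \<in> Z" for u by (rule chain_classD(2)[OF assms(2) ZU[OF that]])
  note VC = recentre_class[OF assms(2-7)]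
  note fb = finite_Ix[OF D(6), of n]
  have dM: "0 < \<delta> * M" using assms(3) M by simp
  let ?h = "\<lambda>R u. if R = {} then (\<lambda>j. contract_blocks n D (shifted c u) (snd (recentre c u)) j + contract_blocks n D (shifted c u) (centre_tensor c) j) else contract_blocks n (D - R) (shifted c u) (contract_blocks n R (fst c) (snd u))"
  have b1: "bounded_fam (Ix n b) ((\<lambda>u. contract_blocks n D (shifted c u) (snd (recentre c u))) ` Z)"
    by (rule bounded_contractions_full[OF assms(6) _ im]) (use chain_classD(2)[OF VC(1)] in auto)
  note b2 = width_centre[OF assms(2,3,4,5,6)]
  have h0: "bounded_fam (Ix n b) (?h {} ` Z)" "gauss_width (Ix n b) (?h {} ` Z) \<le> B + \<delta> * M"
  proof -
    show "bounded_fam (Ix n b) (?h {} ` Z)" using bounded_fam_image_add[OF b1 b2(1)] by simp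
    have "gauss_width (Ix n b) (f ` recentre c ` Z) \<le> B" by (rule B[OF VC])
    then have "gauss_width (Ix n b) ((\<lambda>u. contract_blocks n D (shifted c u) (snd (recentre c u))) ` Z) \<le> B" by (simp add: image_image recentre_def)
    then show "gauss_width (Ix n b) (?h {} ` Z) \<le> B + \<delta> * M" using gauss_width_image_add[OF fb b1 b2(1)] b2(2) by simp
  qed
  have hR: "bounded_fam (Ix n b) (?h R ` Z)" "gauss_width (Ix n b) (?h R ` Z) \<le> 2 * C * (\<delta> * M)" if R: "R \<subseteq> D" "R \<noteq> {}" for R
  proof -
    have e: "?h R = (\<lambda>u. contract_blocks n (D - R) (shifted c u) (contract_blocks n R (fst c) (snd u)))" using R(2) by auto
    show "bounded_fam (Ix n b) (?h R ` Z)" unfolding e by (rule bounded_contractions[OF assms(6) sU im R(1)])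
    note UR = D_minus[OF R(1)]
    let ?w = "\<lambda>u. (shifted c u, contract_blocks n R (fst c) (snd u))"
    have bR: "b \<in> \<K> - R" using K(3) R(1) by auto
    have B: "norms_le n r (\<K> - R) (contract_blocks n R (fst c) ` \<T>) (\<delta> * M)"
      by (rule norms_le_shift[OF R chain_classD(3)[OF assms(2,4)] chain_classD(4)[OF assms(2,4)]])
    have "gauss_width (Ix n b) ((\<lambda>u. contract_blocks n (\<K> - R - {b}) (fst u) (snd u)) ` ?w ` Z) \<le> C * (r * (2 ^ d * cell_radius \<delta>) + \<delta> * M)"
    proof (rule width_boundD[OF width_bound blocks_subset[OF K(1) Diff_subset] refl bR tensor_fam_contract_blocks[OF K(1) UR(5) fT] r dM B])
      show "1 \<le> card (\<K> - R)" "card (\<K> - R) < d" using UR(8)[OF R(2)] by auto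
      show "?w ` Z \<noteq> {}" using assms(6) by simp
      fix u assume "u \<in> ?w ` Z"
      then obtain u' where u: "u' \<in> Z" "u = ?w u'" by auto
      show "snd u \<in> contract_blocks n R (fst c) ` \<T>" using sU[OF u(1)] by (simp add: u(2))
      show "in_balls n r (\<K> - R - {b}) (fst u)" using im[OF u(1)] by (simp add: u(2) in_balls_def)
      fix v assume "v \<in> ?w ` Z"
      then obtain v' where v: "v' \<in> Z" "v = ?w v'" by auto
      show "rho n b (\<K> - R - {b}) u v \<le> 2 ^ d * cell_radius \<delta>" unfolding u(2) v(2) UR(3)
        by (rule shift_rho[OF assms(7) u(1) v(1) R(1)])
    qed
    also have "\<dots> \<le> C * (r * (\<delta>\<^sup>2 * M / r) + \<delta> * M)"
      using cell_radius_bound(3) C r by (intro mult_left_mono add_right_mono) auto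
    finally have l: "gauss_width (Ix n b) (?h R ` Z) \<le> C * (\<delta>\<^sup>2 * M + \<delta> * M)" unfolding e UR(3) using r by (simp add: image_image)
    have "\<delta> * (\<delta> * M) \<le> 1 * (\<delta> * M)" using assms(1) dM by (intro mult_right_mono) auto
    moreover have "\<delta>\<^sup>2 * M = \<delta> * (\<delta> * M)" by (simp add: power2_eq_square)
    ultimately have "\<delta>\<^sup>2 * M + \<delta> * M \<le> 2 * (\<delta> * M)" by linarith
    then have "C * (\<delta>\<^sup>2 * M + \<delta> * M) \<le> C * (2 * (\<delta> * M))" using C by (intro mult_left_mono) auto
    then show "gauss_width (Ix n b) (?h R ` Z) \<le> 2 * C * (\<delta> * M)" using l by simp
  qed
  have ex: "(\<lambda>u j. \<Sum>R\<in>Pow D. ?h R u j) = f"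
  proof (intro ext)
    fix u j
    have e: "contract_blocks n D x (\<lambda>i. \<tau> i - \<sigma> i) j = contract_blocks n D x \<tau> j - contract_blocks n D x \<sigma> j" for x \<tau> \<sigma>
      by (simp add: contract_blocks_def contract_diff)
    have "f u j = (\<Sum>R\<in>Pow D. contract_blocks n (D - R) (shifted c u) (contract_blocks n R (fst c) (snd u)) j)"
      unfolding contract_blocks_expand[OF D(2), of n "fst u" "snd u" j "fst c"] shifted_def ..
    also have "\<dots> = (\<Sum>R\<in>Pow D. ?h R u j)"
      by (intro sum.cong refl) (simp add: contract_blocks_empty recentre_def e)
    finally show "(\<Sum>R\<in>Pow D. ?h R u j) = f u j" by simp
  qed
  have hb: "bounded_fam (Ix n b) (?h R ` Z)" if "R \<in> Pow D" for R using that h0(1) hR(1)[of R] by (cases "R = {}") auto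
  have fP: "finite (Pow D)" using D(1) by simp
  have "gauss_width (Ix n b) (f ` Z) \<le> (\<Sum>R\<in>Pow D. gauss_width (Ix n b) (?h R ` Z))"
  proof -
    have ne: "Pow D \<noteq> {}" by auto
    note ws = gauss_width_image_sum[where I="Ix n b" and A="Pow D" and f="?h" and U=Z, OF fb fP ne hb]
    show ?thesis by (rule conjunct2[OF ws, unfolded ex])
  qed
  \<comment> \<open>The summand for R = {} is given an extra 2 C delta M so that all subsets can be
    counted alike.\<close>
  also have "\<dots> \<le> (\<Sum>R\<in>Pow D. (if R = {} then B + \<delta> * M else 0) + 2 * C * (\<delta> * M))"
  proof (rule sum_mono)
    fix R assume R: "R \<in> Pow D"
    have p: "0 \<le> 2 * C * (\<delta> * M)" using C dM by simp
    show "gauss_width (Ix n b) (?h R ` Z) \<le> (if R = {} then B + \<delta> * M else 0) + 2 * C * (\<delta> * M)"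
    proof (cases "R = {}")
      case True
      then have e: "(if R = {} then B + \<delta> * M else 0) = B + \<delta> * M" by simp
      have "gauss_width (Ix n b) (?h R ` Z) \<le> B + \<delta> * M" unfolding True by (rule h0(2))
      then show ?thesis unfolding e using p by linarith
    next
      case False
      then show ?thesis using hR(2)[of R] R by auto
    qed
  qed
  also have "\<dots> = B + \<delta> * M + real (card (Pow D)) * (2 * C * (\<delta> * M))"
    using fP by (simp add: sum.distrib)
  also have "\<dots> \<le> B + \<delta> * M + 2 ^ d * (2 * C * (\<delta> * M))"
  proof (intro add_left_mono mult_right_mono)
    have "card (Pow D) \<le> 2 ^ d" unfolding card_Pow[OF D(1)] D(3) by (rule power_increasing) auto
    then have "real (card (Pow D)) \<le> real (2 ^ d)" by (simp only: of_nat_le_iff)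
    then show "real (card (Pow D)) \<le> 2 ^ d" by simp
  qed (use C dM in simp)
  also have "\<dots> = B + (1 + 2 ^ d * (2 * C)) * (\<delta> * M)" by (simp add: algebra_simps)
  finally show ?thesis .
qed

text \<open>The partition is made in two rounds because contractions with the centre make sense only
  after a centre is chosen: one round makes the points mutually close, a centre is picked in each
  class, and the other round handles the contractions with it. Concentration charges 3 s Delta for
  each round.\<close>

lemma chain_step:
  assumes "chain_class \<delta> U" "0 < \<delta>" "\<delta> \<le> 1" "\<And>u v. u \<in> U \<Longrightarrow> v \<in> U \<Longrightarrow> rho n b D u v \<le> \<Delta>"
    and B: "\<And>U'. chain_class (\<delta> / 2) U' \<Longrightarrow> (\<And>u v. u \<in> U' \<Longrightarrow> v \<in> U' \<Longrightarrow> rho n b D u v \<le> (\<delta> / 2)\<^sup>2 * M / r) \<Longrightarrow> gauss_width (Ix n b) (f ` U') \<le> B"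
  shows "gauss_width (Ix n b) (f ` U) \<le> B + const_chain d C Ce * (r * \<Delta> / \<delta> + \<delta> * M)"
proof -
  let ?K = "exp (a * (r / \<delta>)\<^sup>2)"
  \<comment> \<open>Each round combines at most 2^d + 2 covers with exponent a (r/delta)^2, which is
    the value of s^2.\<close>
  let ?s = "sqrt ((2 ^ d + 2) * a) * (r / \<delta>)"
  let ?S = "exp (?s\<^sup>2)"
  have a0: "0 < a" using const_facts(7) by simp
  have s0: "0 < ?s" using a0 r assms(2) by (intro mult_pos_pos) (auto simp: add_pos_nonneg)
  have s2: "?s\<^sup>2 = (2 ^ d + 2) * (a * (r / \<delta>)\<^sup>2)" unfolding power_mult_distrib[of "sqrt _"] using a0 by simp
  have K1: "1 \<le> ?K" by (rule exp_bound(6)[OF assms(2,3)])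
  have pw: "?K ^ N * (?K * ?K) \<le> ?S" if "N \<le> 2 ^ d" for N
  proof -
    have "?K ^ N * (?K * ?K) = exp ((real N + 2) * (a * (r / \<delta>)\<^sup>2))"
      by (simp add: exp_of_nat_mult[symmetric] mult_exp_exp algebra_simps)
    also have "\<dots> \<le> ?S" unfolding s2 exp_le_cancel_iff
    proof (rule mult_right_mono)
      have "real N \<le> real (2 ^ d)" using that by (simp only: of_nat_le_iff)
      then show "real N + 2 \<le> 2 ^ d + 2" by simp
    qed (use a0 in simp)
    finally show ?thesis .
  qed
  have fb: "finite (Ix n b)" by (rule finite_Ix[OF D(6)])
  have bU: "bounded_fam (Ix n b) (f ` Z)" if Z: "Z \<subseteq> U" "Z \<noteq> {}" for Z
    by (rule bounded_contractions_full[OF Z(2)]) (use subsetD[OF Z(1)] chain_classD(2,3)[OF assms(1)] in auto)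
  let ?B1 = "B + (1 + 2 ^ d * (2 * C)) * (\<delta> * M)"
  let ?R1 = "\<lambda>u v. (\<forall>k\<in>D. rV k (\<lambda>i. fst u k i - fst v k i) \<le> \<delta> * M / 2)
     \<and> (r * L2_set (\<lambda>i. snd u i - snd v i) (Ix n (\<Union>\<K>)) \<le> \<delta> * M / 2 \<and> rho n b D u v \<le> cell_radius \<delta>)"
  have c1: "few_classes U ?R1 ?S"
  proof (rule few_classes_mono[OF _ order_refl])
    show "few_classes U ?R1 (?K ^ card D * (?K * ?K))"
      unfolding cell_radius_def
      by (intro few_classes_conj few_classes_Ball[OF D(1) _ K1] cover_dual[OF assms(2,3,1)] cover_tensor[OF assms(2,3,1)] cover_rho[OF assms(2,3,1)])
    have "card D \<le> 2 ^ d" unfolding D(3) by (rule order_trans[OF diff_le_self less_imp_le[OF less_exp]])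
    then show "?K ^ card D * (?K * ?K) \<le> ?S" by (rule pw)
  qed
  have "gauss_width (Ix n b) (f ` U) \<le> (?B1 + 3 * ?s * \<Delta>) + 3 * ?s * \<Delta>"
  proof (rule gauss_width_few_classes[OF fb bU[OF order_refl chain_classD(1)[OF assms(1)]] c1 s0])
    show "L2_set (\<lambda>i. f u i - f v i) (Ix n b) \<le> \<Delta>" if "u \<in> U" "v \<in> U" for u v
      using assms(4)[OF that] by (simp add: rho_def)
    fix Y assume Y: "Y \<subseteq> U" "Y \<noteq> {}" and YR: "\<And>u v. u \<in> Y \<Longrightarrow> v \<in> Y \<Longrightarrow> ?R1 u v"
    obtain c where c: "c \<in> Y" using Y(2) by blast
    then have cU: "c \<in> U" using Y(1) by blast
    have YU: "u \<in> U" if "u \<in> Y" for u by (rule subsetD[OF Y(1) that])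
    note clY = chain_class_subset[OF assms(1) Y]
    let ?R2 = "\<lambda>u v. (\<forall>R\<in>Pow D - {{}}. rho n b (D - R) (part_shift R (fst c) u) (part_shift R (fst c) v) \<le> cell_radius \<delta>)
       \<and> L2_set (\<lambda>j. contract_blocks n D (shifted c u) (centre_tensor c) j - contract_blocks n D (shifted c v) (centre_tensor c) j) (Ix n b) \<le> 16 * \<theta> * \<delta>\<^sup>2 * M / r"
    have fP: "finite (Pow D - {{}})" using D(1) by simp
    have c2: "few_classes Y ?R2 ?S"
    proof (rule few_classes_mono[OF _ order_refl])
      show "few_classes Y ?R2 (?K ^ card (Pow D - {{}}) * ?K)"
        unfolding cell_radius_def
        by (intro few_classes_conj few_classes_Ball[OF fP _ K1] cover_shift[OF assms(2,3) clY c] cover_centre[OF assms(2,3) clY c]) auto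
      have "card (Pow D - {{}}) \<le> card (Pow D)" by (rule card_mono) (use D(1) in auto)
      also have "\<dots> \<le> 2 ^ d" unfolding card_Pow[OF D(1)] D(3) by (rule power_increasing) auto
      finally have "?K ^ card (Pow D - {{}}) * (?K * ?K) \<le> ?S" by (rule pw)
      moreover have "?K ^ card (Pow D - {{}}) * ?K \<le> ?K ^ card (Pow D - {{}}) * (?K * ?K)"
        using K1 by (intro mult_left_mono) (auto simp: mult_le_cancel_left1)
      ultimately show "?K ^ card (Pow D - {{}}) * ?K \<le> ?S" by linarith
    qed
    show "gauss_width (Ix n b) (f ` Y) \<le> ?B1 + 3 * ?s * \<Delta>"
    proof (rule gauss_width_few_classes[OF fb bU[OF Y] c2 s0])
      show "L2_set (\<lambda>i. f u i - f v i) (Ix n b) \<le> \<Delta>" if "u \<in> Y" "v \<in> Y" for u v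
        using assms(4)[OF YU[OF that(1)] YU[OF that(2)]] by (simp add: rho_def)
      fix Z assume Z: "Z \<subseteq> Y" "Z \<noteq> {}" and ZR: "\<And>u v. u \<in> Z \<Longrightarrow> v \<in> Z \<Longrightarrow> ?R2 u v"
      have ZY: "u \<in> Y" if "u \<in> Z" for u by (rule subsetD[OF Z(1) that])
      have "cell \<delta> c Z" unfolding cell_def
      proof (rule conjI; intro ballI)
        fix u assume u: "u \<in> Z"
        show "(\<forall>k\<in>D. rV k (shifted c u k) \<le> \<delta> * M / 2) \<and> r * L2_set (\<lambda>i. snd u i - snd c i) (Ix n (\<Union>\<K>)) \<le> \<delta> * M / 2"
          using YR[OF ZY[OF u] c] unfolding shifted_def by simp
        fix v assume v: "v \<in> Z"
        show "rho n b D u v \<le> cell_radius \<delta>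
       \<and> (\<forall>R\<in>Pow D - {{}}. rho n b (D - R) (part_shift R (fst c) u) (part_shift R (fst c) v) \<le> cell_radius \<delta>)
       \<and> L2_set (\<lambda>j. contract_blocks n D (shifted c u) (centre_tensor c) j - contract_blocks n D (shifted c v) (centre_tensor c) j) (Ix n b) \<le> 16 * \<theta> * \<delta>\<^sup>2 * M / r"
          using conjunct2[OF conjunct2[OF YR[OF ZY[OF u] ZY[OF v]]]] ZR[OF u v] by (rule conjI)
      qed
      then show "gauss_width (Ix n b) (f ` Z) \<le> ?B1"
        by (rule cell_bound[OF assms(3,1,2) cU order_trans[OF Z(1) Y(1)] Z(2) _ B])
    qed
  qed
  also have "\<dots> = B + ((1 + 2 ^ d * (2 * C)) * (\<delta> * M) + 6 * sqrt ((2 ^ d + 2) * a) * (r * \<Delta> / \<delta>))" by (simp add: algebra_simps)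
  also have "\<dots> \<le> B + const_chain d C Ce * (r * \<Delta> / \<delta> + \<delta> * M)"
  proof -
    obtain u where "u \<in> U" using chain_classD(1)[OF assms(1)] by blast
    then have "0 \<le> \<Delta>" using assms(4)[of u u] by (simp add: rho_self)
    then have x: "0 \<le> r * \<Delta> / \<delta>" "0 \<le> \<delta> * M" using r M assms(2) by auto
    have "0 \<le> (1 + 2 ^ d * (2 * C)) * (r * \<Delta> / \<delta>)" using x(1) C by (intro mult_nonneg_nonneg) auto
    moreover have "0 \<le> 6 * sqrt ((2 ^ d + 2) * a) * (\<delta> * M)" using x(2) a0 by simp
    ultimately show ?thesis unfolding const_chain_def by (simp add: algebra_simps)
  qed
  finally show ?thesis .
qed

section \<open>Iteration over the scales\<close>

lemma const_chain_ge_1: "1 \<le> const_chain d C Ce"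
proof -
  have "0 \<le> sqrt ((2 ^ d + 2) * a)" using const_facts(7) by simp
  moreover have "0 \<le> 2 ^ d * (2 * C)" using C by simp
  ultimately show ?thesis unfolding const_chain_def by linarith
qed

text \<open>A step at scale delta costs 2 const_chain delta M, and the bound for delta / 2 is again
  2 const_chain delta M; together they reproduce the factor 4. The last term is the crude bound by
  diameter and dimension where the recursion stops.\<close>

lemma chain_iterate:
  assumes "chain_class \<delta> U" "0 < \<delta>" "\<delta> \<le> 1" "\<And>u v. u \<in> U \<Longrightarrow> v \<in> U \<Longrightarrow> rho n b D u v \<le> \<delta>\<^sup>2 * M / r"
  shows "gauss_width (Ix n b) (f ` U) \<le> 4 * const_chain d C Ce * \<delta> * M + sqrt (card (Ix n b)) * ((\<delta> / 2 ^ N)\<^sup>2 * M / r)"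
  using assms
proof (induction N arbitrary: \<delta> U)
  case 0
  have bU: "bounded_fam (Ix n b) (f ` U)"
    by (rule bounded_contractions_full[OF chain_classD(1)[OF 0(1)]]) (use chain_classD(2,3)[OF 0(1)] in auto)
  have "gauss_width (Ix n b) (f ` U) \<le> (\<delta>\<^sup>2 * M / r) * sqrt (card (Ix n b))"
    by (rule gauss_width_le_diam[OF finite_Ix[OF D(6)] bU]) (use 0(4) in \<open>auto simp: rho_def\<close>)
  moreover have "0 \<le> 4 * const_chain d C Ce * \<delta> * M" using const_chain_ge_1 0(2) M by simp
  ultimately show ?case by (simp add: mult.commute)
next
  case (Suc N)
  have "gauss_width (Ix n b) (f ` U) \<le> (4 * const_chain d C Ce * (\<delta> / 2) * M + sqrt (card (Ix n b)) * ((\<delta> / 2 / 2 ^ N)\<^sup>2 * M / r))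
    + const_chain d C Ce * (r * (\<delta>\<^sup>2 * M / r) / \<delta> + \<delta> * M)"
  proof (rule chain_step[OF Suc.prems])
    fix U' assume "chain_class (\<delta> / 2) U'" "\<And>u v. u \<in> U' \<Longrightarrow> v \<in> U' \<Longrightarrow> rho n b D u v \<le> (\<delta> / 2)\<^sup>2 * M / r"
    then show "gauss_width (Ix n b) (f ` U') \<le> 4 * const_chain d C Ce * (\<delta> / 2) * M + sqrt (card (Ix n b)) * ((\<delta> / 2 / 2 ^ N)\<^sup>2 * M / r)"
      using Suc.prems(2,3) by (intro Suc.IH) auto
  qed
  moreover have e: "r * (\<delta>\<^sup>2 * M / r) / \<delta> = \<delta> * M" using r Suc.prems(2) by (simp add: power2_eq_square)
  have "4 * const_chain d C Ce * (\<delta> / 2) * M + const_chain d C Ce * (r * (\<delta>\<^sup>2 * M / r) / \<delta> + \<delta> * M) = 4 * const_chain d C Ce * \<delta> * M"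
    unfolding e by (simp add: algebra_simps)
  moreover have "\<delta> / 2 / 2 ^ N = \<delta> / 2 ^ Suc N" by simp
  ultimately show ?case by (simp only:)
qed

lemma chain_limit:
  assumes "chain_class \<delta> U" "0 < \<delta>" "\<delta> \<le> 1" "\<And>u v. u \<in> U \<Longrightarrow> v \<in> U \<Longrightarrow> rho n b D u v \<le> \<delta>\<^sup>2 * M / r"
  shows "gauss_width (Ix n b) (f ` U) \<le> 4 * const_chain d C Ce * \<delta> * M"
proof -
  have "(\<lambda>N. 4 * const_chain d C Ce * \<delta> * M + sqrt (card (Ix n b)) * ((\<delta> / 2 ^ N)\<^sup>2 * M / r))
     \<longlonglongrightarrow> 4 * const_chain d C Ce * \<delta> * M + sqrt (card (Ix n b)) * (0\<^sup>2 * M / r)"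
    using LIMSEQ_divide_realpow_zero[of 2 \<delta>] r by (intro tendsto_intros) auto
  then have "(\<lambda>N. 4 * const_chain d C Ce * \<delta> * M + sqrt (card (Ix n b)) * ((\<delta> / 2 ^ N)\<^sup>2 * M / r)) \<longlonglongrightarrow> 4 * const_chain d C Ce * \<delta> * M" by simp
  then show ?thesis by (rule LIMSEQ_le_const) (use chain_iterate[OF assms] in auto)
qed

text \<open>The first step admits any diameter Delta, and this is where r Delta enters; from scale
  1/2 on the diameters are prescribed by the scale.\<close>

lemma chain_total:
  assumes "chain_class 1 U" "\<And>u v. u \<in> U \<Longrightarrow> v \<in> U \<Longrightarrow> rho n b D u v \<le> \<Delta>"
  shows "gauss_width (Ix n b) (f ` U) \<le> 3 * const_chain d C Ce * (r * \<Delta> + M)"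
proof -
  have "gauss_width (Ix n b) (f ` U) \<le> 4 * const_chain d C Ce * (1/2) * M + const_chain d C Ce * (r * \<Delta> / 1 + 1 * M)"
    by (rule chain_step[OF assms(1) _ _ assms(2) chain_limit]) auto
  moreover obtain u where "u \<in> U" using chain_classD(1)[OF assms(1)] by blast
  then have "0 \<le> \<Delta>" using assms(2)[of u u] by (simp add: rho_self)
  then have "0 \<le> 2 * const_chain d C Ce * (r * \<Delta>)" using r const_chain_ge_1 by simp
  ultimately show ?thesis by (simp add: algebra_simps)
qed

end


section \<open>Closing the induction on the number of coordinates\<close>

lemma width_bound_mono:
  assumes "width_bound d C" "C \<le> C'" shows "width_bound d C'"
  unfolding width_bound_def
proof (intro allI impI)
  fix n r \<K> b \<T> M \<Delta> and U :: "((nat set \<Rightarrow> ten) \<times> ten) set"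
  assume a: "blocks \<K>" "card \<K> = d" "b \<in> \<K>" "tensor_fam n (\<Union>\<K>) \<T>" "1 \<le> r" "0 < M" "norms_le n r \<K> \<T> M" "U \<noteq> {}"
    "\<forall>u\<in>U. snd u \<in> \<T> \<and> in_balls n r (\<K> - {b}) (fst u)" "\<forall>u\<in>U. \<forall>v\<in>U. rho n b (\<K> - {b}) u v \<le> \<Delta>"
  have "gauss_width (Ix n b) ((\<lambda>u. contract_blocks n (\<K> - {b}) (fst u) (snd u)) ` U) \<le> C * (r * \<Delta> + M)"
    by (rule width_boundD[OF assms(1) a(1-8)]) (use a(9,10) in auto)
  also have "\<dots> \<le> C' * (r * \<Delta> + M)"
  proof (rule mult_right_mono[OF assms(2)])
    obtain u where "u \<in> U" using a(8) by blast
    then have "rho n b (\<K> - {b}) u u \<le> \<Delta>" using a(10) by blast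
    then show "0 \<le> r * \<Delta> + M" using a(5,6) by (simp add: rho_self)
  qed
  finally show "gauss_width (Ix n b) ((\<lambda>u. contract_blocks n (\<K> - {b}) (fst u) (snd u)) ` U) \<le> C' * (r * \<Delta> + M)" .
qed

text \<open>Adjoining differences makes room for recentred tensors when d = 2 and at most doubles
  the support function; the original tensors stay so that the given points remain
  admissible.\<close>

lemma tensor_fam_differences:
  assumes "tensor_fam n L \<T>"
  defines "\<T>2 \<equiv> \<T> \<union> (\<lambda>p i. fst p i - snd p i) ` (\<T> \<times> \<T>)"
  shows "tensor_fam n L \<T>2" "supf (Ix n L) \<T>2 y \<le> 2 * supf (Ix n L) \<T> y"
proof -
  have bT: "bounded_fam (Ix n L) \<T>" "sym_fam \<T>" using assms(1) by (auto simp: tensor_fam_def)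
  obtain R where R: "\<And>v i. v \<in> \<T> \<Longrightarrow> i \<in> Ix n L \<Longrightarrow> \<bar>v i\<bar> \<le> R" and ne: "\<T> \<noteq> {}"
    using bT(1) unfolding bounded_fam_def by blast
  have "\<forall>v\<in>\<T>2. \<forall>i\<in>Ix n L. \<bar>v i\<bar> \<le> 2 * R"
  proof (intro ballI)
    fix v i assume v: "v \<in> \<T>2" and i: "i \<in> Ix n L"
    show "\<bar>v i\<bar> \<le> 2 * R"
    proof (cases "v \<in> \<T>")
      case True then show ?thesis using R[OF True i] by linarith
    next
      case False
      then obtain t s where ts: "t \<in> \<T>" "s \<in> \<T>" "v = (\<lambda>i. t i - s i)" using v unfolding \<T>2_def by auto
      then show ?thesis using R[OF ts(1) i] R[OF ts(2) i] by simp
    qed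
  qed
  then have b: "bounded_fam (Ix n L) \<T>2" unfolding bounded_fam_def using ne by (auto simp: \<T>2_def)
  have "sym_fam \<T>2" unfolding sym_fam_def
  proof
    fix v assume v: "v \<in> \<T>2"
    show "(\<lambda>i. - v i) \<in> \<T>2"
    proof (cases "v \<in> \<T>")
      case True then show ?thesis using bT(2) by (simp add: \<T>2_def sym_fam_def)
    next
      case False
      then obtain t s where ts: "t \<in> \<T>" "s \<in> \<T>" "v = (\<lambda>i. t i - s i)" using v unfolding \<T>2_def by auto
      then have "(\<lambda>i. - v i) \<in> (\<lambda>p i. fst p i - snd p i) ` (\<T> \<times> \<T>)" by (intro image_eqI[of _ _ "(s, t)"]) auto
      then show ?thesis by (simp add: \<T>2_def)
    qed
  qed
  then show "tensor_fam n L \<T>2" using b by (simp add: tensor_fam_def)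
  show "supf (Ix n L) \<T>2 y \<le> 2 * supf (Ix n L) \<T> y"
  proof (rule supf_least)
    show "\<T>2 \<noteq> {}" using ne by (simp add: \<T>2_def)
    have l: "lin (Ix n L) t y \<le> supf (Ix n L) \<T> y" if "t \<in> \<T>" for t by (rule lin_le_supf[OF bT(1) that])
    fix v assume v: "v \<in> \<T>2"
    show "lin (Ix n L) v y \<le> 2 * supf (Ix n L) \<T> y"
    proof (cases "v \<in> \<T>")
      case True then show ?thesis using l[OF True] supf_nonneg[OF bT, of y] by linarith
    next
      case False
      then obtain t s where ts: "t \<in> \<T>" "s \<in> \<T>" "v = (\<lambda>i. t i - s i)" using v unfolding \<T>2_def by auto
      have "(\<lambda>i. - s i) \<in> \<T>" using bT(2) ts(2) by (simp add: sym_fam_def)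
      then have "lin (Ix n L) (\<lambda>i. - s i) y \<le> supf (Ix n L) \<T> y" by (rule l)
      moreover have "lin (Ix n L) v y = lin (Ix n L) t y + lin (Ix n L) (\<lambda>i. - s i) y"
        by (simp add: lin_def ts(3) sum.distrib[symmetric] algebra_simps)
      ultimately show ?thesis using l[OF ts(1)] by linarith
    qed
  qed
qed

lemma norms_le_differences:
  assumes "blocks \<K>" "tensor_fam n (\<Union>\<K>) \<T>" "norms_le n r \<K> \<T> M"
  shows "norms_le n r \<K> (\<T> \<union> (\<lambda>p i. fst p i - snd p i) ` (\<T> \<times> \<T>)) (2 * M)"
  unfolding norms_le_def
proof (intro allI impI, elim conjE)
  fix P P' x assume p: "coarsening \<K> P P'" "card P < card \<K>" "in_balls n r P x"
  let ?T = "\<T> \<union> (\<lambda>p i. fst p i - snd p i) ` (\<T> \<times> \<T>)"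
  have fK: "finite (\<Union>\<K>)" by (rule blocks_finite_Union[OF assms(1)])
  note ab = coarsening_blocks[OF fK p(1)]
  note F = tensor_fam_differences[OF assms(2)]
  have un: "\<Union>P' \<subseteq> \<Union>\<K>" using ab(3) by blast
  have i: "integrable (block_gauss n P') (\<lambda>g. supf (Ix n (\<Union>\<K>)) S (\<lambda>i. tensor_prod P x i * tensor_prod P' (cur g) i))" if "tensor_fam n (\<Union>\<K>) S" for S
    by (rule supf_integrable[OF _ finite_Ix[OF fK]])
       (use that in \<open>auto simp: tensor_fam_def intro!: integrable_mult_right tensor_prod_integrable_Ix[OF fK ab(2) un]\<close>)
  have "mean_sup n P' (\<Union>\<K>) ?T (tensor_prod P x) \<le> (\<integral>g. 2 * supf (Ix n (\<Union>\<K>)) \<T> (\<lambda>i. tensor_prod P x i * tensor_prod P' (cur g) i) \<partial>block_gauss n P')"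
    unfolding mean_sup_def by (rule integral_mono[OF i[OF F(1)] integrable_mult_right[OF i[OF assms(2)]] F(2)])
  also have "\<dots> = 2 * mean_sup n P' (\<Union>\<K>) \<T> (tensor_prod P x)" by (simp add: mean_sup_def)
  also have "\<dots> \<le> 2 * M" using norms_leD[OF assms(3) p] by simp
  finally show "mean_sup n P' (\<Union>\<K>) ?T (tensor_prod P x) \<le> 2 * M" .
qed

text \<open>Radius and family are enlarged beforehand, to 2 r and to the family with its
  differences, so that recentring never leaves the class. By homogeneity M grows to 2^d * 2 M, a
  factor that depends on d alone.\<close>

lemma width_bound_step:
  assumes "2 \<le> d" "1 \<le> C" "1 \<le> Ce" and width_bound: "\<And>d'. 1 \<le> d' \<Longrightarrow> d' < d \<Longrightarrow> width_bound d' C" and entropy_bound: "\<And>d'. 1 \<le> d' \<Longrightarrow> d' < d \<Longrightarrow> entropy_bound d' Ce"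
  shows "width_bound d (3 * const_chain d C Ce * 2 ^ Suc d)"
  unfolding width_bound_def
proof (intro allI impI)
  fix n r \<K> b \<T> M \<Delta> and U :: "((nat set \<Rightarrow> ten) \<times> ten) set"
  assume a: "blocks \<K>" "card \<K> = d" "b \<in> \<K>" "tensor_fam n (\<Union>\<K>) \<T>" "1 \<le> r" "0 < M" "norms_le n r \<K> \<T> M" "U \<noteq> {}"
    "\<forall>u\<in>U. snd u \<in> \<T> \<and> in_balls n r (\<K> - {b}) (fst u)" "\<forall>u\<in>U. \<forall>v\<in>U. rho n b (\<K> - {b}) u v \<le> \<Delta>"
  have u1: "snd u \<in> \<T>" "in_balls n r (\<K> - {b}) (fst u)" if "u \<in> U" for u using a(9) that by auto
  have u2: "rho n b (\<K> - {b}) u v \<le> \<Delta>" if "u \<in> U" "v \<in> U" for u v using a(10) that by blast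
  define S where "S = \<T> \<union> (\<lambda>p i. fst p i - snd p i) ` (\<T> \<times> \<T>)"
  let ?r = "2 * r" and ?M = "2 ^ card \<K> * (2 * M)"
  have fK: "finite (\<Union>\<K>)" by (rule blocks_finite_Union[OF a(1)])
  have fS: "tensor_fam n (\<Union>\<K>) S" unfolding S_def by (rule tensor_fam_differences(1)[OF a(4)])
  have "norms_le n r \<K> S (2 * M)" unfolding S_def by (rule norms_le_differences[OF a(1,4,7)])
  then have BS: "norms_le n ?r \<K> S ?M" by (rule norms_le_scale[OF a(1) fS]) (use a(6) in auto)
  interpret chaining n ?r ?M C Ce \<K> b S
    by unfold_locales (use a assms fS BS width_bound entropy_bound in auto)
  have r1: "1 \<le> ?r" "r \<le> ?r" using a(5) by auto
  have "chain_class 1 U" unfolding chain_class_def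
  proof (intro conjI ballI impI)
    show "U \<noteq> {}" by (rule a)
    fix u assume u: "u \<in> U"
    show uS: "snd u \<in> S" using u1(1)[OF u] by (simp add: S_def)
    show ib: "in_balls n ?r (\<K> - {b}) (fst u)" using u1(2)[OF u] r1(2) order_trans unfolding in_balls_def by blast
    show "supf (Ix n k) (dual_fam n ?r \<K> k S) (fst u k) \<le> 1 * ?M" if k: "k \<in> \<K> - {b}" for k
      using supf_dual_fam_le[OF a(1) D_coord(1)[OF k] K(2) fS BS r1(1), of "fst u k"] ib k by (simp add: in_balls_def)
    show "?r * L2_set (snd u) (Ix n (\<Union>\<K>)) \<le> 1 * ?M" if two: "card \<K> = 2"
    proof -
      obtain k where k: "D = {k}" "k \<in> D" "\<Union>\<K> = k \<union> b" "\<forall>x \<tau>. contract_blocks n D x \<tau> = contract n k (x k) \<tau>" by (rule two_coordinates[OF two])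
      have e: "\<K> - {b, k} = {}" using k(1) by auto
      have "?r * L2_set (contract_blocks n (\<K> - {b, k}) (fst u) (snd u)) (Ix n (k \<union> b)) \<le> ?M"
        by (rule HS_le[OF a(1,3) D_coord(1,2)[OF k(2)] fS BS r1(1) _ uS]) (use a(6) e in \<open>auto simp: in_balls_def\<close>)
      then show ?thesis unfolding e k(3) contract_blocks_empty by simp
    qed
    fix v assume v: "v \<in> U"
    show "in_balls n ?r (\<K> - {b}) (\<lambda>B i. fst u B i - fst v B i)" unfolding in_balls_def
    proof
      fix B assume "B \<in> \<K> - {b}"
      then have "L2_set (fst u B) (Ix n B) \<le> r" "L2_set (fst v B) (Ix n B) \<le> r"
        using u1(2)[OF u] u1(2)[OF v] by (auto simp: in_balls_def)
      then show "L2_set (\<lambda>i. fst u B i - fst v B i) (Ix n B) \<le> ?r"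
        using L2_set_diff_triangle[of "fst u B" "fst v B" "Ix n B" "\<lambda>_. 0"] by simp
    qed
    show "(\<lambda>i. snd u i - snd v i) \<in> S"
      unfolding S_def using u1(1)[OF u] u1(1)[OF v] by (intro UnI2 image_eqI[of _ _ "(snd u, snd v)"]) auto
  qed
  from chain_total[OF this u2]
  have "gauss_width (Ix n b) ((\<lambda>u. contract_blocks n (\<K> - {b}) (fst u) (snd u)) ` U) \<le> 3 * const_chain d C Ce * (?r * \<Delta> + ?M)" unfolding a(2) .
  also have "\<dots> \<le> 3 * const_chain d C Ce * (2 ^ Suc d * (r * \<Delta> + M))"
  proof (rule mult_left_mono)
    obtain u where "u \<in> U" using a(8) by blast
    then have "0 \<le> \<Delta>" using u2[of u u] by (simp add: rho_self)
    then have "1 * (2 * (r * \<Delta>)) \<le> 2 ^ d * (2 * (r * \<Delta>))" using a(5) by (intro mult_right_mono) auto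
    then show "?r * \<Delta> + ?M \<le> 2 ^ Suc d * (r * \<Delta> + M)" unfolding a(2) by (simp add: algebra_simps)
    show "0 \<le> 3 * const_chain d C Ce" using const_chain_ge_1 unfolding a(2) by simp
  qed
  finally show "gauss_width (Ix n b) ((\<lambda>u. contract_blocks n (\<K> - {b}) (fst u) (snd u)) ` U) \<le> 3 * const_chain d C Ce * 2 ^ Suc d * (r * \<Delta> + M)"
    by (simp add: mult.assoc)
qed

text \<open>Widths of smaller order supply the entropy bounds, and both together run the chaining in
  the next order; a maximum merges the constants of all orders.\<close>

lemma width_bound_all: "\<exists>C\<ge>1. \<forall>d'. 1 \<le> d' \<and> d' \<le> d \<longrightarrow> width_bound d' C"
proof (induction d)
  case 0 then show ?case by (intro exI[of _ 1]) auto
next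
  case (Suc d)
  then obtain C where C: "1 \<le> C" "\<forall>d'. 1 \<le> d' \<and> d' \<le> d \<longrightarrow> width_bound d' C" by (elim exE conjE)
  have TC: "width_bound d' C" if "1 \<le> d'" "d' < Suc d" for d' using C(2)[THEN spec[of _ d']] that by simp
  have "\<exists>C'. width_bound (Suc d) C'"
  proof (cases "d = 0")
    case True then show ?thesis using width_bound_1 by auto
  next
    case False
    have "\<exists>C'>0. \<forall>d'. 1 \<le> d' \<and> d' \<le> Suc d \<longrightarrow> entropy_bound d' C'"
    proof (rule entropy_bound_all[of _ C])
      show "0 < C" using C(1) by simp
    qed (simp, rule TC)
    then obtain Ce where Ce: "0 < Ce" "\<forall>d'. 1 \<le> d' \<and> d' \<le> Suc d \<longrightarrow> entropy_bound d' Ce" by (elim exE conjE)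
    have "width_bound (Suc d) (3 * const_chain (Suc d) C (max 1 Ce) * 2 ^ Suc (Suc d))"
    proof (rule width_bound_step[OF _ C(1) _ TC])
      fix d' assume "1 \<le> d'" "d' < Suc d"
      then have "entropy_bound d' Ce" using Ce(2)[THEN spec[of _ d']] by simp
      then show "entropy_bound d' (max 1 Ce)" by (rule entropy_bound_mono) simp
    qed (use False in auto)
    then show ?thesis by (rule exI)
  qed
  then obtain C' where C': "width_bound (Suc d) C'" by (elim exE)
  have "width_bound d' (max C C')" if "1 \<le> d' \<and> d' \<le> Suc d" for d'
  proof (cases "d' = Suc d")
    case True
    show ?thesis unfolding True by (rule width_bound_mono[OF C']) simp
  next
    case False
    then have "width_bound d' C" using that by (intro TC) auto
    then show ?thesis by (rule width_bound_mono) simp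
  qed
  then show ?case using C(1) by (intro exI[of _ "max C C'"] conjI allI impI) auto
qed

section \<open>The theorem in coordinates\<close>

lemma sum_Ix_single: "(\<Sum>j\<in>Ix n {k}. F (j k)) = (\<Sum>i=1..n. F i)"
  by (rule sum.reindex_bij_witness[of _ "\<lambda>i. \<lambda>_\<in>{k}. i" "\<lambda>j. j k"])
     (auto simp: Ix_def PiE_iff extensional_def)

lemma supf_scale: "bounded_fam I V \<Longrightarrow> 0 < c \<Longrightarrow> supf I ((\<lambda>v i. c * v i) ` V) y = c * supf I V y"
  unfolding supf_cmult_eq[symmetric] by (simp add: supf_def image_image lin_cmult_left lin_cmult_right)

locale tensor =
  fixes d n m :: nat and T :: "(nat \<Rightarrow> real) set" and a :: "(nat \<Rightarrow> nat) \<Rightarrow> real"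
  assumes d: "2 \<le> d" and T: "T \<noteq> {}" "\<And>t. t \<in> T \<Longrightarrow> (\<lambda>j. - t j) \<in> T" "\<exists>R. \<forall>t\<in>T. (\<Sum>j=1..m. (t j)^2) \<le> R"
begin

text \<open>The last index is summed against \<open>t\<close> at the outset. The set
  \<open>T\<close> thus becomes a family of tensors in d indices, and index d + 1 is never a
  coordinate.\<close>

definition slice :: "(nat \<Rightarrow> real) \<Rightarrow> ten" where
  "slice t i = (\<Sum>j=1..m. a (i(d + 1 := j)) * t j)"

definition "\<T> = slice ` T"
definition "\<K> = (\<lambda>k. {k}) ` {1..d}"
definition "D = (\<lambda>k. {k}) ` {2..d}"

text \<open>Blocks are singletons here. The factor \<open>r\<close> carries points from the unit
  balls to the balls of radius \<open>r\<close> in which the inductive statement is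
  formulated.\<close>

definition coord :: "real \<Rightarrow> (nat \<Rightarrow> nat \<Rightarrow> real) \<Rightarrow> nat set \<Rightarrow> ten" where
  "coord r x B i = r * x (the_elem B) (i (the_elem B))"

lemma coordinates: "blocks \<K>" "card \<K> = d" "\<Union>\<K> = {1..d}" "{1} \<in> \<K>" "\<K> - {{1}} = D" "\<Union>D = {2..d}" "card D = d - 1" "blocks D" "\<Union>D \<inter> {1} = {}" "\<Union>D \<union> {1} = {1..d}"
proof -
  show b: "blocks \<K>" unfolding blocks_def \<K>_def by auto
  show "card \<K> = d" unfolding \<K>_def by (subst card_image) auto
  show "\<Union>\<K> = {1..d}" "{1} \<in> \<K>" unfolding \<K>_def using d by auto
  show e: "\<K> - {{1}} = D" unfolding \<K>_def D_def by auto
  show "\<Union>D = {2..d}" "\<Union>D \<inter> {1} = {}" "\<Union>D \<union> {1} = {1..d}" unfolding D_def using d by auto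
  show "card D = d - 1" unfolding D_def by (subst card_image) auto
  show "blocks D" unfolding e[symmetric] by (rule blocks_subset[OF b]) auto
qed

lemma sum_idx: "(\<Sum>i\<in>idx d n m. F i) = (\<Sum>i\<in>Ix n {1..d}. \<Sum>j=1..m. F (i(d + 1 := j)))"
proof -
  have "(\<Sum>i\<in>idx d n m. F i) = (\<Sum>(i,j)\<in>Ix n {1..d} \<times> {1..m}. F (i(d + 1 := j)))"
  proof (rule sum.reindex_bij_witness[of _ "\<lambda>(i,j). i(d + 1 := j)" "\<lambda>i. (restrict i {1..d}, i (d + 1))"])
    fix i assume i: "i \<in> idx d n m"
    have e: "(restrict i {1..d})(d + 1 := i (d + 1)) = i"
    proof
      fix l show "((restrict i {1..d})(d + 1 := i (d + 1))) l = i l"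
        using i PiE_arb[of i "{1..d+1}" _ l] by (cases "l \<in> {1..d+1}") (auto simp: idx_def)
    qed
    show "(case (restrict i {1..d}, i (d + 1)) of (i, j) \<Rightarrow> i(d + 1 := j)) = i"
      "(case (restrict i {1..d}, i (d + 1)) of (i, j) \<Rightarrow> F (i(d + 1 := j))) = F i" using e by auto
    have h: "i l \<in> (if l \<le> d then {1..n} else {1..m})" if "l \<in> {1..d+1}" for l
      using i that unfolding idx_def by (rule PiE_mem)
    have "i l \<in> {1..n}" if "l \<in> {1..d}" for l using h[of l] that by simp
    then have A: "restrict i {1..d} \<in> Ix n {1..d}" unfolding Ix_def restrict_PiE_iff by simp
    have B: "i (d + 1) \<in> {1..m}" using h[of "d + 1"] by simp
    show "(restrict i {1..d}, i (d + 1)) \<in> Ix n {1..d} \<times> {1..m}" by (rule SigmaI[OF A B])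
  next
    fix z assume "z \<in> Ix n {1..d} \<times> {1..m}"
    then obtain i j where z: "z = (i, j)" "i \<in> Ix n {1..d}" "j \<in> {1..m}" by auto
    have "restrict (i(d + 1 := j)) {1..d} = restrict i {1..d}" by (auto simp: fun_eq_iff)
    then show "(restrict (case z of (i, j) \<Rightarrow> i(d + 1 := j)) {1..d}, (case z of (i, j) \<Rightarrow> i(d + 1 := j)) (d + 1)) = z"
      using z by (simp add: restrict_Ix_id)
    show "(case z of (i, j) \<Rightarrow> i(d + 1 := j)) \<in> idx d n m"
      using z unfolding idx_def Ix_def by (auto simp: PiE_iff extensional_def)
  qed
  then show ?thesis by (simp add: sum.cartesian_product)
qed

lemma sum_idx_slice:
  assumes "\<And>i j. i \<in> Ix n {1..d} \<Longrightarrow> z (i(d + 1 := j)) = y i"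
  shows "(\<Sum>i\<in>idx d n m. a i * z i * t (i (d + 1))) = lin (Ix n {1..d}) (slice t) y"
  unfolding sum_idx lin_def slice_def sum_distrib_right
  by (intro sum.cong refl) (simp add: assms[simplified])

lemma tensor_fam_slices: "tensor_fam n {1..d} \<T>"
proof -
  obtain R where R: "\<And>t. t \<in> T \<Longrightarrow> (\<Sum>j=1..m. (t j)^2) \<le> R" using T(3) by blast
  have tb: "\<bar>t j\<bar> \<le> 1 + R" if t: "t \<in> T" and j: "j \<in> {1..m}" for t j
  proof -
    have "(t j)^2 \<le> (\<Sum>j=1..m. (t j)^2)" by (rule member_le_sum[OF j]) auto
    then have "(t j)^2 \<le> R" using R[OF t] by linarith
    moreover have "\<bar>t j\<bar> \<le> 1 + (t j)^2"
      using zero_le_power2[of "\<bar>t j\<bar> - 1"] zero_le_power2[of "t j"] by (simp add: power2_diff) 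
    ultimately show ?thesis by linarith
  qed
  have fI: "finite (Ix n {1..d})" by (rule finite_Ix) simp
  let ?c = "\<lambda>i. (\<Sum>j=1..m. \<bar>a (i(d + 1 := j))\<bar> * (1 + R))"
  have "\<bar>v i\<bar> \<le> (\<Sum>i\<in>Ix n {1..d}. ?c i)" if v: "v \<in> \<T>" and i: "i \<in> Ix n {1..d}" for v i
  proof -
    obtain t where t: "t \<in> T" "v = slice t" using v unfolding \<T>_def by auto
    have R0: "0 \<le> R" using order_trans[OF _ R[OF t(1)]] by (simp add: sum_nonneg)
    have "\<bar>v i\<bar> \<le> (\<Sum>j=1..m. \<bar>a (i(d + 1 := j)) * t j\<bar>)" unfolding t(2) slice_def by (rule sum_abs)
    also have "\<dots> \<le> ?c i" unfolding abs_mult by (rule sum_mono) (intro mult_left_mono tb[OF t(1)], auto)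
    also have "\<dots> \<le> (\<Sum>i\<in>Ix n {1..d}. ?c i)"
      by (rule member_le_sum[OF i _ fI]) (use R0 in \<open>auto intro!: sum_nonneg\<close>)
    finally show ?thesis .
  qed
  then have "\<forall>v\<in>\<T>. \<forall>i\<in>Ix n {1..d}. \<bar>v i\<bar> \<le> (\<Sum>i\<in>Ix n {1..d}. ?c i)" by simp
  moreover have "\<T> \<noteq> {}" using T(1) by (simp add: \<T>_def)
  ultimately have "bounded_fam (Ix n {1..d}) \<T>" unfolding bounded_fam_def by (intro conjI exI)
  moreover have "sym_fam \<T>" unfolding sym_fam_def
  proof
    fix v assume "v \<in> \<T>"
    then obtain t where t: "t \<in> T" "v = slice t" unfolding \<T>_def by auto
    have "(\<lambda>i. - v i) = slice (\<lambda>j. - t j)" by (simp add: t(2) slice_def fun_eq_iff sum_negf)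
    then show "(\<lambda>i. - v i) \<in> \<T>" unfolding \<T>_def using T(2)[OF t(1)] by auto
  qed
  ultimately show ?thesis by (simp add: tensor_fam_def)
qed

lemma coord_Ix: "L2_set (coord r x {k}) (Ix n {k}) = \<bar>r\<bar> * sqrt (\<Sum>j=1..n. (x k j)^2)"
proof -
  have "L2_set (\<lambda>i. x k (i k)) (Ix n {k}) = sqrt (\<Sum>j=1..n. (x k j)^2)"
    unfolding L2_set_def using sum_Ix_single[of "\<lambda>j. (x k j)^2" k n] by simp
  then show ?thesis by (simp add: coord_def[abs_def] L2_set_cmult)
qed

lemma tensor_prod_coord: assumes "i \<in> Ix n {1..d}" shows "tensor_prod D (coord r x) i = r ^ (d - 1) * (\<Prod>k=2..d. x k (i k))"
proof -
  have "tensor_prod D (coord r x) i = (\<Prod>k=2..d. coord r x {k} (restrict i {k}))"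
    unfolding tensor_prod_def D_def by (subst prod.reindex) auto
  also have "\<dots> = (\<Prod>k=2..d. r * x k (i k))" by (simp add: coord_def)
  also have "\<dots> = r ^ card {2..d} * (\<Prod>k=2..d. x k (i k))" by (simp add: prod.distrib)
  also have "card {2..d} = d - 1" by simp
  finally show ?thesis .
qed

lemma FA_form_eq: "FA_form d n m a g u = lin (Ix n {1}) (contract_blocks n D (coord 1 (fst u)) (slice (snd u))) (\<lambda>j. g (j 1))"
proof -
  let ?x = "coord 1 (fst u)"
  have "FA_form d n m a g u = (\<Sum>i\<in>idx d n m. a i * (g (i 1) * (\<Prod>k=2..d. fst u k (i k))) * snd u (i (d + 1)))"
    by (simp add: FA_form_def mult.assoc)
  also have "\<dots> = lin (Ix n {1..d}) (slice (snd u)) (\<lambda>i. g (i 1) * tensor_prod D ?x i)"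
  proof (rule sum_idx_slice)
    fix i j assume i: "i \<in> Ix n {1..d}"
    have "(\<Prod>k=2..d. fst u k ((i(d + 1 := j)) k)) = (\<Prod>k=2..d. fst u k (i k))" by (intro prod.cong refl) auto
    then show "g ((i(d + 1 := j)) 1) * (\<Prod>k=2..d. fst u k ((i(d + 1 := j)) k)) = g (i 1) * tensor_prod D ?x i"
      using d tensor_prod_coord[OF i, of 1 "fst u"] by simp
  qed
  also have "\<dots> = lin (Ix n {1}) (contract_blocks n D ?x (slice (snd u))) (\<lambda>j. g (j 1))"
    unfolding contract_blocks_def coordinates(10)[symmetric]
  proof (rule lin_contract[OF coordinates(9)])
    fix i j assume "i \<in> Ix n (\<Union>D)" "j \<in> Ix n {1}"
    have "merge_idx (\<Union>D) i j 1 = j 1" by (simp add: merge_idx_def coordinates(6))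
    then show "g (merge_idx (\<Union>D) i j 1) * tensor_prod D ?x (merge_idx (\<Union>D) i j) = tensor_prod D ?x i * g (j 1)" by (simp add: tensor_prod_merge_idx_left)
  qed
  finally show ?thesis .
qed

abbreviation "avec u \<equiv> contract_blocks n D (coord 1 (fst u)) (slice (snd u))"

text \<open>The contraction is homogeneous of degree d - 1: one power of \<open>r\<close> for each
  of the indices 2, ..., d.\<close>

lemma contract_blocks_coord: "contract_blocks n D (coord r (fst u)) (slice (snd u)) = (\<lambda>j. r ^ (d - 1) * avec u j)"
proof
  fix j
  have "tensor_prod D (coord r x) i = r ^ (d - 1) * tensor_prod D (coord 1 x) i" for x i
    using tensor_prod_cmult[of D r "coord 1 x" i] coordinates(7) by (simp add: coord_def[abs_def])
  then have "tensor_prod D (coord r (fst u)) = (\<lambda>i. r ^ (d - 1) * tensor_prod D (coord 1 (fst u)) i)" by (simp add: fun_eq_iff)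
  then show "contract_blocks n D (coord r (fst u)) (slice (snd u)) j = r ^ (d - 1) * avec u j"
    by (simp add: contract_blocks_def contract_cmult_left)
qed

lemma rho_A_eq: "rho_A d n m a u v = L2_set (\<lambda>j. avec u j - avec v j) (Ix n {1})"
proof -
  let ?p = "\<lambda>u i. (\<Prod>k=2..d. fst u k (i k)) * snd u (i (d + 1))"
  let ?e = "\<lambda>i1. \<lambda>_\<in>{1::nat}. i1"
  have fin: "finite (idx d n m)" unfolding idx_def by (intro finite_PiE) auto
  have s: "(\<Sum>i\<in>{i\<in>idx d n m. i 1 = i1}. a i * ?p u i) = avec u (?e i1)" if i1: "i1 \<in> {1..n}" for i1 u
  proof -
    \<comment> \<open>Evaluating the Gaussian form at a unit vector instead of g reads off one
      component of the contraction.\<close>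
    have "(\<Sum>i\<in>{i\<in>idx d n m. i 1 = i1}. a i * ?p u i) = FA_form d n m a (\<lambda>l. if l = i1 then 1 else 0) u"
      unfolding FA_form_def using fin by (simp add: sum.inter_filter if_distrib mult.assoc cong: if_cong) (intro sum.cong refl, simp)
    also have "\<dots> = (\<Sum>j\<in>Ix n {1}. if j = ?e i1 then avec u j else 0)"
      unfolding FA_form_eq lin_def
      by (intro sum.cong refl) (auto simp: Ix_def PiE_iff extensional_def fun_eq_iff)
    also have "\<dots> = avec u (?e i1)" using i1 by (subst sum.delta) (auto simp: Ix_def intro!: finite_PiE)
    finally show ?thesis .
  qed
  have "(\<Sum>i1=1..n. (\<Sum>i\<in>{i\<in>idx d n m. i 1 = i1}. a i * (?p u i - ?p v i))^2) = (\<Sum>i1=1..n. (avec u (?e i1) - avec v (?e i1))^2)"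
  proof (intro sum.cong refl)
    fix i1 assume "i1 \<in> {1..n}"
    from s[OF this] show "(\<Sum>i\<in>{i\<in>idx d n m. i 1 = i1}. a i * (?p u i - ?p v i))^2 = (avec u (?e i1) - avec v (?e i1))^2"
      by (simp only: right_diff_distrib sum_subtractf)
  qed
  also have "\<dots> = (\<Sum>j\<in>Ix n {1}. (avec u (?e (j 1)) - avec v (?e (j 1)))^2)"
    by (rule sum_Ix_single[symmetric])
  also have "\<dots> = (\<Sum>j\<in>Ix n {1}. (avec u j - avec v j)^2)"
  proof (intro sum.cong refl)
    fix j assume "j \<in> Ix n {1}"
    then have "?e (j 1) = j" by (auto simp: Ix_def PiE_iff extensional_def fun_eq_iff)
    then show "(avec u (?e (j 1)) - avec v (?e (j 1)))^2 = (avec u j - avec v j)^2" by (simp only:)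
  qed
  finally show ?thesis unfolding rho_A_def L2_set_def by simp
qed

section \<open>The given mixed norms as bounds for the tensor family\<close>

definition mean_norm :: "nat set set \<Rightarrow> nat set set \<Rightarrow> (nat set \<Rightarrow> ten) \<Rightarrow> real" where
  "mean_norm P P' x = mean_sup n P' {1..d} \<T> (tensor_prod P x)"

lemma part_pairsD:
  assumes "(P, P') \<in> part_pairs d"
  shows "\<Union>P \<subseteq> {1..d}" "\<Union>P' \<subseteq> {1..d}" "finite P" "finite P'" "blocks P"
proof -
  have p: "partition_on {1..d} (P \<union> P')" using assms by (simp add: part_pairs_def)
  have u: "\<Union>(P \<union> P') = {1..d}" using partition_onD1[OF p] by simp
  then show "\<Union>P \<subseteq> {1..d}" "\<Union>P' \<subseteq> {1..d}" by auto
  have f: "finite (P \<union> P')" by (rule finite_elements[OF _ p]) simp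
  then show "finite P" "finite P'" by auto
  have "finite B \<and> B \<noteq> {}" if "B \<in> P" for B
    using that u partition_onD3[OF p] finite_subset[of B "{1..d}"] by blast
  moreover have "B \<inter> C = {}" if "B \<in> P" "C \<in> P" "B \<noteq> C" for B C
    using disjointD[OF partition_onD2[OF p], of B C] that by simp
  ultimately show "blocks P" unfolding blocks_def using f by simp
qed

lemma normA_eq:
  assumes "(P, P') \<in> part_pairs d"
  shows "normA d n m a T P P' = Sup (mean_norm P P' ` {x. in_balls n 1 P x})"
proof -
  note p = part_pairsD[OF assms]
  have g: "(\<integral>g. (SUP t\<in>T. (\<Sum>i\<in>idx d n m.
        a i * (\<Prod>I\<in>P. x I (restrict i I)) * (\<Prod>J\<in>P'. g (J, restrict i J)) * t (i (d+1))))
      \<partial>gauss (SIGMA J:P'. \<Pi>\<^sub>E j\<in>J. {1..n})) = mean_norm P P' x" for x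
  proof -
    have r: "restrict (i(d + 1 := j)) B = restrict i B" if "B \<subseteq> {1..d}" for i j and B :: "nat set"
      using that by (auto simp: fun_eq_iff restrict_def)
    have "(\<Sum>i\<in>idx d n m. a i * (\<Prod>I\<in>P. x I (restrict i I)) * (\<Prod>J\<in>P'. g (J, restrict i J)) * t (i (d+1)))
      = lin (Ix n {1..d}) (slice t) (\<lambda>i. tensor_prod P x i * tensor_prod P' (cur g) i)" for g t
    proof -
      have "(\<Sum>i\<in>idx d n m. a i * ((\<Prod>I\<in>P. x I (restrict i I)) * (\<Prod>J\<in>P'. g (J, restrict i J))) * t (i (d+1)))
      = lin (Ix n {1..d}) (slice t) (\<lambda>i. tensor_prod P x i * tensor_prod P' (cur g) i)"
      proof (rule sum_idx_slice)
        fix i j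
        have "(\<Prod>I\<in>P. x I (restrict (i(d + 1 := j)) I)) = tensor_prod P x i"
          unfolding tensor_prod_def
        proof (intro prod.cong refl)
          fix B assume "B \<in> P"
          then have "restrict (i(d + 1 := j)) B = restrict i B" by (rule r[OF subset_trans[OF Union_upper p(1)]])
          then show "x B (restrict (i(d + 1 := j)) B) = x B (restrict i B)" by (simp only:)
        qed
        moreover have "(\<Prod>J\<in>P'. g (J, restrict (i(d + 1 := j)) J)) = tensor_prod P' (cur g) i"
          unfolding tensor_prod_def
        proof (intro prod.cong refl)
          fix B assume "B \<in> P'"
          then have "restrict (i(d + 1 := j)) B = restrict i B" by (rule r[OF subset_trans[OF Union_upper p(2)]])
          then show "g (B, restrict (i(d + 1 := j)) B) = g (B, restrict i B)" by (simp only:)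
        qed
        ultimately show "(\<Prod>I\<in>P. x I (restrict (i(d + 1 := j)) I)) * (\<Prod>J\<in>P'. g (J, restrict (i(d + 1 := j)) J)) = tensor_prod P x i * tensor_prod P' (cur g) i"
          by simp
      qed
      then show ?thesis by (simp add: mult.assoc)
    qed
    then show ?thesis by (simp add: mean_norm_def mean_sup_def block_gauss_def supf_def \<T>_def image_image Ix_def)
  qed
  have l: "(\<Sum>j\<in>(\<Pi>\<^sub>E l\<in>I. {1..n}). (x I j)^2) \<le> 1 \<longleftrightarrow> L2_set (x I) (Ix n I) \<le> 1" for x :: "nat set \<Rightarrow> ten" and I
    by (simp add: L2_set_def Ix_def)
  show ?thesis unfolding normA_def g in_balls_def l by (rule arg_cong[where f=Sup]) auto
qed

text \<open>The supremum in the norm is over a set bounded above: on unit balls the deterministic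
  product is at most 1 in absolute value, which leaves an integrable bound independent of
  \<open>x\<close>. Without this \<open>Sup\<close> would carry no information. The last claim is
  homogeneity.\<close>

lemma normA_facts:
  assumes "(P, P') \<in> part_pairs d"
  shows "in_balls n 1 P x \<Longrightarrow> mean_norm P P' x \<le> normA d n m a T P P'" "0 \<le> normA d n m a T P P'"
    and "1 \<le> r \<Longrightarrow> in_balls n r P x \<Longrightarrow> mean_norm P P' x \<le> r ^ card P * normA d n m a T P P'"
proof -
  note p = part_pairsD[OF assms]
  let ?L = "{1..d}"
  have fI: "finite (Ix n ?L)" by (rule finite_Ix) simp
  have bT: "bounded_fam (Ix n ?L) \<T>" using tensor_fam_slices by (simp add: tensor_fam_def)
  from bT obtain R where R0: "\<forall>v\<in>\<T>. \<forall>i\<in>Ix n ?L. \<bar>v i\<bar> \<le> R" unfolding bounded_fam_def by (elim conjE exE)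
  have R: "\<bar>v i\<bar> \<le> R" if "v \<in> \<T>" "i \<in> Ix n ?L" for v i
    by (rule R0[THEN bspec, OF that(1), THEN bspec, OF that(2)])
  have it: "integrable (block_gauss n P') (\<lambda>g. tensor_prod P' (cur g) i)" if "i \<in> Ix n ?L" for i
    by (rule tensor_prod_integrable_Ix[OF _ p(4,2) that]) simp
  have bdd: "bdd_above (mean_norm P P' ` {x. in_balls n 1 P x})"
  proof (rule bdd_aboveI2)
    fix x assume "x \<in> {x. in_balls n 1 P x}"
    then have x: "in_balls n 1 P x" by simp
    have "supf (Ix n ?L) \<T> (\<lambda>i. tensor_prod P x i * tensor_prod P' (cur g) i) \<le> R * (\<Sum>i\<in>Ix n ?L. \<bar>tensor_prod P' (cur g) i\<bar>)" for g
    proof (rule supf_least)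
      show "\<T> \<noteq> {}" using bT by (simp add: bounded_fam_def)
      fix v assume v: "v \<in> \<T>"
      have le: "(\<Sum>i\<in>Ix n ?L. \<bar>tensor_prod P x i * tensor_prod P' (cur g) i\<bar>) \<le> (\<Sum>i\<in>Ix n ?L. \<bar>tensor_prod P' (cur g) i\<bar>)"
      proof (rule sum_mono)
        fix i assume i: "i \<in> Ix n ?L"
        have ri: "restrict i (\<Union>P) \<in> Ix n (\<Union>P)" by (rule restrict_Ix[OF i p(1)])
        have "tensor_prod P x i = tensor_prod P x (restrict i (\<Union>P))"
          unfolding tensor_prod_def by (intro prod.cong refl) (simp add: Int_absorb1 Union_upper restrict_restrict)
        then have "\<bar>tensor_prod P x i\<bar> \<le> 1" using abs_tensor_prod_le[OF x p(5) ri] by simp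
        then show "\<bar>tensor_prod P x i * tensor_prod P' (cur g) i\<bar> \<le> \<bar>tensor_prod P' (cur g) i\<bar>" by (simp add: abs_mult mult_left_le_one_le)
      qed
      show "lin (Ix n ?L) v (\<lambda>i. tensor_prod P x i * tensor_prod P' (cur g) i) \<le> R * (\<Sum>i\<in>Ix n ?L. \<bar>tensor_prod P' (cur g) i\<bar>)"
      proof (cases "Ix n ?L = {}")
        case True then show ?thesis by (simp add: lin_def)
      next
        case False
        then obtain i where "i \<in> Ix n ?L" by blast
        then have "0 \<le> R" using R[OF v, of i] by linarith
        then have "R * (\<Sum>i\<in>Ix n ?L. \<bar>tensor_prod P x i * tensor_prod P' (cur g) i\<bar>) \<le> R * (\<Sum>i\<in>Ix n ?L. \<bar>tensor_prod P' (cur g) i\<bar>)"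
          using le by (rule mult_left_mono[rotated])
        moreover have "\<bar>lin (Ix n ?L) v (\<lambda>i. tensor_prod P x i * tensor_prod P' (cur g) i)\<bar> \<le> R * (\<Sum>i\<in>Ix n ?L. \<bar>tensor_prod P x i * tensor_prod P' (cur g) i\<bar>)"
          by (rule abs_lin_le[OF R[OF v]])
        ultimately show ?thesis by linarith
      qed
    qed
    then show "mean_norm P P' x \<le> (\<integral>g. R * (\<Sum>i\<in>Ix n ?L. \<bar>tensor_prod P' (cur g) i\<bar>) \<partial>block_gauss n P')"
      unfolding mean_norm_def mean_sup_def
    proof (intro integral_mono)
      show "integrable (block_gauss n P') (\<lambda>g. supf (Ix n ?L) \<T> (\<lambda>i. tensor_prod P x i * tensor_prod P' (cur g) i))"
        by (rule supf_integrable[OF bT fI]) (use it in auto)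
      show "integrable (block_gauss n P') (\<lambda>g. R * (\<Sum>i\<in>Ix n ?L. \<bar>tensor_prod P' (cur g) i\<bar>))"
        by (intro integrable_mult_right Bochner_Integration.integrable_sum integrable_abs it)
    qed
  qed
  show le: "mean_norm P P' x \<le> normA d n m a T P P'" if "in_balls n 1 P x" for x
    unfolding normA_eq[OF assms] using that by (intro cSUP_upper[OF _ bdd]) simp
  have "0 \<le> mean_norm P P' (\<lambda>_ _. 0)" unfolding mean_norm_def by (rule mean_sup_nonneg[OF tensor_fam_slices])
  also have "\<dots> \<le> normA d n m a T P P'" by (rule le) (simp add: in_balls_def)
  finally show "0 \<le> normA d n m a T P P'" .
  assume r: "1 \<le> r" and x: "in_balls n r P x"
  let ?x = "\<lambda>B i. (1 / r) * x B i"
  have ib: "in_balls n 1 P ?x" unfolding in_balls_def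
  proof
    fix B assume "B \<in> P"
    then show "L2_set (?x B) (Ix n B) \<le> 1" unfolding L2_set_cmult using x r by (simp add: in_balls_def)
  qed
  have e: "tensor_prod P x = (\<lambda>i. r ^ card P * tensor_prod P ?x i)"
    using tensor_prod_cmult[of P "1 / r" x] r by (simp add: fun_eq_iff power_divide)
  have "mean_norm P P' x = r ^ card P * mean_norm P P' ?x"
    unfolding mean_norm_def e by (rule mean_sup_cmult[OF bT, of "r ^ card P" P' "tensor_prod P ?x"]) (use r in simp)
  also have "\<dots> \<le> r ^ card P * normA d n m a T P P'" using le[OF ib] r by (intro mult_left_mono) auto
  finally show "mean_norm P P' x \<le> r ^ card P * normA d n m a T P P'" .
qed

lemma s_k_facts: "0 \<le> s_k d n m a T k" "(P, P') \<in> part_pairs d \<Longrightarrow> normA d n m a T P P' \<le> s_k d n m a T (card P)"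
proof -
  have "part_pairs d \<subseteq> Pow (Pow {1..d}) \<times> Pow (Pow {1..d})"
  proof
    fix PP assume "PP \<in> part_pairs d"
    then have PP: "(fst PP, snd PP) \<in> part_pairs d" by simp
    have "fst PP \<subseteq> Pow {1..d}" "snd PP \<subseteq> Pow {1..d}" using part_pairsD(1,2)[OF PP] by blast+
    then show "PP \<in> Pow (Pow {1..d}) \<times> Pow (Pow {1..d})" by (simp only: mem_Times_iff Pow_iff simp_thms)
  qed
  then have fin: "finite (part_pairs d)" by (rule finite_subset) simp
  have nn: "0 \<le> normA d n m a T (fst PP) (snd PP)" if "PP \<in> part_pairs d" for PP
    using normA_facts(2)[of "fst PP" "snd PP"] that by simp
  show "0 \<le> s_k d n m a T k" unfolding s_k_def by (rule sum_nonneg) (use nn in auto)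
  assume p: "(P, P') \<in> part_pairs d"
  show "normA d n m a T P P' \<le> s_k d n m a T (card P)"
    unfolding s_k_def
    using member_le_sum[of "(P, P')" "{PP \<in> part_pairs d. card (fst PP) = card P}" "\<lambda>PP. normA d n m a T (fst PP) (snd PP)"]
      p nn fin by auto
qed

text \<open>A coarsening of singletons is a pair from \<open>part_pairs\<close>, so its norm is one
  summand of some s_k. The added epsilon makes M positive even if all norms vanish.\<close>

lemma norms_le_s_k:
  assumes "1 \<le> r" "0 < \<epsilon>"
  shows "norms_le n r \<K> \<T> ((\<Sum>k=0..d-1. r ^ k * s_k d n m a T k) + \<epsilon>)"
  unfolding norms_le_def coordinates(2,3)
proof (intro allI impI, elim conjE)
  fix P P' x assume h: "coarsening \<K> P P'" "card P < d" "in_balls n r P x"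
  have p: "(P, P') \<in> part_pairs d" using coarseningD(1,5)[OF h(1)] unfolding coordinates(3) by (simp add: part_pairs_def)
  have "mean_sup n P' {1..d} \<T> (tensor_prod P x) \<le> r ^ card P * normA d n m a T P P'"
    using normA_facts(3)[OF p assms(1) h(3)] by (simp add: mean_norm_def)
  also have "\<dots> \<le> r ^ card P * s_k d n m a T (card P)" using s_k_facts(2)[OF p] assms(1) by (intro mult_left_mono) auto
  also have "\<dots> \<le> (\<Sum>k=0..d-1. r ^ k * s_k d n m a T k)"
    by (rule member_le_sum) (use h(2) s_k_facts(1) assms(1) in auto)
  finally show "mean_sup n P' {1..d} \<T> (tensor_prod P x) \<le> (\<Sum>k=0..d-1. r ^ k * s_k d n m a T k) + \<epsilon>" using assms(2) by linarith
qed

lemma main_bound: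
  assumes U: "U \<noteq> {}" "U \<subseteq> (\<Pi>\<^sub>E k\<in>{2..d}. B2 n) \<times> T" and "1 \<le> p" and C: "width_bound d C" "0 < C"
  shows "F_A d n m a U \<le> C * (sqrt p * Delta_A d n m a U
        + (\<Sum>k=0..d-1. p powr ((real k + 1 - real d) / 2) * s_k d n m a T k))"
proof -
  let ?r = "sqrt p" and ?I = "Ix n {1}"
  have r: "1 \<le> ?r" using assms(3) by simp
  \<comment> \<open>Both sides are scaled by r^(d-1), the degree of the contraction; after division
    r^k / r^(d-1) is the weight p^((k+1-d)/2).\<close>
  let ?c = "?r ^ (d - 1)"
  have c: "0 < ?c" using r by simp
  have Uu: "slice (snd u) \<in> \<T>" "in_balls n r' D (coord r' (fst u))" if u: "u \<in> U" and r': "0 \<le> r'" for u r'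
  proof -
    show "slice (snd u) \<in> \<T>" using U(2) u by (auto simp: \<T>_def)
    show "in_balls n r' D (coord r' (fst u))" unfolding in_balls_def
    proof
      fix B assume "B \<in> D"
      then obtain k where k: "k \<in> {2..d}" "B = {k}" by (auto simp: D_def)
      have "fst u \<in> (\<Pi>\<^sub>E k\<in>{2..d}. B2 n)" by (rule mem_Times_iff[THEN iffD1, THEN conjunct1, OF subsetD[OF U(2) u]])
      then have "fst u k \<in> B2 n" using k(1) by (rule PiE_mem)
      then have "(\<Sum>j=1..n. (fst u k j)^2) \<le> 1" by (simp add: B2_def)
      then have "sqrt (\<Sum>j=1..n. (fst u k j)^2) \<le> 1" by simp
      then show "L2_set (coord r' (fst u) B) (Ix n B) \<le> r'" unfolding k(2) coord_Ix using r' by (simp add: mult_left_le)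
    qed
  qed
  have fI: "finite ?I" by (rule finite_Ix) simp
  have bV: "bounded_fam ?I (avec ` U)"
    by (rule bounded_fam_contract_blocks[OF _ coordinates(8,9) U(1) Uu(1) Uu(2)]) (use tensor_fam_slices coordinates(10) in auto)
  have F: "F_A d n m a U = gauss_width ?I (avec ` U)"
  proof -
    have "F_A d n m a U = (\<integral>g. supf ?I (avec ` U) (\<lambda>j\<in>?I. g (j 1)) \<partial>gauss {1..n})"
      unfolding F_A_def FA_form_eq supf_def image_image
      by (intro Bochner_Integration.integral_cong refl SUP_cong lin_cong) auto
    also have "\<dots> = gauss_width ?I (avec ` U)" unfolding gauss_width_def
    proof (rule gauss_reindex[OF fI])
      show "inj_on (\<lambda>j. j 1) ?I"
      proof (intro inj_onI ext)
        fix j j' :: "nat \<Rightarrow> nat" and l assume j: "j \<in> ?I" "j' \<in> ?I" "j 1 = j' 1"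
        show "j l = j' l"
        proof (cases "l = 1")
          case False
          then show ?thesis using j(1,2) by (simp add: Ix_def PiE_iff extensional_def)
        qed (use j(3) in simp)
      qed
      show "(\<lambda>j. j 1) ` ?I \<subseteq> {1..n}" by (auto simp: Ix_def PiE_iff)
      show "supf ?I (avec ` U) \<in> borel_measurable (gauss ?I)"
        using supf_gauss_integrable[OF fI bV] by (rule borel_measurable_integrable)
    qed
    finally show ?thesis .
  qed
  have sc: "gauss_width ?I ((\<lambda>v j. ?c * v j) ` avec ` U) = ?c * gauss_width ?I (avec ` U)"
    unfolding gauss_width_def supf_scale[OF bV c] by simp
  have \<Delta>: "rho_A d n m a u v \<le> Delta_A d n m a U" if u: "u \<in> U" "v \<in> U" for u v
  proof -
    from bV obtain R where R0: "\<forall>v\<in>avec ` U. \<forall>j\<in>?I. \<bar>v j\<bar> \<le> R" unfolding bounded_fam_def by (elim conjE exE)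
    have R: "\<bar>avec w j\<bar> \<le> R" if "w \<in> U" "j \<in> ?I" for w j
      by (rule R0[THEN bspec, OF imageI[OF that(1)], THEN bspec, OF that(2)])
    \<comment> \<open>The contractions are uniformly bounded, so \<open>Delta_A\<close> is a genuine
      supremum.\<close>
    have "bdd_above ((\<lambda>uv. rho_A d n m a (fst uv) (snd uv)) ` (U \<times> U))"
    proof (rule bdd_aboveI2)
      fix uv assume "uv \<in> U \<times> U"
      then have m: "fst uv \<in> U" "snd uv \<in> U" by auto
      have "rho_A d n m a (fst uv) (snd uv) \<le> (\<Sum>j\<in>?I. \<bar>avec (fst uv) j - avec (snd uv) j\<bar>)"
        unfolding rho_A_eq by (rule L2_set_le_sum_abs)
      also have "\<dots> \<le> (\<Sum>j\<in>?I. 2 * R)"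
      proof (rule sum_mono)
        fix j assume j: "j \<in> ?I"
        show "\<bar>avec (fst uv) j - avec (snd uv) j\<bar> \<le> 2 * R" using R[OF m(1) j] R[OF m(2) j] by linarith
      qed
      finally show "rho_A d n m a (fst uv) (snd uv) \<le> (\<Sum>j\<in>?I. 2 * R)" .
    qed
    from cSUP_upper[OF _ this, of "(u, v)"] u show ?thesis by (simp add: Delta_A_def)
  qed
  define S where "S = (\<Sum>k=0..d-1. ?r ^ k * s_k d n m a T k)"
  have S0: "0 \<le> S" unfolding S_def using s_k_facts(1) r by (intro sum_nonneg mult_nonneg_nonneg) auto
  let ?w = "\<lambda>u. (coord ?r (fst u), slice (snd u))"
  \<comment> \<open>The inductive statement wants a positive M, so \<open>S + e / C\<close> replaces
    \<open>S\<close>; multiplied by \<open>C\<close> the surplus is \<open>e\<close>, which is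
    arbitrary.\<close>
  have main: "?c * F_A d n m a U \<le> C * (?r * (?c * Delta_A d n m a U) + S) + e" if e: "0 < e" for e
  proof -
    have "gauss_width ?I ((\<lambda>u. contract_blocks n (\<K> - {{1}}) (fst u) (snd u)) ` ?w ` U) \<le> C * (?r * (?c * Delta_A d n m a U) + (S + e / C))"
    proof (rule width_boundD[OF C(1) coordinates(1,2,4) _ r])
      show "tensor_fam n (\<Union>\<K>) \<T>" unfolding coordinates(3) by (rule tensor_fam_slices)
      show "0 < S + e / C" using S0 e C(2) by (simp add: add_nonneg_pos)
      show "norms_le n ?r \<K> \<T> (S + e / C)" unfolding S_def by (rule norms_le_s_k[OF r]) (use e C(2) in simp)
      show "?w ` U \<noteq> {}" using U(1) by simp
      fix u' assume "u' \<in> ?w ` U"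
      then obtain u where u: "u \<in> U" "u' = ?w u" by auto
      show "snd u' \<in> \<T>" "in_balls n ?r (\<K> - {{1}}) (fst u')" unfolding u(2) coordinates(5) using Uu[OF u(1), of ?r] r by auto
      fix v' assume "v' \<in> ?w ` U"
      then obtain v where v: "v \<in> U" "v' = ?w v" by auto
      have "rho n {1} D u' v' = ?c * rho_A d n m a u v"
        unfolding rho_def rho_A_eq u(2) v(2) fst_conv snd_conv contract_blocks_coord[of ?r] right_diff_distrib[symmetric] L2_set_cmult using c by simp
      then show "rho n {1} (\<K> - {{1}}) u' v' \<le> ?c * Delta_A d n m a U"
        unfolding coordinates(5) using \<Delta>[OF u(1) v(1)] c by simp
    qed
    moreover have "(\<lambda>u. contract_blocks n (\<K> - {{1}}) (fst u) (snd u)) ` ?w ` U = (\<lambda>v j. ?c * v j) ` avec ` U"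
      unfolding coordinates(5) image_image fst_conv snd_conv contract_blocks_coord[of ?r] ..
    moreover have "C * (?r * (?c * Delta_A d n m a U) + (S + e / C)) = C * (?r * (?c * Delta_A d n m a U) + S) + e"
      using C(2) by (simp add: distrib_left)
    ultimately show ?thesis unfolding F using sc by simp
  qed
  have "?c * F_A d n m a U \<le> C * (?r * (?c * Delta_A d n m a U) + S)"
    by (rule field_le_epsilon) (use main in simp)
  also have "\<dots> = ?c * (C * (?r * Delta_A d n m a U + S / ?c))" using c assms(3) by (simp add: field_simps)
  finally have "F_A d n m a U \<le> C * (?r * Delta_A d n m a U + S / ?c)" using c by (simp only: mult_le_cancel_left_pos)
  moreover have "S / ?c = (\<Sum>k=0..d-1. p powr ((real k + 1 - real d) / 2) * s_k d n m a T k)"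
    unfolding S_def sum_divide_distrib
  proof (intro sum.cong refl)
    fix k
    have p0: "0 < p" using assms(3) by simp
    have pw: "?r ^ j = p powr (real j / 2)" for j :: nat
      using p0 by (simp add: powr_half_sqrt[symmetric] powr_realpow[symmetric] powr_powr)
    have "(real k + 1 - real d) / 2 = real k / 2 - real (d - 1) / 2"
      using d by (simp add: of_nat_diff field_simps)
    then have "p powr ((real k + 1 - real d) / 2) = p powr (real k / 2 - real (d - 1) / 2)" by (simp only:)
    also have "\<dots> = ?r ^ k / ?c" unfolding pw by (rule powr_diff)
    finally show "?r ^ k * s_k d n m a T k / ?c = p powr ((real k + 1 - real d) / 2) * s_k d n m a T k" by simp
  qed
  ultimately show ?thesis by simp
qed

end

theorem theorem4p1:
  fixes d :: nat
  assumes "d \<ge> 2"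
  shows "\<exists>C::real. \<forall>(n::nat) (m::nat) (T::(nat \<Rightarrow> real) set) (a::(nat \<Rightarrow> nat) \<Rightarrow> real)
      (U::((nat \<Rightarrow> nat \<Rightarrow> real) \<times> (nat \<Rightarrow> real)) set) (p::real).
      n \<ge> 1 \<longrightarrow> m \<ge> 1 \<longrightarrow>
      T \<noteq> {} \<longrightarrow> (\<forall>t\<in>T. \<forall>j. j \<notin> {1..m} \<longrightarrow> t j = 0) \<longrightarrow>
      (\<forall>t\<in>T. (\<lambda>j. - t j) \<in> T) \<longrightarrow>
      (\<exists>R. \<forall>t\<in>T. (\<Sum>j=1..m. (t j)^2) \<le> R) \<longrightarrow>
      U \<noteq> {} \<longrightarrow> U \<subseteq> (\<Pi>\<^sub>E k\<in>{2..d}. B2 n) \<times> T \<longrightarrow>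
      p \<ge> 1 \<longrightarrow>
      F_A d n m a U \<le> C * (sqrt p * Delta_A d n m a U
        + (\<Sum>k=0..d-1. p powr ((real k + 1 - real d) / 2) * s_k d n m a T k))"
proof -
  obtain C where C: "1 \<le> C" "\<forall>d'. 1 \<le> d' \<and> d' \<le> d \<longrightarrow> width_bound d' C" using width_bound_all[of d] by (elim exE conjE)
  have Td: "width_bound d C" using C(2)[THEN spec[of _ d]] assms by simp
  show ?thesis
  proof (intro exI[of _ C] allI impI)
    fix n m and T :: "(nat \<Rightarrow> real) set" and a :: "(nat \<Rightarrow> nat) \<Rightarrow> real" and U :: "((nat \<Rightarrow> nat \<Rightarrow> real) \<times> (nat \<Rightarrow> real)) set" and p :: real
    assume h: "T \<noteq> {}" "\<forall>t\<in>T. (\<lambda>j. - t j) \<in> T" "\<exists>R. \<forall>t\<in>T. (\<Sum>j=1..m. (t j)^2) \<le> R"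
      and U: "U \<noteq> {}" "U \<subseteq> (\<Pi>\<^sub>E k\<in>{2..d}. B2 n) \<times> T" and p: "p \<ge> 1"
    interpret tensor d n m T a by unfold_locales (use assms h in auto)
    show "F_A d n m a U \<le> C * (sqrt p * Delta_A d n m a U
        + (\<Sum>k=0..d-1. p powr ((real k + 1 - real d) / 2) * s_k d n m a T k))"
      by (rule main_bound[OF U p Td]) (use C(1) in simp)
  qed
qed

end
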